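(* Let $\pi$ be a supercritical probability measure on $\mathbb{Z}_+$ with generating series $f_\pi$, and let $(\mathscr{C}(\mathbf{d}^{(N)}))_{N\ge 1}$ be a sequence of configuration models with asymptotic degree distribution $\pi$ such that $$\lim_{N\to\infty}\frac{(d_1^{(N)})^2+\cdots+(d_N^{(N)})^2}{N}=\sum_{k\ge 0}k^2\pi(\{k\}),$$ and such that there exist $\gamma>2$ and $C>0$ with $\max\{d_1^{(N)},\dots,d_N^{(N)}\}\le C N^{1/\gamma}$ for all $N$. Let $\alpha_c$ be the smallest positive solution of $$\frac{f_\pi''\left(f_\pi^{-1}(1-\alpha)\right)}{f_\pi'(1)}=1.$$ For every $\alpha\in[0,\alpha_c]$, let $\pi_\alpha$ be the probability distribution on $\mathbb{Z}_+$ with generating series $$g(\alpha,s)=\frac{1}{1-\alpha}\,f_\pi\!\left(f_\pi^{-1}(1-\alpha)-(1-s)\frac{f_\pi'(f_\pi^{-1}(1-\alpha))}{f_\pi'(1)}\right),$$ and let $\tau^{(N)}(\alpha)=\inf\{k\ge 1:\ |S^{(N)}_k|\le (1-\alpha)N\}$, where $S_k^{(N)}$ is the set of sleeping vertices at step $k$ of the depth first exploration of $\mathscr{C}(\mathbf{d}^{(N)})$. Then, for every $\alpha\in[0,\alpha_c]$, conditionally on their degree sequences, the graphs induced by the vertices of $S^{(N)}_{\tau^{(N)}(\alpha)}$ inside $\mathscr{C}(\mathbf{d}^{(N)})$ have the law of configuration models, with asymptotic degree distribution $\pi_\alpha$; the latter means that for every $k\ge 0$ the proportion of vertices of the induced graph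 having degree $k$ in the induced graph converges in probability to $\pi_\alpha(\{k\})$ as $N\to\infty$.
   Context: **Configuration model.** For $\mathbf{d}=(d_1,\dots,d_N)\in\mathbb{Z}_+^N$ with even sum, $\mathscr{C}(\mathbf{d})$ is the random multigraph on $\{1,\dots,N\}$ obtained by attaching $d_i$ half-edges to vertex $i$ and matching all half-edges uniformly at random; if the sum is odd, $d_N$ is first replaced by $d_N+1$. The degree of a vertex in a multigraph is its number of half-edges (loops count twice). The sequence $(\mathscr{C}(\mathbf{d}^{(N)}))_{N\ge1}$, with $\mathbf d^{(N)}=(d_1^{(N)},\dots,d_N^{(N)})\in\mathbb{Z}_+^N$, has asymptotic degree distribution $\pi$ if $\frac1N\sum_{i=1}^N\mathbf 1_{\{d_i^{(N)}=k\}}\to\pi(\{k\})$ for all $k\ge0$. **Supercriticality.** A probability $\pi$ on $\mathbb{Z}_+$ with $\sum_k k^2\pi(\{k\})<\infty$ and generating function $f_\pi(s)=\sum_k\pi(\{k\})s^k$ is supercritical if $f_\pi''(1)/f_\pi'(1)>1$. Here $f_\pi^{-1}$ is the inverse of $f_\pi:[0,1]\to[\pi(\{0\}),1]$. **Depth first exploration.** At each step $n$ there are an ordered list $A_n$ of active vertices, a set $S_n$ of sleeping vertices and a set $R_n$ of retired vertices, partitioning the vertex set. Start from $A_0=\emptyset$, $S_0=\{1,\dots,N\}$, $R_0=\emptyset$. Each time a vertex $v$ becomes active, its half-edges that are matched to half-edges of sleeping vertices other than $v$ are put in a uniformly random order, which gives an ordered list $\mathbf m_v$ of vertices (with multiplicity).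 Given $(A_n,S_n,R_n)$: (1) if $A_n=\emptyset$ (and $S_n\ne\emptyset$), pick $v$ uniformly at random in $S_n$; it becomes active: $A_{n+1}=(v)$, $S_{n+1}=S_n\setminus\{v\}$, $R_{n+1}=R_n$; (2) if $A_n\neq\emptyset$ and its last element $u$ has no neighbor in $S_n$, then $A_{n+1}$ is $A_n$ with $u$ removed, $S_{n+1}=S_n$, $R_{n+1}=R_n\cup\{u\}$; (3) if $A_n\ne\emptyset$ and its last element $u$ has a neighbor in $S_n$, let $v$ be the first vertex of $\mathbf m_u$ that belongs to $S_n$; it becomes active: $v$ is appended at the end of $A_n$ to form $A_{n+1}$, $S_{n+1}=S_n\setminus\{v\}$, $R_{n+1}=R_n$. The exploration ends after $2N$ steps. The superscript $(N)$ in $S_k^{(N)}$ records the graph size. *)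

theory Defs
  imports
    "HOL-Probability.Probability"
    "HOL-Library.Disjoint_Sets"
    "HOL-Library.Multiset"
    "HOL-Combinatorics.Multiset_Permutations"
begin

section \<open>Multigraphs\<close>

text \<open>An edge is the two-element multiset of its endpoints: a loop at \<open>v\<close> is \<open>{#v, v#}\<close>,
  so that it counts twice in the degree of \<open>v\<close>.\<close>

type_synonym multigraph = "nat set \<times> nat multiset multiset"

definition verts :: "multigraph \<Rightarrow> nat set" where
  "verts G = fst G"

definition edges :: "multigraph \<Rightarrow> nat multiset multiset" where
  "edges G = snd G"

definition vertex_degree :: "multigraph \<Rightarrow> nat \<Rightarrow> nat" where
  "vertex_degree G v = (\<Sum>e\<in>#edges G. count e v)"

definition induced_subgraph :: "multigraph \<Rightarrow> nat set \<Rightarrow> multigraph" where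
  "induced_subgraph G W = (W, {#e \<in># edges G. set_mset e \<subseteq> W#})"

definition degree_proportion :: "multigraph \<Rightarrow> nat \<Rightarrow> real" where
  "degree_proportion G k = real (card {v \<in> verts G. vertex_degree G v = k}) / real (card (verts G))"


section \<open>The configuration model\<close>

text \<open>A half-edge is a pair of the vertex it is attached to and an index.\<close>

type_synonym half_edge = "nat \<times> nat"

definition half_edges :: "nat set \<Rightarrow> (nat \<Rightarrow> nat) \<Rightarrow> half_edge set" where
  "half_edges V d = (SIGMA v:V. {..<d v})"

definition perfect_matchings :: "'a set \<Rightarrow> 'a set set set" where
  "perfect_matchings H = {M. partition_on H M \<and> (\<forall>e\<in>M. card e = 2)}"

definition partner :: "'a set set \<Rightarrow> 'a \<Rightarrow> 'a" where
  "partner M h = (THE h'. {h, h'} \<in> M \<and> h' \<noteq> h)"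

text \<open>The last vertex is \<open>Max V\<close>; this is \<open>N\<close> when \<open>V = {1..N}\<close>.\<close>

definition make_even :: "nat set \<Rightarrow> (nat \<Rightarrow> nat) \<Rightarrow> nat \<Rightarrow> nat" where
  "make_even V d = (if even (\<Sum>v\<in>V. d v) then d else d(Max V := d (Max V) + 1))"

definition random_matching :: "nat set \<Rightarrow> (nat \<Rightarrow> nat) \<Rightarrow> half_edge set set pmf" where
  "random_matching V d = pmf_of_set (perfect_matchings (half_edges V (make_even V d)))"

definition graph_of_matching :: "nat set \<Rightarrow> half_edge set set \<Rightarrow> multigraph" where
  "graph_of_matching V M = (V, {#image_mset fst (mset_set e). e \<in># mset_set M#})"

definition configuration_model :: "nat set \<Rightarrow> (nat \<Rightarrow> nat) \<Rightarrow> multigraph pmf" where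
  "configuration_model V d = map_pmf (graph_of_matching V) (random_matching V d)"

definition has_asymptotic_degrees :: "(nat \<Rightarrow> nat \<Rightarrow> nat) \<Rightarrow> nat pmf \<Rightarrow> bool" where
  "has_asymptotic_degrees d \<pi> \<longleftrightarrow>
     (\<forall>k. (\<lambda>N. real (card {i \<in> {1..N}. d N i = k}) / real N) \<longlonglongrightarrow> pmf \<pi> k)"


section \<open>Depth first exploration\<close>

text \<open>The list \<open>ordering st v\<close> is \<open>m\<^sub>v\<close>; it is only meaningful once \<open>v\<close> has become active.\<close>

record dfs_state =
  active :: "nat list"
  sleeping :: "nat set"
  retired :: "nat set"
  ordering :: "nat \<Rightarrow> nat list"

definition initial_state :: "nat set \<Rightarrow> dfs_state" where
  "initial_state V = \<lparr>active = [], sleeping = V, retired = {}, ordering = (\<lambda>_. [])\<rparr>"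

definition random_ordering :: "half_edge set set \<Rightarrow> nat set \<Rightarrow> nat \<Rightarrow> nat list pmf" where
  "random_ordering M S v =
     map_pmf (map (\<lambda>h. fst (partner M h)))
       (pmf_of_set (permutations_of_set
          {h \<in> \<Union>M. fst h = v \<and> fst (partner M h) \<in> S - {v}}))"

definition activate :: "half_edge set set \<Rightarrow> dfs_state \<Rightarrow> nat \<Rightarrow> dfs_state pmf" where
  "activate M st v =
     map_pmf (\<lambda>ms. st\<lparr>active := active st @ [v], sleeping := sleeping st - {v},
                       ordering := (ordering st)(v := ms)\<rparr>)
       (random_ordering M (sleeping st) v)"

definition has_sleeping_neighbor :: "half_edge set set \<Rightarrow> dfs_state \<Rightarrow> nat \<Rightarrow> bool" where
  "has_sleeping_neighbor M st u \<longleftrightarrow>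
     (\<exists>h\<in>\<Union>M. fst h = u \<and> fst (partner M h) \<in> sleeping st)"

text \<open>The exploration of \<open>N\<close> vertices is over, with no active and no sleeping vertex left,
  at step \<open>2 * N\<close> exactly; the state is constant from then on.\<close>

definition dfs_step :: "half_edge set set \<Rightarrow> dfs_state \<Rightarrow> dfs_state pmf" where
  "dfs_step M st =
     (if active st = [] then
        (if sleeping st = {} then return_pmf st
         else pmf_of_set (sleeping st) \<bind> activate M st)
      else
        (let u = last (active st) in
          if \<not> has_sleeping_neighbor M st u then
            return_pmf (st\<lparr>active := butlast (active st), retired := insert u (retired st)\<rparr>)
          else
            activate M st (hd (filter (\<lambda>v. v \<in> sleeping st) (ordering st u)))))"

text \<open>The list of the \<open>n + 1\<close> successive states during the first \<open>n\<close> steps.\<close>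

primrec dfs_path :: "half_edge set set \<Rightarrow> nat \<Rightarrow> dfs_state \<Rightarrow> dfs_state list pmf" where
  "dfs_path M 0 st = return_pmf [st]"
| "dfs_path M (Suc n) st = dfs_step M st \<bind> (\<lambda>st'. map_pmf ((#) st) (dfs_path M n st'))"

definition exploration :: "nat \<Rightarrow> half_edge set set \<Rightarrow> dfs_state list pmf" where
  "exploration N M = dfs_path M (2 * N) (initial_state {1..N})"

definition tau :: "nat \<Rightarrow> real \<Rightarrow> dfs_state list \<Rightarrow> nat" where
  "tau N \<alpha> traj = Inf {k. 1 \<le> k \<and> k \<le> 2 * N \<and>
                          real (card (sleeping (traj ! k))) \<le> (1 - \<alpha>) * real N}"

text \<open>Law of the graph induced, in the configuration model with \<open>N\<close> vertices and degrees \<open>d\<close>,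
  by the vertices that are sleeping at time \<open>\<tau>(\<alpha>)\<close> of its exploration.\<close>

definition sleeping_graph :: "nat \<Rightarrow> (nat \<Rightarrow> nat) \<Rightarrow> real \<Rightarrow> multigraph pmf" where
  "sleeping_graph N d \<alpha> =
     random_matching {1..N} d \<bind> (\<lambda>M.
     map_pmf
       (\<lambda>traj. induced_subgraph (graph_of_matching {1..N} M) (sleeping (traj ! tau N \<alpha> traj)))
       (exploration N M))"


section \<open>Generating functions\<close>

definition gen_fun :: "nat pmf \<Rightarrow> real \<Rightarrow> real" where
  "gen_fun \<pi> s = (\<Sum>k. pmf \<pi> k * s ^ k)"

text \<open>The derivatives are taken within \<open>[0,1]\<close>, hence are one-sided at the end points
  (the radius of convergence may be 1).\<close>

definition gen_fun' :: "nat pmf \<Rightarrow> real \<Rightarrow> real" where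
  "gen_fun' \<pi> s = vector_derivative (gen_fun \<pi>) (at s within {0..1})"

definition gen_fun'' :: "nat pmf \<Rightarrow> real \<Rightarrow> real" where
  "gen_fun'' \<pi> s = vector_derivative (gen_fun' \<pi>) (at s within {0..1})"

definition gen_fun_inv :: "nat pmf \<Rightarrow> real \<Rightarrow> real" where
  "gen_fun_inv \<pi> = the_inv_into {0..1} (gen_fun \<pi>)"

definition supercritical :: "nat pmf \<Rightarrow> bool" where
  "supercritical \<pi> \<longleftrightarrow>
     summable (\<lambda>k. real k ^ 2 * pmf \<pi> k) \<and> gen_fun'' \<pi> 1 / gen_fun' \<pi> 1 > 1"

text \<open>The bound \<open>\<alpha> \<le> 1 - pmf \<pi> 0\<close> says that \<open>1 - \<alpha>\<close> lies in \<open>[\<pi>({0}), 1]\<close>, where the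
  inverse of the generating function is defined.\<close>

definition alpha_c :: "nat pmf \<Rightarrow> real" where
  "alpha_c \<pi> = (LEAST \<alpha>. 0 < \<alpha> \<and> \<alpha> \<le> 1 - pmf \<pi> 0 \<and>
                   gen_fun'' \<pi> (gen_fun_inv \<pi> (1 - \<alpha>)) / gen_fun' \<pi> 1 = 1)"

definition g_series :: "nat pmf \<Rightarrow> real \<Rightarrow> real \<Rightarrow> real" where
  "g_series \<pi> \<alpha> s =
     1 / (1 - \<alpha>) *
     gen_fun \<pi> (gen_fun_inv \<pi> (1 - \<alpha>)
                - (1 - s) * (gen_fun' \<pi> (gen_fun_inv \<pi> (1 - \<alpha>)) / gen_fun' \<pi> 1))"

definition pi_alpha :: "nat pmf \<Rightarrow> real \<Rightarrow> nat pmf" where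
  "pi_alpha \<pi> \<alpha> = (THE p. \<forall>s\<in>{0..1}. gen_fun p s = g_series \<pi> \<alpha> s)"

end

theory Submission
  imports Defs
begin

text \<open>The half-edges of a uniform matching may be revealed one pair at a time. If the last active
  vertex examines its half-edges in uniform order, the depth first exploration becomes a Markov chain
  on triples of a list of active vertices, a set \<open>S\<close> of sleeping vertices and a set \<open>U\<close> of unmatched
  half-edges, and at any time the matching of \<open>U\<close> is still uniform. At the stopping time the
  induced graph consists of the edges of a uniform matching of \<open>U\<close> that lie inside \<open>S\<close>; given its
  degrees, these form a uniform matching.

  Let \<open>L\<close> be the number of half-edges and \<open>f\<close> the generating function of \<open>\<pi>\<close>. When \<open>card U = t\<^sup>2 L\<close>,
  a step removes a given sleeping vertex of degree \<open>j\<close> with probability \<open>j / (card U - 1)\<close>, so that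
  the number of sleeping vertices of degree \<open>j\<close> stays close to \<open>N \<pi>\<^sub>j t\<^sup>j\<close>, up to the vertices that
  were picked when no vertex was active. At the time of such a pick, \<open>U\<close> is the set of half-edges of
  \<open>S\<close>, so that the number of picks is of order at most \<open>N (t f'(t) - t\<^sup>2 f'(1))\<close>. By convexity of
  \<open>f'\<close> this is nonpositive as long as \<open>t\<close> is at least the point where \<open>f'' = f'(1)\<close>, which is
  where \<open>\<alpha> \<le> \<alpha>\<^sub>c\<close> enters. At the stopping time \<open>t\<close> is then close to the solution \<open>s\<close> of
  \<open>f(s) = 1 - \<alpha>\<close>. A half-edge of \<open>S\<close> has its partner in \<open>S\<close> with probability close to
  \<open>f'(s) / (s f'(1))\<close>, almost independently of the others, and the binomial thinning of the
  weights \<open>\<pi>\<^sub>j s\<^sup>j / (1 - \<alpha>)\<close> has generating function \<open>g(\<alpha>, \<cdot>)\<close>.\<close>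

section \<open>Uniform perfect matchings\<close>

text \<open>For a fixed matching the two explorations are reconciled by averaging: given the active
  list and the sleeping set, the still usable parts of the orderings are independent uniform
  permutations, and deleting a newly activated vertex from all of them keeps this law. The power
  \<open>t^j\<close> comes from a step that lowers \<open>card U\<close> by 2 and loses a vertex of
  degree \<open>j\<close> with probability \<open>j / (card U - 1)\<close>: counts evolve like
  \<open>card U\<close> to the power \<open>j / 2\<close>. The obstacle is circular: picks disturb
  the counts, and the number of picks can only be bounded through the counts. It is broken by
  one-sided deviations in which the picked vertices are weighted so that no pick increases them. The
  squares of their positive parts, with linear corrections, form a supermartingale while they are
  small; it starts at order \<open>N\<close> and would have to reach the order of \<open>N\<close>
  squared, so failure has probability of order \<open>1 / N\<close>. Only degrees up to a fixed
  bound are followed; convergence of the second moments makes the remaining half-edges negligible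
  for all large \<open>N\<close>.\<close>

lemma perfect_matchings_iff:
  "M \<in> perfect_matchings H \<longleftrightarrow> \<Union>M = H \<and> disjoint M \<and> (\<forall>e\<in>M. card e = 2)"
  unfolding perfect_matchings_def partition_on_def by (auto simp: eq_commute)

lemma perfect_matchings_subset:
  "M \<in> perfect_matchings H \<Longrightarrow> M' \<subseteq> M \<Longrightarrow> M' \<in> perfect_matchings (\<Union>M')"
  by (auto simp: perfect_matchings_iff disjoint_def)

lemma edge_unique:
  "M \<in> perfect_matchings H \<Longrightarrow> e \<in> M \<Longrightarrow> e' \<in> M \<Longrightarrow> h \<in> e \<Longrightarrow> h \<in> e' \<Longrightarrow> e = e'"
  unfolding perfect_matchings_iff by (meson disjointD disjoint_iff)

lemma perfect_matchings_ex_partner: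
  assumes "M \<in> perfect_matchings H" "h \<in> H"
  shows "\<exists>h'. {h, h'} \<in> M \<and> h' \<noteq> h"
proof -
  from assms obtain e where e: "e \<in> M" "h \<in> e" "card e = 2"
    by (auto simp: perfect_matchings_iff)
  then obtain a b where "e = {a, b}" "a \<noteq> b" by (meson card_2_iff)
  then show ?thesis using e by (cases "h = a") (auto simp: insert_commute)
qed

lemma partner_eqI:
  assumes "M \<in> perfect_matchings H" "{h, h'} \<in> M" "h' \<noteq> h"
  shows "partner M h = h'"
  unfolding partner_def
proof (rule the_equality)
  show "{h, h'} \<in> M \<and> h' \<noteq> h" using assms by simp
  fix x assume "{h, x} \<in> M \<and> x \<noteq> h"
  then have "{h, x} = {h, h'}"
    using edge_unique[OF assms(1), of _ _ h] assms(2) by auto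
  then show "x = h'" using assms by (auto simp: doubleton_eq_iff)
qed

lemma partner_edge:
  assumes "M \<in> perfect_matchings H" "h \<in> H"
  shows "{h, partner M h} \<in> M" "partner M h \<noteq> h" "partner M h \<in> H" "partner M (partner M h) = h"
proof -
  obtain h' where h': "{h, h'} \<in> M" "h' \<noteq> h" using perfect_matchings_ex_partner[OF assms] by blast
  then have p: "partner M h = h'" using partner_eqI[OF assms(1)] by blast
  show "{h, partner M h} \<in> M" "partner M h \<noteq> h" using p h' by auto
  show "partner M h \<in> H" using h' assms(1) p by (auto simp: perfect_matchings_iff)
  show "partner M (partner M h) = h"
    unfolding p by (rule partner_eqI[OF assms(1)]) (use h' in \<open>auto simp: insert_commute\<close>)
qed

lemma edge_eq_partner:
  assumes "M \<in> perfect_matchings H" "e \<in> M" "h \<in> e"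
  shows "e = {h, partner M h}"
proof -
  have "h \<in> H" using assms by (auto simp: perfect_matchings_iff)
  then show ?thesis using edge_unique[OF assms(1)] partner_edge(1)[OF assms(1)] assms by blast
qed

lemma partner_subset:
  assumes "M \<in> perfect_matchings H" "M' \<subseteq> M" "h \<in> \<Union>M'"
  shows "partner M' h = partner M h"
proof -
  from assms obtain e where e: "e \<in> M'" "h \<in> e" by auto
  moreover have "h \<in> H" using e assms by (auto simp: perfect_matchings_iff)
  ultimately have "{h, partner M h} \<in> M'" "partner M h \<noteq> h"
    using edge_eq_partner[OF assms(1), of e h] partner_edge(2)[OF assms(1)] assms by auto
  then show ?thesis by (rule partner_eqI[OF perfect_matchings_subset[OF assms(1,2)]])
qed

lemma perfect_matchings_remove:
  assumes "M \<in> perfect_matchings H" "h \<in> H"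
  shows "M - {{h, partner M h}} \<in> perfect_matchings (H - {h, partner M h})"
proof -
  have "\<Union>(M - {{h, partner M h}}) = H - {h, partner M h}"
  proof -
    have "e \<inter> {h, partner M h} = {}" if "e \<in> M - {{h, partner M h}}" for e
      using that partner_edge(1)[OF assms] assms(1) unfolding perfect_matchings_iff
      by (intro disjointD) auto
    moreover have "H \<subseteq> {h, partner M h} \<union> \<Union>(M - {{h, partner M h}})"
      using assms by (auto simp: perfect_matchings_iff)
    moreover have "\<Union>M = H" using assms by (simp add: perfect_matchings_iff)
    ultimately show ?thesis by auto
  qed
  with perfect_matchings_subset[OF assms(1), of "M - {{h, partner M h}}"] show ?thesis by auto
qed

lemma perfect_matchings_insert:
  assumes "M \<in> perfect_matchings (H - {h, h'})" "h \<in> H" "h' \<in> H" "h \<noteq> h'"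
  shows "insert {h, h'} M \<in> perfect_matchings H"
proof -
  have M: "\<Union>M = H - {h, h'}" "disjoint M" "\<forall>e\<in>M. card e = 2"
    using assms(1) by (auto simp: perfect_matchings_iff)
  then have "disjoint (insert {h, h'} M)" by (intro pairwise_insert[THEN iffD2]) (auto simp: disjnt_def)
  then show ?thesis using M assms by (auto simp: perfect_matchings_iff)
qed

lemma finite_perfect_matchings: "finite H \<Longrightarrow> finite (perfect_matchings H)"
  by (rule finite_subset[of _ "Pow (Pow H)"]) (auto simp: perfect_matchings_iff)

lemma perfect_matchings_empty [simp]: "perfect_matchings {} = {{}}"
  unfolding perfect_matchings_def by (auto simp: partition_on_empty)

lemma perfect_matchings_nonempty:
  assumes "finite H" "even (card H)"
  shows "perfect_matchings H \<noteq> {}"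
  using assms
proof (induction "card H" arbitrary: H rule: less_induct)
  case less
  show ?case
  proof (cases "H = {}")
    case False
    then obtain h where h: "h \<in> H" by auto
    have "card H \<noteq> 1" using less.prems by auto
    then have "H \<noteq> {h}" by auto
    with h obtain h' where h': "h' \<in> H" "h' \<noteq> h" by auto
    have c: "card (H - {h, h'}) = card H - 2"
      using h h' less.prems by (subst card_Diff_subset) auto
    moreover have "card H > 0" using h less.prems by (auto simp: card_gt_0_iff)
    ultimately have "perfect_matchings (H - {h, h'}) \<noteq> {}"
      using less.prems by (intro less.hyps) (auto simp: even_diff_nat)
    then obtain M where "M \<in> perfect_matchings (H - {h, h'})" by auto
    then have "insert {h, h'} M \<in> perfect_matchings H"
      using h h' by (intro perfect_matchings_insert) auto
    then show ?thesis by auto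
  qed simp
qed

lemma perfect_matchings_even:
  assumes "M \<in> perfect_matchings H" "finite H"
  shows "even (card H)"
proof -
  have "finite M" using assms by (intro finite_UnionD) (auto simp: perfect_matchings_iff)
  have "card (\<Union>M) = (\<Sum>e\<in>M. card e)"
    using assms by (intro card_Union_disjoint) (auto simp: perfect_matchings_iff intro: card_ge_0_finite)
  then have "card H = (\<Sum>e\<in>M. card e)" using assms by (simp add: perfect_matchings_iff)
  also have "\<dots> = (\<Sum>e\<in>M. 2)"
    using assms by (intro sum.cong refl) (auto simp: perfect_matchings_iff)
  also have "\<dots> = 2 * card M" by simp
  finally show ?thesis by simp
qed

text \<open>Serves twice: the number of perfect matchings depends only on the number of half-edges,
  and half-edges may be renamed without affecting uniformity.\<close>

lemma bij_betw_perfect_matchings: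
  assumes "bij_betw f U W"
  shows "bij_betw ((`) ((`) f)) (perfect_matchings U) (perfect_matchings W)"
proof -
  \<comment> \<open>Stated for any function, so that it applies both to \<open>f\<close> and to its
    inverse \<open>g\<close>.\<close>
  have main: "(`) ((`) f) M \<in> perfect_matchings W"
    if "inj_on f U" "f ` U = W" "M \<in> perfect_matchings U" for f :: "'x \<Rightarrow> 'y" and U W M
  proof -
    have "\<Union>((`) f ` M) = W" using that by (auto simp: perfect_matchings_iff)
    moreover have "disjoint ((`) f ` M)"
      unfolding disjoint_def
    proof (intro ballI impI)
      fix a b assume "a \<in> (`) f ` M" "b \<in> (`) f ` M" "a \<noteq> b"
      then obtain x y where xy: "x \<in> M" "y \<in> M" "a = f ` x" "b = f ` y" "x \<noteq> y" by auto
      then have "x \<inter> y = {}" "x \<subseteq> U" "y \<subseteq> U"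
        using that by (auto simp: perfect_matchings_iff disjoint_def)
      then show "a \<inter> b = {}" using xy that(1) by (auto dest: inj_onD)
    qed
    moreover have "\<forall>e\<in>(`) f ` M. card e = 2"
    proof
      fix e assume "e \<in> (`) f ` M"
      then obtain x where "x \<in> M" "e = f ` x" by auto
      moreover have "x \<subseteq> U" "card x = 2" using that \<open>x \<in> M\<close> by (auto simp: perfect_matchings_iff)
      ultimately show "card e = 2" using that(1) inj_on_subset[of f U x] by (simp add: card_image)
    qed
    ultimately show ?thesis by (simp add: perfect_matchings_iff)
  qed
  have f: "inj_on f U" "f ` U = W" using assms by (auto simp: bij_betw_def)
  define g where "g = the_inv_into U f"
  have g: "inj_on g W" "g ` W = U"
    using bij_betw_the_inv_into[OF assms] by (auto simp: g_def bij_betw_def)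
  have gf: "g (f x) = x" if "x \<in> U" for x using f that by (simp add: g_def the_inv_into_f_f)
  have fg: "f (g x) = x" if "x \<in> W" for x using f that by (auto simp: g_def f_the_inv_into_f)
  have 1: "(`) g ` ((`) f ` M) = M" if "M \<in> perfect_matchings U" for M
  proof -
    have "g ` (f ` e) = e" if "e \<in> M" for e
    proof -
      have "e \<subseteq> U" using that \<open>M \<in> _\<close> by (auto simp: perfect_matchings_iff)
      then have "(\<lambda>x. g (f x)) ` e = (\<lambda>x. x) ` e" using gf by (intro image_cong) auto
      then show ?thesis by (simp add: image_image)
    qed
    then have "(\<lambda>e. g ` (f ` e)) ` M = (\<lambda>e. e) ` M" by (intro image_cong) auto
    then show ?thesis by (simp add: image_image)
  qed
  have 2: "(`) f ` ((`) g ` M) = M" if "M \<in> perfect_matchings W" for M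
  proof -
    have "f ` (g ` e) = e" if "e \<in> M" for e
    proof -
      have "e \<subseteq> W" using that \<open>M \<in> _\<close> by (auto simp: perfect_matchings_iff)
      then have "(\<lambda>x. f (g x)) ` e = (\<lambda>x. x) ` e" using fg by (intro image_cong) auto
      then show ?thesis by (simp add: image_image)
    qed
    then have "(\<lambda>e. f ` (g ` e)) ` M = (\<lambda>e. e) ` M" by (intro image_cong) auto
    then show ?thesis by (simp add: image_image)
  qed
  show ?thesis
    using 1 2 main[OF f] main[OF g] by (intro bij_betw_byWitness[where f' = "(`) ((`) g)"]) auto
qed

lemma card_perfect_matchings_eq:
  assumes "finite U" "finite W" "card U = card W"
  shows "card (perfect_matchings U) = card (perfect_matchings W)"
proof -
  obtain f where "bij_betw f U W" using finite_same_card_bij[OF assms] by auto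
  from bij_betw_same_card[OF bij_betw_perfect_matchings[OF this]] show ?thesis .
qed

text \<open>The matchings of \<open>U\<close> split according to the partner \<open>h'\<close> of
  \<open>h\<close>. All classes have the same size, the number of perfect matchings of a set with
  \<open>card U - 2\<close> elements, so the partner is uniform and the rest is a uniform matching
  of what remains.\<close>

lemma perfect_matchings_reveal:
  assumes "finite U" "even (card U)" "h \<in> U"
  shows "pmf_of_set (perfect_matchings U) =
    pmf_of_set (U - {h}) \<bind> (\<lambda>h'. map_pmf (insert {h, h'}) (pmf_of_set (perfect_matchings (U - {h, h'}))))"
proof -
  define F where "F h' = insert {h, h'} ` perfect_matchings (U - {h, h'})" for h'
  have c: "card (U - {h, h'}) = card U - 2" if "h' \<in> U - {h}" for h'
    using that assms by (subst card_Diff_subset) auto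
  have nonempty: "perfect_matchings (U - {h, h'}) \<noteq> {}" if "h' \<in> U - {h}" for h'
    using assms c[OF that] by (intro perfect_matchings_nonempty) auto
  have notin: "{h, h'} \<notin> M" if "M \<in> perfect_matchings (U - {h, h'})" for M h'
    using that by (auto simp: perfect_matchings_iff)
  have inj: "inj_on (insert {h, h'}) (perfect_matchings (U - {h, h'}))" for h'
    using notin by (intro inj_onI) (metis insert_ident)
  have UN: "perfect_matchings U = (\<Union>h'\<in>U - {h}. F h')"
  proof (intro set_eqI iffI)
    fix M assume M: "M \<in> perfect_matchings U"
    note p = partner_edge[OF M assms(3)]
    have "M = insert {h, partner M h} (M - {{h, partner M h}})" using p by auto
    then show "M \<in> (\<Union>h'\<in>U - {h}. F h')"
      using perfect_matchings_remove[OF M assms(3)] p unfolding F_def by blast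
  next
    fix M assume "M \<in> (\<Union>h'\<in>U - {h}. F h')"
    then show "M \<in> perfect_matchings U"
      using assms by (auto simp: F_def intro!: perfect_matchings_insert)
  qed
  have "U \<noteq> {h}" using assms by auto
  then have ne: "U - {h} \<noteq> {}" using assms by auto
  then obtain h0 where h0: "h0 \<in> U - {h}" by auto
  have "pmf_of_set (\<Union>h'\<in>U - {h}. F h') = pmf_of_set (U - {h}) \<bind> (\<lambda>h'. pmf_of_set (F h'))"
  proof (rule pmf_of_set_UN)
    show "finite (\<Union> (F ` (U - {h})))" using UN finite_perfect_matchings[OF assms(1)] by simp
    show "U - {h} \<noteq> {}" by fact
    show "F x \<noteq> {}" if "x \<in> U - {h}" for x using nonempty[OF that] by (auto simp: F_def)
    show "card (F x) = card (perfect_matchings (U - {h, h0}))" if "x \<in> U - {h}" for x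
      unfolding F_def using assms c[OF that] c[OF h0]
      by (subst card_image[OF inj]) (auto intro!: card_perfect_matchings_eq)
    show "disjoint_family_on F (U - {h})"
      unfolding disjoint_family_on_def
    proof (intro ballI impI)
      fix a b assume ab: "a \<in> U - {h}" "b \<in> U - {h}" "a \<noteq> b"
      show "F a \<inter> F b = {}"
      proof (rule ccontr)
        assume "F a \<inter> F b \<noteq> {}"
        then obtain M where "M \<in> F a" "M \<in> F b" by auto
        moreover from this have "M \<in> perfect_matchings U" unfolding UN using ab by blast
        ultimately have "partner M h = a" "partner M h = b"
          using ab by (auto simp: F_def intro!: partner_eqI)
        with ab show False by simp
      qed
    qed
  qed
  also have "\<dots> = pmf_of_set (U - {h}) \<bind> (\<lambda>h'. map_pmf (insert {h, h'}) (pmf_of_set (perfect_matchings (U - {h, h'}))))"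
  proof (intro bind_pmf_cong refl)
    fix h' assume "h' \<in> set_pmf (pmf_of_set (U - {h}))"
    then have "h' \<in> U - {h}" using assms ne by (simp add: set_pmf_of_set)
    then show "pmf_of_set (F h') = map_pmf (insert {h, h'}) (pmf_of_set (perfect_matchings (U - {h, h'})))"
      unfolding F_def using assms nonempty
      by (intro map_pmf_of_set_inj[symmetric] inj finite_perfect_matchings) auto
  qed
  finally show ?thesis using UN by simp
qed

text \<open>The form in which a partner is revealed inside a computation: the continuation
  \<open>f\<close> may depend on the matching only through the partner of \<open>h\<close> and the
  other edges.\<close>

lemma bind_matching_partner:
  assumes "finite U" "even (card U)" "h \<in> U"
  shows "pmf_of_set (perfect_matchings U) \<bind> (\<lambda>M. f (partner M h) (M - {{h, partner M h}})) =
    pmf_of_set (U - {h}) \<bind> (\<lambda>h'. pmf_of_set (perfect_matchings (U - {h, h'})) \<bind> f h')"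
proof -
  have "U \<noteq> {h}" using assms by auto
  then have ne: "U - {h} \<noteq> {}" using assms by auto
  have "f (partner (insert {h, h'} M) h) (insert {h, h'} M - {{h, partner (insert {h, h'} M) h}}) = f h' M"
    if "h' \<in> U - {h}" "M \<in> perfect_matchings (U - {h, h'})" for h' M
  proof -
    have "insert {h, h'} M \<in> perfect_matchings U"
      using that assms by (intro perfect_matchings_insert) auto
    then have "partner (insert {h, h'} M) h = h'"
      by (rule partner_eqI) (use that in auto)
    moreover have "{h, h'} \<notin> M" using that by (auto simp: perfect_matchings_iff)
    ultimately show ?thesis by simp
  qed
  moreover have "perfect_matchings (U - {h, h'}) \<noteq> {}" if "h' \<in> U - {h}" for h'
    using that assms by (intro perfect_matchings_nonempty) (auto simp: card_Diff_subset)
  ultimately show ?thesis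
    using assms ne
    by (subst perfect_matchings_reveal[OF assms], unfold bind_assoc_pmf bind_map_pmf)
       (intro bind_pmf_cong refl, auto simp: set_pmf_of_set finite_perfect_matchings)
qed

section \<open>Running a chain until a stopping condition\<close>

text \<open>The bound \<open>n\<close> on the number of steps makes the recursion total. The uses
  below take it at least as large as a potential that decreases at every step, so that the stopping
  condition is reached.\<close>

primrec run_until :: "('s \<Rightarrow> bool) \<Rightarrow> ('s \<Rightarrow> 's pmf) \<Rightarrow> nat \<Rightarrow> 's \<Rightarrow> 's pmf" where
  "run_until stop step 0 x = return_pmf x"
| "run_until stop step (Suc n) x =
     (if stop x then return_pmf x else step x \<bind> run_until stop step n)"

lemma run_until_stop: "stop x \<Longrightarrow> run_until stop step n x = return_pmf x"
  by (cases n) auto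

lemma map_run_until:
  assumes "I x"
    and step: "\<And>x. I x \<Longrightarrow> \<not> stop x \<Longrightarrow> map_pmf F (step x) = step' (F x)"
    and inv: "\<And>x y. I x \<Longrightarrow> \<not> stop x \<Longrightarrow> y \<in> set_pmf (step x) \<Longrightarrow> I y"
    and stop: "\<And>x. I x \<Longrightarrow> stop x = stop' (F x)"
  shows "map_pmf F (run_until stop step n x) = run_until stop' step' n (F x)"
  using assms(1)
proof (induction n arbitrary: x)
  case (Suc n)
  show ?case
  proof (cases "stop x")
    case True
    then show ?thesis using stop Suc.prems by simp
  next
    case False
    then have "map_pmf F (run_until stop step (Suc n) x) =
      step x \<bind> (\<lambda>y. map_pmf F (run_until stop step n y))"
      by (simp add: map_bind_pmf)
    also have "\<dots> = step x \<bind> (\<lambda>y. run_until stop' step' n (F y))"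
      using Suc False inv by (intro bind_pmf_cong) auto
    also have "\<dots> = map_pmf F (step x) \<bind> run_until stop' step' n" by (simp add: bind_map_pmf)
    finally show ?thesis using False stop step Suc.prems by simp
  qed
qed simp

lemma run_until_invariant:
  assumes "I x" "y \<in> set_pmf (run_until stop step n x)"
    and inv: "\<And>x y. I x \<Longrightarrow> \<not> stop x \<Longrightarrow> y \<in> set_pmf (step x) \<Longrightarrow> I y"
  shows "I y"
  using assms(1,2)
proof (induction n arbitrary: x)
  case (Suc n)
  then show ?case by (cases "stop x") (auto dest: inv)
qed simp

lemma prob_bind_pmf:
  "measure_pmf.prob (p \<bind> f) A = measure_pmf.expectation p (\<lambda>x. measure_pmf.prob (f x) A)"
proof -
  have "ennreal (measure_pmf.prob (p \<bind> f) A) =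
    (\<integral>\<^sup>+x. ennreal (measure_pmf.prob (f x) A) \<partial>measure_pmf p)"
    by (simp add: measure_pmf.emeasure_eq_measure[symmetric])
  also have "\<dots> = ennreal (measure_pmf.expectation p (\<lambda>x. measure_pmf.prob (f x) A))"
    by (intro nn_integral_eq_integral measure_pmf.integrable_const_bound[where B = 1]) auto
  finally show ?thesis by (simp add: integral_nonneg_AE)
qed

text \<open>A maximal inequality in disguise. Where \<open>V x \<ge> l\<close> the bound is trivial,
  being at least 1; elsewhere one step preserves it by the supermartingale property. So the
  invariant \<open>I\<close> and the drift have to be controlled only while \<open>V\<close> is
  below \<open>l\<close>, and \<open>V x < l\<close> itself may be used in proving them.\<close>

lemma run_until_supermartingale:
  fixes V :: "'s \<Rightarrow> real" and pot :: "'s \<Rightarrow> nat"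
  assumes "I x" "pot x \<le> n" "l > 0"
    and fin: "\<And>x. I x \<Longrightarrow> \<not> stop x \<Longrightarrow> finite (set_pmf (step x))"
    and pot: "\<And>x y. I x \<Longrightarrow> \<not> stop x \<Longrightarrow> y \<in> set_pmf (step x) \<Longrightarrow> pot y < pot x"
    and nonneg: "\<And>x. I x \<Longrightarrow> 0 \<le> V x"
    and inv: "\<And>x y. I x \<Longrightarrow> V x < l \<Longrightarrow> \<not> stop x \<Longrightarrow> y \<in> set_pmf (step x) \<Longrightarrow> I y"
    and super: "\<And>x. I x \<Longrightarrow> V x < l \<Longrightarrow> \<not> stop x \<Longrightarrow> measure_pmf.expectation (step x) V \<le> V x"
    and Q: "\<And>x. I x \<Longrightarrow> V x < l \<Longrightarrow> stop x \<Longrightarrow> Q x"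
    and pot0: "\<And>x. I x \<Longrightarrow> pot x = 0 \<Longrightarrow> stop x"
  shows "measure_pmf.prob (run_until stop step n x) {x. \<not> Q x} \<le> V x / l"
  using assms(1,2)
proof (induction n arbitrary: x)
  case 0
  then have s: "stop x" using pot0 by simp
  show ?case
  proof (cases "V x < l")
    case True
    then have "Q x" using s Q 0 by simp
    then show ?thesis using nonneg[OF 0(1)] \<open>l > 0\<close> by (simp add: measure_return_pmf)
  next
    case False
    then have "1 \<le> V x / l" using \<open>l > 0\<close> by simp
    then show ?thesis using measure_pmf.prob_le_1 by (rule order_trans[rotated])
  qed
next
  case (Suc n)
  consider "V x \<ge> l" | "V x < l" "stop x" | "V x < l" "\<not> stop x" by linarith
  then show ?case
  proof cases
    case 1
    then have "1 \<le> V x / l" using \<open>l > 0\<close> by simp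
    then show ?thesis using measure_pmf.prob_le_1 by (rule order_trans[rotated])
  next
    case 2
    then have "Q x" using Q Suc by simp
    then show ?thesis using 2 nonneg[OF Suc.prems(1)] \<open>l > 0\<close> by (simp add: measure_return_pmf)
  next
    case 3
    note fin = fin[OF Suc.prems(1) 3(2)]
    have "measure_pmf.prob (run_until stop step (Suc n) x) {x. \<not> Q x} =
      measure_pmf.expectation (step x) (\<lambda>y. measure_pmf.prob (run_until stop step n y) {x. \<not> Q x})"
      using 3 by (simp add: prob_bind_pmf)
    also have "\<dots> \<le> measure_pmf.expectation (step x) (\<lambda>y. V y / l)"
    proof (rule integral_mono_AE)
      show "AE y in measure_pmf (step x). measure_pmf.prob (run_until stop step n y) {x. \<not> Q x} \<le> V y / l"
        using Suc.prems 3 inv pot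
        by (auto simp: AE_measure_pmf_iff intro!: Suc.IH dest: pot[OF Suc.prems(1) 3(2)])
    qed (use fin in \<open>auto intro: integrable_measure_pmf_finite\<close>)
    also have "\<dots> = measure_pmf.expectation (step x) V / l" by simp
    also have "\<dots> \<le> V x / l" using super[OF Suc.prems(1) 3] \<open>l > 0\<close> by (simp add: divide_right_mono)
    finally show ?thesis .
  qed
qed

section \<open>From the exploration to the lazy exploration\<close>

definition nbrs :: "half_edge set set \<Rightarrow> nat \<Rightarrow> nat set \<Rightarrow> half_edge set" where
  "nbrs M u S = {h \<in> \<Union>M. fst h = u \<and> fst (partner M h) \<in> S}"

definition rord :: "half_edge set set \<Rightarrow> nat \<Rightarrow> nat set \<Rightarrow> nat list pmf" where
  "rord M u S = map_pmf (map (\<lambda>h. fst (partner M h))) (pmf_of_set (permutations_of_set (nbrs M u S)))"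

lemma random_ordering_eq: "random_ordering M S v = rord M v (S - {v})"
  by (simp add: random_ordering_def rord_def nbrs_def)

lemma finite_nbrs: "finite (\<Union>M) \<Longrightarrow> finite (nbrs M u S)"
  by (rule finite_subset[of _ "\<Union>M"]) (auto simp: nbrs_def)

lemma set_rord:
  assumes "finite (\<Union>M)" "ms \<in> set_pmf (rord M u S)"
  shows "set ms = (\<lambda>h. fst (partner M h)) ` nbrs M u S"
proof -
  have "set_pmf (pmf_of_set (permutations_of_set (nbrs M u S))) = permutations_of_set (nbrs M u S)"
    using finite_nbrs[OF assms(1), of u S] by (simp add: set_pmf_of_set)
  then show ?thesis using assms(2) by (auto simp: rord_def dest: permutations_of_setD)
qed

lemma rord_empty: "nbrs M u S = {} \<Longrightarrow> rord M u S = return_pmf []"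
  by (simp add: rord_def pmf_of_set_singleton)

lemma filter_random_permutation:
  assumes "finite A"
  shows "map_pmf (filter P) (pmf_of_set (permutations_of_set A)) =
    pmf_of_set (permutations_of_set {x \<in> A. P x})"
proof -
  have "map_pmf (filter P) (pmf_of_set (permutations_of_set A)) =
    map_pmf fst (map_pmf (partition P) (pmf_of_set (permutations_of_set A)))"
    by (simp add: pmf.map_comp o_def)
  then show ?thesis using assms by (simp add: partition_random_permutations map_fst_pair_pmf)
qed

text \<open>A uniform permutation filtered by a predicate is a uniform permutation of what is kept.
  The set \<open>B\<close> is free because it will be either the set of all half-edges from
  \<open>u\<close> to \<open>S\<close> or this set without the one that led to
  \<open>v\<close>.\<close>

lemma rord_filter:
  assumes "finite (\<Union>M)" "{h \<in> B. fst (partner M h) \<noteq> v} = nbrs M u (S - {v})" "finite B"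
  shows "map_pmf (\<lambda>xs. filter (\<lambda>x. x \<noteq> v) (map (\<lambda>h. fst (partner M h)) xs))
    (pmf_of_set (permutations_of_set B)) = rord M u (S - {v})"
proof -
  have "map_pmf (\<lambda>xs. filter (\<lambda>x. x \<noteq> v) (map (\<lambda>h. fst (partner M h)) xs))
      (pmf_of_set (permutations_of_set B)) =
    map_pmf (map (\<lambda>h. fst (partner M h)))
      (map_pmf (filter (\<lambda>h. fst (partner M h) \<noteq> v)) (pmf_of_set (permutations_of_set B)))"
    by (simp add: pmf.map_comp o_def filter_map)
  then show ?thesis using assms by (simp add: filter_random_permutation rord_def)
qed

text \<open>The conditional law, for a fixed matching, of the usable parts of the orderings given
  the active list \<open>A\<close> and the sleeping set \<open>S\<close>. The default
  \<open>[]\<close> off \<open>A\<close> agrees with \<open>lump\<close>.\<close>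

definition lam :: "half_edge set set \<Rightarrow> nat list \<Rightarrow> nat set \<Rightarrow> (nat \<Rightarrow> nat list) pmf" where
  "lam M A S = Pi_pmf (set A) [] (\<lambda>u. rord M u S)"

lemma lam_Nil: "lam M [] S = return_pmf (\<lambda>_. [])"
  by (simp add: lam_def)

lemma lam_filter:
  assumes "finite (\<Union>M)"
  shows "map_pmf (\<lambda>ord w. filter (\<lambda>x. x \<noteq> v) (ord w)) (lam M A S) = lam M A (S - {v})"
proof -
  have r: "map_pmf (filter (\<lambda>x. x \<noteq> v)) (rord M u S) = rord M u (S - {v})" for u
    using rord_filter[OF assms, of "nbrs M u S" v u S] finite_nbrs[OF assms]
    by (simp add: rord_def pmf.map_comp o_def nbrs_def conj_ac)
  have "Pi_pmf (set A) [] (\<lambda>u. map_pmf (filter (\<lambda>x. x \<noteq> v)) (rord M u S)) =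
    map_pmf (\<lambda>h. filter (\<lambda>x. x \<noteq> v) \<circ> h) (Pi_pmf (set A) [] (\<lambda>u. rord M u S))"
    by (rule Pi_pmf_map) auto
  then show ?thesis by (simp add: r lam_def o_def)
qed

lemma lam_snoc:
  assumes "v \<notin> set A"
  shows "lam M (A @ [v]) S = rord M v S \<bind> (\<lambda>ms. map_pmf (\<lambda>ord. ord(v := ms)) (lam M A S))"
  unfolding lam_def using assms by (simp add: Pi_pmf_insert' map_pmf_def)

lemma lam_outside:
  assumes "ord \<in> set_pmf (lam M A S)" "v \<notin> set A"
  shows "ord v = []"
  using assms set_Pi_pmf_subset[of "set A" "[]" "\<lambda>u. rord M u S"] by (auto simp: lam_def)

text \<open>The list of an active vertex without sleeping neighbours is empty, and this is also the
  default value: retiring such a vertex does not change the law.\<close>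

lemma lam_snoc_empty:
  assumes "v \<notin> set A" "nbrs M v S = {}"
  shows "lam M (A @ [v]) S = lam M A S"
proof -
  have "map_pmf (\<lambda>ord. ord(v := [])) (lam M A S) = map_pmf (\<lambda>x. x) (lam M A S)"
    by (intro map_pmf_cong refl) (auto simp: fun_eq_iff lam_outside[OF _ assms(1)])
  then show ?thesis using assms by (simp add: lam_snoc rord_empty bind_return_pmf)
qed

section \<open>The exploration with orderings cut down to the sleeping vertices\<close>

type_synonym fstate = "nat list \<times> nat set \<times> (nat \<Rightarrow> nat list)"

definition fact_step :: "half_edge set set \<Rightarrow> nat list \<Rightarrow> nat set \<Rightarrow> (nat \<Rightarrow> nat list) \<Rightarrow> nat \<Rightarrow> fstate pmf" where
  "fact_step M A S ord v =
     map_pmf (\<lambda>ms. (A @ [v], S - {v}, \<lambda>w. if w = v then ms else filter (\<lambda>x. x \<noteq> v) (ord w)))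
       (rord M v (S - {v}))"

definition fstep :: "half_edge set set \<Rightarrow> fstate \<Rightarrow> fstate pmf" where
  "fstep M = (\<lambda>(A, S, ord).
     if A = [] then (if S = {} then return_pmf (A, S, ord) else pmf_of_set S \<bind> fact_step M A S ord)
     else if ord (last A) = [] then return_pmf (butlast A, S, ord)
     else fact_step M A S ord (hd (ord (last A))))"

text \<open>Cutting down the orderings removes the dependence on the past: the head of a list is the
  next vertex to visit, an empty list means that no neighbour sleeps, and the lists have the law
  \<open>lam\<close>.\<close>

definition lump :: "dfs_state \<Rightarrow> fstate" where
  "lump st = (active st, sleeping st,
     \<lambda>u. if u \<in> set (active st) then filter (\<lambda>v. v \<in> sleeping st) (ordering st u) else [])"

text \<open>The last condition turns \<open>has_sleeping_neighbor\<close> into nonemptiness of the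
  filtered ordering.\<close>

definition dfs_inv :: "half_edge set set \<Rightarrow> dfs_state \<Rightarrow> bool" where
  "dfs_inv M st \<longleftrightarrow> finite (sleeping st) \<and> distinct (active st) \<and> set (active st) \<inter> sleeping st = {} \<and>
     (\<forall>u\<in>set (active st). set (filter (\<lambda>v. v \<in> sleeping st) (ordering st u)) =
        (\<lambda>h. fst (partner M h)) ` nbrs M u (sleeping st))"

lemma dfs_inv_hd:
  assumes "dfs_inv M st" "active st \<noteq> []" "has_sleeping_neighbor M st (last (active st))"
  shows "hd (filter (\<lambda>v. v \<in> sleeping st) (ordering st (last (active st)))) \<in> sleeping st"
    "filter (\<lambda>v. v \<in> sleeping st) (ordering st (last (active st))) \<noteq> []"
proof -
  let ?xs = "filter (\<lambda>v. v \<in> sleeping st) (ordering st (last (active st)))"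
  obtain h where "h \<in> nbrs M (last (active st)) (sleeping st)"
    using assms(3) by (auto simp: has_sleeping_neighbor_def nbrs_def)
  then have "nbrs M (last (active st)) (sleeping st) \<noteq> {}" by blast
  moreover have "set ?xs = (\<lambda>h. fst (partner M h)) ` nbrs M (last (active st)) (sleeping st)"
    using assms(1,2) last_in_set[OF assms(2)] by (simp add: dfs_inv_def)
  ultimately have "set ?xs \<noteq> {}" by (simp only: image_is_empty not_False_eq_True)
  then show ne: "?xs \<noteq> []" by (simp only: set_empty not_False_eq_True)
  from hd_in_set[OF ne] show "hd ?xs \<in> sleeping st" by auto
qed

lemma dfs_inv_activate:
  assumes "finite (\<Union>M)" "dfs_inv M st" "v \<in> sleeping st" "st' \<in> set_pmf (activate M st v)"
  shows "dfs_inv M st'"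
proof -
  from assms(4) obtain ms where ms: "ms \<in> set_pmf (rord M v (sleeping st - {v}))"
    and st': "st' = st\<lparr>active := active st @ [v], sleeping := sleeping st - {v}, ordering := (ordering st)(v := ms)\<rparr>"
    by (auto simp: activate_def random_ordering_eq)
  have "set (filter (\<lambda>x. x \<in> sleeping st - {v}) (ordering st u)) =
      (\<lambda>h. fst (partner M h)) ` nbrs M u (sleeping st - {v})" if "u \<in> set (active st)" for u
  proof -
    have "set (filter (\<lambda>x. x \<in> sleeping st - {v}) (ordering st u)) =
      set (filter (\<lambda>v. v \<in> sleeping st) (ordering st u)) - {v}" by auto
    also have "\<dots> = (\<lambda>h. fst (partner M h)) ` nbrs M u (sleeping st) - {v}"
      using assms(2) that by (simp add: dfs_inv_def)
    also have "\<dots> = (\<lambda>h. fst (partner M h)) ` nbrs M u (sleeping st - {v})"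
      by (auto simp: nbrs_def)
    finally show ?thesis .
  qed
  moreover have "set (filter (\<lambda>x. x \<in> sleeping st - {v}) ms) =
      (\<lambda>h. fst (partner M h)) ` nbrs M v (sleeping st - {v})"
    using set_rord[OF assms(1) ms] by (auto simp: nbrs_def)
  ultimately show ?thesis
    using assms(2,3) unfolding dfs_inv_def st' by auto
qed

lemma dfs_inv_step:
  assumes "finite (\<Union>M)" "dfs_inv M st" "st' \<in> set_pmf (dfs_step M st)"
  shows "dfs_inv M st'"
proof -
  have fin: "finite (sleeping st)" using assms(2) by (simp add: dfs_inv_def)
  show ?thesis
  proof (cases "active st = []")
    case True
    then show ?thesis using assms fin dfs_inv_activate[OF assms(1,2)]
      by (auto simp: dfs_step_def set_pmf_of_set split: if_splits)
  next
    case ne: False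
    show ?thesis
    proof (cases "has_sleeping_neighbor M st (last (active st))")
      case True
      then show ?thesis using assms ne dfs_inv_activate[OF assms(1,2)] dfs_inv_hd[OF assms(2) ne True]
        by (auto simp: dfs_step_def)
    next
      case False
      then have "st' = st\<lparr>active := butlast (active st), retired := insert (last (active st)) (retired st)\<rparr>"
        using assms ne by (auto simp: dfs_step_def)
      then show ?thesis using assms(2) unfolding dfs_inv_def
        by (auto simp: distinct_butlast dest: in_set_butlastD)
    qed
  qed
qed

lemma lump_activate:
  assumes "finite (\<Union>M)" "dfs_inv M st" "v \<in> sleeping st"
  shows "map_pmf lump (activate M st v) =
    fact_step M (active st) (sleeping st) (snd (snd (lump st))) v"
  unfolding activate_def fact_step_def random_ordering_eq pmf.map_comp
proof (rule map_pmf_cong[OF refl], unfold o_def)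
  fix ms assume ms: "ms \<in> set_pmf (rord M v (sleeping st - {v}))"
  have "filter (\<lambda>x. x \<in> sleeping st - {v}) ms = ms"
    using set_rord[OF assms(1) ms] by (auto simp: nbrs_def filter_id_conv)
  moreover have "v \<notin> set (active st)" using assms by (auto simp: dfs_inv_def)
  moreover have "filter (\<lambda>x. x \<in> sleeping st - {v}) xs =
      filter (\<lambda>x. x \<noteq> v) (filter (\<lambda>x. x \<in> sleeping st) xs)" for xs
    by (induction xs) auto
  ultimately show "lump (st\<lparr>active := active st @ [v], sleeping := sleeping st - {v}, ordering := (ordering st)(v := ms)\<rparr>) =
    (active st @ [v], sleeping st - {v}, \<lambda>w. if w = v then ms else filter (\<lambda>x. x \<noteq> v) (snd (snd (lump st)) w))"
    by (auto simp: lump_def fun_eq_iff)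
qed

lemma lump_step:
  assumes "finite (\<Union>M)" "dfs_inv M st"
  shows "map_pmf lump (dfs_step M st) = fstep M (lump st)"
proof -
  have fin: "finite (sleeping st)" using assms(2) by (simp add: dfs_inv_def)
  define ord where "ord = snd (snd (lump st))"
  have l: "lump st = (active st, sleeping st, ord)" by (simp add: lump_def ord_def)
  note act = lump_activate[OF assms, folded ord_def]
  show ?thesis
  proof (cases "active st = []")
    case True
    show ?thesis
    proof (cases "sleeping st = {}")
      case False
      then have "map_pmf lump (pmf_of_set (sleeping st) \<bind> activate M st) =
          pmf_of_set (sleeping st) \<bind> fact_step M (active st) (sleeping st) ord"
        unfolding map_bind_pmf using fin act by (intro bind_pmf_cong refl) (auto simp: set_pmf_of_set)
      then show ?thesis using True False by (simp add: dfs_step_def fstep_def l)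
    qed (use True in \<open>simp add: dfs_step_def fstep_def l\<close>)
  next
    case ne: False
    have u: "last (active st) \<in> set (active st)" using ne by simp
    then have o: "ord (last (active st)) = filter (\<lambda>v. v \<in> sleeping st) (ordering st (last (active st)))"
      by (simp add: ord_def lump_def)
    show ?thesis
    proof (cases "has_sleeping_neighbor M st (last (active st))")
      case True
      note h = dfs_inv_hd[OF assms(2) ne True]
      show ?thesis using ne True h act by (simp add: dfs_step_def fstep_def l o)
    next
      case False
      then have "nbrs M (last (active st)) (sleeping st) = {}"
        by (auto simp: has_sleeping_neighbor_def nbrs_def)
      then have "set (ord (last (active st))) = {}"
        using assms(2) u unfolding dfs_inv_def o by auto
      then have oe: "ord (last (active st)) = []" by simp
      define A where "A = butlast (active st)"
      have A: "active st = A @ [last (active st)]" using ne by (simp add: A_def)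
      have "distinct (active st)" using assms(2) by (simp add: dfs_inv_def)
      then have ls: "last (active st) \<notin> set A" by (subst (asm) A) simp
      have sA: "set (active st) = insert (last (active st)) (set A)" by (subst A) simp
      \<comment> \<open>The retired vertex had an empty filtered list, so resetting its entry to the
        default \<open>[]\<close> changes nothing.\<close>
      have "lump (st\<lparr>active := butlast (active st), retired := insert (last (active st)) (retired st)\<rparr>) =
        (butlast (active st), sleeping st, ord)"
      proof -
        have "(if u \<in> set A then filter (\<lambda>v. v \<in> sleeping st) (ordering st u) else []) = ord u" for u
          using oe ls sA by (cases "u = last (active st)") (auto simp: ord_def lump_def)
        then have "(\<lambda>u. if u \<in> set A then filter (\<lambda>v. v \<in> sleeping st) (ordering st u) else []) = ord"
          by (rule ext)
        then show ?thesis by (simp add: lump_def cong: if_cong flip: A_def)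
      qed
      then show ?thesis using ne False oe by (simp add: dfs_step_def fstep_def l)
    qed
  qed
qed

text \<open>The number of steps left: a sleeping vertex still needs an activation and a retirement,
  an active one only a retirement.\<close>

definition dfs_pot :: "dfs_state \<Rightarrow> nat" where
  "dfs_pot st = 2 * card (sleeping st) + length (active st)"

text \<open>The subtraction has to be truncated, since the final state has potential 0 and repeats
  itself. The third claim will show that fewer than \<open>N\<close> vertices sleep from time 1
  on.\<close>

lemma dfs_step_sleeping:
  assumes "finite (\<Union>M)" "dfs_inv M st" "st' \<in> set_pmf (dfs_step M st)"
  shows "sleeping st' \<subseteq> sleeping st" "dfs_pot st' \<le> dfs_pot st - 1"
    "active st = [] \<Longrightarrow> sleeping st \<noteq> {} \<Longrightarrow> sleeping st' \<subset> sleeping st"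
proof -
  have fin: "finite (sleeping st)" using assms(2) by (simp add: dfs_inv_def)
  have act: "sleeping st'' = sleeping st - {v} \<and> length (active st'') = Suc (length (active st))"
    if "st'' \<in> set_pmf (activate M st v)" for v st''
    using that by (auto simp: activate_def)
  have card: "2 * card (sleeping st - {v}) + 2 = 2 * card (sleeping st)" if "v \<in> sleeping st" for v
    using that fin card_Suc_Diff1[of "sleeping st" v] by simp
  consider "st' = st" "active st = []" "sleeping st = {}"
    | v where "v \<in> sleeping st" "sleeping st' = sleeping st - {v}" "length (active st') = Suc (length (active st))"
    | "active st \<noteq> []" "sleeping st' = sleeping st" "length (active st') = length (active st) - 1"
  proof (cases "active st = []")
    case True
    show ?thesis
    proof (cases "sleeping st = {}")
      case False
      then obtain v where v: "v \<in> sleeping st" "st' \<in> set_pmf (activate M st v)"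
        using assms True fin by (auto simp: dfs_step_def set_pmf_of_set)
      then show ?thesis using act[OF v(2)] that(2) by blast
    next
      case e: True
      then have "st' = st" using assms(3) True by (simp add: dfs_step_def)
      then show ?thesis using True e that(1) by blast
    qed
  next
    case ne: False
    show ?thesis
    proof (cases "has_sleeping_neighbor M st (last (active st))")
      case True
      let ?v = "hd (filter (\<lambda>v. v \<in> sleeping st) (ordering st (last (active st))))"
      have "st' \<in> set_pmf (activate M st ?v)" using assms(3) True ne by (simp add: dfs_step_def)
      from act[OF this] show ?thesis using dfs_inv_hd(1)[OF assms(2) ne True] that(2) by blast
    next
      case False
      then have "st' = st\<lparr>active := butlast (active st), retired := insert (last (active st)) (retired st)\<rparr>"
        using assms(3) ne by (simp add: dfs_step_def)
      then show ?thesis using ne that(3) by simp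
    qed
  qed
  note cases = this
  show "sleeping st' \<subseteq> sleeping st" by (rule cases) auto
  show "dfs_pot st' \<le> dfs_pot st - 1"
  proof (rule cases)
    fix v assume "v \<in> sleeping st" "sleeping st' = sleeping st - {v}" "length (active st') = Suc (length (active st))"
    then show ?thesis using card[of v] by (simp add: dfs_pot_def)
  next
    assume "active st \<noteq> []" "sleeping st' = sleeping st" "length (active st') = length (active st) - 1"
    then show ?thesis by (cases "active st") (auto simp: dfs_pot_def)
  qed (auto simp: dfs_pot_def)
  show "sleeping st' \<subset> sleeping st" if "active st = []" "sleeping st \<noteq> {}"
    by (rule cases) (use that in auto)
qed

section \<open>Comparison with the exploration that examines one half-edge at a time\<close>

type_synonym mstate = "nat list \<times> nat set \<times> half_edge set set"

text \<open>The top vertex examines its half-edges one at a time; the third component is the set of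
  edges that have not been examined.\<close>

definition mstep :: "mstate \<Rightarrow> mstate pmf" where
  "mstep = (\<lambda>(A, S, M).
     if A = [] then map_pmf (\<lambda>v. ([v], S - {v}, M)) (pmf_of_set S)
     else let E = {h \<in> \<Union>M. fst h = last A} in
       if E = {} then return_pmf (butlast A, S, M)
       else map_pmf (\<lambda>h. let v = fst (partner M h); M' = M - {{h, partner M h}} in
              if v \<in> S then (A @ [v], S - {v}, M') else (A, S, M')) (pmf_of_set E))"

lemma mstep_Nil: "mstep ([], S, M) = map_pmf (\<lambda>v. ([v], S - {v}, M)) (pmf_of_set S)"
  by (simp add: mstep_def)

lemma mstep_pop:
  "A \<noteq> [] \<Longrightarrow> {h \<in> \<Union>M. fst h = last A} = {} \<Longrightarrow> mstep (A, S, M) = return_pmf (butlast A, S, M)"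
  by (simp only: mstep_def Let_def prod.case if_False if_True simp_thms)

lemma mstep_examine:
  "A \<noteq> [] \<Longrightarrow> {h \<in> \<Union>M. fst h = last A} \<noteq> {} \<Longrightarrow> mstep (A, S, M) =
    map_pmf (\<lambda>h. let v = fst (partner M h); M' = M - {{h, partner M h}} in
      if v \<in> S then (A @ [v], S - {v}, M') else (A, S, M')) (pmf_of_set {h \<in> \<Union>M. fst h = last A})"
  by (simp only: mstep_def Let_def prod.case if_False)

text \<open>Rejection sampling: a draw from \<open>E\<close> that misses \<open>B\<close> is
  replaced by a fresh draw from \<open>B\<close>. This absorbs the examinations of half-edges that
  do not lead to a sleeping vertex.\<close>

lemma pmf_of_set_restart:
  assumes "finite E" "B \<subseteq> E" "B \<noteq> {}"
  shows "pmf_of_set E \<bind> (\<lambda>h. if h \<in> B then T h else pmf_of_set B \<bind> T) = pmf_of_set B \<bind> T"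
proof (rule pmf_eqI)
  fix x
  have fB: "finite B" using assms finite_subset by blast
  have nE: "E \<noteq> {}" using assms by auto
  define s where "s = (\<Sum>h\<in>B. pmf (T h) x)"
  have "(\<Sum>h\<in>E. pmf (if h \<in> B then T h else pmf_of_set B \<bind> T) x) =
    (\<Sum>h\<in>B. pmf (T h) x) + (\<Sum>h\<in>E - B. pmf (pmf_of_set B \<bind> T) x)"
    using assms(1,2) by (subst sum.subset_diff[OF assms(2,1)]) (auto intro!: sum.cong)
  also have "\<dots> = s + (real (card E) - real (card B)) * (s / real (card B))"
    using assms fB card_mono[OF assms(1,2)]
    by (simp add: pmf_bind_pmf_of_set s_def card_Diff_subset of_nat_diff)
  also have "\<dots> = real (card E) * (s / real (card B))"
    using fB assms by (simp add: field_simps)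
  finally show "pmf (pmf_of_set E \<bind> (\<lambda>h. if h \<in> B then T h else pmf_of_set B \<bind> T)) x =
      pmf (pmf_of_set B \<bind> T) x"
    using nE assms fB by (simp add: pmf_bind_pmf_of_set s_def)
qed

text \<open>After the top vertex \<open>u\<close> has used \<open>h\<close>, the rest of its list is
  a uniform permutation of its other half-edges towards \<open>S\<close>, independent of the other
  lists. Deleting \<open>v\<close> everywhere and drawing an ordering for \<open>v\<close> therefore
  reproduces \<open>lam\<close> for the longer list of active vertices.\<close>

lemma lam_activate_top:
  assumes fin: "finite (\<Union>M)" and d: "u \<notin> set A" "v \<notin> set A" "v \<noteq> u"
    and h: "h \<in> nbrs M u S" and v: "v = fst (partner M h)"
  shows "(pmf_of_set (permutations_of_set (nbrs M u S - {h})) \<bind> (\<lambda>xs. lam M A S \<bind> (\<lambda>ord.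
      map_pmf (\<lambda>ms w. if w = v then ms else
        filter (\<lambda>x. x \<noteq> v) ((ord(u := v # map (\<lambda>h. fst (partner M h)) xs)) w))
      (rord M v (S - {v}))))) = lam M (A @ [u] @ [v]) (S - {v})"
proof -
  let ?f = "\<lambda>h. fst (partner M h)"
  let ?P = "pmf_of_set (permutations_of_set (nbrs M u S - {h}))"
  have l: "map_pmf (\<lambda>xs. filter (\<lambda>x. x \<noteq> v) (map ?f xs)) ?P = rord M u (S - {v})"
    using finite_nbrs[OF fin, of u S] v by (intro rord_filter fin) (auto simp: nbrs_def)
  have "lam M (A @ [u] @ [v]) (S - {v}) = rord M v (S - {v}) \<bind> (\<lambda>ms.
      rord M u (S - {v}) \<bind> (\<lambda>l. lam M A (S - {v}) \<bind> (\<lambda>ord. return_pmf (ord(u := l, v := ms)))))"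
    using d by (subst append_assoc[symmetric], subst lam_snoc)
      (auto simp: lam_snoc map_bind_pmf pmf.map_comp o_def map_pmf_def bind_assoc_pmf bind_return_pmf)
  also have "\<dots> = rord M v (S - {v}) \<bind> (\<lambda>ms. ?P \<bind> (\<lambda>xs. lam M A S \<bind> (\<lambda>ord.
      return_pmf ((\<lambda>w. filter (\<lambda>x. x \<noteq> v) (ord w))(u := filter (\<lambda>x. x \<noteq> v) (map ?f xs), v := ms)))))"
    by (subst l[symmetric], subst lam_filter[OF fin, symmetric]) (simp add: bind_map_pmf)
  also have "\<dots> = ?P \<bind> (\<lambda>xs. rord M v (S - {v}) \<bind> (\<lambda>ms. lam M A S \<bind> (\<lambda>ord.
      return_pmf ((\<lambda>w. filter (\<lambda>x. x \<noteq> v) (ord w))(u := filter (\<lambda>x. x \<noteq> v) (map ?f xs), v := ms)))))"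
    by (rule bind_commute_pmf)
  also have "\<dots> = ?P \<bind> (\<lambda>xs. lam M A S \<bind> (\<lambda>ord. rord M v (S - {v}) \<bind> (\<lambda>ms.
      return_pmf ((\<lambda>w. filter (\<lambda>x. x \<noteq> v) (ord w))(u := filter (\<lambda>x. x \<noteq> v) (map ?f xs), v := ms)))))"
    by (intro bind_pmf_cong refl) (rule bind_commute_pmf)
  also have "\<dots> = ?P \<bind> (\<lambda>xs. lam M A S \<bind> (\<lambda>ord. map_pmf (\<lambda>ms w. if w = v then ms else
        filter (\<lambda>x. x \<noteq> v) ((ord(u := v # map ?f xs)) w)) (rord M v (S - {v}))))"
    unfolding map_pmf_def
    by (intro bind_pmf_cong refl arg_cong[where f = return_pmf]) (auto simp: fun_eq_iff)
  finally show ?thesis ..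
qed

abbreviation "small m \<equiv> (\<lambda>x. card (fst (snd x)) \<le> m)"

text \<open>The run started with freshly drawn orderings. Only the final sleeping set is kept,
  because the lists have no counterpart in \<open>mstep\<close>.\<close>

definition lam_run :: "half_edge set set \<Rightarrow> nat \<Rightarrow> nat \<Rightarrow> nat list \<Rightarrow> nat set \<Rightarrow> nat set pmf" where
  "lam_run M m n A S = lam M A S \<bind> (\<lambda>ord.
     map_pmf (\<lambda>x. fst (snd x)) (run_until (small m) (fstep M) n (A, S, ord)))"

text \<open>The head of a uniform permutation is uniform and its tail is again a uniform
  permutation, so the orderings may be redrawn after each activation instead of being
  stored.\<close>

lemma lam_run_restart:
  assumes fin: "finite (\<Union>M)" and "finite S" "u \<notin> set A" "set (A @ [u]) \<inter> S = {}" "m < card S"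
    and ne: "nbrs M u S \<noteq> {}"
  shows "lam_run M m (Suc n) (A @ [u]) S =
    pmf_of_set (nbrs M u S) \<bind> (\<lambda>h. let v = fst (partner M h) in lam_run M m n (A @ [u] @ [v]) (S - {v}))"
proof -
  let ?f = "\<lambda>h. fst (partner M h)"
  let ?B = "nbrs M u S"
  let ?P = "\<lambda>h. pmf_of_set (permutations_of_set (?B - {h}))"
  let ?run = "\<lambda>n x. map_pmf (\<lambda>x. fst (snd x)) (run_until (small m) (fstep M) n x)"
  have fB: "finite ?B" by (rule finite_nbrs[OF fin])
  have r: "rord M u S = pmf_of_set ?B \<bind> (\<lambda>h. ?P h \<bind> (\<lambda>xs. return_pmf (?f h # map ?f xs)))"
    using fB ne by (simp add: rord_def random_permutation_of_set[OF fB ne] map_bind_pmf)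
  have "lam_run M m (Suc n) (A @ [u]) S = rord M u S \<bind> (\<lambda>l. lam M A S \<bind> (\<lambda>ord.
      ?run (Suc n) (A @ [u], S, ord(u := l))))"
    using assms by (simp add: lam_run_def lam_snoc bind_assoc_pmf bind_map_pmf)
  also have "\<dots> = pmf_of_set ?B \<bind> (\<lambda>h. ?P h \<bind> (\<lambda>xs. lam M A S \<bind> (\<lambda>ord.
      ?run (Suc n) (A @ [u], S, ord(u := ?f h # map ?f xs)))))"
    unfolding r by (simp add: bind_assoc_pmf bind_return_pmf del: run_until.simps)
  also have "\<dots> = pmf_of_set ?B \<bind> (\<lambda>h. let v = ?f h in
      (?P h \<bind> (\<lambda>xs. lam M A S \<bind> (\<lambda>ord.
      map_pmf (\<lambda>ms w. if w = v then ms else filter (\<lambda>x. x \<noteq> v) ((ord(u := v # map ?f xs)) w))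
      (rord M v (S - {v}))))) \<bind> (\<lambda>ord. ?run n (A @ [u] @ [v], S - {v}, ord)))"
    using assms(5)
    by (intro bind_pmf_cong refl)
       (simp add: Let_def bind_assoc_pmf bind_map_pmf map_bind_pmf fstep_def fact_step_def)
  also have "\<dots> = pmf_of_set ?B \<bind> (\<lambda>h. let v = ?f h in lam_run M m n (A @ [u] @ [v]) (S - {v}))"
  proof (intro bind_pmf_cong refl)
    fix h assume "h \<in> set_pmf (pmf_of_set ?B)"
    then have h: "h \<in> ?B" using fB ne by (simp add: set_pmf_of_set)
    then have v: "?f h \<in> S" by (simp add: nbrs_def)
    then have "?f h \<notin> set A" "?f h \<noteq> u" using assms(4) by auto
    from lam_activate_top[OF fin assms(3) this h refl]
    show "(let v = ?f h in
      (?P h \<bind> (\<lambda>xs. lam M A S \<bind> (\<lambda>ord.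
      map_pmf (\<lambda>ms w. if w = v then ms else filter (\<lambda>x. x \<noteq> v) ((ord(u := v # map ?f xs)) w))
      (rord M v (S - {v}))))) \<bind> (\<lambda>ord. ?run n (A @ [u] @ [v], S - {v}, ord))) =
      (let v = ?f h in lam_run M m n (A @ [u] @ [v]) (S - {v}))"
      by (simp add: Let_def lam_run_def)
  qed
  finally show ?thesis .
qed

text \<open>Induction on the steps of the lazy exploration. Its bound \<open>n'\<close> also counts
  edges, because it spends steps on edges that lead to no sleeping vertex, during which the other
  side stands still. The premise on \<open>M - M'\<close> says that the edges examined so far have
  no end in \<open>S\<close>, so that every half-edge from an active vertex to \<open>S\<close> is
  still covered by \<open>M'\<close>.\<close>

lemma lam_run_eq_mstep:
  assumes M: "M \<in> perfect_matchings H" and H: "finite H"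
  shows "finite S \<Longrightarrow> distinct A \<Longrightarrow> set A \<inter> S = {} \<Longrightarrow> M' \<subseteq> M \<Longrightarrow>
    (\<And>e h. e \<in> M - M' \<Longrightarrow> h \<in> e \<Longrightarrow> fst h \<notin> S) \<Longrightarrow>
    2 * card S + length A \<le> n \<Longrightarrow> 2 * card S + length A + card M' \<le> n' \<Longrightarrow>
    lam_run M m n A S = map_pmf (\<lambda>x. fst (snd x)) (run_until (small m) mstep n' (A, S, M'))"
proof (induction n' arbitrary: n A S M')
  case 0
  then have "S = {}" by auto
  then show ?case by (simp add: lam_run_def run_until_stop)
next
  case (Suc n')
  have UM: "\<Union>M = H" using M by (simp add: perfect_matchings_iff)
  have fin: "finite (\<Union>M)" using UM H by simp
  have finM: "finite M" using fin by (rule finite_UnionD)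
  have finM': "finite M'" using finM Suc.prems(4) finite_subset by blast
  have UM': "\<Union>M' \<subseteq> \<Union>M" using Suc.prems(4) by blast
  show ?case
  proof (cases "card S \<le> m")
    case True
    then show ?thesis by (simp add: lam_run_def run_until_stop)
  next
    case nstop: False
    then have S: "S \<noteq> {}" by auto
    then have "n \<noteq> 0" using Suc.prems by (auto simp: card_gt_0_iff)
    then obtain n1 where n: "n = Suc n1" by (cases n) auto
    show ?thesis
    proof (cases A rule: rev_cases)
      case Nil
      have "lam_run M m n [] S = pmf_of_set S \<bind> (\<lambda>v. rord M v (S - {v}) \<bind> (\<lambda>ms.
          map_pmf (\<lambda>x. fst (snd x)) (run_until (small m) (fstep M) n1 ([v], S - {v}, (\<lambda>_. [])(v := ms)))))"
        using nstop S unfolding n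
        by (simp add: lam_run_def lam_Nil bind_return_pmf fstep_def fact_step_def map_bind_pmf
            bind_assoc_pmf bind_map_pmf fun_upd_def cong: if_cong)
      also have "\<dots> = pmf_of_set S \<bind> (\<lambda>v. lam_run M m n1 [v] (S - {v}))"
        using lam_snoc[of _ "[]" M] by (simp add: lam_run_def lam_Nil bind_assoc_pmf bind_return_pmf)
      also have "\<dots> = pmf_of_set S \<bind> (\<lambda>v. map_pmf (\<lambda>x. fst (snd x)) (run_until (small m) mstep n' ([v], S - {v}, M')))"
      proof (intro bind_pmf_cong refl)
        fix v assume "v \<in> set_pmf (pmf_of_set S)"
        then have v: "v \<in> S" using Suc.prems(1) S by (simp add: set_pmf_of_set)
        have "Suc (card (S - {v})) = card S" using v Suc.prems(1) by (rule card_Suc_Diff1[rotated])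
        then show "lam_run M m n1 [v] (S - {v}) =
            map_pmf (\<lambda>x. fst (snd x)) (run_until (small m) mstep n' ([v], S - {v}, M'))"
          using Suc.prems n Nil by (intro Suc.IH) auto
      qed
      also have "\<dots> = map_pmf (\<lambda>x. fst (snd x)) (run_until (small m) mstep (Suc n') (A, S, M'))"
        using nstop Nil by (simp add: mstep_Nil map_bind_pmf bind_map_pmf)
      finally show ?thesis using Nil by simp
    next
      case (snoc A' u)
      let ?E = "{h \<in> \<Union>M'. fst h = u}"
      let ?B = "nbrs M u S"
      have u: "u \<notin> set A'" "u \<notin> S" using Suc.prems snoc by auto
      have fE: "finite ?E" using fin UM' by (auto intro: finite_subset[of _ "\<Union>M"])
      have BE: "?B \<subseteq> ?E"
      proof
        fix h assume h: "h \<in> ?B"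
        then have "h \<in> H" by (auto simp: nbrs_def UM[symmetric])
        then have "{h, partner M h} \<in> M" by (rule partner_edge[OF M])
        moreover have "fst (partner M h) \<in> S" using h by (simp add: nbrs_def)
        ultimately have "{h, partner M h} \<in> M'" using Suc.prems(5) by blast
        then show "h \<in> ?E" using h by (auto simp: nbrs_def)
      qed
      have pE: "partner M' h = partner M h" if "h \<in> ?E" for h
        using partner_subset[OF M Suc.prems(4)] that by simp
      have EB: "h \<in> ?B \<longleftrightarrow> fst (partner M h) \<in> S" if "h \<in> ?E" for h
        using that UM' by (auto simp: nbrs_def)
      show ?thesis
      proof (cases "?E = {}")
        case True
        then have B: "?B = {}" using BE by (simp only: subset_empty)
        have "lam_run M m n A S = lam M A' S \<bind> (\<lambda>ord.
            map_pmf (\<lambda>x. fst (snd x)) (run_until (small m) (fstep M) n (A, S, ord)))"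
          unfolding lam_run_def snoc lam_snoc_empty[OF u(1) B] ..
        also have "\<dots> = lam_run M m n1 A' S"
          unfolding lam_run_def n
        proof (intro bind_pmf_cong refl arg_cong[where f = "map_pmf _"])
          fix ord assume "ord \<in> set_pmf (lam M A' S)"
          then have "ord u = []" using lam_outside u(1) by blast
          then show "run_until (small m) (fstep M) (Suc n1) (A, S, ord) = run_until (small m) (fstep M) n1 (A', S, ord)"
            using nstop snoc by (simp add: fstep_def bind_return_pmf)
        qed
        also have "\<dots> = map_pmf (\<lambda>x. fst (snd x)) (run_until (small m) mstep n' (A', S, M'))"
          using Suc.prems n snoc by (intro Suc.IH) auto
        also have "\<dots> = map_pmf (\<lambda>x. fst (snd x)) (run_until (small m) mstep (Suc n') (A, S, M'))"
          using nstop True mstep_pop[of A M' S]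
          by (simp add: snoc bind_return_pmf del: Union_iff)
        finally show ?thesis .
      next
        case Ene: False
        let ?e = "\<lambda>h. {h, partner M h}"
        \<comment> \<open>A half-edge that does not lead to \<open>S\<close> keeps \<open>n\<close>:
          only an edge is consumed, and the run starts over from the same \<open>A\<close> and
          \<open>S\<close>.\<close>
        define br where "br h = (let v = fst (partner M h) in
          if v \<in> S then lam_run M m n1 (A @ [v]) (S - {v}) else lam_run M m n A S)" for h
        have edge: "?e h \<in> M'" if "h \<in> ?E" for h
        proof -
          from that obtain e where e: "e \<in> M'" "h \<in> e" by auto
          then have "e = ?e h" using edge_eq_partner[OF M] Suc.prems(4) by blast
          then show ?thesis using e by simp
        qed
        have c: "Suc (card (M' - {?e h})) = card M'" if "h \<in> ?E" for h
          using edge[OF that] finM' by (rule card_Suc_Diff1[rotated])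
        have "map_pmf (\<lambda>x. fst (snd x)) (run_until (small m) mstep (Suc n') (A, S, M')) =
          pmf_of_set ?E \<bind> (\<lambda>h. map_pmf (\<lambda>x. fst (snd x)) (run_until (small m) mstep n'
            (let v = fst (partner M' h); M'' = M' - {{h, partner M' h}} in
              if v \<in> S then (A @ [v], S - {v}, M'') else (A, S, M''))))"
          using nstop Ene mstep_examine[of A M' S]
          by (simp add: snoc map_bind_pmf bind_map_pmf del: Union_iff)
        also have "\<dots> = pmf_of_set ?E \<bind> br"
        proof (intro bind_pmf_cong refl)
          fix h assume "h \<in> set_pmf (pmf_of_set ?E)"
          then have h: "h \<in> ?E" using fE Ene by (simp add: set_pmf_of_set)
          have diff: "h' \<in> ?e h" if "e \<in> M - (M' - {?e h})" "e \<notin> M - M'" "h' \<in> e" for e h'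
            using that by auto
          show "map_pmf (\<lambda>x. fst (snd x)) (run_until (small m) mstep n'
            (let v = fst (partner M' h); M'' = M' - {{h, partner M' h}} in
              if v \<in> S then (A @ [v], S - {v}, M'') else (A, S, M''))) = br h"
          proof (cases "fst (partner M h) \<in> S")
            case True
            let ?v = "fst (partner M h)"
            have "Suc (card (S - {?v})) = card S" using True Suc.prems(1) by (rule card_Suc_Diff1[rotated])
            moreover have "fst h' \<notin> S - {?v}" if "e \<in> M - (M' - {?e h})" "h' \<in> e" for e h'
            proof (cases "e \<in> M - M'")
              case False
              then have "h' \<in> ?e h" using diff that by blast
              then show ?thesis using h u by auto
            qed (use that Suc.prems(5) in blast)
            ultimately have "lam_run M m n1 (A @ [?v]) (S - {?v}) =
              map_pmf (\<lambda>x. fst (snd x)) (run_until (small m) mstep n' (A @ [?v], S - {?v}, M' - {?e h}))"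
              using Suc.prems n c[OF h] True by (intro Suc.IH) auto
            then show ?thesis using True pE[OF h] by (simp add: br_def Let_def)
          next
            case False
            have "fst h' \<notin> S" if "e \<in> M - (M' - {?e h})" "h' \<in> e" for e h'
            proof (cases "e \<in> M - M'")
              case e: False
              then have "h' \<in> ?e h" using diff that by blast
              then show ?thesis using h u False by auto
            qed (use that Suc.prems(5) in blast)
            then have "lam_run M m n A S =
              map_pmf (\<lambda>x. fst (snd x)) (run_until (small m) mstep n' (A, S, M' - {?e h}))"
              using Suc.prems n c[OF h] by (intro Suc.IH) auto
            then show ?thesis using False pE[OF h] by (simp add: br_def Let_def)
          qed
        qed
        \<comment> \<open>If no half-edge leads to \<open>S\<close>, all branches are the same run;
          otherwise the failed examinations are rejected draws.\<close>
        also have "\<dots> = lam_run M m n A S"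
        proof (cases "?B = {}")
          case True
          have "pmf_of_set ?E \<bind> br = pmf_of_set ?E \<bind> (\<lambda>_. lam_run M m n A S)"
            using fE Ene EB True by (intro bind_pmf_cong refl) (auto simp: set_pmf_of_set br_def Let_def)
          then show ?thesis by simp
        next
          case False
          let ?T = "\<lambda>h. let v = fst (partner M h) in lam_run M m n1 (A' @ [u] @ [v]) (S - {v})"
          have T: "lam_run M m n A S = pmf_of_set ?B \<bind> ?T"
            unfolding n snoc using lam_run_restart[OF fin Suc.prems(1) u(1) _ _ False] Suc.prems(3) nstop snoc
            by simp
          have "pmf_of_set ?E \<bind> br = pmf_of_set ?E \<bind> (\<lambda>h. if h \<in> ?B then ?T h else pmf_of_set ?B \<bind> ?T)"
            using fE Ene EB T snoc
            by (intro bind_pmf_cong refl) (auto simp: set_pmf_of_set br_def Let_def)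
          also have "\<dots> = pmf_of_set ?B \<bind> ?T" by (rule pmf_of_set_restart[OF fE BE False])
          finally show ?thesis using T by simp
        qed
        finally show ?thesis ..
      qed
    qed
  qed
qed

section \<open>Revealing the matching along the exploration\<close>

type_synonym ustate = "nat list \<times> nat set \<times> half_edge set \<times> nat set"

text \<open>The third component is the set of unmatched half-edges, the fourth one collects the vertices
  that were picked while no vertex was active.\<close>

definition ustep :: "ustate \<Rightarrow> ustate pmf" where
  "ustep = (\<lambda>(A, S, U, C).
     if A = [] then map_pmf (\<lambda>v. ([v], S - {v}, U, insert v C)) (pmf_of_set S)
     else let E = {h \<in> U. fst h = last A} in
       if E = {} then return_pmf (butlast A, S, U, C)
       else pmf_of_set E \<bind> (\<lambda>h. map_pmf (\<lambda>h'. let v = fst h' in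
              if v \<in> S then (A @ [v], S - {v}, U - {h, h'}, C) else (A, S, U - {h, h'}, C))
            (pmf_of_set (U - {h}))))"

lemma ustep_Nil: "ustep ([], S, U, C) = map_pmf (\<lambda>v. ([v], S - {v}, U, insert v C)) (pmf_of_set S)"
  by (simp add: ustep_def)

lemma ustep_pop:
  "A \<noteq> [] \<Longrightarrow> {h \<in> U. fst h = last A} = {} \<Longrightarrow> ustep (A, S, U, C) = return_pmf (butlast A, S, U, C)"
  by (simp only: ustep_def Let_def prod.case if_False if_True simp_thms)

lemma ustep_examine:
  "A \<noteq> [] \<Longrightarrow> {h \<in> U. fst h = last A} \<noteq> {} \<Longrightarrow> ustep (A, S, U, C) =
    pmf_of_set {h \<in> U. fst h = last A} \<bind> (\<lambda>h. map_pmf (\<lambda>h'. let v = fst h' in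
      if v \<in> S then (A @ [v], S - {v}, U - {h, h'}, C) else (A, S, U - {h, h'}, C)) (pmf_of_set (U - {h})))"
  by (simp only: ustep_def Let_def prod.case if_False)

abbreviation "unmatched x \<equiv> fst (snd (snd x))"

text \<open>Deferred decisions: a step looks at the matching only through the partner of the
  examined half-edge, which is uniform, and leaves a uniform matching of the others. The remaining
  matching is part of the outcome because the induced graph will be read off it. The component
  \<open>C\<close> is a mere record, hence arbitrary at the start.\<close>

lemma mstep_annealed:
  assumes "finite U" "even (card U)" "finite S"
  shows "pmf_of_set (perfect_matchings U) \<bind> (\<lambda>M.
      map_pmf snd (run_until (small m) mstep n (A, S, M))) =
    run_until (small m) ustep n (A, S, U, C) \<bind> (\<lambda>x.
      map_pmf (\<lambda>M. (fst (snd x), M)) (pmf_of_set (perfect_matchings (unmatched x))))"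
  using assms
proof (induction n arbitrary: A S U C)
  case 0
  then show ?case by (simp add: bind_return_pmf map_pmf_def)
next
  case (Suc n)
  let ?rhs = "\<lambda>x. map_pmf (\<lambda>M. (fst (snd x), M)) (pmf_of_set (perfect_matchings (unmatched x)))"
  let ?lhs = "\<lambda>n x. map_pmf snd (run_until (small m) mstep n x)"
  have sM: "\<Union>M = U" if "M \<in> set_pmf (pmf_of_set (perfect_matchings U))" for M
    using that Suc.prems perfect_matchings_nonempty[of U] finite_perfect_matchings[of U]
    by (simp add: set_pmf_of_set perfect_matchings_iff)
  show ?case
  proof (cases "card S \<le> m")
    case True
    then show ?thesis by (simp add: bind_return_pmf map_pmf_def)
  next
    case nstop: False
    then have S: "S \<noteq> {}" by auto
    show ?thesis
    proof (cases "A = []")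
      case True
      have "pmf_of_set (perfect_matchings U) \<bind> (\<lambda>M. ?lhs (Suc n) (A, S, M)) =
        pmf_of_set (perfect_matchings U) \<bind> (\<lambda>M. pmf_of_set S \<bind> (\<lambda>v. ?lhs n ([v], S - {v}, M)))"
        using nstop True by (simp add: mstep_Nil map_bind_pmf bind_map_pmf)
      also have "\<dots> = pmf_of_set S \<bind> (\<lambda>v. pmf_of_set (perfect_matchings U) \<bind> (\<lambda>M. ?lhs n ([v], S - {v}, M)))"
        by (rule bind_commute_pmf)
      also have "\<dots> = pmf_of_set S \<bind> (\<lambda>v. run_until (small m) ustep n ([v], S - {v}, U, insert v C) \<bind> ?rhs)"
        using Suc.prems by (intro bind_pmf_cong refl Suc.IH) auto
      also have "\<dots> = run_until (small m) ustep (Suc n) (A, S, U, C) \<bind> ?rhs"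
        using nstop True by (simp add: ustep_Nil bind_map_pmf bind_assoc_pmf)
      finally show ?thesis .
    next
      case ne: False
      let ?E = "{h \<in> U. fst h = last A}"
      show ?thesis
      proof (cases "?E = {}")
        case True
        have "pmf_of_set (perfect_matchings U) \<bind> (\<lambda>M. ?lhs (Suc n) (A, S, M)) =
          pmf_of_set (perfect_matchings U) \<bind> (\<lambda>M. ?lhs n (butlast A, S, M))"
          using nstop ne True
          by (intro bind_pmf_cong refl) (simp add: mstep_pop bind_return_pmf sM del: Union_iff)
        also have "\<dots> = run_until (small m) ustep n (butlast A, S, U, C) \<bind> ?rhs"
          using Suc.prems by (intro Suc.IH) auto
        also have "\<dots> = run_until (small m) ustep (Suc n) (A, S, U, C) \<bind> ?rhs"
          using nstop ne True by (simp add: ustep_pop bind_return_pmf)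
        finally show ?thesis .
      next
        case False
        \<comment> \<open>The continuation in terms of the partner and the remaining edges, as
          \<open>bind_matching_partner\<close> requires.\<close>
        define F where "F h' M = ?lhs n (let v = fst h' in
            if v \<in> S then (A @ [v], S - {v}, M) else (A, S, M))" for h' :: half_edge and M
        have fE: "finite ?E" using Suc.prems by simp
        have "pmf_of_set (perfect_matchings U) \<bind> (\<lambda>M. ?lhs (Suc n) (A, S, M)) =
          pmf_of_set (perfect_matchings U) \<bind> (\<lambda>M. pmf_of_set ?E \<bind> (\<lambda>h.
            F (partner M h) (M - {{h, partner M h}})))"
        proof (intro bind_pmf_cong refl)
          fix M assume "M \<in> set_pmf (pmf_of_set (perfect_matchings U))"
          from sM[OF this] show "?lhs (Suc n) (A, S, M) =
              pmf_of_set ?E \<bind> (\<lambda>h. F (partner M h) (M - {{h, partner M h}}))"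
            using nstop False mstep_examine[OF ne, of M S]
            by (simp add: bind_map_pmf map_bind_pmf F_def Let_def del: Union_iff)
        qed
        also have "\<dots> = pmf_of_set ?E \<bind> (\<lambda>h. pmf_of_set (perfect_matchings U) \<bind> (\<lambda>M.
            F (partner M h) (M - {{h, partner M h}})))"
          by (rule bind_commute_pmf)
        also have "\<dots> = pmf_of_set ?E \<bind> (\<lambda>h. pmf_of_set (U - {h}) \<bind> (\<lambda>h'.
            pmf_of_set (perfect_matchings (U - {h, h'})) \<bind> F h'))"
        proof (intro bind_pmf_cong refl)
          fix h assume "h \<in> set_pmf (pmf_of_set ?E)"
          then have "h \<in> U" using fE False by (simp add: set_pmf_of_set)
          from bind_matching_partner[OF Suc.prems(1,2) this, of F]
          show "pmf_of_set (perfect_matchings U) \<bind> (\<lambda>M. F (partner M h) (M - {{h, partner M h}})) =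
            pmf_of_set (U - {h}) \<bind> (\<lambda>h'. pmf_of_set (perfect_matchings (U - {h, h'})) \<bind> F h')" .
        qed
        also have "\<dots> = pmf_of_set ?E \<bind> (\<lambda>h. pmf_of_set (U - {h}) \<bind> (\<lambda>h'.
            run_until (small m) ustep n (let v = fst h' in
              if v \<in> S then (A @ [v], S - {v}, U - {h, h'}, C) else (A, S, U - {h, h'}, C)) \<bind> ?rhs))"
        proof (intro bind_pmf_cong refl)
          fix h h' assume "h \<in> set_pmf (pmf_of_set ?E)"
          then have h: "h \<in> U" using fE False by (simp add: set_pmf_of_set)
          assume h': "h' \<in> set_pmf (pmf_of_set (U - {h}))"
          have "U \<noteq> {h}" using Suc.prems by auto
          then have "U - {h} \<noteq> {}" using h by auto
          then have h': "h' \<in> U" "h' \<noteq> h" using h' Suc.prems by (auto simp: set_pmf_of_set)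
          then have c: "card (U - {h, h'}) = card U - 2"
            using h Suc.prems by (subst card_Diff_subset) auto
          show "pmf_of_set (perfect_matchings (U - {h, h'})) \<bind> F h' =
            run_until (small m) ustep n (let v = fst h' in
              if v \<in> S then (A @ [v], S - {v}, U - {h, h'}, C) else (A, S, U - {h, h'}, C)) \<bind> ?rhs"
            unfolding F_def Let_def using c Suc.prems by (auto intro!: Suc.IH)
        qed
        also have "\<dots> = run_until (small m) ustep (Suc n) (A, S, U, C) \<bind> ?rhs"
          using nstop ustep_examine[OF ne False] by (simp add: bind_map_pmf bind_assoc_pmf)
        finally show ?thesis .
      qed
    qed
  qed
qed

section \<open>The edges inside the sleeping set\<close>

definition inner :: "nat set \<Rightarrow> half_edge set set \<Rightarrow> half_edge set set" where
  "inner S M = {e \<in> M. fst ` e \<subseteq> S}"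

lemma induced_subgraph_graph_of_matching:
  assumes "M \<in> perfect_matchings H" "finite H"
  shows "induced_subgraph (graph_of_matching V M) S = graph_of_matching S (inner S M)"
proof -
  have "finite (\<Union>M)" using assms by (simp add: perfect_matchings_iff)
  then have finM: "finite M" by (rule finite_UnionD)
  have "filter_mset (\<lambda>e. set_mset e \<subseteq> S) (image_mset (\<lambda>e. image_mset fst (mset_set e)) (mset_set M)) =
    image_mset (\<lambda>e. image_mset fst (mset_set e)) (filter_mset (\<lambda>e. set_mset (image_mset fst (mset_set e)) \<subseteq> S) (mset_set M))"
    by (simp add: filter_mset_image_mset)
  also have "filter_mset (\<lambda>e. set_mset (image_mset fst (mset_set e)) \<subseteq> S) (mset_set M) = mset_set (inner S M)"
  proof -
    have "{e \<in> M. set_mset (image_mset fst (mset_set e)) \<subseteq> S} = inner S M"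
    proof -
      have "finite e" if "e \<in> M" for e
        using that assms by (auto simp: perfect_matchings_iff intro: card_ge_0_finite)
      then show ?thesis unfolding inner_def by (intro Collect_cong conj_cong refl) simp
    qed
    then show ?thesis using finM by (simp add: filter_mset_mset_set)
  qed
  finally show ?thesis by (simp add: induced_subgraph_def graph_of_matching_def edges_def)
qed

lemma inner_subset: "T \<subseteq> S \<Longrightarrow> inner T M = {e \<in> inner S M. fst ` e \<subseteq> T}"
  unfolding inner_def by (auto simp del: image_subset_iff)

text \<open>An examined edge has an end at an active vertex, so it does not lie inside
  \<open>S\<close>. The edges inside the sleeping set can therefore be taken from the unexamined
  part of the matching, whose law is known.\<close>

definition mstep_inv :: "half_edge set set \<Rightarrow> mstate \<Rightarrow> bool" where
  "mstep_inv M = (\<lambda>(A, S, M'). finite S \<and> set A \<inter> S = {} \<and> M' \<subseteq> M \<and> inner S M' = inner S M)"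

lemma mstep_inv_step:
  assumes "M \<in> perfect_matchings H" "finite H" "mstep_inv M x" "\<not> small m x" "y \<in> set_pmf (mstep x)"
  shows "mstep_inv M y"
proof -
  obtain A S M' where x: "x = (A, S, M')" by (metis prod_cases3)
  have I: "finite S" "set A \<inter> S = {}" "M' \<subseteq> M" "inner S M' = inner S M"
    using assms(3) by (auto simp: x mstep_inv_def)
  have S: "S \<noteq> {}" using assms(4) by (auto simp: x)
  have sub: "inner (S - {v}) M' = inner (S - {v}) M" for v
    using I(4) inner_subset[of "S - {v}" S] by simp
  show ?thesis
  proof (cases "A = []")
    case True
    then show ?thesis using assms(5) I S sub by (auto simp: x mstep_Nil mstep_inv_def set_pmf_of_set)
  next
    case ne: False
    let ?E = "{h \<in> \<Union>M'. fst h = last A}"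
    show ?thesis
    proof (cases "?E = {}")
      case True
      then have "y = (butlast A, S, M')" using assms(5) mstep_pop[OF ne True] by (simp add: x)
      then show ?thesis using I by (auto simp: mstep_inv_def dest: in_set_butlastD)
    next
      case False
      have "finite ?E" using assms(1,2) I(3)
        by (intro finite_subset[of ?E H]) (auto simp: perfect_matchings_iff)
      then obtain h where h: "h \<in> ?E" and y: "y = (let v = fst (partner M' h); M'' = M' - {{h, partner M' h}} in
              if v \<in> S then (A @ [v], S - {v}, M'') else (A, S, M''))"
        using assms(5) mstep_examine[OF ne False] False by (auto simp: x set_pmf_of_set simp del: Union_iff)
      have "last A \<notin> S" using ne I(2) by (auto dest: last_in_set)
      then have in': "inner S (M' - {{h, partner M' h}}) = inner S M'"
        using h by (auto simp: inner_def)
      then have "inner (S - {v}) (M' - {{h, partner M' h}}) = inner (S - {v}) M" for v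
        using I(4) inner_subset[of "S - {v}" S] by simp
      then show ?thesis using I in' by (auto simp: y mstep_inv_def Let_def)
    qed
  qed
qed

section \<open>Locating the stopping time on a recorded path\<close>

lemma run_until_dfs_path:
  assumes fin: "finite (\<Union>M)"
  shows "dfs_inv M st \<Longrightarrow> dfs_pot st \<le> n \<Longrightarrow>
    run_until (\<lambda>st. card (sleeping st) \<le> m) (dfs_step M) n st =
    map_pmf (\<lambda>tr. hd (dropWhile (\<lambda>st. m < card (sleeping st)) tr)) (dfs_path M n st)"
proof (induction n arbitrary: st)
  case 0
  then show ?case by (simp add: dfs_pot_def)
next
  case (Suc n)
  show ?case
  proof (cases "card (sleeping st) \<le> m")
    case True
    then show ?thesis by (simp add: map_bind_pmf pmf.map_comp o_def)
  next
    case False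
    have "dfs_step M st \<bind> run_until (\<lambda>st. card (sleeping st) \<le> m) (dfs_step M) n =
      dfs_step M st \<bind> (\<lambda>st. map_pmf (\<lambda>tr. hd (dropWhile (\<lambda>st. m < card (sleeping st)) tr)) (dfs_path M n st))"
    proof (intro bind_pmf_cong refl Suc.IH)
      fix st' assume st': "st' \<in> set_pmf (dfs_step M st)"
      then show "dfs_inv M st'" using dfs_inv_step[OF fin Suc.prems(1)] by blast
      show "dfs_pot st' \<le> n" using dfs_step_sleeping(2)[OF fin Suc.prems(1) st'] Suc.prems(2) by simp
    qed
    then show ?thesis using False by (simp add: map_bind_pmf pmf.map_comp o_def)
  qed
qed

text \<open>The strict inclusion is due to the first step, which activates a vertex when none is
  active. The condition \<open>dfs_pot st \<le> n\<close> leaves enough steps to empty the sleeping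
  set.\<close>

lemma dfs_path_props:
  assumes fin: "finite (\<Union>M)"
  shows "dfs_inv M st \<Longrightarrow> tr \<in> set_pmf (dfs_path M n st) \<Longrightarrow>
    length tr = Suc n \<and> tr ! 0 = st \<and> (\<forall>k\<le>n. sleeping (tr ! k) \<subseteq> sleeping st) \<and>
    (\<forall>k. 1 \<le> k \<longrightarrow> k \<le> n \<longrightarrow> active st = [] \<longrightarrow> sleeping st \<noteq> {} \<longrightarrow> sleeping (tr ! k) \<subset> sleeping st) \<and>
    (dfs_pot st \<le> n \<longrightarrow> sleeping (tr ! n) = {})"
proof (induction n arbitrary: st tr)
  case 0
  then show ?case by (auto simp: dfs_pot_def dfs_inv_def)
next
  case (Suc n)
  from Suc.prems(2) obtain st' tr' where st': "st' \<in> set_pmf (dfs_step M st)"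
    and tr': "tr' \<in> set_pmf (dfs_path M n st')" and tr: "tr = st # tr'" by auto
  note d = dfs_step_sleeping[OF fin Suc.prems(1) st']
  note IH = Suc.IH[OF dfs_inv_step[OF fin Suc.prems(1) st'] tr']
  have "sleeping (tr ! k) \<subseteq> sleeping st" if "k \<le> Suc n" for k
    using that IH d(1) by (cases k) (auto simp: tr)
  moreover have "sleeping (tr ! k) \<subset> sleeping st"
    if "1 \<le> k" "k \<le> Suc n" "active st = []" "sleeping st \<noteq> {}" for k
  proof -
    from that obtain j where j: "k = Suc j" "j \<le> n" by (cases k) auto
    then have "sleeping (tr ! k) \<subseteq> sleeping st'" using IH by (simp add: tr)
    then show ?thesis using d(3)[OF that(3,4)] by blast
  qed
  moreover have "sleeping (tr ! Suc n) = {}" if "dfs_pot st \<le> Suc n"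
    using that IH d(2) by (simp add: tr)
  ultimately show ?case using IH by (simp add: tr)
qed

text \<open>The cap \<open>N - 1\<close> in \<open>m\<close> encodes the restriction
  \<open>k \<ge> 1\<close> in \<open>tau\<close>: at time 0 all \<open>N\<close> vertices sleep, at
  later times at most \<open>N - 1\<close> do. So \<open>tau\<close> is the first time at which at
  most \<open>m\<close> vertices sleep, also when \<alpha> is 0.\<close>

lemma nth_tau:
  assumes fin: "finite (\<Union>M)" and N: "N \<ge> 1" and a: "0 \<le> \<alpha>" "\<alpha> \<le> 1"
    and m: "m = min (nat \<lfloor>(1 - \<alpha>) * real N\<rfloor>) (N - 1)"
    and tr: "tr \<in> set_pmf (exploration N M)"
  shows "tr ! tau N \<alpha> tr = hd (dropWhile (\<lambda>st. m < card (sleeping st)) tr)"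
proof -
  have inv: "dfs_inv M (initial_state {1..N})" by (simp add: dfs_inv_def initial_state_def)
  note p = dfs_path_props[OF fin inv, of tr "2 * N"]
  have len: "length tr = Suc (2 * N)" and t0: "tr ! 0 = initial_state {1..N}"
    using p tr by (auto simp: exploration_def)
  have last: "sleeping (tr ! (2 * N)) = {}"
    using p tr by (auto simp: exploration_def dfs_pot_def initial_state_def)
  have lt: "card (sleeping (tr ! k)) < N" if "1 \<le> k" "k \<le> 2 * N" for k
  proof -
    have "sleeping (tr ! k) \<subset> {1..N}"
      using p tr that N by (auto simp: exploration_def initial_state_def)
    then have "card (sleeping (tr ! k)) < card {1..N}" by (intro psubset_card_mono) auto
    then show ?thesis by simp
  qed
  have c0: "card (sleeping (tr ! 0)) = N" by (simp add: t0 initial_state_def)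
  have nn: "0 \<le> (1 - \<alpha>) * real N" using a by simp
  have small: "real c \<le> (1 - \<alpha>) * real N \<longleftrightarrow> c \<le> m" if "c < N" for c
  proof -
    have "real c \<le> (1 - \<alpha>) * real N \<longleftrightarrow> c \<le> nat \<lfloor>(1 - \<alpha>) * real N\<rfloor>"
      using nn by (simp add: le_nat_iff le_floor_iff)
    then show ?thesis using that unfolding m by auto
  qed
  have mN: "m < N" using N unfolding m by auto
  define K where "K = {k. 1 \<le> k \<and> k \<le> 2 * N \<and> real (card (sleeping (tr ! k))) \<le> (1 - \<alpha>) * real N}"
  have K: "k \<in> K \<longleftrightarrow> k \<le> 2 * N \<and> card (sleeping (tr ! k)) \<le> m" for k
    using small[OF lt] c0 mN by (cases "k = 0") (auto simp: K_def)
  have "2 * N \<in> K" using last by (simp add: K)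
  then have tauK: "tau N \<alpha> tr \<in> K" unfolding tau_def K_def[symmetric] by (intro Inf_nat_def1) auto
  have min: "k \<notin> K" if "k < tau N \<alpha> tr" for k
    using that wellorder_Inf_le1[of k K] unfolding tau_def K_def[symmetric] by auto
  have t: "tau N \<alpha> tr < length tr" "\<not> m < card (sleeping (tr ! tau N \<alpha> tr))"
    using tauK by (auto simp: K len)
  have "m < card (sleeping (tr ! k))" if "k < tau N \<alpha> tr" for k
    using min[OF that] that t(1) by (simp add: K len)
  note t = t this
  have "takeWhile (\<lambda>st. m < card (sleeping st)) tr = take (tau N \<alpha> tr) tr"
    using t by (intro takeWhile_eq_take_P_nth) auto
  then have "dropWhile (\<lambda>st. m < card (sleeping st)) tr = drop (tau N \<alpha> tr) tr"
    using t(1) by (simp add: dropWhile_eq_drop)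
  then show ?thesis using t(1) by (simp add: hd_drop_conv_nth)
qed

lemma finite_half_edges: "finite V \<Longrightarrow> finite (half_edges V e)"
  by (simp add: half_edges_def)

lemma card_half_edges: "finite V \<Longrightarrow> card (half_edges V e) = (\<Sum>v\<in>V. e v)"
  by (simp add: half_edges_def)

lemma even_make_even:
  assumes "finite V" "V \<noteq> {}"
  shows "even (\<Sum>v\<in>V. make_even V d v)"
proof (cases "even (\<Sum>v\<in>V. d v)")
  case False
  have "(\<Sum>v\<in>V. make_even V d v) = (\<Sum>v\<in>V. d v + (if v = Max V then 1 else 0))"
    using False by (intro sum.cong) (auto simp: make_even_def)
  also have "\<dots> = (\<Sum>v\<in>V. d v) + 1" using assms by (simp add: sum.distrib)
  finally show ?thesis using False by simp
qed (simp add: make_even_def)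

text \<open>For a fixed matching the induced graph is a function of the sleeping set, so it suffices
  to carry the law of this set through the successive descriptions of the exploration; the matching
  is averaged out only at the end.\<close>

theorem sleeping_graph_eq:
  fixes N m n :: nat and d :: "nat \<Rightarrow> nat" and \<alpha> :: real
  assumes N: "N \<ge> 1" and a: "0 \<le> \<alpha>" "\<alpha> \<le> 1"
  defines "m \<equiv> min (nat \<lfloor>(1 - \<alpha>) * real N\<rfloor>) (N - 1)"
    and "e \<equiv> make_even {1..N} d"
  assumes n: "2 * N + card (half_edges {1..N} e) \<le> n"
  shows "sleeping_graph N d \<alpha> =
    run_until (small m) ustep n ([], {1..N}, half_edges {1..N} e, {}) \<bind> (\<lambda>x.
      map_pmf (\<lambda>M. graph_of_matching (fst (snd x)) (inner (fst (snd x)) M))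
        (pmf_of_set (perfect_matchings (unmatched x))))"
proof -
  let ?V = "{1..N}"
  let ?H = "half_edges ?V e"
  have H: "finite ?H" by (simp add: finite_half_edges)
  have ev: "even (card ?H)" using even_make_even[of ?V d] N by (simp add: card_half_edges e_def)
  have PM: "set_pmf (pmf_of_set (perfect_matchings ?H)) = perfect_matchings ?H"
    using perfect_matchings_nonempty[OF H ev] finite_perfect_matchings[OF H] by (simp add: set_pmf_of_set)
  have "sleeping_graph N d \<alpha> = pmf_of_set (perfect_matchings ?H) \<bind> (\<lambda>M.
     map_pmf (\<lambda>traj. induced_subgraph (graph_of_matching ?V M) (sleeping (traj ! tau N \<alpha> traj))) (exploration N M))"
    by (simp add: sleeping_graph_def random_matching_def e_def)
  also have "\<dots> = pmf_of_set (perfect_matchings ?H) \<bind> (\<lambda>M.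
      map_pmf (\<lambda>x. graph_of_matching (fst x) (inner (fst x) (snd x)))
        (map_pmf snd (run_until (small m) mstep n ([], ?V, M))))"
  proof (intro bind_pmf_cong refl)
    fix M assume "M \<in> set_pmf (pmf_of_set (perfect_matchings ?H))"
    then have M: "M \<in> perfect_matchings ?H" using PM by simp
    have fin: "finite (\<Union>M)" using M H by (simp add: perfect_matchings_iff)
    have cM: "card M \<le> card ?H"
    proof -
      have "finite M" using fin by (rule finite_UnionD)
      have "card (\<Union>M) = (\<Sum>e\<in>M. card e)"
        using M by (intro card_Union_disjoint) (auto simp: perfect_matchings_iff intro: card_ge_0_finite)
      also have "\<dots> \<ge> (\<Sum>e\<in>M. 1)" using M by (intro sum_mono) (auto simp: perfect_matchings_iff)
      finally show ?thesis using M by (simp add: perfect_matchings_iff)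
    qed
    have inv: "dfs_inv M (initial_state ?V)" by (simp add: dfs_inv_def initial_state_def)
    have pot: "dfs_pot (initial_state ?V) \<le> 2 * N" by (simp add: dfs_pot_def initial_state_def)
    have l: "lump (initial_state ?V) = ([], ?V, \<lambda>_. [])" by (simp add: lump_def initial_state_def)
    have "map_pmf (\<lambda>traj. sleeping (traj ! tau N \<alpha> traj)) (exploration N M) =
      map_pmf (\<lambda>traj. sleeping (hd (dropWhile (\<lambda>st. m < card (sleeping st)) traj))) (exploration N M)"
      by (intro map_pmf_cong refl) (simp add: nth_tau[OF fin N a m_def[THEN meta_eq_to_obj_eq]])
    also have "\<dots> = map_pmf sleeping (run_until (\<lambda>st. card (sleeping st) \<le> m) (dfs_step M) (2 * N) (initial_state ?V))"
      unfolding exploration_def run_until_dfs_path[OF fin inv pot] by (simp add: pmf.map_comp o_def)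
    also have "\<dots> = map_pmf (\<lambda>x. fst (snd x)) (map_pmf lump (run_until (\<lambda>st. card (sleeping st) \<le> m) (dfs_step M) (2 * N) (initial_state ?V)))"
      by (simp add: pmf.map_comp o_def lump_def)
    also have "map_pmf lump (run_until (\<lambda>st. card (sleeping st) \<le> m) (dfs_step M) (2 * N) (initial_state ?V)) =
      run_until (small m) (fstep M) (2 * N) (lump (initial_state ?V))"
      by (rule map_run_until[where I = "dfs_inv M"])
         (use inv lump_step[OF fin] dfs_inv_step[OF fin] in \<open>auto simp: lump_def\<close>)
    also have "map_pmf (\<lambda>x. fst (snd x)) \<dots> = lam_run M m (2 * N) [] ?V"
      unfolding l by (simp add: lam_run_def lam_Nil bind_return_pmf)
    also have "\<dots> = map_pmf (\<lambda>x. fst (snd x)) (run_until (small m) mstep n ([], ?V, M))"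
      using n cM by (intro lam_run_eq_mstep[OF M H]) auto
    finally have eq: "map_pmf (\<lambda>traj. sleeping (traj ! tau N \<alpha> traj)) (exploration N M) = \<dots>" .
    have "map_pmf (\<lambda>traj. induced_subgraph (graph_of_matching ?V M) (sleeping (traj ! tau N \<alpha> traj))) (exploration N M) =
      map_pmf (\<lambda>S. graph_of_matching S (inner S M)) (map_pmf (\<lambda>traj. sleeping (traj ! tau N \<alpha> traj)) (exploration N M))"
      by (simp add: pmf.map_comp o_def induced_subgraph_graph_of_matching[OF M H])
    also have "\<dots> = map_pmf (\<lambda>x. graph_of_matching (fst (snd x)) (inner (fst (snd x)) M))
        (run_until (small m) mstep n ([], ?V, M))"
      unfolding eq by (simp add: pmf.map_comp o_def)
    \<comment> \<open>The full matching is replaced by its unexamined part, which has the same edges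
      inside the sleeping set.\<close>
    also have "\<dots> = map_pmf (\<lambda>x. graph_of_matching (fst (snd x)) (inner (fst (snd x)) (snd (snd x))))
        (run_until (small m) mstep n ([], ?V, M))"
    proof (intro map_pmf_cong refl)
      fix x assume x: "x \<in> set_pmf (run_until (small m) mstep n ([], ?V, M))"
      have "mstep_inv M x"
        by (rule run_until_invariant[OF _ x]) (use mstep_inv_step[OF M H] in \<open>auto simp: mstep_inv_def\<close>)
      then show "graph_of_matching (fst (snd x)) (inner (fst (snd x)) M) =
        graph_of_matching (fst (snd x)) (inner (fst (snd x)) (snd (snd x)))"
        by (auto simp: mstep_inv_def split: prod.splits)
    qed
    finally show "map_pmf (\<lambda>traj. induced_subgraph (graph_of_matching ?V M) (sleeping (traj ! tau N \<alpha> traj))) (exploration N M) =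
      map_pmf (\<lambda>x. graph_of_matching (fst x) (inner (fst x) (snd x)))
        (map_pmf snd (run_until (small m) mstep n ([], ?V, M)))"
      by (simp add: pmf.map_comp o_def)
  qed
  also have "\<dots> = map_pmf (\<lambda>x. graph_of_matching (fst x) (inner (fst x) (snd x)))
      (pmf_of_set (perfect_matchings ?H) \<bind> (\<lambda>M. map_pmf snd (run_until (small m) mstep n ([], ?V, M))))"
    by (simp add: map_bind_pmf)
  also have "\<dots> = run_until (small m) ustep n ([], ?V, ?H, {}) \<bind> (\<lambda>x.
      map_pmf (\<lambda>M. graph_of_matching (fst (snd x)) (inner (fst (snd x)) M))
        (pmf_of_set (perfect_matchings (unmatched x))))"
    unfolding mstep_annealed[OF H ev finite_atLeastAtMost, where C = "{}"]
    by (simp add: map_bind_pmf pmf.map_comp o_def)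
  finally show ?thesis .
qed

section \<open>The law of the sleeping graph given its degrees\<close>

lemma vertex_degree_graph_of_matching:
  assumes "M \<in> perfect_matchings H" "finite H"
  shows "vertex_degree (graph_of_matching V M) v = card {h \<in> H. fst h = v}"
proof -
  have fin: "finite (\<Union>M)" using assms by (simp add: perfect_matchings_iff)
  then have finM: "finite M" by (rule finite_UnionD)
  have fe: "finite e" if "e \<in> M" for e using that fin by (meson Union_upper finite_subset)
  have "vertex_degree (graph_of_matching V M) v = (\<Sum>e\<in>M. count (image_mset fst (mset_set e)) v)"
    by (simp add: vertex_degree_def graph_of_matching_def edges_def multiset.map_comp o_def sum_unfold_sum_mset)
  also have "\<dots> = (\<Sum>e\<in>M. card {h \<in> e. fst h = v})"
  proof (intro sum.cong refl)
    fix e assume "e \<in> M"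
    have "{x \<in> e. v = fst x} = {x \<in> e. fst x = v}" by auto
    then show "count (image_mset fst (mset_set e)) v = card {h \<in> e. fst h = v}"
      using fe[OF \<open>e \<in> M\<close>] by (simp add: count_image_mset' filter_mset_mset_set)
  qed
  also have "\<dots> = card (\<Union>e\<in>M. {h \<in> e. fst h = v})"
  proof (rule card_UN_disjoint[symmetric])
    show "\<forall>i\<in>M. \<forall>j\<in>M. i \<noteq> j \<longrightarrow> {h \<in> i. fst h = v} \<inter> {h \<in> j. fst h = v} = {}"
      using edge_unique[OF assms(1)] by blast
  qed (use finM fe in auto)
  also have "(\<Union>e\<in>M. {h \<in> e. fst h = v}) = {h \<in> H. fst h = v}"
    using assms(1) by (auto simp: perfect_matchings_iff)
  finally show ?thesis .
qed

lemma inner_iff_partner: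
  assumes "M \<in> perfect_matchings H" "h \<in> H"
  shows "h \<in> \<Union>(inner S M) \<longleftrightarrow> fst h \<in> S \<and> fst (partner M h) \<in> S"
proof
  assume "h \<in> \<Union>(inner S M)"
  then obtain e where e: "e \<in> M" "h \<in> e" "fst ` e \<subseteq> S" by (auto simp: inner_def simp del: image_subset_iff)
  then have "e = {h, partner M h}" using edge_eq_partner[OF assms(1)] by blast
  then show "fst h \<in> S \<and> fst (partner M h) \<in> S" using e by auto
next
  assume "fst h \<in> S \<and> fst (partner M h) \<in> S"
  then have "{h, partner M h} \<in> inner S M" using partner_edge[OF assms] by (simp add: inner_def)
  then show "h \<in> \<Union>(inner S M)" by blast
qed

lemma vertex_degree_inner:
  assumes "M \<in> perfect_matchings H" "finite H" "v \<in> S"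
  shows "vertex_degree (graph_of_matching S (inner S M)) v =
    card {h \<in> H. fst h = v \<and> fst (partner M h) \<in> S}"
proof -
  have sub: "inner S M \<subseteq> M" by (auto simp: inner_def)
  have UM: "\<Union>M = H" using assms by (simp add: perfect_matchings_iff)
  have "finite (\<Union>(inner S M))"
    using Union_mono[OF sub] unfolding UM by (rule finite_subset) fact
  then have "vertex_degree (graph_of_matching S (inner S M)) v = card {h \<in> \<Union>(inner S M). fst h = v}"
    using vertex_degree_graph_of_matching[OF perfect_matchings_subset[OF assms(1) sub]] by blast
  also have "{h \<in> \<Union>(inner S M). fst h = v} = {h \<in> H. fst h = v \<and> fst (partner M h) \<in> S}"
  proof -
    have "\<Union>(inner S M) \<subseteq> H" using sub UM by blast
    then show ?thesis using inner_iff_partner[OF assms(1)] assms(3) by blast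
  qed
  finally show ?thesis .
qed

lemma pmf_of_set_disintegrate:
  assumes "finite X" "X \<noteq> {}"
  shows "pmf_of_set X = map_pmf g (pmf_of_set X) \<bind> (\<lambda>y. pmf_of_set {x \<in> X. g x = y})"
proof (rule pmf_eqI)
  fix x
  let ?F = "\<lambda>y. {x \<in> X. g x = y}"
  have "pmf (map_pmf g (pmf_of_set X) \<bind> (\<lambda>y. pmf_of_set (?F y))) x =
    (\<Sum>x'\<in>X. pmf (pmf_of_set (?F (g x'))) x) / real (card X)"
    using assms by (simp add: bind_map_pmf pmf_bind_pmf_of_set)
  also have "(\<Sum>x'\<in>X. pmf (pmf_of_set (?F (g x'))) x) = (\<Sum>x'\<in>X. indicator (?F (g x')) x / real (card (?F (g x'))))"
    using assms by (intro sum.cong refl, subst pmf_of_set) auto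
  also have "\<dots> = indicator X x"
  proof (cases "x \<in> X")
    case True
    have "(\<Sum>x'\<in>X. indicator (?F (g x')) x / real (card (?F (g x')))) =
      (\<Sum>x'\<in>?F (g x). 1 / real (card (?F (g x))))"
      using assms True by (intro sum.mono_neutral_cong_right) (auto simp: indicator_def)
    also have "\<dots> = 1" using assms True by (auto simp: card_eq_0_iff)
    finally show ?thesis using True by simp
  qed (auto intro!: sum.neutral)
  finally show "pmf (pmf_of_set X) x = pmf (map_pmf g (pmf_of_set X) \<bind> (\<lambda>y. pmf_of_set (?F y))) x"
    using assms by simp
qed

text \<open>Fixing the edges \<open>Q\<close> that are not inside \<open>V\<close> leaves complete
  freedom on the other half-edges, all of which are attached to \<open>V\<close>. Given
  \<open>Q\<close>, a uniform matching is thus uniform inside \<open>V\<close>.\<close>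

lemma perfect_matchings_fibre:
  fixes V :: "nat set"
  assumes M0: "M0 \<in> perfect_matchings U"
  defines "Q \<equiv> M0 - inner V M0"
  shows "{M \<in> perfect_matchings U. M - inner V M = Q} = (\<lambda>I. Q \<union> I) ` perfect_matchings (U - \<Union>Q)"
    and "\<And>I. I \<in> perfect_matchings (U - \<Union>Q) \<Longrightarrow> inner V (Q \<union> I) = I"
    and "\<And>h. h \<in> U - \<Union>Q \<Longrightarrow> fst h \<in> V"
proof -
  have dec: "\<Union>(inner V M) = U - \<Union>(M - inner V M)" if "M \<in> perfect_matchings U" for M
  proof -
    have "U = \<Union>(inner V M) \<union> \<Union>(M - inner V M)"
      using that unfolding inner_def perfect_matchings_iff by blast
    moreover have "\<Union>(inner V M) \<inter> \<Union>(M - inner V M) = {}"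
    proof (rule ccontr)
      assume "\<Union>(inner V M) \<inter> \<Union>(M - inner V M) \<noteq> {}"
      then obtain e e' h where "e \<in> inner V M" "e' \<in> M - inner V M" "h \<in> e" "h \<in> e'" by blast
      moreover from this have "e = e'" using edge_unique[OF that, of e e' h] by (auto simp: inner_def)
      ultimately show False by blast
    qed
    ultimately show ?thesis by blast
  qed
  have W: "U - \<Union>Q = \<Union>(inner V M0)" using dec[OF M0] by (simp add: Q_def)
  show V: "fst h \<in> V" if "h \<in> U - \<Union>Q" for h
    using that unfolding W by (auto simp: inner_def)
  have Qn: "inner V Q = {}" by (auto simp: Q_def inner_def)
  show in': "inner V (Q \<union> I) = I" if "I \<in> perfect_matchings (U - \<Union>Q)" for I
  proof -
    have "inner V I = I"
      using that V by (auto simp: inner_def perfect_matchings_iff)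
    moreover have "inner V (Q \<union> I) = inner V Q \<union> inner V I" by (auto simp: inner_def)
    ultimately show ?thesis using Qn by simp
  qed
  show "{M \<in> perfect_matchings U. M - inner V M = Q} = (\<lambda>I. Q \<union> I) ` perfect_matchings (U - \<Union>Q)"
  proof (intro set_eqI iffI)
    fix M assume "M \<in> {M \<in> perfect_matchings U. M - inner V M = Q}"
    then have M: "M \<in> perfect_matchings U" "M - inner V M = Q" by auto
    have "inner V M \<subseteq> M" by (auto simp: inner_def)
    then have "inner V M \<in> perfect_matchings (U - \<Union>Q)" "M = Q \<union> inner V M"
      using perfect_matchings_subset[OF M(1), of "inner V M"] dec[OF M(1)] M(2) by auto
    then show "M \<in> (\<lambda>I. Q \<union> I) ` perfect_matchings (U - \<Union>Q)" by blast
  next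
    fix M assume "M \<in> (\<lambda>I. Q \<union> I) ` perfect_matchings (U - \<Union>Q)"
    then obtain I where I: "I \<in> perfect_matchings (U - \<Union>Q)" "M = Q \<union> I" by auto
    have QM: "Q \<subseteq> M0" by (auto simp: Q_def)
    then have "\<Union>Q \<subseteq> U" using M0 by (auto simp: perfect_matchings_iff)
    have dQ: "disjoint Q" using M0 QM by (auto simp: perfect_matchings_iff disjoint_def)
    have "disjoint (Q \<union> I)"
      unfolding disjoint_def
    proof (intro ballI impI)
      fix a b assume "a \<in> Q \<union> I" "b \<in> Q \<union> I" "a \<noteq> b"
      moreover have "x \<inter> y = {}" if "x \<in> Q" "y \<in> I" for x y
      proof -
        have "x \<subseteq> \<Union>Q" using that by blast
        moreover have "y \<subseteq> U - \<Union>Q" using that I(1) by (auto simp: perfect_matchings_iff)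
        ultimately show ?thesis by blast
      qed
      moreover have "disjoint I" using I(1) by (simp add: perfect_matchings_iff)
      ultimately show "a \<inter> b = {}"
        using dQ disjointD[of Q] disjointD[of I] by (metis Int_commute UnE)
    qed
    moreover have "\<Union>(Q \<union> I) = U" using I(1) \<open>\<Union>Q \<subseteq> U\<close> by (auto simp: perfect_matchings_iff)
    moreover have "\<forall>e\<in>Q \<union> I. card e = 2" using I(1) M0 QM by (auto simp: perfect_matchings_iff)
    ultimately have "M \<in> perfect_matchings U" by (simp add: I(2) perfect_matchings_iff)
    moreover have "Q \<inter> I = {}" using Qn in'[OF I(1)] by (auto simp: inner_def)
    then have "M - inner V M = Q" using in'[OF I(1)] by (auto simp: I(2))
    ultimately show "M \<in> {M \<in> perfect_matchings U. M - inner V M = Q}" by simp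
  qed
qed

lemma graph_of_matching_relabel:
  assumes "M \<in> perfect_matchings W" "finite W" "inj_on f W" "\<And>h. h \<in> W \<Longrightarrow> fst (f h) = fst h"
  shows "graph_of_matching V ((`) f ` M) = graph_of_matching V M"
proof -
  have UM: "\<Union>M = W" using assms by (simp add: perfect_matchings_iff)
  have sub: "e \<subseteq> W" if "e \<in> M" for e using that UM by auto
  have inj: "inj_on ((`) f) M"
    using assms(3) sub by (intro inj_onI) (metis inj_on_image_eq_iff)
  have "mset_set ((`) f ` M) = image_mset ((`) f) (mset_set M)"
    using image_mset_mset_set[OF inj] by simp
  moreover have "image_mset fst (mset_set (f ` e)) = image_mset fst (mset_set e)" if "e \<in> M" for e
  proof -
    have i: "inj_on f e" using assms(3) sub[OF that] inj_on_subset by blast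
    have "image_mset fst (mset_set (f ` e)) = image_mset (\<lambda>h. fst (f h)) (mset_set e)"
      by (simp add: image_mset_mset_set[OF i, symmetric] multiset.map_comp o_def)
    also have "\<dots> = image_mset fst (mset_set e)"
    proof (rule image_mset_cong)
      fix h assume "h \<in># mset_set e"
      then have "h \<in> W" using sub[OF that] finite_subset[OF sub[OF that] assms(2)] by auto
      then show "fst (f h) = fst h" by (rule assms(4))
    qed
    finally show ?thesis .
  qed
  moreover have "finite M" using UM assms(2) finite_UnionD by blast
  ultimately have "image_mset (\<lambda>e. image_mset fst (mset_set e)) (mset_set ((`) f ` M)) =
      image_mset (\<lambda>e. image_mset fst (mset_set e)) (mset_set M)"
    by (simp add: multiset.map_comp o_def) (intro image_mset_cong, auto)
  then show ?thesis by (simp add: graph_of_matching_def)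
qed

text \<open>The multigraph forgets the indices of the half-edges, so those at \<open>v\<close> can
  be renumbered from 0 to \<open>D v - 1\<close>. The parity correction does nothing, as the degrees
  add up to the even number \<open>card W\<close>.\<close>

lemma graph_of_uniform_matching:
  assumes "finite W" "even (card W)" "finite V" "\<And>h. h \<in> W \<Longrightarrow> fst h \<in> V"
    and D: "\<And>v. v \<in> V \<Longrightarrow> D v = card {h \<in> W. fst h = v}"
  shows "map_pmf (graph_of_matching V) (pmf_of_set (perfect_matchings W)) = configuration_model V D"
proof -
  have "\<exists>g. bij_betw g {h \<in> W. fst h = v} {..<D v}" if "v \<in> V" for v
    using ex_bij_betw_finite_nat[of "{h \<in> W. fst h = v}"] assms(1) D[OF that]
    by (auto simp: atLeast0LessThan)
  then obtain g where g: "\<And>v. v \<in> V \<Longrightarrow> bij_betw (g v) {h \<in> W. fst h = v} {..<D v}" by metis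
  define f where "f h = (fst h, g (fst h) h)" for h :: half_edge
  have inj: "inj_on f W"
  proof (rule inj_onI)
    fix x y assume xy: "x \<in> W" "y \<in> W" "f x = f y"
    then have "inj_on (g (fst x)) {h \<in> W. fst h = fst x}" using g assms(4) by (auto simp: bij_betw_def)
    then show "x = y" by (rule inj_onD) (use xy in \<open>auto simp: f_def\<close>)
  qed
  have im: "f ` W = half_edges V D"
  proof (intro set_eqI iffI)
    fix x assume "x \<in> f ` W"
    then obtain h where h: "h \<in> W" "x = f h" by auto
    then have "g (fst h) h \<in> {..<D (fst h)}"
      using g[OF assms(4)[OF h(1)]] by (auto simp: bij_betw_def)
    then show "x \<in> half_edges V D" using h assms(4) by (auto simp: f_def half_edges_def)
  next
    fix x assume "x \<in> half_edges V D"
    then have "fst x \<in> V" "snd x \<in> {..<D (fst x)}" by (auto simp: half_edges_def)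
    then have "snd x \<in> g (fst x) ` {h \<in> W. fst h = fst x}" using g[of "fst x"] by (simp add: bij_betw_def)
    then obtain h where "h \<in> W" "fst h = fst x" "g (fst x) h = snd x" by force
    then have "x = f h" by (simp add: f_def prod_eq_iff)
    then show "x \<in> f ` W" using \<open>h \<in> W\<close> by blast
  qed
  have bij: "bij_betw f W (half_edges V D)" using inj im by (simp add: bij_betw_def)
  have ne: "perfect_matchings W \<noteq> {}" "finite (perfect_matchings W)"
    using assms perfect_matchings_nonempty finite_perfect_matchings by auto
  have "card (half_edges V D) = card W" using bij bij_betw_same_card by metis
  then have me: "make_even V D = D" using assms(2,3) by (simp add: make_even_def card_half_edges)
  have "configuration_model V D = map_pmf (graph_of_matching V)
      (map_pmf ((`) ((`) f)) (pmf_of_set (perfect_matchings W)))"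
    unfolding configuration_model_def random_matching_def me
    using map_pmf_of_set_bij_betw[OF bij_betw_perfect_matchings[OF bij] ne] by simp
  also have "\<dots> = map_pmf (graph_of_matching V) (pmf_of_set (perfect_matchings W))"
    unfolding pmf.map_comp using ne graph_of_matching_relabel[OF _ assms(1) inj]
    by (intro map_pmf_cong refl) (auto simp: f_def set_pmf_of_set)
  finally show ?thesis ..
qed

text \<open>Each component either avoids \<open>A\<close> or lives on \<open>A\<close> with law
  \<open>r\<close>, so conditioning on \<open>A\<close> merely selects components. They will be
  indexed by the stopped state and the edges that are not inside the sleeping set.\<close>

lemma cond_pmf_mixture:
  assumes p: "p = q \<bind> K" and ne: "set_pmf p \<inter> A \<noteq> {}"
    and K: "\<And>y. y \<in> set_pmf q \<Longrightarrow> set_pmf (K y) \<inter> A = {} \<or> (set_pmf (K y) \<subseteq> A \<and> K y = r)"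
  shows "cond_pmf p A = r"
proof (rule pmf_eqI)
  fix x
  define G where "G = {y. set_pmf (K y) \<subseteq> A \<and> K y = r}"
  from ne obtain y where y: "y \<in> set_pmf q" "set_pmf (K y) \<inter> A \<noteq> {}" by (auto simp: p)
  then have rA: "set_pmf r \<subseteq> A" using K by auto
  have prob: "measure_pmf.prob (K y) B = indicat_real G y * measure_pmf.prob r B"
    if "y \<in> set_pmf q" "B \<subseteq> A" for y B
  proof (cases "set_pmf (K y) \<inter> A = {}")
    case True
    then have "y \<notin> G" using set_pmf_not_empty[of "K y"] by (auto simp: G_def)
    moreover have "measure_pmf.prob (K y) B = 0"
      using True that by (auto simp: measure_pmf_zero_iff)
    ultimately show ?thesis by simp
  next
    case False
    then show ?thesis using K[OF that(1)] by (auto simp: G_def)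
  qed
  have pB: "measure_pmf.prob p B = measure_pmf.prob q G * measure_pmf.prob r B" if "B \<subseteq> A" for B
  proof -
    have "measure_pmf.prob p B = measure_pmf.expectation q (\<lambda>y. measure_pmf.prob (K y) B)"
      by (simp add: p prob_bind_pmf)
    also have "\<dots> = measure_pmf.expectation q (\<lambda>y. indicat_real G y * measure_pmf.prob r B)"
      using prob that by (intro integral_cong_AE) (auto simp: AE_measure_pmf_iff)
    finally show ?thesis by simp
  qed
  have r1: "measure_pmf.prob r A = 1" using rA by (simp add: measure_pmf.prob_eq_1 AE_measure_pmf_iff subset_eq)
  have c: "measure_pmf.prob p A > 0" using ne by (auto intro: measure_pmf_posI)
  show "pmf (cond_pmf p A) x = pmf r x"
  proof (cases "x \<in> A")
    case True
    have "pmf p x = measure_pmf.prob q G * pmf r x"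
      using pB[of "{x}"] True by (simp add: measure_pmf_single)
    then show ?thesis using c True pB[of A] r1 by (simp add: pmf_cond[OF ne])
  next
    case False
    then show ?thesis using rA by (auto simp: pmf_cond[OF ne] pmf_eq_0_set_pmf)
  qed
qed

lemma ustep_cases:
  assumes "y \<in> set_pmf (ustep (A, S, U, C))" "finite S" "S \<noteq> {}" "finite U" "even (card U)"
  obtains (pick) v where "A = []" "v \<in> S" "y = ([v], S - {v}, U, insert v C)"
  | (pop) "A \<noteq> []" "{h \<in> U. fst h = last A} = {}" "y = (butlast A, S, U, C)"
  | (match) h h' where "A \<noteq> []" "h \<in> U" "fst h = last A" "h' \<in> U" "h' \<noteq> h"
      "y = (if fst h' \<in> S then (A @ [fst h'], S - {fst h'}, U - {h, h'}, C) else (A, S, U - {h, h'}, C))"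
proof (cases "A = []")
  case True
  then show ?thesis using assms pick by (auto simp: ustep_Nil set_pmf_of_set)
next
  case ne: False
  let ?E = "{h \<in> U. fst h = last A}"
  show ?thesis
  proof (cases "?E = {}")
    case True
    have "y = (butlast A, S, U, C)" using assms(1) ustep_pop[OF ne True] by simp
    with pop[OF ne True] show ?thesis by blast
  next
    case False
    have "finite ?E" using assms by simp
    from assms(1)[unfolded ustep_examine[OF ne False] set_bind_pmf set_pmf_of_set[OF False this]]
    obtain h where h: "h \<in> ?E" and y: "y \<in> set_pmf (map_pmf (\<lambda>h'. let v = fst h' in
      if v \<in> S then (A @ [v], S - {v}, U - {h, h'}, C) else (A, S, U - {h, h'}, C)) (pmf_of_set (U - {h})))"
      by blast
    have "U \<noteq> {h}" using assms by auto
    then have "set_pmf (pmf_of_set (U - {h})) = U - {h}" using h assms by (intro set_pmf_of_set) auto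
    then obtain h' where "h' \<in> U" "h' \<noteq> h"
      "y = (if fst h' \<in> S then (A @ [fst h'], S - {fst h'}, U - {h, h'}, C) else (A, S, U - {h, h'}, C))"
      using y unfolding Let_def set_map_pmf by blast
    then show ?thesis using h ne by (intro match[of h h']) auto
  qed
qed

definition uinv0 :: "ustate \<Rightarrow> bool" where
  "uinv0 = (\<lambda>(A, S, U, C). finite S \<and> finite U \<and> even (card U))"

lemma uinv0_step:
  assumes "uinv0 x" "\<not> small m x" "y \<in> set_pmf (ustep x)"
  shows "uinv0 y"
proof -
  obtain A S U C where x: "x = (A, S, U, C)" by (metis prod_cases4)
  have I: "finite S" "S \<noteq> {}" "finite U" "even (card U)" using assms by (auto simp: x uinv0_def)
  from assms(3)[unfolded x] I show ?thesis
  proof (cases rule: ustep_cases)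
    case (match h h')
    then have "card (U - {h, h'}) = card U - 2" using I by (subst card_Diff_subset) auto
    then show ?thesis using match I by (auto simp: uinv0_def)
  qed (use I in \<open>auto simp: uinv0_def\<close>)
qed

text \<open>The stopped state and the edges not inside the sleeping set determine the vertex set and
  all degrees of the induced graph, and the remaining half-edges are matched uniformly. So this data
  decides whether \<open>G\<close> occurs, and on \<open>G\<close> the law is always the same
  configuration model.\<close>

lemma cond_sleeping_graph:
  fixes d D :: "nat \<Rightarrow> nat" and V :: "nat set"
  assumes N: "N \<ge> 1" and a: "0 \<le> \<alpha>" "\<alpha> \<le> 1"
  defines "G \<equiv> {G. verts G = V \<and> (\<forall>v\<in>V. vertex_degree G v = D v)}"
  assumes ne: "set_pmf (sleeping_graph N d \<alpha>) \<inter> G \<noteq> {}"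
  shows "cond_pmf (sleeping_graph N d \<alpha>) G = configuration_model V D"
proof -
  define m where "m = min (nat \<lfloor>(1 - \<alpha>) * real N\<rfloor>) (N - 1)"
  define e where "e = make_even {1..N} d"
  define R where "R = run_until (small m) ustep (2 * N + card (half_edges {1..N} e)) ([], {1..N}, half_edges {1..N} e, {})"
  define outer where "outer x = map_pmf (\<lambda>M. M - inner (fst (snd x)) M) (pmf_of_set (perfect_matchings (unmatched x)))" for x :: ustate
  define K where "K xQ = (let S = fst (snd (fst xQ)) in map_pmf (graph_of_matching S)
    (pmf_of_set (perfect_matchings (unmatched (fst xQ) - \<Union>(snd xQ)))))" for xQ :: "ustate \<times> half_edge set set"
  have ev: "even (card (half_edges {1..N} e))"
    using even_make_even[of "{1..N}" d] N by (simp add: card_half_edges e_def)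
  have inv: "uinv0 x" if "x \<in> set_pmf R" for x
    by (rule run_until_invariant[OF _ that[unfolded R_def]])
       (use ev uinv0_step in \<open>auto simp: uinv0_def finite_half_edges\<close>)
  have PM: "perfect_matchings (unmatched x) \<noteq> {}" "finite (perfect_matchings (unmatched x))" if "x \<in> set_pmf R" for x
    using inv[OF that] perfect_matchings_nonempty finite_perfect_matchings by (auto simp: uinv0_def split: prod.splits)
  have fib: "map_pmf (\<lambda>M. graph_of_matching (fst (snd x)) (inner (fst (snd x)) M))
        (pmf_of_set {M \<in> perfect_matchings (unmatched x). M - inner (fst (snd x)) M = Q}) = K (x, Q)"
    if xR: "x \<in> set_pmf R" and Qx: "Q \<in> set_pmf (outer x)" for x Q
  proof -
    let ?V = "fst (snd x)" and ?U = "unmatched x"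
    obtain M0 where M0: "M0 \<in> perfect_matchings ?U" and Q: "Q = M0 - inner ?V M0"
      using Qx PM[OF xR] by (auto simp: outer_def set_pmf_of_set)
    note f = perfect_matchings_fibre[OF M0, where V = ?V, folded Q]
    have ne: "perfect_matchings (?U - \<Union>Q) \<noteq> {}" using f(1) M0 Q by blast
    have fin: "finite (perfect_matchings (?U - \<Union>Q))"
      using inv[OF xR] by (intro finite_perfect_matchings) (auto simp: uinv0_def split: prod.splits)
    have inj: "inj_on (\<lambda>I. Q \<union> I) (perfect_matchings (?U - \<Union>Q))"
      using f(2) by (intro inj_onI) metis
    have "pmf_of_set {M \<in> perfect_matchings ?U. M - inner ?V M = Q} = map_pmf (\<lambda>I. Q \<union> I) (pmf_of_set (perfect_matchings (?U - \<Union>Q)))"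
      unfolding f(1) by (rule map_pmf_of_set_inj[OF inj ne fin, symmetric])
    then show ?thesis
      using f(2) by (auto simp: K_def Let_def pmf.map_comp o_def set_pmf_of_set[OF ne fin] intro!: map_pmf_cong)
  qed
  have sg: "sleeping_graph N d \<alpha> = (R \<bind> (\<lambda>x. map_pmf (Pair x) (outer x))) \<bind> K"
  proof -
    have "sleeping_graph N d \<alpha> = R \<bind> (\<lambda>x. map_pmf (\<lambda>M. graph_of_matching (fst (snd x)) (inner (fst (snd x)) M))
        (pmf_of_set (perfect_matchings (unmatched x))))"
      unfolding R_def m_def e_def by (rule sleeping_graph_eq[OF N a]) simp
    also have "\<dots> = R \<bind> (\<lambda>x. outer x \<bind> (\<lambda>Q. K (x, Q)))"
    proof (intro bind_pmf_cong refl)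
      fix x assume x: "x \<in> set_pmf R"
      show "map_pmf (\<lambda>M. graph_of_matching (fst (snd x)) (inner (fst (snd x)) M))
        (pmf_of_set (perfect_matchings (unmatched x))) = outer x \<bind> (\<lambda>Q. K (x, Q))"
        by (subst pmf_of_set_disintegrate[OF PM(2,1)[OF x], where g = "\<lambda>M. M - inner (fst (snd x)) M"])
           (auto simp: map_bind_pmf outer_def[symmetric] fib[OF x] intro!: bind_pmf_cong)
    qed
    finally show ?thesis by (simp add: bind_assoc_pmf bind_map_pmf)
  qed
  show ?thesis
  proof (rule cond_pmf_mixture[OF sg ne])
    fix xQ assume "xQ \<in> set_pmf (R \<bind> (\<lambda>x. map_pmf (Pair x) (outer x)))"
    then obtain x Q where xQ: "xQ = (x, Q)" "x \<in> set_pmf R" "Q \<in> set_pmf (outer x)" by auto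
    let ?S = "fst (snd x)" and ?U = "unmatched x"
    let ?W = "?U - \<Union>Q"
    obtain M0 where M0: "M0 \<in> perfect_matchings ?U" and Q: "Q = M0 - inner ?S M0"
      using xQ PM[OF xQ(2)] by (auto simp: outer_def set_pmf_of_set)
    note f = perfect_matchings_fibre[OF M0, where V = ?S, folded Q]
    have W: "perfect_matchings ?W \<noteq> {}" using f(1) M0 Q by blast
    have finW: "finite ?W" and finS: "finite ?S"
      using inv[OF xQ(2)] by (auto simp: uinv0_def split: prod.splits)
    have evW: "even (card ?W)" using W perfect_matchings_even finW by blast
    have setK: "set_pmf (K xQ) = graph_of_matching ?S ` perfect_matchings ?W"
      using W finite_perfect_matchings[OF finW] by (simp add: K_def Let_def xQ set_pmf_of_set)
    have G: "graph_of_matching ?S I \<in> G \<longleftrightarrow> ?S = V \<and> (\<forall>v\<in>V. card {h \<in> ?W. fst h = v} = D v)"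
      if "I \<in> perfect_matchings ?W" for I
      using vertex_degree_graph_of_matching[OF that finW]
      by (auto simp: G_def verts_def) (auto simp: graph_of_matching_def)
    show "set_pmf (K xQ) \<inter> G = {} \<or> set_pmf (K xQ) \<subseteq> G \<and> K xQ = configuration_model V D"
    proof (cases "?S = V \<and> (\<forall>v\<in>V. card {h \<in> ?W. fst h = v} = D v)")
      case True
      then have "K xQ = configuration_model V D"
        using graph_of_uniform_matching[OF finW evW finS f(3), of D] by (simp add: K_def Let_def xQ)
      moreover have "set_pmf (K xQ) \<subseteq> G" unfolding setK using True G by blast
      ultimately show ?thesis by blast
    next
      case False
      then have "set_pmf (K xQ) \<inter> G = {}" unfolding setK using G by blast
      then show ?thesis by blast
    qed
  qed
qed

section \<open>Supermartingales along the exploration\<close>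

lemma pos_part_square_step:
  fixes y d :: real
  shows "(max 0 (y + d))\<^sup>2 \<le> (max 0 y)\<^sup>2 + 2 * max 0 y * d + d\<^sup>2"
proof (cases "y \<ge> 0")
  case True
  have "(max 0 (y + d))\<^sup>2 \<le> (y + d)\<^sup>2" by (cases "y + d \<ge> 0") (auto simp: max_def)
  then show ?thesis using True by (simp add: max_def power2_sum)
next
  case False
  have "(max 0 (y + d))\<^sup>2 \<le> d\<^sup>2"
    unfolding abs_le_square_iff[symmetric] using False by (auto simp: max_def)
  then show ?thesis using False by (simp add: max_def)
qed

text \<open>The first-order term carries the drift, and its factor \<open>max 0 y\<close> means that
  only the drift at positive deviations has to be controlled.\<close>

lemma average_pos_part_square:
  fixes y c :: real and d :: "'b \<Rightarrow> real"
  assumes "finite W" "W \<noteq> {}" "\<And>w. w \<in> W \<Longrightarrow> \<bar>d w\<bar> \<le> c"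
  shows "(\<Sum>w\<in>W. (max 0 (y + d w))\<^sup>2) / card W \<le> (max 0 y)\<^sup>2 + 2 * max 0 y * ((\<Sum>w\<in>W. d w) / card W) + c\<^sup>2"
proof -
  have "(\<Sum>w\<in>W. (max 0 (y + d w))\<^sup>2) \<le> (\<Sum>w\<in>W. (max 0 y)\<^sup>2 + 2 * max 0 y * d w + c\<^sup>2)"
  proof (rule sum_mono)
    fix w assume "w \<in> W"
    then have "(d w)\<^sup>2 \<le> c\<^sup>2" using assms(3) abs_le_square_iff[of "d w" c] by fastforce
    then show "(max 0 (y + d w))\<^sup>2 \<le> (max 0 y)\<^sup>2 + 2 * max 0 y * d w + c\<^sup>2"
      using pos_part_square_step[of y "d w"] by linarith
  qed
  also have "\<dots> = card W * ((max 0 y)\<^sup>2 + c\<^sup>2) + 2 * max 0 y * (\<Sum>w\<in>W. d w)"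
    by (simp add: sum.distrib distrib_left flip: sum_distrib_left)
  finally show ?thesis using assms by (simp add: field_simps card_gt_0_iff)
qed

lemma power_one_minus_upper:
  fixes x :: real
  assumes "0 \<le> x" "x \<le> 1"
  shows "(1 - x) ^ j \<le> 1 - real j * x + (real j)\<^sup>2 * x\<^sup>2"
proof (induction j)
  case (Suc j)
  have "(1 - x) ^ Suc j \<le> (1 - real j * x + (real j)\<^sup>2 * x\<^sup>2) * (1 - x)"
    using mult_right_mono[OF Suc, of "1 - x"] assms by (simp add: mult_ac)
  also have "\<dots> = 1 - real (Suc j) * x + ((real j)\<^sup>2 + real j) * x\<^sup>2 - (real j)\<^sup>2 * x ^ 3"
    by (simp add: algebra_simps power2_eq_square power3_eq_cube)
  also have "\<dots> \<le> 1 - real (Suc j) * x + (real (Suc j))\<^sup>2 * x\<^sup>2"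
  proof -
    have "((real j)\<^sup>2 + real j) * x\<^sup>2 \<le> (real (Suc j))\<^sup>2 * x\<^sup>2"
      by (intro mult_right_mono) (auto simp: power2_eq_square algebra_simps)
    moreover have "0 \<le> (real j)\<^sup>2 * x ^ 3" using assms by simp
    ultimately show ?thesis by linarith
  qed
  finally show ?case .
qed simp

text \<open>The factor \<open>1 - j / (u - 1)\<close> is the probability that none of the half-edges of a vertex of
  degree \<open>j\<close> is the partner in a step with \<open>u\<close> unmatched half-edges.\<close>

lemma sqrt_ratio_power_bounds:
  fixes u L r r' :: real and j :: nat
  assumes "u \<ge> 2" "L > 0"
  defines "r \<equiv> sqrt (u / L) ^ j" and "r' \<equiv> sqrt ((u - 2) / L) ^ j"
  shows "r - r' \<le> j * r / (u - 1)" "r' \<le> r" "j * r / (u - 1) - r * ((real j)\<^sup>2 + 2 * j) / u\<^sup>2 \<le> r - r'"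
proof -
  define q where "q = sqrt (1 - 2 / u)"
  have q: "0 \<le> q" "q \<le> 1" using assms by (auto simp: q_def)
  have "(u - 2) / L = (1 - 2 / u) * (u / L)" using assms by (simp add: field_simps)
  then have r': "r' = q ^ j * r"
    unfolding r_def r'_def q_def by (simp only: real_sqrt_mult power_mult_distrib)
  have r: "0 \<le> r" using assms by (simp add: r_def)
  show "r' \<le> r" using q r by (simp add: r' mult_left_le_one_le power_le_one)
  \<comment> \<open>Gives \<open>q \<ge> 1 - 1 / (u - 1)\<close>. With Bernoulli's inequality this
    yields exactly the factor \<open>1 - j / (u - 1)\<close>, so the upper deviation has no error
    term.\<close>
  have "(1 - 1 / (u - 1))\<^sup>2 \<le> 1 - 2 / u"
  proof -
    define w where "w = u - 1"
    have w: "w \<ge> 1" "u = w + 1" using assms by (auto simp: w_def)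
    have "2 / w - 2 / (w + 1) = 2 / (w * (w + 1))" using w by (simp add: field_simps)
    also have "\<dots> \<ge> 2 / (w * (2 * w))" using w by (intro divide_left_mono mult_left_mono) auto
    finally have "1 / w\<^sup>2 \<le> 2 / w - 2 / (w + 1)" by (simp add: power2_eq_square)
    moreover have "(1 - 1 / w)\<^sup>2 = 1 - 2 / w + 1 / w\<^sup>2"
      by (simp add: power2_diff power_divide)
    ultimately show ?thesis by (simp add: w(2))
  qed
  then have l: "1 - 1 / (u - 1) \<le> q" unfolding q_def by (intro real_le_rsqrt)
  have l0: "0 \<le> 1 - 1 / (u - 1)" using assms by (simp add: field_simps)
  have "1 + real j * (- (1 / (u - 1))) \<le> (1 + - (1 / (u - 1))) ^ j"
    using l0 by (intro Bernoulli_inequality) auto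
  also have "\<dots> \<le> q ^ j" using l l0 by (intro power_mono) auto
  finally have "1 - j / (u - 1) \<le> q ^ j" by simp
  from mult_right_mono[OF this r] show "r - r' \<le> j * r / (u - 1)"
    by (simp add: r' algebra_simps)
  \<comment> \<open>The opposite bound is lossy: replacing \<open>1 / (u - 1)\<close> by
    \<open>1 / u\<close> costs at most \<open>2 * j / u\<^sup>2\<close>, and the second-order term
    of the power costs \<open>j\<^sup>2 / u\<^sup>2\<close>.\<close>
  have "q \<le> 1 - 1 / u"
    unfolding q_def using assms by (intro real_le_lsqrt) (auto simp: field_simps power2_eq_square)
  then have "q ^ j \<le> (1 - 1 / u) ^ j" using q by (intro power_mono) auto
  also have "\<dots> \<le> 1 - real j * (1 / u) + (real j)\<^sup>2 * (1 / u)\<^sup>2"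
    using assms by (intro power_one_minus_upper) auto
  also have "\<dots> \<le> 1 - j / (u - 1) + ((real j)\<^sup>2 + 2 * j) / u\<^sup>2"
  proof -
    have "1 / (u - 1) - 1 / u = 1 / (u * (u - 1))" using assms by (simp add: field_simps)
    also have "\<dots> \<le> 2 / u\<^sup>2" using assms by (simp add: field_simps power2_eq_square)
    finally have "real j * (1 / (u - 1) - 1 / u) \<le> real j * (2 / u\<^sup>2)" by (intro mult_left_mono) auto
    then have "real j / (u - 1) - real j / u \<le> 2 * real j / u\<^sup>2"
      by (simp add: right_diff_distrib mult.commute)
    then show ?thesis by (simp add: power_divide add_divide_distrib)
  qed
  finally have "q ^ j \<le> 1 - j / (u - 1) + ((real j)\<^sup>2 + 2 * j) / u\<^sup>2" .
  from mult_right_mono[OF this r] show "j * r / (u - 1) - r * ((real j)\<^sup>2 + 2 * j) / u\<^sup>2 \<le> r - r'"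
    by (simp add: r' algebra_simps)
qed

lemma expectation_bind_pmf_of_set_le:
  fixes h :: "'b \<Rightarrow> real"
  assumes "finite A" "A \<noteq> {}" "\<And>a. finite (set_pmf (f a))"
    "\<And>a. a \<in> A \<Longrightarrow> measure_pmf.expectation (f a) h \<le> c"
  shows "measure_pmf.expectation (pmf_of_set A \<bind> f) h \<le> c"
proof -
  have "measure_pmf.expectation (pmf_of_set A \<bind> f) h =
      (\<Sum>a\<in>A. measure_pmf.expectation (f a) h) / card A"
    using assms by (simp add: pmf_expectation_bind_pmf_of_set divide_inverse mult.commute flip: sum_distrib_left)
  also have "\<dots> \<le> (\<Sum>a\<in>A. c) / card A"
    using assms by (intro divide_right_mono sum_mono) auto
  finally show ?thesis using assms by simp
qed

section \<open>Deviations and energies for a fixed degree sequence\<close>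

locale half_edge_exploration =
  fixes V :: "nat set" and e :: "nat \<Rightarrow> nat"
  assumes finite_V: "finite V"
begin

abbreviation "H \<equiv> half_edges V e"

definition L :: real where "L = real (card H)"

definition D :: "nat \<Rightarrow> nat set" where "D j = {v \<in> V. e v = j}"

definition P :: "nat set" where "P = {v \<in> V. 1 \<le> e v}"

text \<open>A square root because a matching step destroys two half-edges, of which only one, the
  partner, can belong to a sleeping vertex.\<close>

definition scale :: "half_edge set \<Rightarrow> real" where "scale U = sqrt (card U / L)"

definition num :: "nat \<Rightarrow> nat set \<Rightarrow> real" where "num j S = real (card (S \<inter> D j))"

text \<open>All half-edges of sleeping vertices are unmatched, and unmatched half-edges sit at
  sleeping or active vertices. Hence \<open>U = half_edges S e\<close> whenever
  \<open>A = []\<close>, the identity behind the bound on the number of picks.\<close>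

definition uinv :: "ustate \<Rightarrow> bool" where
  "uinv = (\<lambda>(A, S, U, C). S \<subseteq> V \<and> C \<subseteq> V - S \<and> set A \<subseteq> V - S \<and> U \<subseteq> H \<and> half_edges S e \<subseteq> U \<and>
     (\<forall>h\<in>U. fst h \<in> S \<union> set A) \<and> even (card U))"

definition upot :: "ustate \<Rightarrow> nat" where
  "upot = (\<lambda>(A, S, U, C). 2 * card S + length A + card U)"

text \<open>Where they are positive, the deviations below have nonpositive drift, up to an error of order
  \<open>1 / (card U)\<^sup>2\<close> for \<open>low_dev\<close>. The squares of their positive parts therefore grow by at most a
  constant in a step that matches two half-edges, which \<open>slack\<close> pays out of the decrease of \<open>card U\<close>.
  The deviation \<open>pick_dev\<close> uses that a proportion at least \<open>\<delta>\<close> of the sleeping vertices has a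
  half-edge.\<close>

definition up_dev :: "nat \<Rightarrow> ustate \<Rightarrow> real" where
  "up_dev j = (\<lambda>(A, S, U, C). num j S + scale U ^ j * num j C - scale U ^ j * num j V)"

definition low_dev :: "nat \<Rightarrow> ustate \<Rightarrow> real" where
  "low_dev j = (\<lambda>(A, S, U, C). scale U ^ j * num j V - num j S - num j C)"

definition pick_dev :: "real \<Rightarrow> ustate \<Rightarrow> real" where
  "pick_dev \<delta> = (\<lambda>(A, S, U, C). \<delta> * card C - card (C \<inter> P))"

definition slack :: "real \<Rightarrow> nat \<Rightarrow> real" where
  "slack \<rho> j = (1 + j / \<rho>)\<^sup>2 + ((real j)\<^sup>2 + 2 * j) / \<rho>\<^sup>2"

definition deg_energy :: "real \<Rightarrow> nat \<Rightarrow> ustate \<Rightarrow> real" where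
  "deg_energy \<rho> j x = (max 0 (up_dev j x))\<^sup>2 + (max 0 (low_dev j x))\<^sup>2 + slack \<rho> j * card (unmatched x)"

text \<open>The second term pays for the variance: a pick lowers it by 1 and changes
  \<open>pick_dev\<close> by at most 1.\<close>

definition pick_energy :: "real \<Rightarrow> ustate \<Rightarrow> real" where
  "pick_energy \<delta> x = (max 0 (pick_dev \<delta> x))\<^sup>2 + card (fst (snd x))"

definition energy :: "real \<Rightarrow> real \<Rightarrow> nat \<Rightarrow> ustate \<Rightarrow> real" where
  "energy \<rho> \<delta> K x = (\<Sum>j\<le>K. deg_energy \<rho> j x) + pick_energy \<delta> x"

lemma finite_H: "finite H" by (simp add: finite_half_edges finite_V)

lemma finite_D: "finite (D j)" using finite_V by (simp add: D_def)

lemma uinv_finite: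
  assumes "uinv (A, S, U, C)"
  shows "finite S" "finite U" "finite C" "even (card U)"
proof -
  have "S \<subseteq> V" "C \<subseteq> V" "U \<subseteq> H" "even (card U)" using assms by (auto simp: uinv_def)
  then show "finite S" "finite U" "finite C" "even (card U)"
    using finite_V finite_H finite_subset by simp_all
qed

text \<open>The last claim keeps the chain from jumping over the threshold: started with at least
  \<open>m\<close> sleeping vertices, it stops with exactly \<open>m\<close>.\<close>

lemma uinv_step:
  assumes "uinv (A, S, U, C)" "S \<noteq> {}" "y \<in> set_pmf (ustep (A, S, U, C))"
  shows "uinv y" "upot y < upot (A, S, U, C)" "card S \<le> Suc (card (fst (snd y)))"
proof -
  note fin = uinv_finite[OF assms(1)]
  have I: "S \<subseteq> V" "C \<subseteq> V - S" "set A \<subseteq> V - S" "U \<subseteq> H" "half_edges S e \<subseteq> U"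
    "\<And>h. h \<in> U \<Longrightarrow> fst h \<in> S \<union> set A" "even (card U)"
    using assms(1) by (auto simp: uinv_def)
  have he: "half_edges (S - {v}) e \<subseteq> half_edges S e" for v by (auto simp: half_edges_def)
  have cS: "Suc (card (S - {v})) = card S" if "v \<in> S" for v
    using that fin(1) by (rule card_Suc_Diff1[rotated])
  have "uinv y \<and> upot y < upot (A, S, U, C) \<and> card S \<le> Suc (card (fst (snd y)))"
    using assms(3) fin(1) assms(2) fin(2) fin(4)
  proof (cases rule: ustep_cases)
    case (pick v)
    have "half_edges (S - {v}) e \<subseteq> U" using he[of v] I(5) by blast
    then show ?thesis using pick I cS[OF pick(2)] by (auto simp: uinv_def upot_def)
  next
    case pop
    define A' where "A' = butlast A"
    have A: "A = A' @ [last A]" using pop by (simp add: A'_def)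
    have "set A' \<subseteq> set A" "length A = Suc (length A')" by (subst A, auto)+
    moreover have "fst h \<in> S \<union> set A'" if "h \<in> U" for h
    proof -
      have "fst h \<noteq> last A" using that pop(2) by blast
      moreover have "set A = insert (last A) (set A')" by (subst A) simp
      ultimately show ?thesis using I(6)[OF that] by auto
    qed
    ultimately show ?thesis using pop I by (auto simp: uinv_def upot_def A'_def[symmetric])
  next
    case (match h h')
    have c: "card (U - {h, h'}) = card U - 2" using match fin by (subst card_Diff_subset) auto
    have "{h, h'} \<subseteq> U" using match by auto
    from card_mono[OF fin(2) this] have c2: "2 \<le> card U" using match by simp
    have hS: "fst h \<notin> S" using match(3) I(3) last_in_set[OF match(1)] by auto
    show ?thesis
    proof (cases "fst h' \<in> S")
      case True
      have "half_edges (S - {fst h'}) e \<subseteq> U - {h, h'}"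
        using he[of "fst h'"] I(5) hS by (auto simp: half_edges_def)
      moreover have "\<forall>k\<in>U - {h, h'}. fst k \<in> (S - {fst h'}) \<union> set (A @ [fst h'])"
      proof
        fix k assume "k \<in> U - {h, h'}"
        then show "fst k \<in> (S - {fst h'}) \<union> set (A @ [fst h'])" using I(6)[of k] by auto
      qed
      moreover have "S - {fst h'} \<subseteq> V" "C \<subseteq> V - (S - {fst h'})" "U - {h, h'} \<subseteq> H"
        "set (A @ [fst h']) \<subseteq> V - (S - {fst h'})" "even (card (U - {h, h'}))"
        using I(1-4,7) True c c2 by auto
      ultimately have "uinv (A @ [fst h'], S - {fst h'}, U - {h, h'}, C)"
        unfolding uinv_def prod.case by blast
      then show ?thesis using match(6) True c c2 cS[OF True] by (simp add: upot_def)
    next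
      case False
      have "half_edges S e \<subseteq> U - {h, h'}" using I(5) hS False by (auto simp: half_edges_def)
      then show ?thesis using match False I c c2 by (auto simp: uinv_def upot_def)
    qed
  qed
  then show "uinv y" "upot y < upot (A, S, U, C)" "card S \<le> Suc (card (fst (snd y)))" by auto
qed

lemma finite_set_ustep:
  assumes "uinv (A, S, U, C)" "S \<noteq> {}"
  shows "finite (set_pmf (ustep (A, S, U, C)))"
proof (cases "A = []")
  case True
  then show ?thesis using uinv_finite(1)[OF assms(1)] assms(2) by (simp add: ustep_Nil)
next
  case ne: False
  let ?E = "{h \<in> U. fst h = last A}"
  note fin = uinv_finite[OF assms(1)]
  show ?thesis
  proof (cases "?E = {}")
    case False
    have "finite ?E" using fin by simp
    moreover have "U - {h} \<noteq> {}" if "h \<in> U" for h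
    proof -
      have "U \<noteq> {h}" using fin by auto
      then show ?thesis using that by auto
    qed
    ultimately show ?thesis using False fin by (auto simp: ustep_examine[OF ne False] set_pmf_of_set)
  qed (simp add: ustep_pop[OF ne])
qed

lemma num_remove:
  assumes "finite S"
  shows "num j (S - {v}) = num j S - (if v \<in> S \<inter> D j then 1 else 0)"
proof -
  have "(S - {v}) \<inter> D j = (S \<inter> D j) - {v}" by auto
  moreover have "Suc (card (S \<inter> D j - {v})) = card (S \<inter> D j)" if "v \<in> S \<inter> D j"
    using assms that by (intro card_Suc_Diff1) auto
  ultimately show ?thesis
    by (cases "v \<in> S \<inter> D j") (simp_all add: num_def flip: of_nat_Suc)
qed

lemma num_insert:
  assumes "finite C" "v \<notin> C"
  shows "num j (insert v C) = num j C + (if v \<in> D j then 1 else 0)"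
  using assms by (auto simp: num_def Int_insert_left)

lemma num_le:
  assumes "S \<subseteq> V" shows "num j S \<le> num j V" "num j S \<le> card V" "0 \<le> num j S"
proof -
  show "num j S \<le> num j V" unfolding num_def of_nat_le_iff
    using assms finite_V by (intro card_mono) auto
  show "num j S \<le> card V" unfolding num_def of_nat_le_iff
    using assms finite_V by (intro card_mono) auto
qed (simp add: num_def)

lemma scale_bounds:
  assumes "U \<subseteq> H"
  shows "0 \<le> scale U" "scale U \<le> 1" "scale U ^ j \<le> 1"
proof -
  have "card U \<le> card H" using card_mono[OF finite_H assms] .
  then show *: "0 \<le> scale U" "scale U \<le> 1"
    unfolding scale_def L_def by (auto simp: divide_le_eq_1)
  then show "scale U ^ j \<le> 1" by (simp add: power_le_one)
qed

lemma card_half_edges_D: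
  assumes "half_edges S e \<subseteq> U" "S \<subseteq> V" "U \<subseteq> H"
  shows "real (card {h \<in> U. fst h \<in> S \<inter> D j}) = j * num j S"
proof -
  have "{h \<in> U. fst h \<in> S \<inter> D j} = half_edges (S \<inter> D j) e"
    using assms by (auto simp: half_edges_def)
  moreover have "finite (S \<inter> D j)" using finite_D by auto
  ultimately show ?thesis by (simp add: card_half_edges num_def D_def)
qed

text \<open>The average is over the partner of one examined half-edge \<open>h\<close>. A sleeping
  vertex of degree \<open>j\<close> has all its half-edges among the \<open>u - 1\<close>
  candidates, so the count \<open>X\<close> loses \<open>j * X / (u - 1)\<close> on average, to be
  compared with the loss \<open>r - r'\<close> of the reference curve. The condition on \<rho> keeps
  \<open>card U\<close> at least of the order of \<open>card V\<close>, which bounds the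
  increments.\<close>

lemma deg_energy_match:
  assumes x: "x = (A, S, U, C)" and inv: "uinv x" and \<rho>: "\<rho> > 0" "\<rho> * real (card V) \<le> real (card U) - 1"
    and h: "h \<in> U" "fst h \<notin> S" and V: "V \<noteq> {}"
  defines "nx \<equiv> (\<lambda>h'. if fst h' \<in> S then (A @ [fst h'], S - {fst h'}, U - {h, h'}, C) else (A, S, U - {h, h'}, C))"
  shows "(\<Sum>h'\<in>U - {h}. deg_energy \<rho> j (nx h')) / card (U - {h}) \<le> deg_energy \<rho> j x"
proof -
  note fin = uinv_finite[OF inv[unfolded x]]
  have I: "S \<subseteq> V" "C \<subseteq> V - S" "U \<subseteq> H" "half_edges S e \<subseteq> U"
    using inv by (auto simp: x uinv_def)
  define u where "u = real (card U)"
  define W where "W = U - {h}"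
  define r where "r = scale U ^ j"
  define r' where "r' = sqrt ((u - 2) / L) ^ j"
  define n where "n = num j V"
  define N where "N = real (card V)"
  define X where "X = num j S"
  define c where "c = num j C"
  define \<xi> where "\<xi> h' = (if fst h' \<in> S \<inter> D j then 1 else 0 :: real)" for h' :: half_edge
  have "card U \<noteq> 1" "card U > 0" using fin h by (auto simp: card_gt_0_iff)
  then have u2: "u \<ge> 2" by (simp add: u_def)
  have N: "N \<ge> 1" using V finite_V by (simp add: N_def Suc_leI card_gt_0_iff)
  have L0: "L > 0" using card_mono[OF finite_H I(3)] u2 by (simp add: L_def u_def)
  have cW: "real (card W) = u - 1" using h fin \<open>card U > 0\<close> by (simp add: W_def u_def)
  have "card W \<noteq> 0" using cW u2 by (intro notI) simp
  then have W: "finite W" "W \<noteq> {}" by (auto intro: card_ge_0_finite)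
  have rr: "r = sqrt (u / L) ^ j" by (simp add: r_def scale_def u_def)
  note b = sqrt_ratio_power_bounds[OF u2 L0, of j, folded rr r'_def]
  have r01: "0 \<le> r" "r \<le> 1" using scale_bounds[OF I(3)] by (auto simp: r_def)
  have CV: "C \<subseteq> V" using I by auto
  note nums = num_le[OF I(1), of j] num_le[OF CV, of j] num_le[OF subset_refl, of j]
  have nn: "0 \<le> n - c" "n \<le> N" "n - c \<le> N" "0 \<le> c" "0 \<le> n" "0 \<le> X"
    using nums by (auto simp: n_def c_def N_def X_def)
  have diff: "0 \<le> r - r'" "r - r' \<le> j / (u - 1)"
  proof -
    have "j * r / (u - 1) \<le> j * 1 / (u - 1)"
      using r01 u2 by (intro divide_right_mono) (auto simp: mult_left_le)
    then show "0 \<le> r - r'" "r - r' \<le> j / (u - 1)" using b(1,2) by auto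
  qed
  have uN: "N / (u - 1) \<le> 1 / \<rho>" "N / u \<le> 1 / \<rho>"
    using \<rho> u2 N by (auto simp: field_simps u_def N_def)
  have jr: "(r - r') * z \<le> j / \<rho>" if "0 \<le> z" "z \<le> N" for z
  proof -
    have "(r - r') * z \<le> (j / (u - 1)) * N" using diff that N by (intro mult_mono) auto
    also have "\<dots> = j * (N / (u - 1))" by simp
    also have "\<dots> \<le> j * (1 / \<rho>)" using uN by (intro mult_left_mono) auto
    finally show ?thesis by simp
  qed
  have card_next: "real (card (U - {h, h'})) = u - 2" if "h' \<in> W" for h'
    using that h fin u2 by (subst card_Diff_subset) (auto simp: W_def u_def)
  have scale_next: "scale (U - {h, h'}) ^ j = r'" if "h' \<in> W" for h'
    using card_next[OF that] by (simp add: scale_def r'_def)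
  have up: "up_dev j (nx h') = up_dev j x + ((r - r') * (n - c) - \<xi> h')" if "h' \<in> W" for h'
    using scale_next[OF that] num_remove[OF fin(1), of j "fst h'"]
    by (auto simp: nx_def up_dev_def x \<xi>_def r_def[symmetric] n_def[symmetric] c_def[symmetric] algebra_simps)
  have low: "low_dev j (nx h') = low_dev j x + (\<xi> h' - (r - r') * n)" if "h' \<in> W" for h'
    using scale_next[OF that] num_remove[OF fin(1), of j "fst h'"]
    by (auto simp: nx_def low_dev_def x \<xi>_def r_def[symmetric] n_def[symmetric] c_def[symmetric] algebra_simps)
  have sum\<xi>: "(\<Sum>h'\<in>W. \<xi> h') = j * X"
  proof -
    have "(\<Sum>h'\<in>W. \<xi> h') = real (card {h' \<in> W. fst h' \<in> S \<inter> D j})"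
      using W by (simp add: \<xi>_def sum.If_cases Int_def)
    also have "{h' \<in> W. fst h' \<in> S \<inter> D j} = {h' \<in> U. fst h' \<in> S \<inter> D j}"
      using h by (auto simp: W_def)
    finally show ?thesis using card_half_edges_D[OF I(4,1,3)] by (simp add: X_def)
  qed
  have avg_up: "(\<Sum>h'\<in>W. (r - r') * (n - c) - \<xi> h') / card W = (r - r') * (n - c) - j * X / (u - 1)"
    using W u2 by (simp add: sum_subtractf sum\<xi> cW diff_divide_distrib)
  have avg_low: "(\<Sum>h'\<in>W. \<xi> h' - (r - r') * n) / card W = j * X / (u - 1) - (r - r') * n"
    using W u2 by (simp add: sum_subtractf sum\<xi> cW diff_divide_distrib)
  have upx: "up_dev j x = X - r * (n - c)"
    by (simp add: up_dev_def x X_def r_def n_def c_def algebra_simps)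
  have lowx: "low_dev j x = r * n - X - c" by (simp add: low_dev_def x X_def r_def n_def c_def)
  define B where "B = (1 + j / \<rho>)\<^sup>2"
  define E where "E = ((real j)\<^sup>2 + 2 * j) / \<rho>\<^sup>2"
  have 1: "(\<Sum>h'\<in>W. (max 0 (up_dev j (nx h')))\<^sup>2) / card W \<le> (max 0 (up_dev j x))\<^sup>2 + B"
  proof -
    have "(\<Sum>h'\<in>W. (max 0 (up_dev j (nx h')))\<^sup>2) / card W =
      (\<Sum>h'\<in>W. (max 0 (up_dev j x + ((r - r') * (n - c) - \<xi> h')))\<^sup>2) / card W"
      using up by (intro arg_cong[where f = "\<lambda>z. z / card W"] sum.cong) auto
    also have "\<dots> \<le> (max 0 (up_dev j x))\<^sup>2 + 2 * max 0 (up_dev j x) *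
        ((r - r') * (n - c) - j * X / (u - 1)) + (1 + j / \<rho>)\<^sup>2"
      unfolding avg_up[symmetric]
    proof (rule average_pos_part_square[OF W])
      fix h' show "\<bar>(r - r') * (n - c) - \<xi> h'\<bar> \<le> 1 + j / \<rho>"
        using jr[OF nn(1,3)] mult_nonneg_nonneg[OF diff(1) nn(1)] by (auto simp: \<xi>_def)
    qed
    finally have le: "(\<Sum>h'\<in>W. (max 0 (up_dev j (nx h')))\<^sup>2) / card W \<le> (max 0 (up_dev j x))\<^sup>2 +
        2 * max 0 (up_dev j x) * ((r - r') * (n - c) - j * X / (u - 1)) + (1 + j / \<rho>)\<^sup>2" .
    \<comment> \<open>Only a positive deviation counts, and then \<open>X \<ge> r * (n - c)\<close>:
      the mean loss of \<open>X\<close> is at least that of the curve.\<close>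
    have "max 0 (up_dev j x) * ((r - r') * (n - c) - j * X / (u - 1)) \<le> 0"
    proof (cases "up_dev j x \<ge> 0")
      case True
      have "(r - r') * (n - c) \<le> j * r / (u - 1) * (n - c)" using b(1) nn by (intro mult_right_mono) auto
      also have "\<dots> = j / (u - 1) * (r * (n - c))" by simp
      also have "\<dots> \<le> j / (u - 1) * X" using True upx u2 by (intro mult_left_mono) auto
      finally have "(r - r') * (n - c) - j * X / (u - 1) \<le> 0" by simp
      then show ?thesis using True by (simp add: mult_nonneg_nonpos)
    qed simp
    then have "2 * max 0 (up_dev j x) * ((r - r') * (n - c) - j * X / (u - 1)) \<le> 0"
      by (simp only: mult.assoc)
    with le show ?thesis unfolding B_def by linarith
  qed
  have 2: "(\<Sum>h'\<in>W. (max 0 (low_dev j (nx h')))\<^sup>2) / card W \<le> (max 0 (low_dev j x))\<^sup>2 + B + 2 * E"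
  proof -
    have "(\<Sum>h'\<in>W. (max 0 (low_dev j (nx h')))\<^sup>2) / card W =
      (\<Sum>h'\<in>W. (max 0 (low_dev j x + (\<xi> h' - (r - r') * n)))\<^sup>2) / card W"
      using low by (intro arg_cong[where f = "\<lambda>z. z / card W"] sum.cong) auto
    also have "\<dots> \<le> (max 0 (low_dev j x))\<^sup>2 + 2 * max 0 (low_dev j x) *
        (j * X / (u - 1) - (r - r') * n) + (1 + j / \<rho>)\<^sup>2"
      unfolding avg_low[symmetric]
    proof (rule average_pos_part_square[OF W])
      fix h' show "\<bar>\<xi> h' - (r - r') * n\<bar> \<le> 1 + j / \<rho>"
        using jr[OF nn(5,2)] mult_nonneg_nonneg[OF diff(1) nn(5)] by (auto simp: \<xi>_def)
    qed
    finally have le: "(\<Sum>h'\<in>W. (max 0 (low_dev j (nx h')))\<^sup>2) / card W \<le> (max 0 (low_dev j x))\<^sup>2 +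
        2 * max 0 (low_dev j x) * (j * X / (u - 1) - (r - r') * n) + (1 + j / \<rho>)\<^sup>2" .
    have "max 0 (low_dev j x) * (j * X / (u - 1) - (r - r') * n) \<le> E"
    proof (cases "low_dev j x \<ge> 0")
      case True
      \<comment> \<open>The error in the bound for the curve is of order
        \<open>1 / u\<^sup>2\<close>. Multiplied by \<open>n \<le> N\<close> and by the deviation,
        itself at most \<open>N\<close>, it stays below the constant \<open>E\<close>.\<close>
      let ?q = "((real j)\<^sup>2 + 2 * j) / u\<^sup>2"
      have q: "0 \<le> ?q" by simp
      have "(j * r / (u - 1) - r * ?q) * n \<le> (r - r') * n"
        using mult_right_mono[OF b(3) nn(5)] by simp
      moreover have "(j * r / (u - 1) - r * ?q) * n = j * r / (u - 1) * n - r * n * ?q"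
        by (subst left_diff_distrib) (simp only: mult_ac)
      moreover have "j / (u - 1) * (X - r * n) = j * X / (u - 1) - j * r / (u - 1) * n"
        by (simp add: right_diff_distrib diff_divide_distrib)
      ultimately have "j * X / (u - 1) - (r - r') * n \<le> j / (u - 1) * (X - r * n) + r * n * ?q"
        by linarith
      also have "j / (u - 1) * (X - r * n) \<le> 0"
        using True lowx nn u2 by (intro mult_nonneg_nonpos) auto
      also have "r * n * ?q \<le> 1 * N * ?q"
        using r01 nn q by (intro mult_right_mono mult_mono) auto
      finally have a: "j * X / (u - 1) - (r - r') * n \<le> N * ?q" by simp
      have "r * n \<le> 1 * N" using r01 nn by (intro mult_mono) auto
      then have l: "low_dev j x \<le> N" using lowx nn by linarith
      have "low_dev j x * (j * X / (u - 1) - (r - r') * n) \<le> low_dev j x * (N * ?q)"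
        using a True by (rule mult_left_mono)
      also have "\<dots> \<le> N * (N * ?q)" using l N q by (intro mult_right_mono) auto
      also have "\<dots> = ((real j)\<^sup>2 + 2 * j) * (N / u)\<^sup>2" by (simp add: power2_eq_square)
      also have "\<dots> \<le> ((real j)\<^sup>2 + 2 * j) * (1 / \<rho>)\<^sup>2"
        using uN N u2 by (intro mult_left_mono power_mono) auto
      also have "\<dots> = E" by (simp add: E_def power_divide)
      finally show ?thesis using True by simp
    qed (simp add: E_def)
    then have "2 * max 0 (low_dev j x) * (j * X / (u - 1) - (r - r') * n) \<le> 2 * E"
      by (simp only: mult.assoc)
    with le show ?thesis unfolding B_def by linarith
  qed
  have 3: "(\<Sum>h'\<in>W. slack \<rho> j * card (unmatched (nx h'))) / card W = slack \<rho> j * (u - 2)"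
  proof -
    have "(\<Sum>h'\<in>W. slack \<rho> j * card (unmatched (nx h'))) = (\<Sum>h'\<in>W. slack \<rho> j * (u - 2))"
      using card_next by (intro sum.cong) (auto simp: nx_def)
    then show ?thesis using W by simp
  qed
  have "(\<Sum>h'\<in>W. deg_energy \<rho> j (nx h')) / card W =
    (\<Sum>h'\<in>W. (max 0 (up_dev j (nx h')))\<^sup>2) / card W + (\<Sum>h'\<in>W. (max 0 (low_dev j (nx h')))\<^sup>2) / card W +
    (\<Sum>h'\<in>W. slack \<rho> j * card (unmatched (nx h'))) / card W"
    by (simp add: deg_energy_def sum.distrib add_divide_distrib)
  also have "\<dots> \<le> ((max 0 (up_dev j x))\<^sup>2 + B) + ((max 0 (low_dev j x))\<^sup>2 + B + 2 * E) + slack \<rho> j * (u - 2)"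
    using 1 2 3 by linarith
  also have "\<dots> = deg_energy \<rho> j x"
  proof -
    \<comment> \<open>A match lowers \<open>card U\<close> by 2 and so releases
      \<open>2 * B + 2 * E\<close>: one \<open>B\<close> for each deviation and \<open>2 * E\<close>
      for the lower one.\<close>
    have "slack \<rho> j = B + E" by (simp add: slack_def B_def E_def)
    then show ?thesis by (simp add: deg_energy_def x u_def algebra_simps)
  qed
  finally show ?thesis by (simp add: W_def)
qed

text \<open>True for every picked vertex, without averaging. If \<open>v\<close> has degree
  \<open>j\<close>, moving it from \<open>S\<close> to \<open>C\<close> changes
  \<open>up_dev\<close> by \<open>scale U ^ j - 1 \<le> 0\<close> and leaves \<open>low_dev\<close>
  unchanged; this is why \<open>C\<close> has different weights in the two deviations.\<close>

lemma deg_energy_pick: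
  assumes "uinv ([], S, U, C)" "v \<in> S"
  shows "deg_energy \<rho> j ([v], S - {v}, U, insert v C) \<le> deg_energy \<rho> j ([], S, U, C)"
proof -
  note fin = uinv_finite[OF assms(1)]
  have I: "S \<subseteq> V" "C \<subseteq> V - S" "U \<subseteq> H" using assms by (auto simp: uinv_def)
  have v: "v \<notin> C" using assms I by auto
  have r: "scale U ^ j \<le> 1" using scale_bounds[OF I(3)] by simp
  have "up_dev j ([v], S - {v}, U, insert v C) \<le> up_dev j ([], S, U, C)"
    using r num_remove[OF fin(1), of j v] num_insert[OF fin(3) v, of j] assms(2)
    by (auto simp: up_dev_def algebra_simps)
  then have "(max 0 (up_dev j ([v], S - {v}, U, insert v C)))\<^sup>2 \<le> (max 0 (up_dev j ([], S, U, C)))\<^sup>2"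
    by (intro power_mono) auto
  moreover have "low_dev j ([v], S - {v}, U, insert v C) = low_dev j ([], S, U, C)"
    using num_remove[OF fin(1), of j v] num_insert[OF fin(3) v, of j] assms(2)
    by (auto simp: low_dev_def)
  ultimately show ?thesis by (simp add: deg_energy_def)
qed

text \<open>The pick is uniform in \<open>S\<close>, so it hits a vertex with a half-edge with
  probability at least \<delta>, and \<open>pick_dev\<close> has no upward drift.\<close>

lemma pick_energy_pick:
  assumes "uinv ([], S, U, C)" "S \<noteq> {}" "0 \<le> \<delta>" "\<delta> \<le> 1" "\<delta> * real (card S) \<le> real (card (S \<inter> P))"
  shows "(\<Sum>v\<in>S. pick_energy \<delta> ([v], S - {v}, U, insert v C)) / card S \<le> pick_energy \<delta> ([], S, U, C)"
proof -
  note fin = uinv_finite[OF assms(1)]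
  have I: "S \<subseteq> V" "C \<subseteq> V - S" using assms by (auto simp: uinv_def)
  define \<xi> where "\<xi> v = (if v \<in> P then 1 else 0 :: real)" for v
  have cS: "card S > 0" using fin assms by (simp add: card_gt_0_iff)
  have dev: "pick_dev \<delta> ([v], S - {v}, U, insert v C) = pick_dev \<delta> ([], S, U, C) + (\<delta> - \<xi> v)" if "v \<in> S" for v
  proof -
    have "v \<notin> C" using that I by auto
    then show ?thesis using fin by (auto simp: pick_dev_def \<xi>_def Int_insert_left algebra_simps)
  qed
  have "(\<Sum>v\<in>S. \<xi> v) = card (S \<inter> P)" using fin by (simp add: \<xi>_def sum.If_cases)
  then have avg: "(\<Sum>v\<in>S. \<delta> - \<xi> v) / card S = \<delta> - card (S \<inter> P) / card S"
    using cS by (simp add: sum_subtractf diff_divide_distrib)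
  have le: "\<delta> - card (S \<inter> P) / card S \<le> 0" using assms cS by (simp add: field_simps)
  have "(\<Sum>v\<in>S. (max 0 (pick_dev \<delta> ([v], S - {v}, U, insert v C)))\<^sup>2) / card S =
    (\<Sum>v\<in>S. (max 0 (pick_dev \<delta> ([], S, U, C) + (\<delta> - \<xi> v)))\<^sup>2) / card S"
    using dev by (intro arg_cong[where f = "\<lambda>z. z / card S"] sum.cong) auto
  also have "\<dots> \<le> (max 0 (pick_dev \<delta> ([], S, U, C)))\<^sup>2 +
      2 * max 0 (pick_dev \<delta> ([], S, U, C)) * (\<delta> - card (S \<inter> P) / card S) + 1\<^sup>2"
    unfolding avg[symmetric]
    using assms fin by (intro average_pos_part_square) (auto simp: \<xi>_def)
  also have "2 * max 0 (pick_dev \<delta> ([], S, U, C)) * (\<delta> - card (S \<inter> P) / card S) \<le> 0"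
    using le by (intro mult_nonneg_nonpos) auto
  finally have 1: "(\<Sum>v\<in>S. (max 0 (pick_dev \<delta> ([v], S - {v}, U, insert v C)))\<^sup>2) / card S \<le>
    (max 0 (pick_dev \<delta> ([], S, U, C)))\<^sup>2 + 1" by simp
  have "(\<Sum>v\<in>S. real (card (S - {v}))) / card S = real (card S) - 1"
  proof -
    have "(\<Sum>v\<in>S. real (card (S - {v}))) = (\<Sum>v\<in>S. real (card S) - 1)"
      using fin cS by (intro sum.cong refl) (simp add: of_nat_diff)
    then show ?thesis using cS by simp
  qed
  with 1 show ?thesis by (simp add: pick_energy_def sum.distrib add_divide_distrib)
qed

lemma energy_step:
  assumes inv: "uinv (A, S, U, C)" and S: "S \<noteq> {}" and \<rho>: "\<rho> > 0" "\<rho> * real (card V) \<le> real (card U) - 1"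
    and \<delta>: "0 \<le> \<delta>" "\<delta> \<le> 1" "\<delta> * real (card S) \<le> real (card (S \<inter> P))"
  shows "measure_pmf.expectation (ustep (A, S, U, C)) (energy \<rho> \<delta> K) \<le> energy \<rho> \<delta> K (A, S, U, C)"
proof -
  note fin = uinv_finite[OF inv]
  show ?thesis
  proof (cases "A = []")
    case True
    have "(\<Sum>v\<in>S. energy \<rho> \<delta> K ([v], S - {v}, U, insert v C)) / card S =
      (\<Sum>v\<in>S. \<Sum>j\<le>K. deg_energy \<rho> j ([v], S - {v}, U, insert v C)) / card S +
      (\<Sum>v\<in>S. pick_energy \<delta> ([v], S - {v}, U, insert v C)) / card S"
      by (simp add: energy_def sum.distrib add_divide_distrib)
    also have "(\<Sum>v\<in>S. \<Sum>j\<le>K. deg_energy \<rho> j ([v], S - {v}, U, insert v C)) / card S \<le>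
      (\<Sum>v\<in>S. \<Sum>j\<le>K. deg_energy \<rho> j ([], S, U, C)) / card S"
      using deg_energy_pick inv True by (intro divide_right_mono sum_mono) auto
    also have "\<dots> = (\<Sum>j\<le>K. deg_energy \<rho> j ([], S, U, C))" using fin S by simp
    also have "(\<Sum>v\<in>S. pick_energy \<delta> ([v], S - {v}, U, insert v C)) / card S \<le> pick_energy \<delta> ([], S, U, C)"
      using inv True S \<delta> by (intro pick_energy_pick) auto
    finally show ?thesis using fin S True
      by (simp add: ustep_Nil integral_pmf_of_set energy_def)
  next
    case ne: False
    let ?E = "{h \<in> U. fst h = last A}"
    show ?thesis
    proof (cases "?E = {}")
      case True
      then show ?thesis using ustep_pop[OF ne True]
        by (simp add: energy_def deg_energy_def pick_energy_def up_dev_def low_dev_def pick_dev_def)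
    next
      case False
      let ?nx = "\<lambda>h h'. if fst h' \<in> S then (A @ [fst h'], S - {fst h'}, U - {h, h'}, C) else (A, S, U - {h, h'}, C)"
      have V: "V \<noteq> {}" using inv S by (auto simp: uinv_def)
      have W: "finite (U - {h})" "U - {h} \<noteq> {}" if "h \<in> U" for h
      proof -
        have "U \<noteq> {h}" using fin by auto
        then show "U - {h} \<noteq> {}" "finite (U - {h})" using that fin by auto
      qed
      have fE: "finite ?E" using fin by simp
      \<comment> \<open>The dummy branch off \<open>?E\<close> only provides a finite support for
        every \<open>h\<close>.\<close>
      have step: "ustep (A, S, U, C) = pmf_of_set ?E \<bind> (\<lambda>h. map_pmf (?nx h) (if h \<in> ?E then pmf_of_set (U - {h}) else return_pmf h))"
        unfolding ustep_examine[OF ne False] Let_def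
        using fE False by (intro bind_pmf_cong refl) (simp add: set_pmf_of_set)
      show ?thesis
        unfolding step
      proof (rule expectation_bind_pmf_of_set_le[OF fE False])
        show "finite (set_pmf (map_pmf (?nx h) (if h \<in> ?E then pmf_of_set (U - {h}) else return_pmf h)))" for h
        proof (cases "h \<in> ?E")
          case True
          then have "h \<in> U" by simp
          from W[OF this] show ?thesis using True by simp
        next
          case False
          then show ?thesis by (subst if_not_P) simp_all
        qed
        fix h assume h: "h \<in> ?E"
        then have hU: "h \<in> U" and hS: "fst h \<notin> S"
          using inv last_in_set[OF ne] by (auto simp: uinv_def)
        note W = W[OF hU]
        have "measure_pmf.expectation (map_pmf (?nx h) (if h \<in> ?E then pmf_of_set (U - {h}) else return_pmf h)) (energy \<rho> \<delta> K) =
          (\<Sum>h'\<in>U - {h}. energy \<rho> \<delta> K (?nx h h')) / card (U - {h})"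
          using h W by (simp add: integral_pmf_of_set)
        also have "\<dots> = (\<Sum>j\<le>K. (\<Sum>h'\<in>U - {h}. deg_energy \<rho> j (?nx h h')) / card (U - {h})) +
            (\<Sum>h'\<in>U - {h}. pick_energy \<delta> (?nx h h')) / card (U - {h})"
          unfolding energy_def sum.distrib add_divide_distrib
          by (subst sum.swap) (simp add: sum_divide_distrib)
        also have "\<dots> \<le> (\<Sum>j\<le>K. deg_energy \<rho> j (A, S, U, C)) +
            (\<Sum>h'\<in>U - {h}. pick_energy \<delta> (A, S, U, C)) / card (U - {h})"
        proof (intro add_mono sum_mono divide_right_mono)
          show "(\<Sum>h'\<in>U - {h}. deg_energy \<rho> j (?nx h h')) / card (U - {h}) \<le> deg_energy \<rho> j (A, S, U, C)" for j
            by (rule deg_energy_match[OF refl inv \<rho> hU hS V])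
          show "pick_energy \<delta> (?nx h h') \<le> pick_energy \<delta> (A, S, U, C)" for h'
            using fin by (auto simp: pick_energy_def pick_dev_def card_Diff1_le)
        qed simp
        also have "\<dots> = energy \<rho> \<delta> K (A, S, U, C)" using W by (simp add: energy_def)
        finally show "measure_pmf.expectation (map_pmf (?nx h) (if h \<in> ?E then pmf_of_set (U - {h}) else return_pmf h)) (energy \<rho> \<delta> K)
          \<le> energy \<rho> \<delta> K (A, S, U, C)" .
      qed
    qed
  qed
qed

end

section \<open>The energy controls the stopped chain\<close>

context half_edge_exploration
begin

definition good :: "real \<Rightarrow> real \<Rightarrow> nat \<Rightarrow> ustate \<Rightarrow> bool" where
  "good \<epsilon> \<delta> K x \<longleftrightarrow> (\<forall>j\<le>K. up_dev j x < \<epsilon> * real (card V) \<and> low_dev j x < \<epsilon> * real (card V)) \<and>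
     pick_dev \<delta> x < \<epsilon> * real (card V)"

definition picks :: "ustate \<Rightarrow> nat" where
  "picks = (\<lambda>(A, S, U, C). card (C \<inter> P))"

lemma energy_nonneg:
  assumes "\<rho> > 0"
  shows "0 \<le> deg_energy \<rho> j x" "0 \<le> pick_energy \<delta> x" "0 \<le> energy \<rho> \<delta> K x"
proof -
  show *: "0 \<le> deg_energy \<rho> j x" for j
    using assms by (simp add: deg_energy_def slack_def)
  show **: "0 \<le> pick_energy \<delta> x" by (simp add: pick_energy_def)
  show "0 \<le> energy \<rho> \<delta> K x" unfolding energy_def by (intro add_nonneg_nonneg sum_nonneg * **)
qed

lemma good_if_energy_small:
  assumes "\<rho> > 0" "\<epsilon> > 0" "energy \<rho> \<delta> K x < (\<epsilon> * real (card V))\<^sup>2"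
  shows "good \<epsilon> \<delta> K x"
proof -
  note nn = energy_nonneg[OF assms(1)]
  have small: "z < \<epsilon> * real (card V)" if "(max 0 z)\<^sup>2 < (\<epsilon> * real (card V))\<^sup>2" for z :: real
  proof -
    have "max 0 z < \<epsilon> * real (card V)" using assms(2) by (intro power_less_imp_less_base[OF that]) auto
    then show ?thesis by simp
  qed
  have "deg_energy \<rho> j x \<le> energy \<rho> \<delta> K x" if "j \<le> K" for j
    using that nn member_le_sum[of j "{..K}" "\<lambda>j. deg_energy \<rho> j x"] by (simp add: energy_def add_increasing2)
  moreover have "(max 0 (up_dev j x))\<^sup>2 \<le> deg_energy \<rho> j x" "(max 0 (low_dev j x))\<^sup>2 \<le> deg_energy \<rho> j x" for j
    using assms(1) by (auto simp: deg_energy_def slack_def)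
  moreover have "(max 0 (pick_dev \<delta> x))\<^sup>2 \<le> energy \<rho> \<delta> K x"
  proof -
    have "(max 0 (pick_dev \<delta> x))\<^sup>2 \<le> pick_energy \<delta> x" by (simp add: pick_energy_def)
    also have "\<dots> \<le> energy \<rho> \<delta> K x" unfolding energy_def by (simp add: nn sum_nonneg)
    finally show ?thesis .
  qed
  ultimately show ?thesis
    using assms(3) unfolding good_def by (meson le_less_trans small)
qed

definition initial :: ustate where "initial = ([], V, H, {})"

text \<open>All deviations vanish at the start, so the initial energy is linear in the numbers of
  half-edges and vertices, against a threshold that is quadratic in the number of vertices.\<close>

lemma energy_initial:
  assumes "V \<noteq> {}" "L > 0"
  shows "energy \<rho> \<delta> K initial = (\<Sum>j\<le>K. slack \<rho> j) * L + card V"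
proof -
  have s: "scale H = 1" using assms by (simp add: scale_def L_def)
  have "up_dev j initial = 0" "low_dev j initial = 0" "pick_dev \<delta> initial = 0" for j
    by (simp_all add: up_dev_def low_dev_def pick_dev_def initial_def s num_def)
  then have "deg_energy \<rho> j initial = slack \<rho> j * L" "pick_energy \<delta> initial = card V" for j
    by (simp_all add: deg_energy_def pick_energy_def) (simp_all add: initial_def L_def)
  then show ?thesis by (simp add: energy_def sum_distrib_right)
qed

lemma uinv_initial:
  assumes "even (card H)"
  shows "uinv initial"
  using assms by (auto simp: uinv_def initial_def half_edges_def)

text \<open>The bootstrap. While the energy is below the threshold the state is \<open>good\<close>;
  for \<open>good\<close> states the assumptions \<open>large\<close> and \<open>picks\<close>
  supply what the drift bound and the invariant need, which keeps the argument running. The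
  \<open>+ 1\<close> in \<open>picks\<close> covers the pick that is about to be made.\<close>

lemma run_until_good:
  assumes even: "even (card H)" and V: "V \<noteq> {}" and L: "L > 0"
    and \<epsilon>: "\<epsilon> > 0" and \<delta>: "0 \<le> \<delta>" "\<delta> \<le> 1" and \<rho>: "\<rho> > 0"
    and m: "m \<le> card V" "num 0 V \<le> (1 - \<delta>) * real m"
    and n: "2 * card V + card H \<le> n"
    and large: "\<And>A S U C. uinv (A, S, U, C) \<Longrightarrow> good \<epsilon> \<delta> K (A, S, U, C) \<Longrightarrow> m < card S \<Longrightarrow>
      \<rho> * real (card V) \<le> real (card U) - 1"
    and picks: "\<And>S U C. uinv ([], S, U, C) \<Longrightarrow> good \<epsilon> \<delta> K ([], S, U, C) \<Longrightarrow> m < card S \<Longrightarrow>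
      real (card (C \<inter> P)) + 1 \<le> \<kappa>" and "\<kappa> \<ge> 0"
  shows "measure_pmf.prob (run_until (small m) ustep n initial)
      {x. \<not> (uinv x \<and> good \<epsilon> \<delta> K x \<and> real (picks x) \<le> \<kappa> \<and> card (fst (snd x)) = m)}
    \<le> ((\<Sum>j\<le>K. slack \<rho> j) * L + card V) / (\<epsilon> * real (card V))\<^sup>2"
proof -
  define I where "I x \<longleftrightarrow> uinv x \<and> real (picks x) \<le> \<kappa> \<and> m \<le> card (fst (snd x))" for x
  have V0: "real (card V) > 0" using V finite_V by (simp add: card_gt_0_iff)
  show ?thesis
    unfolding energy_initial[OF V L, of \<rho> \<delta> K, symmetric]
  proof (rule run_until_supermartingale[where I = I and pot = upot])
    show "I initial" using uinv_initial[OF even] m \<open>\<kappa> \<ge> 0\<close> by (simp add: I_def picks_def initial_def)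
    show "upot initial \<le> n" using n by (simp add: upot_def initial_def)
    show "0 < (\<epsilon> * real (card V))\<^sup>2" using \<epsilon> V0 by simp
    show "0 \<le> energy \<rho> \<delta> K x" for x using energy_nonneg[OF \<rho>] by simp
    show "small m x" if "I x" "upot x = 0" for x
      using that by (auto simp: upot_def split: prod.splits)
  next
    fix x assume x: "I x" "\<not> small m x"
    obtain A S U C where [simp]: "x = (A, S, U, C)" by (metis prod_cases4)
    have S: "S \<noteq> {}" and inv: "uinv (A, S, U, C)" using x by (auto simp: I_def)
    show "finite (set_pmf (ustep x))" using finite_set_ustep[OF inv S] by simp
    show "upot y < upot x" if "y \<in> set_pmf (ustep x)" for y
      using uinv_step[OF inv S] that by simp
  next
    fix x assume x: "I x" "energy \<rho> \<delta> K x < (\<epsilon> * real (card V))\<^sup>2" "\<not> small m x"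
    obtain A S U C where [simp]: "x = (A, S, U, C)" by (metis prod_cases4)
    have S: "S \<noteq> {}" "m < card S" and inv: "uinv (A, S, U, C)" using x by (auto simp: I_def)
    note fin = uinv_finite[OF inv]
    have g: "good \<epsilon> \<delta> K (A, S, U, C)" using good_if_energy_small[OF \<rho> \<epsilon> x(2)] by simp
    \<comment> \<open>More than \<open>m\<close> vertices sleep, and at most
      \<open>(1 - \<delta>) * m\<close> vertices have degree 0.\<close>
    have "\<delta> * real (card S) \<le> real (card (S \<inter> P))"
    proof -
      have SV: "S \<subseteq> V" using inv by (auto simp: uinv_def)
      have "S = (S \<inter> P) \<union> (S \<inter> D 0)" using SV by (auto simp: P_def D_def)
      moreover have "(S \<inter> P) \<inter> (S \<inter> D 0) = {}" by (auto simp: P_def D_def)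
      ultimately have "card S = card (S \<inter> P) + card (S \<inter> D 0)"
        using fin(1) by (metis card_Un_disjoint finite_Int)
      moreover have "real (card (S \<inter> D 0)) \<le> num 0 V" using num_le(1)[OF SV, of 0] by (simp add: num_def)
      moreover have "(1 - \<delta>) * real m \<le> (1 - \<delta>) * real (card S)" using \<delta> S by (intro mult_left_mono) auto
      ultimately show ?thesis using m(2) by (simp add: algebra_simps)
    qed
    then show "measure_pmf.expectation (ustep x) (energy \<rho> \<delta> K) \<le> energy \<rho> \<delta> K x"
      using energy_step[OF inv S(1) \<rho> large[OF inv g S(2)] \<delta>] by simp
    fix y assume y: "y \<in> set_pmf (ustep x)"
    note st = uinv_step[OF inv S(1), of y]
    have "real (picks y) \<le> \<kappa>"
      using y[simplified] fin(1) S(1) fin(2) fin(4)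
    proof (cases rule: ustep_cases)
      case (pick v)
      have "card (insert v C \<inter> P) \<le> Suc (card (C \<inter> P))"
        using card_insert_le_m1[of "Suc (card (C \<inter> P))" "C \<inter> P" v] fin(3)
        by (auto simp: Int_insert_left)
      moreover have "real (card (C \<inter> P)) + 1 \<le> \<kappa>" using picks inv g S pick(1) by blast
      ultimately show ?thesis using pick by (simp add: picks_def)
    qed (use x(1) in \<open>auto simp: I_def picks_def\<close>)
    moreover have "m \<le> card (fst (snd y))" using st(3) y S(2) by simp
    ultimately show "I y" using st(1) y by (simp add: I_def)
  next
    fix x assume "I x" "energy \<rho> \<delta> K x < (\<epsilon> * real (card V))\<^sup>2" "small m x"
    then show "uinv x \<and> good \<epsilon> \<delta> K x \<and> real (picks x) \<le> \<kappa> \<and> card (fst (snd x)) = m"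
      using good_if_energy_small[OF \<rho> \<epsilon>] by (auto simp: I_def)
  qed
qed

section \<open>The degrees of the sleeping vertices\<close>

definition pgf :: "real \<Rightarrow> real" where "pgf t = (\<Sum>v\<in>V. t ^ e v)"

text \<open>This is \<open>t\<close> times the derivative of \<open>pgf\<close>; at
  \<open>t = 1\<close> it counts all half-edges.\<close>

definition pgf' :: "real \<Rightarrow> real" where "pgf' t = (\<Sum>v\<in>V. real (e v) * t ^ e v)"

definition tail :: "nat \<Rightarrow> real" where "tail K = (\<Sum>v\<in>{v\<in>V. K < e v}. real (e v))"

lemma sum_by_degree:
  fixes f :: "nat \<Rightarrow> real"
  assumes "S \<subseteq> V"
  shows "(\<Sum>v\<in>S. f (e v)) = (\<Sum>j\<le>K. f j * num j S) + (\<Sum>v\<in>{v\<in>S. K < e v}. f (e v))"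
proof -
  have fin: "finite S" using assms finite_V finite_subset by blast
  have "S = {v\<in>S. e v \<le> K} \<union> {v\<in>S. K < e v}" by auto
  then have "(\<Sum>v\<in>S. f (e v)) = (\<Sum>v\<in>{v\<in>S. e v \<le> K} \<union> {v\<in>S. K < e v}. f (e v))" by simp
  also have "\<dots> = (\<Sum>v\<in>{v\<in>S. e v \<le> K}. f (e v)) + (\<Sum>v\<in>{v\<in>S. K < e v}. f (e v))"
    using fin by (intro sum.union_disjoint) auto
  also have "(\<Sum>v\<in>{v\<in>S. e v \<le> K}. f (e v)) = (\<Sum>j\<le>K. \<Sum>v\<in>{v\<in>{v\<in>S. e v \<le> K}. e v = j}. f (e v))"
    using fin by (intro sum.group[symmetric]) auto
  also have "\<dots> = (\<Sum>j\<le>K. f j * num j S)"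
  proof (intro sum.cong refl)
    fix j assume "j \<in> {..K}"
    then have "{v\<in>{v\<in>S. e v \<le> K}. e v = j} = S \<inter> D j" using assms by (auto simp: D_def)
    then have "(\<Sum>v\<in>{v\<in>{v\<in>S. e v \<le> K}. e v = j}. f (e v)) = (\<Sum>v\<in>S \<inter> D j. f j)"
      by (auto simp: D_def)
    then show "(\<Sum>v\<in>{v\<in>{v\<in>S. e v \<le> K}. e v = j}. f (e v)) = f j * num j S" by (simp add: num_def)
  qed
  finally show ?thesis .
qed

lemma tail_bounds:
  assumes "S \<subseteq> V" "\<And>j. K < j \<Longrightarrow> 0 \<le> f j" "\<And>j. K < j \<Longrightarrow> f j \<le> real j"
  shows "0 \<le> (\<Sum>v\<in>{v\<in>S. K < e v}. f (e v))" "(\<Sum>v\<in>{v\<in>S. K < e v}. f (e v)) \<le> tail K"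
proof -
  show "0 \<le> (\<Sum>v\<in>{v\<in>S. K < e v}. f (e v))" using assms by (intro sum_nonneg) auto
  have "(\<Sum>v\<in>{v\<in>S. K < e v}. f (e v)) \<le> (\<Sum>v\<in>{v\<in>S. K < e v}. real (e v))"
    using assms by (intro sum_mono) auto
  also have "\<dots> \<le> tail K" unfolding tail_def
    using assms finite_V by (intro sum_mono2) auto
  finally show "(\<Sum>v\<in>{v\<in>S. K < e v}. f (e v)) \<le> tail K" .
qed

lemma card_by_degree:
  assumes "S \<subseteq> V"
  shows "(\<Sum>j\<le>K. num j S) \<le> card S" "card S \<le> (\<Sum>j\<le>K. num j S) + tail K"
  using sum_by_degree[OF assms, of "\<lambda>_. 1" K] tail_bounds[OF assms, of K "\<lambda>_. 1"] by auto

lemma pgf_by_degree: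
  assumes "0 \<le> t" "t \<le> 1"
  shows "(\<Sum>j\<le>K. t ^ j * num j V) \<le> pgf t" "pgf t \<le> (\<Sum>j\<le>K. t ^ j * num j V) + tail K"
proof -
  have "t ^ j \<le> real j" if "K < j" for j
  proof -
    have "t ^ j \<le> 1" using assms by (rule power_le_one)
    also have "\<dots> \<le> real j" using that by simp
    finally show ?thesis .
  qed
  then show "(\<Sum>j\<le>K. t ^ j * num j V) \<le> pgf t" "pgf t \<le> (\<Sum>j\<le>K. t ^ j * num j V) + tail K"
    using sum_by_degree[OF subset_refl, of "\<lambda>j. t ^ j" K] tail_bounds[OF subset_refl, of K "\<lambda>j. t ^ j"] assms
    by (auto simp: pgf_def)
qed

text \<open>Requires no bound on the picks, as \<open>C\<close> enters \<open>up_dev\<close> with a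
  nonnegative weight. It yields a lower bound for \<open>scale U\<close> before anything is known
  about the picks.\<close>

lemma good_card_upper:
  assumes "uinv (A, S, U, C)" "good \<epsilon> \<delta> K (A, S, U, C)"
  shows "card S \<le> pgf (scale U) + real (K + 1) * (\<epsilon> * real (card V)) + tail K"
proof -
  let ?t = "scale U"
  have I: "S \<subseteq> V" "U \<subseteq> H" using assms(1) by (auto simp: uinv_def)
  note t = scale_bounds[OF I(2)]
  have "num j S \<le> ?t ^ j * num j V + \<epsilon> * real (card V)" if "j \<le> K" for j
  proof -
    have "0 \<le> ?t ^ j * num j C" using t by (simp add: num_def)
    moreover have "up_dev j (A, S, U, C) < \<epsilon> * real (card V)" using assms(2) that by (simp add: good_def)
    ultimately show ?thesis by (simp add: up_dev_def)
  qed
  then have "(\<Sum>j\<le>K. num j S) \<le> (\<Sum>j\<le>K. ?t ^ j * num j V + \<epsilon> * real (card V))" by (intro sum_mono) auto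
  also have "\<dots> = (\<Sum>j\<le>K. ?t ^ j * num j V) + real (K + 1) * (\<epsilon> * real (card V))"
    by (simp add: sum.distrib algebra_simps)
  finally show ?thesis using card_by_degree(2)[OF I(1), of K] pgf_by_degree(1)[OF t(1,2), of K] by linarith
qed

text \<open>Without active vertices \<open>card U\<close> is the total degree of \<open>S\<close>,
  and \<open>up_dev\<close> bounds the counts in \<open>S\<close> by the curve minus the weighted
  counts in \<open>C\<close>. Each picked vertex of degree between 1 and \<open>J\<close> thus
  lowers the bound by at least \<open>scale U ^ J\<close>. The cutoff \<open>J\<close> is separate
  from \<open>K\<close> so that this factor stays fixed when \<open>K\<close> is enlarged.\<close>

lemma good_picks:
  assumes "uinv ([], S, U, C)" "good \<epsilon> \<delta> K ([], S, U, C)" "J \<le> K" "L > 0" "\<epsilon> > 0"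
  shows "scale U ^ J * (card (C \<inter> P) - tail J) \<le>
    pgf' (scale U) - (scale U)\<^sup>2 * L + (real K + 1)\<^sup>2 * (\<epsilon> * real (card V)) + tail K"
proof -
  let ?t = "scale U"
  have I: "S \<subseteq> V" "C \<subseteq> V" "U \<subseteq> H" "half_edges S e \<subseteq> U" "\<And>h. h \<in> U \<Longrightarrow> fst h \<in> S"
    using assms(1) by (auto simp: uinv_def)
  note fin = uinv_finite[OF assms(1)]
  note t = scale_bounds[OF I(3)]
  have "U = half_edges S e" using I(3-5) by (force simp: half_edges_def)
  then have "real (card U) = (\<Sum>v\<in>S. real (e v))" using fin by (simp add: card_half_edges)
  also have "\<dots> \<le> (\<Sum>j\<le>K. j * num j S) + tail K"
    using sum_by_degree[OF I(1), of real K] tail_bounds[OF I(1), of K real] by auto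
  also have "(\<Sum>j\<le>K. j * num j S) \<le>
      (\<Sum>j\<le>K. j * (?t ^ j * num j V) - (if j \<in> {1..J} then ?t ^ J * num j C else 0) + real (K + 1) * (\<epsilon> * real (card V)))"
  proof (intro sum_mono)
    fix j assume "j \<in> {..K}"
    then have j: "j \<le> K" by simp
    then have "num j S \<le> ?t ^ j * num j V - ?t ^ j * num j C + \<epsilon> * real (card V)"
      using assms(2) by (auto simp: good_def up_dev_def)
    then have "j * num j S \<le> j * (?t ^ j * num j V - ?t ^ j * num j C + \<epsilon> * real (card V))"
      by (intro mult_left_mono) auto
    also have "\<dots> = j * (?t ^ j * num j V) - j * (?t ^ j * num j C) + j * (\<epsilon> * real (card V))"
      by (simp add: algebra_simps)
    also have "j * (\<epsilon> * real (card V)) \<le> real (K + 1) * (\<epsilon> * real (card V))"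
      using j \<open>\<epsilon> > 0\<close> by (intro mult_right_mono) auto
    finally have up: "j * num j S \<le> j * (?t ^ j * num j V) - j * (?t ^ j * num j C) + real (K + 1) * (\<epsilon> * real (card V))"
      by simp
    have "(if j \<in> {1..J} then ?t ^ J * num j C else 0) \<le> j * (?t ^ j * num j C)"
    proof (cases "j \<in> {1..J}")
      case True
      have "1 * (?t ^ J * num j C) \<le> j * (?t ^ j * num j C)"
        using True t by (intro mult_mono mult_right_mono power_decreasing) (auto simp: num_def)
      then show ?thesis using True by simp
    next
      case False
      have "0 \<le> j * (?t ^ j * num j C)" using t by (simp add: num_def)
      then show ?thesis by (subst if_not_P[OF False])
    qed
    with up show "j * num j S \<le> j * (?t ^ j * num j V) - (if j \<in> {1..J} then ?t ^ J * num j C else 0) + real (K + 1) * (\<epsilon> * real (card V))"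
      by linarith
  qed
  also have "\<dots> = (\<Sum>j\<le>K. (j * ?t ^ j) * num j V) - ?t ^ J * (\<Sum>j\<in>{1..J}. num j C) + (real K + 1)\<^sup>2 * (\<epsilon> * real (card V))"
  proof -
    have "(\<Sum>j\<le>K. if j \<in> {1..J} then ?t ^ J * num j C else 0) = (\<Sum>j\<in>{1..J}. ?t ^ J * num j C)"
      using assms(3) by (simp add: sum.If_cases) (intro sum.cong, auto)
    then show ?thesis
      by (simp add: sum.distrib sum_subtractf sum_distrib_left power2_eq_square mult_ac, simp add: algebra_simps)
  qed
  also have "(\<Sum>j\<le>K. (j * ?t ^ j) * num j V) \<le> pgf' ?t"
  proof -
    have "0 \<le> (\<Sum>v\<in>{v \<in> V. K < e v}. real (e v) * ?t ^ e v)" using t by (intro sum_nonneg) auto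
    then show ?thesis
      using sum_by_degree[OF subset_refl, of "\<lambda>j. j * ?t ^ j" K] by (simp add: pgf'_def)
  qed
  finally have up: "card U \<le> pgf' ?t - ?t ^ J * (\<Sum>j\<in>{1..J}. num j C) +
      (real K + 1)\<^sup>2 * (\<epsilon> * real (card V)) + tail K" by simp
  have "?t ^ J * (card (C \<inter> P) - tail J) \<le> ?t ^ J * (\<Sum>j\<in>{1..J}. num j C)"
  proof (intro mult_left_mono)
    have "real (card (C \<inter> P)) = (\<Sum>v\<in>C. if 1 \<le> e v then 1 else 0)"
    proof -
      have "C \<inter> P = {v \<in> C. 1 \<le> e v}" using I(2) by (auto simp: P_def)
      then show ?thesis using fin(3) by (simp add: sum.If_cases Int_def)
    qed
    also have "\<dots> = (\<Sum>j\<le>J. (if 1 \<le> j then 1 else 0) * num j C) + (\<Sum>v\<in>{v\<in>C. J < e v}. if 1 \<le> e v then 1 else 0)"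
      by (rule sum_by_degree[OF I(2)])
    also have "(\<Sum>v\<in>{v\<in>C. J < e v}. if 1 \<le> e v then 1 else 0) \<le> tail J"
      using tail_bounds(2)[OF I(2), of J "\<lambda>j. if 1 \<le> j then 1 else 0"] by auto
    also have "(\<Sum>j\<le>J. (if 1 \<le> j then 1 else 0) * num j C) = (\<Sum>j\<in>{1..J}. num j C)"
      by (intro sum.mono_neutral_cong_right) auto
    finally show "card (C \<inter> P) - tail J \<le> (\<Sum>j\<in>{1..J}. num j C)" by simp
  qed (use t in simp)
  with up have "card U \<le> pgf' ?t - ?t ^ J * (card (C \<inter> P) - tail J) + (real K + 1)\<^sup>2 * (\<epsilon> * real (card V)) + tail K"
    by linarith
  moreover have "real (card U) = ?t\<^sup>2 * L" using assms(4) by (simp add: scale_def)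
  ultimately show ?thesis by linarith
qed

text \<open>\<open>pick_dev\<close> converts a bound on the picked vertices with half-edges into the
  bound \<open>c\<close> on all picked vertices, after which \<open>low_dev\<close> bounds the
  counts in \<open>S\<close> from below.\<close>

lemma good_lower:
  assumes "uinv (A, S, U, C)" "good \<epsilon> \<delta> K (A, S, U, C)" "0 < \<delta>" "real (picks (A, S, U, C)) \<le> \<kappa>" "\<epsilon> > 0"
  defines "c \<equiv> (\<kappa> + \<epsilon> * real (card V)) / \<delta>"
  shows "j \<le> K \<Longrightarrow> scale U ^ j * num j V - \<epsilon> * real (card V) - c \<le> num j S"
    and "j \<le> K \<Longrightarrow> num j S \<le> scale U ^ j * num j V + \<epsilon> * real (card V)"
    and "pgf (scale U) - tail K - real (K + 1) * (\<epsilon> * real (card V)) - c \<le> card S"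
proof -
  let ?t = "scale U"
  have I: "S \<subseteq> V" "C \<subseteq> V" "U \<subseteq> H" using assms(1) by (auto simp: uinv_def)
  note t = scale_bounds[OF I(3)]
  have "\<delta> * card C < card (C \<inter> P) + \<epsilon> * real (card V)"
    using assms(2) by (simp add: good_def pick_dev_def)
  then have "card C * \<delta> \<le> \<kappa> + \<epsilon> * real (card V)" using assms(4) by (simp add: picks_def mult.commute)
  then have c: "card C \<le> c" using assms(3) by (simp add: c_def pos_le_divide_eq)
  have low: "?t ^ j * num j V - \<epsilon> * real (card V) - num j C \<le> num j S" if "j \<le> K" for j
    using assms(2) that by (auto simp: good_def low_dev_def)
  show "?t ^ j * num j V - \<epsilon> * real (card V) - c \<le> num j S" if "j \<le> K"
  proof -
    have "num j C \<le> card C" using uinv_finite(3)[OF assms(1)] by (simp add: num_def card_mono)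
    then show ?thesis using low[OF that] c by linarith
  qed
  show "num j S \<le> ?t ^ j * num j V + \<epsilon> * real (card V)" if "j \<le> K"
  proof -
    have "0 \<le> ?t ^ j * num j C" using t by (simp add: num_def)
    moreover have "up_dev j (A, S, U, C) < \<epsilon> * real (card V)" using assms(2) that by (simp add: good_def)
    ultimately show ?thesis by (simp add: up_dev_def)
  qed
  have "(\<Sum>j\<le>K. ?t ^ j * num j V - \<epsilon> * real (card V) - num j C) \<le> (\<Sum>j\<le>K. num j S)"
    using low by (intro sum_mono) auto
  then have "(\<Sum>j\<le>K. ?t ^ j * num j V) - real (K + 1) * (\<epsilon> * real (card V)) - (\<Sum>j\<le>K. num j C) \<le> (\<Sum>j\<le>K. num j S)"
    by (simp add: sum_subtractf sum.distrib algebra_simps)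
  then show "pgf ?t - tail K - real (K + 1) * (\<epsilon> * real (card V)) - c \<le> card S"
    using card_by_degree(1)[OF I(1), of K] card_by_degree(1)[OF I(2), of K] pgf_by_degree(2)[OF t(1,2), of K] c
    by linarith
qed

end

section \<open>Concentration of the degrees in a uniform matching\<close>

definition pattern :: "'a set \<Rightarrow> 'a set \<Rightarrow> 'a set \<Rightarrow> 'a set set \<Rightarrow> bool" where
  "pattern I T B M \<longleftrightarrow> (\<forall>h\<in>T. partner M h \<in> I \<longleftrightarrow> h \<in> B)"

lemma set_pmf_matchings:
  "finite U \<Longrightarrow> even (card U) \<Longrightarrow> set_pmf (pmf_of_set (perfect_matchings U)) = perfect_matchings U"
  by (simp add: perfect_matchings_nonempty finite_perfect_matchings set_pmf_of_set)

text \<open>Induction on \<open>card T\<close>, revealing the partner of one \<open>h\<close> in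
  \<open>T\<close>. If it lies outside \<open>T\<close>, the same problem remains with two
  half-edges fewer; the few partners inside \<open>T\<close> go into the error. The free parameter
  \<open>w\<close> is needed because \<open>card I / card U\<close> drifts away from
  \<open>p\<close>: each step adds at most 2 to it.\<close>

lemma prob_pattern:
  fixes p w :: real
  assumes "finite U" "even (card U)" "I \<subseteq> U" "T \<subseteq> I" "B \<subseteq> T" "2 * card T < card U"
    and "0 \<le> p" "p \<le> 1" "\<bar>real (card I) - p * real (card U)\<bar> \<le> w"
  shows "\<bar>measure_pmf.prob (pmf_of_set (perfect_matchings U)) {M. pattern I T B M} -
      p ^ card B * (1 - p) ^ (card T - card B)\<bar> \<le>
    real (card T) * (w + 4 * real (card T)) / (real (card U) - 2 * real (card T))"
  using assms
proof (induction "card T" arbitrary: U I T B w)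
  case 0
  then have "T = {}" using finite_subset[of T U] by auto
  then show ?case using 0 by (simp add: pattern_def)
next
  case (Suc r)
  have finT: "finite T" using Suc.prems finite_subset by metis
  from Suc.hyps(2) obtain h where h: "h \<in> T" by (metis card.empty ex_in_conv nat.distinct(1))
  have hU: "h \<in> U" "h \<in> I" using h Suc.prems by auto
  define u where "u = real (card U)"
  define R where "R = real (card T)"
  have R: "R = r + 1" "R \<ge> 1" using Suc.hyps(2) by (auto simp: R_def)
  have u: "u > 2 * R" using Suc.prems(6) by (simp add: u_def R_def)
  define Q where "Q h' = map_pmf (insert {h, h'}) (pmf_of_set (perfect_matchings (U - {h, h'})))" for h'
  define x where "x h' = measure_pmf.prob (Q h') {M. pattern I T B M}" for h'
  define W where "W = U - {h}"
  have cW: "real (card W) = u - 1" using hU Suc.prems(1)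
    by (simp add: W_def u_def card_gt_0_iff of_nat_diff Suc_leI) (metis One_nat_def Suc_leI card_gt_0_iff empty_iff of_nat_1 of_nat_diff)
  have "card W \<noteq> 0" using cW u R by (intro notI) simp
  then have W: "finite W" "W \<noteq> {}" by (auto intro: card_ge_0_finite)
  have px: "measure_pmf.prob (pmf_of_set (perfect_matchings U)) {M. pattern I T B M} = (\<Sum>h'\<in>W. x h') / (u - 1)"
    using W cW
    by (subst perfect_matchings_reveal[OF Suc.prems(1,2) hU(1)])
       (simp add: prob_bind_pmf integral_pmf_of_set x_def Q_def W_def)
  define B' where "B' = B - {h}"
  define T' where "T' = T - {h}"
  have cT': "card T' = r" "real (card T') = R - 1" using Suc.hyps(2) h finT R by (auto simp: T'_def)
  have finB: "finite B" using finT Suc.prems finite_subset by metis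
  define \<theta> where "\<theta> = p ^ card B' * (1 - p) ^ (card T' - card B')"
  define fac where "fac = (if h \<in> B then p else 1 - p)"
  have \<theta>: "0 \<le> \<theta>" "\<theta> \<le> 1" using Suc.prems by (auto simp: \<theta>_def intro!: mult_le_one power_le_one)
  have fac: "0 \<le> fac" "fac \<le> 1" using Suc.prems by (auto simp: fac_def)
  have B'T': "B' \<subseteq> T'" using Suc.prems(5) by (auto simp: B'_def T'_def)
  have target: "p ^ card B * (1 - p) ^ (card T - card B) = fac * \<theta>"
  proof (cases "h \<in> B")
    case True
    have "card B = Suc (card B')" unfolding B'_def by (rule card.remove[OF finB True])
    then show ?thesis using True cT'(1) by (simp add: \<theta>_def fac_def flip: Suc.hyps(2))
  next
    case False
    then have "B' = B" by (simp add: B'_def)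
    moreover have "card B' \<le> card T'" using B'T' finT by (intro card_mono) (auto simp: T'_def)
    ultimately have "card T - card B = Suc (card T' - card B')" using cT' Suc.hyps(2) by simp
    then show ?thesis using False \<open>B' = B\<close> by (simp add: \<theta>_def fac_def)
  qed
  \<comment> \<open>The bound of the induction hypothesis for \<open>R - 1\<close> half-edges,
    deviation \<open>w + 2\<close> and \<open>u - 2\<close> half-edges in all.\<close>
  define err where "err = (R - 1) * (w + 4 * R - 2) / (u - 2 * R)"
  \<comment> \<open>The partners outside \<open>T\<close> that comply with the prescription for
    \<open>h\<close>; there are about \<open>fac * (u - 1)\<close> of them.\<close>
  define G where "G = {h' \<in> U - T. h' \<in> I \<longleftrightarrow> h \<in> B}"
  have w0: "w \<ge> 0" using Suc.prems(9) by linarith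
  have err0: "0 \<le> err" using R u w0 by (simp add: err_def)
  have x01: "0 \<le> x h'" "x h' \<le> 1" for h' by (auto simp: x_def)
  have notT: "partner M k = partner M' k \<and> partner M k \<notin> {h, h'}"
    if "M' \<in> perfect_matchings (U - {h, h'})" "M = insert {h, h'} M'" "h' \<in> W" "k \<in> U - {h, h'}" for M M' k h'
  proof -
    have M: "M \<in> perfect_matchings U" unfolding that(2) using that hU by (intro perfect_matchings_insert) (auto simp: W_def)
    have "k \<in> \<Union>M'" using that by (auto simp: perfect_matchings_iff)
    then have "partner M' k = partner M k" using partner_subset[OF M, of M'] that(2) by auto
    moreover have "partner M' k \<in> U - {h, h'}" using partner_edge(3)[OF that(1,4)] .
    ultimately show ?thesis by auto
  qed
  have xin: "\<bar>x h' - \<theta>\<bar> \<le> err" if "h' \<in> G" "h' \<in> W" for h'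
  proof -
    let ?U = "U - {h, h'}" and ?I = "I - {h, h'}"
    have h': "h' \<in> U" "h' \<notin> T" "h' \<noteq> h" "h' \<in> I \<longleftrightarrow> h \<in> B" using that by (auto simp: G_def W_def)
    have cU: "card ?U = card U - 2" using h' hU Suc.prems(1) by (subst card_Diff_subset) auto
    have cU2: "real (card ?U) = u - 2" using cU u R by (simp add: u_def)
    have ev: "even (card ?U)" using cU Suc.prems(2) by simp
    have finI: "finite I" using Suc.prems finite_subset by metis
    have cI: "real (card ?I) = real (card I) - (if h' \<in> I then 2 else 1)"
    proof (cases "h' \<in> I")
      case True
      then have "{h, h'} \<subseteq> I" using hU by auto
      from card_mono[OF finI this] card_Diff_subset[OF _ this] show ?thesis using True h' by simp
    next
      case False
      then have "?I = I - {h}" by auto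
      moreover have "card I > 0" using hU finI by (auto simp: card_gt_0_iff)
      ultimately show ?thesis using False hU by simp
    qed
    have eq: "measure_pmf.prob (pmf_of_set (perfect_matchings ?U)) {M. pattern ?I T' B' M} = x h'"
    proof -
      have "pattern ?I T' B' M' \<longleftrightarrow> pattern I T B (insert {h, h'} M')" if M': "M' \<in> perfect_matchings ?U" for M'
      proof -
        let ?M = "insert {h, h'} M'"
        have M: "?M \<in> perfect_matchings U" using M' h' hU by (intro perfect_matchings_insert) auto
        have ph: "partner ?M h = h'" using h' by (intro partner_eqI[OF M]) auto
        have sub: "T' \<subseteq> U - {h, h'}" using Suc.prems h' by (auto simp: T'_def)
        have "pattern I T B ?M \<longleftrightarrow> (\<forall>k\<in>T'. partner ?M k \<in> I \<longleftrightarrow> k \<in> B)"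
          using h ph h' by (auto simp: pattern_def T'_def)
        also have "\<dots> \<longleftrightarrow> (\<forall>k\<in>T'. partner M' k \<in> ?I \<longleftrightarrow> k \<in> B')"
        proof (intro ball_cong refl)
          fix k assume k: "k \<in> T'"
          then have "partner ?M k = partner M' k \<and> partner ?M k \<notin> {h, h'}"
            using notT[OF M' refl \<open>h' \<in> W\<close>] sub by auto
          then show "(partner ?M k \<in> I \<longleftrightarrow> k \<in> B) = (partner M' k \<in> ?I \<longleftrightarrow> k \<in> B')"
            using k by (auto simp: T'_def B'_def)
        qed
        finally show ?thesis by (simp add: pattern_def)
      qed
      then have "{M. pattern ?I T' B' M} \<inter> set_pmf (pmf_of_set (perfect_matchings ?U)) =
        {M. pattern I T B (insert {h, h'} M)} \<inter> set_pmf (pmf_of_set (perfect_matchings ?U))"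
        using set_pmf_matchings[of ?U] ev Suc.prems(1) by blast
      then have "measure_pmf.prob (pmf_of_set (perfect_matchings ?U)) {M. pattern ?I T' B' M} =
        measure_pmf.prob (pmf_of_set (perfect_matchings ?U)) {M. pattern I T B (insert {h, h'} M)}"
        by (metis measure_Int_set_pmf)
      also have "\<dots> = measure_pmf.prob (pmf_of_set (perfect_matchings ?U)) (insert {h, h'} -` {M. pattern I T B M})"
        by (simp only: vimage_def mem_Collect_eq)
      also have "\<dots> = x h'" unfolding x_def Q_def by (rule measure_map_pmf[symmetric])
      finally show ?thesis .
    qed
    have "\<bar>measure_pmf.prob (pmf_of_set (perfect_matchings ?U)) {M. pattern ?I T' B' M} -
        p ^ card B' * (1 - p) ^ (card T' - card B')\<bar> \<le>
      real (card T') * ((w + 2) + 4 * real (card T')) / (real (card ?U) - 2 * real (card T'))"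
    proof (rule Suc.hyps(1))
      show "r = card T'" "finite ?U" "even (card ?U)" using cT' ev Suc.prems(1) by auto
      show "?I \<subseteq> ?U" "T' \<subseteq> ?I" "B' \<subseteq> T'" using Suc.prems h' B'T' by (auto simp: T'_def)
      show "2 * card T' < card ?U" using cU cT' Suc.hyps(2) Suc.prems(6) by simp
      have "\<bar>real (card ?I) - p * real (card ?U)\<bar> \<le> \<bar>real (card I) - p * u\<bar> + \<bar>(if h' \<in> I then 2 else 1) - 2 * p\<bar>"
        unfolding cU2 cI by (auto simp: algebra_simps)
      also have "\<dots> \<le> w + 2" using Suc.prems(7-9) by (auto simp: u_def)
      finally show "\<bar>real (card ?I) - p * real (card ?U)\<bar> \<le> w + 2" .
    qed (use Suc.prems in auto)
    also have "real (card T') * ((w + 2) + 4 * real (card T')) / (real (card ?U) - 2 * real (card T')) = err"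
      unfolding cU2 cT'(2) err_def by (simp add: algebra_simps)
    finally show ?thesis unfolding eq \<theta>_def[symmetric] by simp
  qed
  have xout: "x h' = 0" if "h' \<in> W" "h' \<notin> G" "h' \<notin> T" for h'
  proof -
    have h': "h' \<in> U" "h' \<noteq> h" "h' \<in> I \<longleftrightarrow> h \<notin> B" using that by (auto simp: G_def W_def)
    have cU: "card (U - {h, h'}) = card U - 2" using h' hU Suc.prems(1) by (subst card_Diff_subset) auto
    have "\<not> pattern I T B (insert {h, h'} M')" if M': "M' \<in> perfect_matchings (U - {h, h'})" for M'
    proof -
      have M: "insert {h, h'} M' \<in> perfect_matchings U" using M' h' hU by (intro perfect_matchings_insert) auto
      have ph: "partner (insert {h, h'} M') h = h'" using h' by (intro partner_eqI[OF M]) auto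
      show ?thesis
      proof
        assume "pattern I T B (insert {h, h'} M')"
        then have "partner (insert {h, h'} M') h \<in> I \<longleftrightarrow> h \<in> B" using h unfolding pattern_def by blast
        then show False using h'(3) unfolding ph by blast
      qed
    qed
    then show ?thesis using set_pmf_matchings[of "U - {h, h'}"] cU Suc.prems(1,2)
      by (auto simp: x_def Q_def measure_pmf_zero_iff)
  qed
  have GW: "G \<subseteq> W" "G \<inter> T' = {}" "T' \<subseteq> W" using h Suc.prems by (auto simp: G_def W_def T'_def)
  have fin': "finite G" "finite T'"
    using finite_subset[OF GW(1) W(1)] finite_subset[OF GW(3) W(1)] by simp_all
  have "(\<Sum>h'\<in>W. x h') = (\<Sum>h'\<in>T' \<union> G. x h')"
  proof (rule sum.mono_neutral_right[OF W(1)])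
    show "T' \<union> G \<subseteq> W" using GW by simp
    show "\<forall>h'\<in>W - (T' \<union> G). x h' = 0"
    proof
      fix h' assume "h' \<in> W - (T' \<union> G)"
      then show "x h' = 0" by (intro xout) (auto simp: T'_def W_def)
    qed
  qed
  also have "\<dots> = (\<Sum>h'\<in>T'. x h') + (\<Sum>h'\<in>G. x h')" using fin' GW by (intro sum.union_disjoint) auto
  finally have sumx: "(\<Sum>h'\<in>W. x h') = (\<Sum>h'\<in>T'. x h') + (\<Sum>h'\<in>G. x h')" .
  have t1: "0 \<le> (\<Sum>h'\<in>T'. x h')" "(\<Sum>h'\<in>T'. x h') \<le> R - 1"
    using x01 sum_bounded_above[of T' x 1] cT' by (auto intro: sum_nonneg)
  have t2: "\<bar>(\<Sum>h'\<in>G. x h') - card G * \<theta>\<bar> \<le> card G * err"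
  proof -
    have "\<bar>\<Sum>h'\<in>G. x h' - \<theta>\<bar> \<le> (\<Sum>h'\<in>G. \<bar>x h' - \<theta>\<bar>)" by (rule sum_abs)
    also have "\<dots> \<le> (\<Sum>h'\<in>G. err)" using xin GW by (intro sum_mono) auto
    finally show ?thesis by (simp add: sum_subtractf)
  qed
  have cG: "card G \<le> u - 1" using card_mono[OF W(1) GW(1)] cW by linarith
  have t3: "\<bar>card G - fac * (u - 1)\<bar> \<le> w + R"
  proof (cases "h \<in> B")
    case True
    have "G = I - T" using True Suc.prems by (auto simp: G_def)
    then have "real (card G) = card I - R"
      using Suc.prems finT card_mono[of I T] finite_subset[of I U]
      by (simp add: card_Diff_subset R_def of_nat_diff)
    then have "card G - fac * (u - 1) = (card I - p * u) + (p - R)"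
      using True by (simp add: fac_def algebra_simps)
    then show ?thesis using Suc.prems(7-9) R by (auto simp: u_def)
  next
    case False
    have "G = U - I" using False Suc.prems by (auto simp: G_def)
    then have "real (card G) = u - card I"
      using Suc.prems card_mono[of U I] finite_subset[of I U] by (simp add: card_Diff_subset u_def of_nat_diff)
    then have "card G - fac * (u - 1) = - (card I - p * u) + (1 - p)"
      using False by (simp add: fac_def algebra_simps)
    then show ?thesis using Suc.prems(7-9) R by (auto simp: u_def)
  qed
  have "\<bar>(\<Sum>h'\<in>W. x h') - fac * \<theta> * (u - 1)\<bar> \<le> (R - 1) + card G * err + (w + R)"
  proof -
    have eq: "(\<Sum>h'\<in>W. x h') - fac * \<theta> * (u - 1) =
      (\<Sum>h'\<in>T'. x h') + ((\<Sum>h'\<in>G. x h') - card G * \<theta>) + \<theta> * (card G - fac * (u - 1))"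
      unfolding sumx by (simp add: algebra_simps)
    have t4: "\<bar>\<theta> * (card G - fac * (u - 1))\<bar> \<le> 1 * (w + R)"
      unfolding abs_mult using \<theta> t3 by (intro mult_mono) auto
    have tri: "\<bar>a + b + c\<bar> \<le> a' + b' + c'" if "0 \<le> a" "a \<le> a'" "\<bar>b\<bar> \<le> b'" "\<bar>c\<bar> \<le> 1 * c'" for a b c a' b' c' :: real
      using that by linarith
    show ?thesis unfolding eq by (rule tri[OF t1 t2 t4])
  qed
  also have "\<dots> \<le> (w + 2 * R - 1) + (u - 1) * err" using cG err0 by (simp add: mult_right_mono)
  finally have dev: "\<bar>(\<Sum>h'\<in>W. x h') - fac * \<theta> * (u - 1)\<bar> \<le> (w + 2 * R - 1) + (u - 1) * err" by simp
  have "\<bar>(\<Sum>h'\<in>W. x h') / (u - 1) - fac * \<theta>\<bar> \<le> ((w + 2 * R - 1) + (u - 1) * err) / (u - 1)"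
  proof -
    have div: "\<bar>a / c - b\<bar> \<le> d / c" if "\<bar>a - b * c\<bar> \<le> d" "0 < c" for a b c d :: real
    proof -
      have "a / c - b = (a - b * c) / c" using that by (simp add: field_simps)
      then show ?thesis using that by (simp add: abs_divide divide_right_mono)
    qed
    show ?thesis by (rule div[OF dev]) (use u R in simp)
  qed
  also have "\<dots> = (w + 2 * R - 1) / (u - 1) + err" using u R by (simp add: add_divide_distrib)
  also have "(w + 2 * R - 1) / (u - 1) \<le> (w + 2 * R - 1) / (u - 2 * R)"
    using u R w0 by (intro divide_left_mono mult_pos_pos) auto
  also have "(w + 2 * R - 1) / (u - 2 * R) + err = (w + 2 * R - 1 + (R - 1) * (w + 4 * R - 2)) / (u - 2 * R)"
    by (simp add: err_def add_divide_distrib)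
  also have "\<dots> \<le> R * (w + 4 * R) / (u - 2 * R)"
  proof (intro divide_right_mono)
    have "w + 2 * R - 1 + (R - 1) * (w + 4 * R - 2) = R * (w + 4 * R) - (4 * R - 1)" by (simp add: algebra_simps)
    then show "w + 2 * R - 1 + (R - 1) * (w + 4 * R - 2) \<le> R * (w + 4 * R)" using R by linarith
  qed (use u in simp)
  finally show ?case unfolding px target u_def[symmetric] R_def[symmetric] by simp
qed

definition deg_in :: "'a set \<Rightarrow> 'a set \<Rightarrow> 'a set set \<Rightarrow> nat" where
  "deg_in I T M = card {h \<in> T. partner M h \<in> I}"

text \<open>For \<open>p\<close> in \<open>{0..1}\<close> this is the binomial law; the polynomial
  makes sense for every real \<open>p\<close>, which makes continuity in \<open>p\<close>
  immediate.\<close>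

definition binom :: "nat \<Rightarrow> real \<Rightarrow> nat \<Rightarrow> real" where
  "binom j p k = real (j choose k) * p ^ k * (1 - p) ^ (j - k)"

text \<open>The event is the disjoint union of the patterns given by the \<open>k\<close>-element
  subsets of \<open>T1\<close>, and for two sets by pairs of such subsets, read as one pattern on
  \<open>T1 \<union> T2\<close>; this is where near independence comes from. There are at most
  \<open>2 ^ j\<close> and \<open>4 ^ j\<close> patterns respectively, and \<open>err\<close> is the
  error for up to \<open>2 * j\<close> half-edges.\<close>

lemma prob_deg_in:
  fixes p :: real
  assumes U: "finite U" "even (card U)" "I \<subseteq> U" and j: "4 * j < card U"
    and T: "T1 \<subseteq> I" "card T1 = j" "finite T1"
  defines "p \<equiv> card I / card U" and "err \<equiv> 16 * (real j)\<^sup>2 / (real (card U) - 4 * real j)"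
  shows "\<bar>measure_pmf.prob (pmf_of_set (perfect_matchings U)) {M. deg_in I T1 M = k} - binom j p k\<bar> \<le> 4 ^ j * err"
    and "T2 \<subseteq> I \<Longrightarrow> card T2 = j \<Longrightarrow> finite T2 \<Longrightarrow> T1 \<inter> T2 = {} \<Longrightarrow>
      \<bar>measure_pmf.prob (pmf_of_set (perfect_matchings U)) {M. deg_in I T1 M = k \<and> deg_in I T2 M = k} -
        (binom j p k)\<^sup>2\<bar> \<le> 4 ^ j * err"
proof -
  let ?P = "measure_pmf.prob (pmf_of_set (perfect_matchings U))"
  define u where "u = real (card U)"
  have u: "u > 4 * j" using j by (simp add: u_def)
  have u0: "u > 0" using u by linarith
  have p: "0 \<le> p" "p \<le> 1" "\<bar>card I - p * card U\<bar> \<le> 0"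
    using card_mono[OF U(1,3)] u0 by (auto simp: p_def u_def divide_le_eq_1)
  have err0: "0 \<le> err" using u by (simp add: err_def u_def)
  have pat: "\<bar>?P {M. pattern I T B M} - p ^ card B * (1 - p) ^ (card T - card B)\<bar> \<le> err"
    if "T \<subseteq> I" "B \<subseteq> T" "card T \<le> 2 * j" for T B
  proof -
    have "\<bar>?P {M. pattern I T B M} - p ^ card B * (1 - p) ^ (card T - card B)\<bar> \<le>
        real (card T) * (0 + 4 * real (card T)) / (real (card U) - 2 * real (card T))"
      using that j U p by (intro prob_pattern) auto
    also have "\<dots> = 4 * (real (card T))\<^sup>2 / (u - 2 * real (card T))" by (simp add: u_def power2_eq_square)
    also have "\<dots> \<le> 4 * (2 * real j)\<^sup>2 / (u - 4 * real j)"
    proof (intro frac_le mult_left_mono power_mono)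
      have c: "real (card T) \<le> 2 * real j" using that(3) by linarith
      then show "real (card T) \<le> 2 * real j" "u - 4 * real j \<le> u - 2 * real (card T)" by auto
    qed (use u in auto)
    also have "\<dots> = err" by (simp add: err_def u_def power_mult_distrib)
    finally show ?thesis .
  qed
  define Bs where "Bs T = {B. B \<subseteq> T \<and> card B = k}" for T :: "'a set"
  have finBs: "finite (Bs T)" if "finite T" for T using that by (simp add: Bs_def)
  have cBs: "card (Bs T) = j choose k" if "card T = j" "finite T" for T
    using n_subsets[OF that(2), of k] that by (simp add: Bs_def)
  have pc: "pattern I T B M \<longleftrightarrow> B = {h \<in> T. partner M h \<in> I}" if "B \<subseteq> T" for T B M
    using that by (auto simp: pattern_def)
  have setdeg: "{M. deg_in I T M = k} = (\<Union>B\<in>Bs T. {M. pattern I T B M})" for T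
  proof (intro set_eqI iffI)
    fix M assume "M \<in> {M. deg_in I T M = k}"
    then have "{h \<in> T. partner M h \<in> I} \<in> Bs T" by (simp add: deg_in_def Bs_def)
    moreover have "pattern I T {h \<in> T. partner M h \<in> I} M" by (simp add: pattern_def)
    ultimately show "M \<in> (\<Union>B\<in>Bs T. {M. pattern I T B M})" by blast
  next
    fix M assume "M \<in> (\<Union>B\<in>Bs T. {M. pattern I T B M})"
    then obtain B where "B \<subseteq> T" "card B = k" "pattern I T B M" by (auto simp: Bs_def)
    then show "M \<in> {M. deg_in I T M = k}" using pc[of B T M] by (simp add: deg_in_def)
  qed
  have uniq: "B = B'" if "B \<in> Bs T" "B' \<in> Bs T" "pattern I T B M" "pattern I T B' M" for T B B' M
  proof -
    have "B \<subseteq> T" "B' \<subseteq> T" using that by (simp_all add: Bs_def)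
    then show ?thesis using pc[of B T M] pc[of B' T M] that(3,4) by simp
  qed
  have disj: "disjoint_family_on (\<lambda>B. {M. pattern I T B M}) (Bs T)" for T
    unfolding disjoint_family_on_def using uniq by blast
  have ch: "real (j choose k) \<le> 2 ^ j"
  proof (cases "k \<le> j")
    case True
    have "(j choose k) \<le> (\<Sum>i\<le>j. j choose i)" using True by (intro member_le_sum) auto
    also have "\<dots> = 2 ^ j" by (rule choose_row_sum)
    finally show ?thesis by (metis of_nat_le_iff of_nat_numeral of_nat_power)
  qed (simp add: binomial_eq_0)
  have "?P {M. deg_in I T1 M = k} = (\<Sum>B\<in>Bs T1. ?P {M. pattern I T1 B M})"
    unfolding setdeg using finBs[OF T(3)] disj by (intro measure_pmf.finite_measure_finite_Union) auto
  moreover have "binom j p k = (\<Sum>B\<in>Bs T1. p ^ card B * (1 - p) ^ (card T1 - card B))"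
  proof -
    have "(\<Sum>B\<in>Bs T1. p ^ card B * (1 - p) ^ (card T1 - card B)) = (\<Sum>B\<in>Bs T1. p ^ k * (1 - p) ^ (j - k))"
      using T by (intro sum.cong) (auto simp: Bs_def)
    then show ?thesis using cBs[OF T(2,3)] by (simp add: binom_def)
  qed
  ultimately have "\<bar>?P {M. deg_in I T1 M = k} - binom j p k\<bar> =
      \<bar>\<Sum>B\<in>Bs T1. ?P {M. pattern I T1 B M} - p ^ card B * (1 - p) ^ (card T1 - card B)\<bar>"
    by (simp add: sum_subtractf)
  also have "\<dots> \<le> (\<Sum>B\<in>Bs T1. err)"
    using T pat by (intro order.trans[OF sum_abs] sum_mono) (auto simp: Bs_def)
  also have "\<dots> = (j choose k) * err" using cBs[OF T(2,3)] by simp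
  also have "\<dots> \<le> 4 ^ j * err"
  proof (intro mult_right_mono err0)
    have "(2::real) ^ j \<le> 4 ^ j" by (intro power_mono) auto
    then show "real (j choose k) \<le> 4 ^ j" using ch by linarith
  qed
  finally show "\<bar>?P {M. deg_in I T1 M = k} - binom j p k\<bar> \<le> 4 ^ j * err" .
  assume T2: "T2 \<subseteq> I" "card T2 = j" "finite T2" "T1 \<inter> T2 = {}"
  have pu: "pattern I T1 B1 M \<and> pattern I T2 B2 M \<longleftrightarrow> pattern I (T1 \<union> T2) (B1 \<union> B2) M"
    if "B1 \<subseteq> T1" "B2 \<subseteq> T2" for B1 B2 M
    using that T2(4) by (auto simp: pattern_def)
  have card12: "card (T1 \<union> T2) = 2 * j" using T T2 by (simp add: card_Un_disjoint)
  have cB12: "card (B1 \<union> B2) = 2 * k" if "B1 \<in> Bs T1" "B2 \<in> Bs T2" for B1 B2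
  proof -
    have "finite B1" "finite B2" using that T T2 finite_subset by (auto simp: Bs_def)
    moreover have "B1 \<inter> B2 = {}" using that T2(4) by (auto simp: Bs_def)
    ultimately show ?thesis using that by (simp add: card_Un_disjoint Bs_def)
  qed
  have sd: "{M. deg_in I T1 M = k \<and> deg_in I T2 M = k} =
      (\<Union>BB\<in>Bs T1 \<times> Bs T2. {M. pattern I (T1 \<union> T2) (fst BB \<union> snd BB) M})"
  proof -
    have "{M. deg_in I T1 M = k \<and> deg_in I T2 M = k} = {M. deg_in I T1 M = k} \<inter> {M. deg_in I T2 M = k}" by auto
    also have "\<dots> = (\<Union>BB\<in>Bs T1 \<times> Bs T2. {M. pattern I T1 (fst BB) M \<and> pattern I T2 (snd BB) M})"
      unfolding setdeg by auto
    also have "\<dots> = (\<Union>BB\<in>Bs T1 \<times> Bs T2. {M. pattern I (T1 \<union> T2) (fst BB \<union> snd BB) M})"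
    proof (intro SUP_cong refl Collect_cong)
      fix BB M assume "BB \<in> Bs T1 \<times> Bs T2"
      then have "fst BB \<subseteq> T1" "snd BB \<subseteq> T2" by (auto simp: Bs_def)
      from pu[OF this, of M] show "(pattern I T1 (fst BB) M \<and> pattern I T2 (snd BB) M) =
        pattern I (T1 \<union> T2) (fst BB \<union> snd BB) M" .
    qed
    finally show ?thesis .
  qed
  have "disjoint_family_on (\<lambda>BB. {M. pattern I (T1 \<union> T2) (fst BB \<union> snd BB) M}) (Bs T1 \<times> Bs T2)"
    unfolding disjoint_family_on_def
  proof (intro ballI impI, rule ccontr)
    fix a b assume ab: "a \<in> Bs T1 \<times> Bs T2" "b \<in> Bs T1 \<times> Bs T2" "a \<noteq> b"
      "{M. pattern I (T1 \<union> T2) (fst a \<union> snd a) M} \<inter> {M. pattern I (T1 \<union> T2) (fst b \<union> snd b) M} \<noteq> {}"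
    then obtain M where "pattern I (T1 \<union> T2) (fst a \<union> snd a) M" "pattern I (T1 \<union> T2) (fst b \<union> snd b) M" by auto
    moreover have "fst a \<subseteq> T1" "snd a \<subseteq> T2" "fst b \<subseteq> T1" "snd b \<subseteq> T2" using ab by (auto simp: Bs_def)
    ultimately have M: "pattern I T1 (fst a) M" "pattern I T2 (snd a) M" "pattern I T1 (fst b) M" "pattern I T2 (snd b) M"
      using pu by blast+
    have "fst a = fst b" using uniq[OF _ _ M(1,3)] ab by auto
    moreover have "snd a = snd b" using uniq[OF _ _ M(2,4)] ab by auto
    ultimately show False using ab by (simp add: prod_eq_iff)
  qed
  then have "?P {M. deg_in I T1 M = k \<and> deg_in I T2 M = k} =
      (\<Sum>BB\<in>Bs T1 \<times> Bs T2. ?P {M. pattern I (T1 \<union> T2) (fst BB \<union> snd BB) M})"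
    unfolding sd using finBs T T2 by (intro measure_pmf.finite_measure_finite_Union) auto
  moreover have "(binom j p k)\<^sup>2 = (\<Sum>BB\<in>Bs T1 \<times> Bs T2. p ^ card (fst BB \<union> snd BB) * (1 - p) ^ (card (T1 \<union> T2) - card (fst BB \<union> snd BB)))"
  proof -
    have "(\<Sum>BB\<in>Bs T1 \<times> Bs T2. p ^ card (fst BB \<union> snd BB) * (1 - p) ^ (card (T1 \<union> T2) - card (fst BB \<union> snd BB))) =
        (\<Sum>BB\<in>Bs T1 \<times> Bs T2. p ^ (2 * k) * (1 - p) ^ (2 * j - 2 * k))"
      using cB12 card12 by (intro sum.cong) auto
    also have "\<dots> = (real (j choose k))\<^sup>2 * (p ^ (2 * k) * (1 - p) ^ (2 * j - 2 * k))"
      using cBs T T2 by (simp add: card_cartesian_product power2_eq_square)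
    also have "\<dots> = (binom j p k)\<^sup>2"
    proof -
      have "2 * j - 2 * k = 2 * (j - k)" by simp
      then show ?thesis by (simp only: binom_def power_mult_distrib power_even_eq mult.assoc)
    qed
    finally show ?thesis ..
  qed
  ultimately have "\<bar>?P {M. deg_in I T1 M = k \<and> deg_in I T2 M = k} - (binom j p k)\<^sup>2\<bar> =
      \<bar>\<Sum>BB\<in>Bs T1 \<times> Bs T2. ?P {M. pattern I (T1 \<union> T2) (fst BB \<union> snd BB) M} -
        p ^ card (fst BB \<union> snd BB) * (1 - p) ^ (card (T1 \<union> T2) - card (fst BB \<union> snd BB))\<bar>"
    by (simp add: sum_subtractf)
  also have "\<dots> \<le> (\<Sum>BB\<in>Bs T1 \<times> Bs T2. err)"
  proof (intro order.trans[OF sum_abs] sum_mono)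
    fix BB assume "BB \<in> Bs T1 \<times> Bs T2"
    then have "fst BB \<union> snd BB \<subseteq> T1 \<union> T2" by (auto simp: Bs_def)
    moreover have "T1 \<union> T2 \<subseteq> I" using T T2 by simp
    ultimately show "\<bar>?P {M. pattern I (T1 \<union> T2) (fst BB \<union> snd BB) M} -
        p ^ card (fst BB \<union> snd BB) * (1 - p) ^ (card (T1 \<union> T2) - card (fst BB \<union> snd BB))\<bar> \<le> err"
      using card12 by (intro pat) auto
  qed
  also have "\<dots> = real (j choose k) * real (j choose k) * err"
    using cBs T T2 by (simp add: card_cartesian_product)
  also have "\<dots> \<le> 2 ^ j * 2 ^ j * err" using ch by (intro mult_right_mono mult_mono err0) auto
  also have "\<dots> = 4 ^ j * err" by (simp add: power_mult_distrib[symmetric])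
  finally show "\<bar>?P {M. deg_in I T1 M = k \<and> deg_in I T2 M = k} - (binom j p k)\<^sup>2\<bar> \<le> 4 ^ j * err" .
qed

lemma prob_square_bound:
  fixes f :: "'b \<Rightarrow> real"
  assumes "finite (set_pmf P)" "\<eta> > 0"
  shows "measure_pmf.prob P {x. \<eta> < \<bar>f x\<bar>} \<le> measure_pmf.expectation P (\<lambda>x. (f x)\<^sup>2) / \<eta>\<^sup>2"
proof -
  have int: "integrable P g" for g :: "'b \<Rightarrow> real" by (rule integrable_measure_pmf_finite[OF assms(1)])
  have "measure_pmf.prob P {x. \<eta> < \<bar>f x\<bar>} = measure_pmf.expectation P (indicat_real {x. \<eta> < \<bar>f x\<bar>})" by simp
  also have "\<dots> \<le> measure_pmf.expectation P (\<lambda>x. (f x)\<^sup>2 / \<eta>\<^sup>2)"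
  proof (rule integral_mono[OF int int])
    fix x
    show "indicat_real {x. \<eta> < \<bar>f x\<bar>} x \<le> (f x)\<^sup>2 / \<eta>\<^sup>2"
    proof (cases "\<eta> < \<bar>f x\<bar>")
      case True
      then have "\<eta>\<^sup>2 \<le> (f x)\<^sup>2" using assms(2) by (simp add: abs_le_square_iff[symmetric])
      then show ?thesis using assms(2) True by simp
    qed simp
  qed
  finally show ?thesis by simp
qed

text \<open>Second moment method. The count is centred at the binomial value instead of its exact
  mean, so an off-diagonal term is bounded by three errors: one from the joint probability and one
  from each of the two means.\<close>

lemma prob_degree_count:
  fixes p :: real and T :: "'v \<Rightarrow> 'a set"
  assumes U: "finite U" "even (card U)" "I \<subseteq> U" and j: "4 * j < card U"
    and X: "finite X" and T: "\<And>v. v \<in> X \<Longrightarrow> T v \<subseteq> I \<and> card (T v) = j \<and> finite (T v)"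
    and disj: "\<And>v w. v \<in> X \<Longrightarrow> w \<in> X \<Longrightarrow> v \<noteq> w \<Longrightarrow> T v \<inter> T w = {}" and \<eta>: "\<eta> > 0"
  defines "p \<equiv> card I / card U" and "err \<equiv> 16 * (real j)\<^sup>2 / (real (card U) - 4 * real j)"
  shows "measure_pmf.prob (pmf_of_set (perfect_matchings U))
      {M. \<eta> < \<bar>real (card {v \<in> X. deg_in I (T v) M = k}) - card X * binom j p k\<bar>}
    \<le> (card X + 3 * 4 ^ j * err * (real (card X))\<^sup>2) / \<eta>\<^sup>2"
proof -
  let ?\<mu> = "pmf_of_set (perfect_matchings U)"
  have fin: "finite (set_pmf ?\<mu>)" using set_pmf_matchings[OF U(1,2)] finite_perfect_matchings[OF U(1)] by simp
  have int: "integrable ?\<mu> g" for g :: "'a set set \<Rightarrow> real" by (rule integrable_measure_pmf_finite[OF fin])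
  define q where "q = binom j p k"
  define y where "y v M = (if deg_in I (T v) M = k then 1 else 0 :: real)" for v M
  have u0: "real (card U) > 4 * real j" using j by simp
  have p: "0 \<le> p" "p \<le> 1"
    using card_mono[OF U(1,3)] u0 by (auto simp: p_def divide_le_eq_1)
  have q: "0 \<le> q" "q \<le> 1"
  proof -
    show "0 \<le> q" using p by (simp add: q_def binom_def)
    have "q = pmf (binomial_pmf j p) k" using p by (simp add: q_def binom_def)
    then show "q \<le> 1" by (simp add: pmf_le_1)
  qed
  have err0: "0 \<le> err" using u0 by (simp add: err_def)
  have Ey: "measure_pmf.expectation ?\<mu> (y v) = measure_pmf.prob ?\<mu> {M. deg_in I (T v) M = k}" for v
  proof -
    have "y v = indicat_real {M. deg_in I (T v) M = k}" by (auto simp: y_def indicator_def)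
    then show ?thesis by simp
  qed
  have Eyy: "measure_pmf.expectation ?\<mu> (\<lambda>M. y v M * y w M) =
      measure_pmf.prob ?\<mu> {M. deg_in I (T v) M = k \<and> deg_in I (T w) M = k}" for v w
  proof -
    have "(\<lambda>M. y v M * y w M) = indicat_real {M. deg_in I (T v) M = k \<and> deg_in I (T w) M = k}"
      by (auto simp: y_def indicator_def)
    then show ?thesis by simp
  qed
  have off: "measure_pmf.expectation ?\<mu> (\<lambda>M. (y v M - q) * (y w M - q)) \<le> 3 * (4 ^ j * err)"
    if vw: "v \<in> X" "w \<in> X" "v \<noteq> w" for v w
  proof -
    define a b c where "a = measure_pmf.expectation ?\<mu> (y v)"
      and "b = measure_pmf.expectation ?\<mu> (y w)" and "c = measure_pmf.expectation ?\<mu> (\<lambda>M. y v M * y w M)"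
    define z where "z = 4 ^ j * err"
    have "a - q \<ge> - z" "b - q \<ge> - z" "c - q\<^sup>2 \<le> z"
      using prob_deg_in(1)[OF U j, of "T v" k] prob_deg_in(1)[OF U j, of "T w" k]
        prob_deg_in(2)[OF U j, of "T v" "T w" k] T[OF vw(1)] T[OF vw(2)] disj[OF vw]
      by (simp_all add: a_def b_def c_def Ey Eyy q_def p_def err_def z_def abs_le_iff)
    moreover have "measure_pmf.expectation ?\<mu> (\<lambda>M. (y v M - q) * (y w M - q)) = c - q * a - q * b + q\<^sup>2"
    proof -
      have "(\<lambda>M. (y v M - q) * (y w M - q)) = (\<lambda>M. y v M * y w M - q * y v M - q * y w M + q\<^sup>2)"
        by (auto simp: algebra_simps power2_eq_square)
      then show ?thesis using int by (simp add: a_def b_def c_def Bochner_Integration.integral_add Bochner_Integration.integral_diff)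
    qed
    moreover have "c - q * a - q * b + q\<^sup>2 = (c - q\<^sup>2) + q * (q - a) + q * (q - b)"
      by (simp add: algebra_simps power2_eq_square)
    moreover have "q * (q - a) \<le> 1 * z" "q * (q - b) \<le> 1 * z"
    proof -
      have z0: "0 \<le> z" using err0 by (simp add: z_def)
      have "q * (q - a) \<le> q * z" "q * (q - b) \<le> q * z" using calculation(1,2) q by (auto intro: mult_left_mono)
      moreover have "q * z \<le> 1 * z" using q z0 by (intro mult_right_mono) auto
      ultimately show "q * (q - a) \<le> 1 * z" "q * (q - b) \<le> 1 * z" by linarith+
    qed
    ultimately show ?thesis unfolding z_def[symmetric] by linarith
  qed
  have diag: "measure_pmf.expectation ?\<mu> (\<lambda>M. (y v M - q) * (y v M - q)) \<le> 1" for v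
  proof -
    have "measure_pmf.expectation ?\<mu> (\<lambda>M. (y v M - q) * (y v M - q)) \<le> measure_pmf.expectation ?\<mu> (\<lambda>M. 1)"
    proof (rule integral_mono[OF int int])
      fix M
      have "\<bar>y v M - q\<bar> \<le> 1" using q by (auto simp: y_def)
      then have "\<bar>y v M - q\<bar> * \<bar>y v M - q\<bar> \<le> 1 * 1" by (intro mult_mono) auto
      then show "(y v M - q) * (y v M - q) \<le> 1" by (simp add: abs_mult[symmetric])
    qed
    then show ?thesis by simp
  qed
  have cnt: "real (card {v \<in> X. deg_in I (T v) M = k}) - card X * q = (\<Sum>v\<in>X. y v M - q)" for M
    using X by (simp add: y_def sum_subtractf sum.If_cases Int_def)
  have "measure_pmf.expectation ?\<mu> (\<lambda>M. (\<Sum>v\<in>X. y v M - q)\<^sup>2) =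
      (\<Sum>v\<in>X. \<Sum>w\<in>X. measure_pmf.expectation ?\<mu> (\<lambda>M. (y v M - q) * (y w M - q)))"
    using int by (simp add: power2_eq_square sum_product Bochner_Integration.integral_sum)
  also have "\<dots> \<le> (\<Sum>v\<in>X. \<Sum>w\<in>X. (if v = w then 1 else 0) + 3 * (4 ^ j * err))"
  proof (intro sum_mono)
    fix v w assume "v \<in> X" "w \<in> X"
    then show "measure_pmf.expectation ?\<mu> (\<lambda>M. (y v M - q) * (y w M - q)) \<le> (if v = w then 1 else 0) + 3 * (4 ^ j * err)"
      using off[of v w] diag[of v] err0 by (cases "v = w") (auto intro: order.trans)
  qed
  also have "\<dots> = card X + 3 * 4 ^ j * err * (real (card X))\<^sup>2"
    using X by (simp add: sum.distrib power2_eq_square algebra_simps)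
  finally have E: "measure_pmf.expectation ?\<mu> (\<lambda>M. (\<Sum>v\<in>X. y v M - q)\<^sup>2) \<le> \<dots>" .
  have "measure_pmf.prob ?\<mu> {M. \<eta> < \<bar>\<Sum>v\<in>X. y v M - q\<bar>} \<le> measure_pmf.expectation ?\<mu> (\<lambda>M. (\<Sum>v\<in>X. y v M - q)\<^sup>2) / \<eta>\<^sup>2"
    by (rule prob_square_bound[OF fin \<eta>])
  also have "\<dots> \<le> (card X + 3 * 4 ^ j * err * (real (card X))\<^sup>2) / \<eta>\<^sup>2"
    using E by (intro divide_right_mono) auto
  finally show ?thesis unfolding q_def[symmetric] cnt .
qed

section \<open>Generating functions\<close>

lemma sums_expectation_nat:
  fixes f :: "nat \<Rightarrow> real"
  assumes "\<And>k. k \<in> set_pmf p \<Longrightarrow> \<bar>f k\<bar> \<le> B"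
  shows "(\<lambda>k. pmf p k * f k) sums measure_pmf.expectation p f"
proof -
  have int: "integrable (measure_pmf p) f"
    using assms by (intro measure_pmf.integrable_const_bound[where B = B]) (auto simp: AE_measure_pmf_iff)
  have "integrable (count_space UNIV) (\<lambda>k. pmf p k * f k)"
    using int unfolding measure_pmf_eq_density by (subst (asm) integrable_density) auto
  from sums_integral_count_space_nat[OF this]
  show ?thesis unfolding measure_pmf_eq_density by (subst integral_density) auto
qed

lemma gen_fun_eq_expectation:
  assumes "x \<in> {0..1}"
  shows "gen_fun p x = measure_pmf.expectation p (\<lambda>k. x ^ k)"
    "(\<lambda>k. pmf p k * x ^ k) sums gen_fun p x"
proof -
  have "(\<lambda>k. pmf p k * x ^ k) sums measure_pmf.expectation p (\<lambda>k. x ^ k)"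
    using assms by (intro sums_expectation_nat[where B = 1]) (auto simp: power_le_one power_abs)
  then show "gen_fun p x = measure_pmf.expectation p (\<lambda>k. x ^ k)"
    "(\<lambda>k. pmf p k * x ^ k) sums gen_fun p x"
    by (auto simp: gen_fun_def sums_iff)
qed

lemma expectation_bind_pmf_unit:
  fixes f :: "'b \<Rightarrow> real"
  assumes "\<And>x. x \<in> set_pmf (p \<bind> K) \<Longrightarrow> 0 \<le> f x \<and> f x \<le> 1"
  shows "measure_pmf.expectation (p \<bind> K) f = measure_pmf.expectation p (\<lambda>x. measure_pmf.expectation (K x) f)"
proof -
  have f01: "0 \<le> f y" "f y \<le> 1" if "x \<in> set_pmf p" "y \<in> set_pmf (K x)" for x y
    using assms[of y] that by auto
  have intK: "integrable (measure_pmf (K x)) f" if "x \<in> set_pmf p" for x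
    using f01[OF that] by (intro measure_pmf.integrable_const_bound[where B = 1]) (auto simp: AE_measure_pmf_iff)
  have bK0: "0 \<le> measure_pmf.expectation (K x) f" if "x \<in> set_pmf p" for x
    using f01[OF that] by (intro integral_nonneg_AE) (simp add: AE_measure_pmf_iff)
  have bK1: "measure_pmf.expectation (K x) f \<le> 1" if "x \<in> set_pmf p" for x
  proof -
    have "measure_pmf.expectation (K x) f \<le> measure_pmf.expectation (K x) (\<lambda>_. 1)"
      using f01[OF that] intK[OF that] by (intro integral_mono_AE) (simp_all add: AE_measure_pmf_iff)
    then show ?thesis by simp
  qed
  have nn: "0 \<le> measure_pmf.expectation (p \<bind> K) f"
    "0 \<le> measure_pmf.expectation p (\<lambda>x. measure_pmf.expectation (K x) f)"
    using assms bK0 by (auto intro!: integral_nonneg_AE simp: AE_measure_pmf_iff)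
  have int: "integrable (measure_pmf (p \<bind> K)) f"
    using assms by (intro measure_pmf.integrable_const_bound[where B = 1]) (auto simp: AE_measure_pmf_iff f01)
  have intE: "integrable (measure_pmf p) (\<lambda>x. measure_pmf.expectation (K x) f)"
    using bK0 bK1 by (intro measure_pmf.integrable_const_bound[where B = 1]) (auto simp: AE_measure_pmf_iff)
  have "ennreal (measure_pmf.expectation (p \<bind> K) f) = (\<integral>\<^sup>+x. ennreal (f x) \<partial>measure_pmf (p \<bind> K))"
    by (rule nn_integral_eq_integral[OF int, symmetric]) (use f01 in \<open>auto simp: AE_measure_pmf_iff\<close>)
  also have "\<dots> = (\<integral>\<^sup>+x. (\<integral>\<^sup>+y. ennreal (f y) \<partial>measure_pmf (K x)) \<partial>measure_pmf p)" by simp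
  also have "\<dots> = (\<integral>\<^sup>+x. ennreal (measure_pmf.expectation (K x) f) \<partial>measure_pmf p)"
  proof (rule nn_integral_cong_AE, unfold AE_measure_pmf_iff, rule ballI)
    fix x assume x: "x \<in> set_pmf p"
    show "(\<integral>\<^sup>+y. ennreal (f y) \<partial>measure_pmf (K x)) = ennreal (measure_pmf.expectation (K x) f)"
      by (rule nn_integral_eq_integral[OF intK[OF x]]) (use f01[OF x] in \<open>simp add: AE_measure_pmf_iff\<close>)
  qed
  also have "\<dots> = ennreal (measure_pmf.expectation p (\<lambda>x. measure_pmf.expectation (K x) f))"
    by (rule nn_integral_eq_integral[OF intE]) (use bK0 in \<open>simp add: AE_measure_pmf_iff\<close>)
  finally show ?thesis using nn by simp
qed

text \<open>Once the coefficients below \<open>n\<close> agree, the difference divided by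
  \<open>x ^ n\<close> is a power series that vanishes on (0,1) and is continuous at 0, so the next
  ones agree. This uniqueness makes the definite description \<open>pi_alpha\<close> usable.\<close>

lemma gen_fun_inject:
  assumes eq: "\<And>x. x \<in> {0..1} \<Longrightarrow> gen_fun p x = gen_fun q x"
  shows "p = q"
proof (rule pmf_eqI)
  fix i
  define a where "a k = pmf p k - pmf q k" for k
  have sums: "(\<lambda>k. a k * x ^ k) sums 0" if "x \<in> {0..1}" for x
    using sums_diff[OF gen_fun_eq_expectation(2)[OF that, of p] gen_fun_eq_expectation(2)[OF that, of q]] eq[OF that]
    by (simp add: a_def left_diff_distrib)
  have "a k = 0" for k
  proof (induction k rule: less_induct)
    case (less n)
    have s0: "(\<lambda>k. a (k + n) * x ^ k) sums 0" if "0 < x" "x < 1" for x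
    proof -
      have "(\<lambda>k. a (k + n) * x ^ (k + n)) sums 0"
        using sums_split_initial_segment[OF sums[of x], of n] less that by simp
      then have "(\<lambda>k. x ^ n * (a (k + n) * x ^ k)) sums (x ^ n * 0)" by (simp add: power_add mult_ac)
      then show ?thesis using that by (subst (asm) sums_mult_iff) auto
    qed
    have summ: "summable (\<lambda>k. a (k + n) * (1/2) ^ k)" using s0[of "1/2"] by (auto simp: sums_iff)
    define F where "F x = (\<Sum>k. a (k + n) * x ^ k)" for x
    have "isCont F 0"
      unfolding F_def using isCont_powser[OF summ, of 0] by simp
    then have "(F \<longlongrightarrow> F 0) (at_right 0)"
      by (auto simp: isCont_def intro: tendsto_mono[OF at_le])
    moreover have "eventually (\<lambda>x. F x = 0) (at_right 0)"
      unfolding eventually_at_right_field using s0 by (intro exI[of _ 1]) (auto simp: F_def sums_iff)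
    then have "(F \<longlongrightarrow> 0) (at_right 0)" by (rule tendsto_eventually)
    ultimately have "F 0 = 0" using tendsto_unique[OF trivial_limit_at_right_real] by blast
    then show "a n = 0" by (simp add: F_def)
  qed
  then show "pmf p i = pmf q i" by (simp add: a_def)
qed

lemma one_minus_power_lower:
  fixes t :: real
  assumes "0 \<le> t" "t \<le> 1"
  shows "real n * t ^ (n - 1) * (1 - t) \<le> 1 - t ^ n"
proof (cases n)
  case (Suc m)
  have "(\<Sum>i<n. t ^ (n - 1)) \<le> (\<Sum>i<n. t ^ i)"
    using assms by (intro sum_mono power_decreasing) auto
  then have "(real n * t ^ (n - 1)) * (1 - t) \<le> (\<Sum>i<n. t ^ i) * (1 - t)"
    using assms by (intro mult_right_mono) auto
  also have "\<dots> = 1 - t ^ n" by (simp add: one_diff_power_eq mult.commute)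
  finally show ?thesis .
qed simp

text \<open>Absolute summability of \<open>c'\<close> gives uniform convergence of the
  differentiated series on the closed interval, which includes the one-sided derivative at 1 even if
  the radius of convergence is 1. General exponents \<open>m\<close> cover both derivatives.\<close>

lemma series_field_derivative_unit:
  fixes c c' :: "nat \<Rightarrow> real"
  assumes c': "summable (\<lambda>k. \<bar>c' k\<bar>)" and c: "summable c" and eq: "\<And>k. c' k = c k * real (m k)"
  shows "x \<in> {0..1} \<Longrightarrow> ((\<lambda>x. \<Sum>k. c k * x ^ m k) has_field_derivative (\<Sum>k. c' k * x ^ (m k - 1))) (at x within {0..1})"
proof -
  have "\<exists>g. \<forall>x\<in>{0..1}. (\<lambda>k. c k * x ^ m k) sums g x \<and>
      (g has_field_derivative (\<Sum>k. c' k * x ^ (m k - 1))) (at x within {0..1})"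
  proof (rule has_field_derivative_series)
    show "((\<lambda>x. c k * x ^ m k) has_field_derivative c' k * x ^ (m k - 1)) (at x within {0..1})" for k x
      by (auto intro!: derivative_eq_intros simp: eq)
    show "uniform_limit {0..1} (\<lambda>n x. \<Sum>i<n. c' i * x ^ (m i - 1)) (\<lambda>x. \<Sum>k. c' k * x ^ (m k - 1)) sequentially"
      by (rule Weierstrass_m_test[OF _ c']) (auto simp: abs_mult power_abs mult_left_le power_le_one)
    show "summable (\<lambda>k. c k * 1 ^ m k)" using c by simp
  qed auto
  then obtain g where g: "\<And>x. x \<in> {0..1} \<Longrightarrow> (\<lambda>k. c k * x ^ m k) sums g x"
    "\<And>x. x \<in> {0..1} \<Longrightarrow> (g has_field_derivative (\<Sum>k. c' k * x ^ (m k - 1))) (at x within {0..1})" by blast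
  assume x: "x \<in> {0..1}"
  show "((\<lambda>x. \<Sum>k. c k * x ^ m k) has_field_derivative (\<Sum>k. c' k * x ^ (m k - 1))) (at x within {0..1})"
    by (rule has_field_derivative_transform_within[OF g(2)[OF x] zero_less_one x])
      (use g(1) in \<open>auto simp: sums_iff\<close>)
qed

section \<open>Derivatives of the generating function of a law with finite second moment\<close>

context
  fixes \<pi> :: "nat pmf"
  assumes sq: "summable (\<lambda>k. real k ^ 2 * pmf \<pi> k)"
begin

definition "der1 s = (\<Sum>k. (real k * pmf \<pi> k) * s ^ (k - 1))"
definition "der2 s = (\<Sum>k. (real k * real (k - 1) * pmf \<pi> k) * s ^ (k - 2))"

lemma summable_moments:
  "summable (\<lambda>k. real k * pmf \<pi> k)" "summable (\<lambda>k. real k * real (k - 1) * pmf \<pi> k)" "summable (pmf \<pi>)"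
proof -
  show "summable (pmf \<pi>)" using gen_fun_eq_expectation(2)[of 1 \<pi>] by (auto simp: sums_iff)
  show "summable (\<lambda>k. real k * pmf \<pi> k)"
  proof (rule summable_comparison_test'[OF sq])
    show "norm (real k * pmf \<pi> k) \<le> real k ^ 2 * pmf \<pi> k" for k
    proof -
      have "real k \<le> real k ^ 2" by (cases k) (auto simp: power2_eq_square)
      then show ?thesis by (simp add: mult_right_mono)
    qed
  qed
  show "summable (\<lambda>k. real k * real (k - 1) * pmf \<pi> k)"
  proof (rule summable_comparison_test'[OF sq])
    show "norm (real k * real (k - 1) * pmf \<pi> k) \<le> real k ^ 2 * pmf \<pi> k" for k
      by (auto simp: power2_eq_square intro!: mult_right_mono mult_left_mono)
  qed
qed

lemma gen_fun_derivatives: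
  assumes "s \<in> {0..1}"
  shows "(gen_fun \<pi> has_field_derivative der1 s) (at s within {0..1})"
    "(der1 has_field_derivative der2 s) (at s within {0..1})"
    "gen_fun' \<pi> s = der1 s" "gen_fun'' \<pi> s = der2 s"
proof -
  have d1: "(gen_fun \<pi> has_field_derivative der1 s) (at s within {0..1})" if "s \<in> {0..1}" for s
  proof -
    have "((\<lambda>x. \<Sum>k. pmf \<pi> k * x ^ k) has_field_derivative (\<Sum>k. (real k * pmf \<pi> k) * s ^ (k - 1))) (at s within {0..1})"
      by (rule series_field_derivative_unit[where c' = "\<lambda>k. real k * pmf \<pi> k" and m = "\<lambda>k. k"])
        (use summable_moments that in simp_all)
    moreover have "gen_fun \<pi> = (\<lambda>x. \<Sum>k. pmf \<pi> k * x ^ k)" by (rule ext) (rule gen_fun_def)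
    ultimately show ?thesis by (simp only: der1_def)
  qed
  have d2: "(der1 has_field_derivative der2 s) (at s within {0..1})" if "s \<in> {0..1}" for s
  proof -
    have "((\<lambda>x. \<Sum>k. (real k * pmf \<pi> k) * x ^ (k - 1)) has_field_derivative
        (\<Sum>k. (real k * real (k - 1) * pmf \<pi> k) * s ^ (k - 1 - 1))) (at s within {0..1})"
      by (rule series_field_derivative_unit[where c' = "\<lambda>k. real k * real (k - 1) * pmf \<pi> k" and m = "\<lambda>k. k - 1"])
        (use summable_moments that in simp_all)
    moreover have "der1 = (\<lambda>x. \<Sum>k. (real k * pmf \<pi> k) * x ^ (k - 1))" by (rule ext) (rule der1_def)
    moreover have "k - 1 - 1 = k - 2" for k :: nat by simp
    ultimately show ?thesis by (simp only: der2_def)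
  qed
  have e1: "gen_fun' \<pi> s = der1 s" if "s \<in> {0..1}" for s
    unfolding gen_fun'_def using d1[OF that] that
    by (intro vector_derivative_within_closed_interval) (auto simp: has_real_derivative_iff_has_vector_derivative)
  have "(gen_fun' \<pi> has_field_derivative der2 s) (at s within {0..1})"
    by (rule has_field_derivative_transform_within[OF d2[OF assms] zero_less_one assms]) (simp add: e1)
  then show "gen_fun'' \<pi> s = der2 s"
    unfolding gen_fun''_def using assms
    by (intro vector_derivative_within_closed_interval) (auto simp: has_real_derivative_iff_has_vector_derivative)
  show "(gen_fun \<pi> has_field_derivative der1 s) (at s within {0..1})"
    "(der1 has_field_derivative der2 s) (at s within {0..1})" "gen_fun' \<pi> s = der1 s"
    using d1 d2 e1 assms by auto
qed

lemma summable_der: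
  assumes "s \<in> {0..1}"
  shows "summable (\<lambda>k. (real k * pmf \<pi> k) * s ^ (k - 1))"
    "summable (\<lambda>k. (real k * real (k - 1) * pmf \<pi> k) * s ^ (k - 2))"
proof -
  have p: "s ^ n \<le> 1" "0 \<le> s" for n using assms by (auto simp: power_le_one)
  show "summable (\<lambda>k. (real k * pmf \<pi> k) * s ^ (k - 1))"
    by (rule summable_comparison_test'[OF summable_moments(1)]) (use p in \<open>auto simp: abs_mult mult_left_le\<close>)
  show "summable (\<lambda>k. (real k * real (k - 1) * pmf \<pi> k) * s ^ (k - 2))"
    by (rule summable_comparison_test'[OF summable_moments(2)]) (use p in \<open>auto simp: abs_mult mult_left_le\<close>)
qed

lemma der1_mult:
  assumes "s \<in> {0..1}"
  shows "(\<lambda>k. real k * pmf \<pi> k * s ^ k) sums (s * der1 s)"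
proof -
  have "(\<lambda>k. s * ((real k * pmf \<pi> k) * s ^ (k - 1))) sums (s * der1 s)"
    unfolding der1_def using summable_der(1)[OF assms] by (intro sums_mult summable_sums)
  moreover have "(\<lambda>k. s * ((real k * pmf \<pi> k) * s ^ (k - 1))) = (\<lambda>k. real k * pmf \<pi> k * s ^ k)"
  proof
    show "s * ((real k * pmf \<pi> k) * s ^ (k - 1)) = real k * pmf \<pi> k * s ^ k" for k by (cases k) auto
  qed
  ultimately show ?thesis by (simp only:)
qed

lemma continuous_gen_fun: "continuous_on {0..1} (gen_fun \<pi>)" "continuous_on {0..1} der1" "continuous_on {0..1} der2"
proof -
  show "continuous_on {0..1} (gen_fun \<pi>)" "continuous_on {0..1} der1"
    by (auto intro!: DERIV_continuous_on gen_fun_derivatives)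
  have "uniform_limit {0..1} (\<lambda>n x. \<Sum>i<n. (real i * real (i - 1) * pmf \<pi> i) * x ^ (i - 2)) der2 sequentially"
    unfolding der2_def[abs_def]
    by (rule Weierstrass_m_test[OF _ summable_moments(2)]) (auto simp: abs_mult power_abs mult_left_le power_le_one)
  then show "continuous_on {0..1} der2"
    by (rule uniform_limit_theorem[rotated]) (auto intro!: always_eventually continuous_intros)
qed

lemma gen_fun_strict_mono:
  assumes "der1 1 > 0" "0 \<le> x" "x < y" "y \<le> 1"
  shows "gen_fun \<pi> x < gen_fun \<pi> y"
proof -
  have "\<exists>k. real k * pmf \<pi> k \<noteq> 0"
  proof (rule ccontr)
    assume "\<not> (\<exists>k. real k * pmf \<pi> k \<noteq> 0)"
    then have "(\<lambda>k. (real k * pmf \<pi> k) * 1 ^ (k - 1)) = (\<lambda>_. 0)" by (intro ext) simp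
    then have "der1 1 = 0" unfolding der1_def by simp
    then show False using assms by simp
  qed
  then obtain k where "real k * pmf \<pi> k \<noteq> 0" by blast
  then have "k \<noteq> 0" "pmf \<pi> k \<noteq> 0" by auto
  then have k: "k \<ge> 1" "pmf \<pi> k > 0" using pmf_nonneg[of \<pi> k] by linarith+
  have sums: "(\<lambda>k. pmf \<pi> k * y ^ k - pmf \<pi> k * x ^ k) sums (gen_fun \<pi> y - gen_fun \<pi> x)"
    using assms by (intro sums_diff gen_fun_eq_expectation) auto
  have "0 < (\<Sum>k. pmf \<pi> k * y ^ k - pmf \<pi> k * x ^ k)"
  proof (rule suminf_pos2[of _ k])
    show "summable (\<lambda>k. pmf \<pi> k * y ^ k - pmf \<pi> k * x ^ k)" using sums by (simp add: sums_iff)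
    show "0 \<le> pmf \<pi> k * y ^ k - pmf \<pi> k * x ^ k" for k
      using assms by (auto intro!: mult_left_mono power_mono)
    show "0 < pmf \<pi> k * y ^ k - pmf \<pi> k * x ^ k"
      using assms k by (auto intro!: mult_strict_left_mono power_strict_mono)
  qed
  then show ?thesis using sums by (simp add: sums_iff)
qed

lemma der2_nonneg_mono:
  assumes "0 \<le> x" "x \<le> y" "y \<le> 1"
  shows "der2 x \<le> der2 y"
  unfolding der2_def
proof (rule suminf_le)
  show "summable (\<lambda>k. (real k * real (k - 1) * pmf \<pi> k) * x ^ (k - 2))"
    "summable (\<lambda>k. (real k * real (k - 1) * pmf \<pi> k) * y ^ (k - 2))"
    using assms by (intro summable_der; simp)+
  show "(real k * real (k - 1) * pmf \<pi> k) * x ^ (k - 2) \<le> (real k * real (k - 1) * pmf \<pi> k) * y ^ (k - 2)" for k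
    using assms by (intro mult_left_mono power_mono) simp_all
qed

lemma inj_on_gen_fun:
  assumes "der1 1 > 0"
  shows "inj_on (gen_fun \<pi>) {0..1}"
proof (rule linorder_inj_onI')
  fix x y :: real assume "x \<in> {0..1}" "y \<in> {0..1}" "x < y"
  then have "gen_fun \<pi> x < gen_fun \<pi> y" using gen_fun_strict_mono[OF assms] by simp
  then show "gen_fun \<pi> x \<noteq> gen_fun \<pi> y" by simp
qed

text \<open>Convexity of the first derivative: its tangent at \<open>t\<close> lies below it at 1,
  and this holds term by term.\<close>

lemma der1_chord:
  assumes "t \<in> {0..1}"
  shows "(1 - t) * der2 t \<le> der1 1 - der1 t"
proof -
  have "(1 - t) * der2 t = (\<Sum>k. (1 - t) * ((real k * real (k - 1) * pmf \<pi> k) * t ^ (k - 2)))"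
    unfolding der2_def by (rule suminf_mult[OF summable_der(2)[OF assms], symmetric])
  also have "\<dots> \<le> (\<Sum>k. (real k * pmf \<pi> k) * 1 ^ (k - 1) - (real k * pmf \<pi> k) * t ^ (k - 1))"
  proof (rule suminf_le)
    show "summable (\<lambda>k. (1 - t) * ((real k * real (k - 1) * pmf \<pi> k) * t ^ (k - 2)))"
      by (intro summable_mult summable_der assms)
    show "summable (\<lambda>k. (real k * pmf \<pi> k) * 1 ^ (k - 1) - (real k * pmf \<pi> k) * t ^ (k - 1))"
      by (intro summable_diff summable_der assms) auto
    fix k
    have "real (k - 1) * t ^ (k - 1 - 1) * (1 - t) \<le> 1 - t ^ (k - 1)"
      using assms by (intro one_minus_power_lower) auto
    from mult_left_mono[OF this, of "real k * pmf \<pi> k"]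
    show "(1 - t) * ((real k * real (k - 1) * pmf \<pi> k) * t ^ (k - 2)) \<le>
        (real k * pmf \<pi> k) * 1 ^ (k - 1) - (real k * pmf \<pi> k) * t ^ (k - 1)"
      by (simp add: algebra_simps numeral_2_eq_2)
  qed
  also have "\<dots> = der1 1 - der1 t"
    unfolding der1_def by (intro suminf_diff[symmetric] summable_der assms) auto
  finally show ?thesis .
qed

end

text \<open>Supercriticality forces mass on some \<open>k \<ge> 3\<close>, which makes the second
  derivative strictly increasing. At 0 it is below and at 1 above the first derivative at 1, so the
  equation has a single root \<open>sc\<close>, and the minimum in \<open>alpha_c\<close> is over
  one element.\<close>

lemma supercritical_facts:
  assumes "supercritical \<pi>"
  obtains sc where "0 < sc" "sc < 1" "gen_fun'' \<pi> sc = gen_fun' \<pi> 1" "alpha_c \<pi> = 1 - gen_fun \<pi> sc" "0 < gen_fun' \<pi> 1"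
proof -
  have sq: "summable (\<lambda>k. real k ^ 2 * pmf \<pi> k)" and sup: "gen_fun'' \<pi> 1 / gen_fun' \<pi> 1 > 1"
    using assms by (auto simp: supercritical_def)
  note der = gen_fun_derivatives[OF sq]
  let ?d1 = "der1 \<pi>" and ?d2 = "der2 \<pi>"
  have g1: "gen_fun' \<pi> 1 = ?d1 1" and g2: "s \<in> {0..1} \<Longrightarrow> gen_fun'' \<pi> s = ?d2 s" for s using der by auto
  have "?d1 1 \<ge> 0" unfolding der1_def[OF sq] using summable_moments[OF sq] by (intro suminf_nonneg) auto
  moreover have "?d1 1 \<noteq> 0" using sup g1 by auto
  ultimately have d1: "?d1 1 > 0" by simp
  have d21: "?d2 1 > ?d1 1" using sup d1 by (simp add: g1 g2 field_simps)
  \<comment> \<open>For \<open>k \<le> 2\<close> one has \<open>k * (k - 1) \<le> k\<close>, so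
    without such mass the second derivative at 1 could not exceed the first.\<close>
  have "\<exists>k\<ge>3. pmf \<pi> k > 0"
  proof (rule ccontr)
    assume "\<not> (\<exists>k\<ge>3. pmf \<pi> k > 0)"
    then have z: "pmf \<pi> k = 0" if "k \<ge> 3" for k 
    proof -
      have "\<not> 0 < pmf \<pi> k" using that \<open>\<not> (\<exists>k\<ge>3. pmf \<pi> k > 0)\<close> by blast
      then show ?thesis using pmf_nonneg[of \<pi> k] by linarith
    qed
    have "(real k * real (k - 1) * pmf \<pi> k) * 1 ^ (k - 2) \<le> (real k * pmf \<pi> k) * 1 ^ (k - 1)" for k
    proof (cases "k \<ge> 3")
      case False
      then have "real (k - 1) * (real k * pmf \<pi> k) \<le> 1 * (real k * pmf \<pi> k)" by (intro mult_right_mono) auto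
      then show ?thesis by (simp add: mult_ac)
    qed (simp add: z)
    then have "?d2 1 \<le> ?d1 1"
      unfolding der1_def[OF sq] der2_def[OF sq] using summable_der[OF sq, of 1] by (intro suminf_le) auto
    then show False using d21 by simp
  qed
  then obtain k3 where k3: "k3 \<ge> 3" "pmf \<pi> k3 > 0" by blast
  have d2strict: "?d2 x < ?d2 y" if "0 \<le> x" "x < y" "y \<le> 1" for x y
  proof -
    let ?f = "\<lambda>k. (real k * real (k - 1) * pmf \<pi> k) * y ^ (k - 2) - (real k * real (k - 1) * pmf \<pi> k) * x ^ (k - 2)"
    have sums: "?f sums (?d2 y - ?d2 x)"
      unfolding der2_def[OF sq] using that by (intro sums_diff summable_sums summable_der[OF sq]) auto
    have "0 < suminf ?f"
    proof (rule suminf_pos2[of _ k3])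
      show "summable ?f" using sums by (simp add: sums_iff)
      show "0 \<le> ?f k" for k using that by (auto intro!: mult_left_mono power_mono)
      have "x ^ (k3 - 2) < y ^ (k3 - 2)" using that k3 by (intro power_strict_mono) auto
      then show "0 < ?f k3" using k3 by (simp add: mult_strict_left_mono)
    qed
    then show ?thesis using sums by (simp add: sums_iff)
  qed
  \<comment> \<open>At 0 only \<open>k = 2\<close> contributes, namely
    \<open>2 * pmf \<pi> 2\<close>; the first derivative at 1 contains this term and the positive
    term of \<open>k3\<close>.\<close>
  have d20: "?d2 0 < ?d1 1"
  proof -
    let ?f = "\<lambda>k. (real k * pmf \<pi> k) * 1 ^ (k - 1) - (real k * real (k - 1) * pmf \<pi> k) * 0 ^ (k - 2)"
    have sums: "?f sums (?d1 1 - ?d2 0)"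
      unfolding der1_def[OF sq] der2_def[OF sq] by (intro sums_diff summable_sums summable_der[OF sq]) auto
    have "0 < suminf ?f"
    proof (rule suminf_pos2[of _ k3])
      show "summable ?f" using sums by (simp add: sums_iff)
      show "0 \<le> ?f k" for k
      proof (cases "k \<le> 2")
        case True
        then have "k = 0 \<or> k = 1 \<or> k = 2" by auto
        then show ?thesis by auto
      next
        case False
        then have z: "(0::real) ^ (k - 2) = 0" by (simp add: power_0_left)
        show ?thesis unfolding z by simp
      qed
      have z: "(0::real) ^ (k3 - 2) = 0" using k3 by (simp add: power_0_left)
      show "0 < ?f k3" unfolding z using k3 by simp
    qed
    then show ?thesis using sums by (simp add: sums_iff)
  qed
  obtain sc where sc: "0 \<le> sc" "sc \<le> 1" "?d2 sc = ?d1 1"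
    using IVT'[OF less_imp_le[OF d20] less_imp_le[OF d21] zero_le_one continuous_gen_fun(3)[OF sq]] by blast
  have "sc \<noteq> 0" "sc \<noteq> 1" using sc(3) d20 d21 by auto
  then have sc01: "0 < sc" "sc < 1" using sc by auto
  have mono: "x < y \<Longrightarrow> 0 \<le> x \<Longrightarrow> y \<le> 1 \<Longrightarrow> gen_fun \<pi> x < gen_fun \<pi> y" for x y
    using gen_fun_strict_mono[OF sq d1] by blast
  note inj = inj_on_gen_fun[OF sq d1]
  have f0: "gen_fun \<pi> 0 = pmf \<pi> 0" and f1: "gen_fun \<pi> 1 = 1"
  proof -
    show "gen_fun \<pi> 1 = 1" using gen_fun_eq_expectation(1)[of 1 \<pi>] by simp
    show "gen_fun \<pi> 0 = pmf \<pi> 0" using powser_zero[of "pmf \<pi>"] by (simp add: gen_fun_def)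
  qed
  have inv: "gen_fun_inv \<pi> (gen_fun \<pi> s) = s" if "s \<in> {0..1}" for s
    unfolding gen_fun_inv_def by (rule the_inv_into_f_f[OF inj that])
  have "alpha_c \<pi> = 1 - gen_fun \<pi> sc"
    unfolding alpha_c_def
  proof (rule Least_equality)
    show "0 < 1 - gen_fun \<pi> sc \<and> 1 - gen_fun \<pi> sc \<le> 1 - pmf \<pi> 0 \<and>
      gen_fun'' \<pi> (gen_fun_inv \<pi> (1 - (1 - gen_fun \<pi> sc))) / gen_fun' \<pi> 1 = 1"
      using mono[of sc 1] mono[of 0 sc] f0 f1 sc01 sc d1 inv[of sc] by (simp add: g1 g2)
    fix y assume y: "0 < y \<and> y \<le> 1 - pmf \<pi> 0 \<and> gen_fun'' \<pi> (gen_fun_inv \<pi> (1 - y)) / gen_fun' \<pi> 1 = 1"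
    then obtain s where s: "0 \<le> s" "s \<le> 1" "gen_fun \<pi> s = 1 - y"
      using IVT'[OF _ _ zero_le_one continuous_gen_fun(1)[OF sq], of "1 - y"] by (auto simp: f0 f1)
    then have "?d2 s = ?d1 1" using y inv[of s] d1 by (simp add: g1 g2)
    then have "s = sc" using d2strict[of s sc] d2strict[of sc s] s sc by (cases s sc rule: linorder_cases) auto
    then show "1 - gen_fun \<pi> sc \<le> y" using s by simp
  qed
  then show ?thesis using that sc01 sc d1 by (simp add: g1 g2)
qed

text \<open>The root is found in \<open>{sc..1}\<close>. For \<open>x \<ge> s\<close> the second
  derivative is therefore at least its value \<mu> at \<open>sc\<close>, and
  \<open>der1_chord\<close> gives \<open>(1 - x) * \<mu> \<le> \<mu> - gen_fun' \<pi> x\<close>,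
  which is the sixth claim.\<close>

lemma subcritical_root:
  assumes "supercritical \<pi>" "\<alpha> \<in> {0..alpha_c \<pi>}"
  defines "s \<equiv> gen_fun_inv \<pi> (1 - \<alpha>)" and "\<mu> \<equiv> gen_fun' \<pi> 1"
  shows "0 < s" "s \<le> 1" "gen_fun \<pi> s = 1 - \<alpha>" "pmf \<pi> 0 < 1 - \<alpha>" "\<mu> > 0"
    "\<And>t. s \<le> t \<Longrightarrow> t \<le> 1 \<Longrightarrow> gen_fun' \<pi> t \<le> t * \<mu>"
    "\<And>t. 0 \<le> t \<Longrightarrow> t < s \<Longrightarrow> gen_fun \<pi> t < 1 - \<alpha>"
    "\<And>t. s < t \<Longrightarrow> t \<le> 1 \<Longrightarrow> 1 - \<alpha> < gen_fun \<pi> t"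
proof -
  have sq: "summable (\<lambda>k. real k ^ 2 * pmf \<pi> k)" using assms by (auto simp: supercritical_def)
  obtain sc where sc: "0 < sc" "sc < 1" "gen_fun'' \<pi> sc = gen_fun' \<pi> 1" "alpha_c \<pi> = 1 - gen_fun \<pi> sc" "0 < gen_fun' \<pi> 1"
    using supercritical_facts[OF assms(1)] by blast
  have g1: "gen_fun' \<pi> t = der1 \<pi> t" "gen_fun'' \<pi> t = der2 \<pi> t" if "t \<in> {0..1}" for t
    using gen_fun_derivatives[OF sq that] by auto
  have d1: "der1 \<pi> 1 > 0" using sc(5) g1[of 1] by simp
  note mono = gen_fun_strict_mono[OF sq d1]
  note inj = inj_on_gen_fun[OF sq d1]
  have f0: "gen_fun \<pi> 0 = pmf \<pi> 0" and f1: "gen_fun \<pi> 1 = 1"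
  proof -
    show "gen_fun \<pi> 1 = 1" using gen_fun_eq_expectation(1)[of 1 \<pi>] by simp
    show "gen_fun \<pi> 0 = pmf \<pi> 0" using powser_zero[of "pmf \<pi>"] by (simp add: gen_fun_def)
  qed
  have ivt: "gen_fun \<pi> sc \<le> 1 - \<alpha>" "1 - \<alpha> \<le> gen_fun \<pi> 1" using assms(2) sc(4) f1 by auto
  have "continuous_on {sc..1} (gen_fun \<pi>)"
    using continuous_gen_fun(1)[OF sq] by (rule continuous_on_subset) (use sc in auto)
  then obtain t where t: "sc \<le> t" "t \<le> 1" "gen_fun \<pi> t = 1 - \<alpha>"
    using IVT'[OF ivt less_imp_le[OF sc(2)]] by blast
  have st: "s = t"
    unfolding s_def gen_fun_inv_def t(3)[symmetric] using t sc by (intro the_inv_into_f_f[OF inj]) auto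
  show s: "0 < s" "s \<le> 1" "gen_fun \<pi> s = 1 - \<alpha>" using st t sc by auto
  show "pmf \<pi> 0 < 1 - \<alpha>" using mono[of 0 s] s f0 by simp
  show "\<mu> > 0" using sc by (simp add: \<mu>_def)
  show "gen_fun \<pi> t < 1 - \<alpha>" if "0 \<le> t" "t < s" for t using mono[OF that] s by simp
  show "1 - \<alpha> < gen_fun \<pi> t" if "s < t" "t \<le> 1" for t using mono[of s t] s that by simp
  show "gen_fun' \<pi> x \<le> x * \<mu>" if x: "s \<le> x" "x \<le> 1" for x
  proof -
    have x01: "x \<in> {0..1}" using x s by auto
    have "der2 \<pi> sc \<le> der2 \<pi> x" using sc t st x by (intro der2_nonneg_mono[OF sq]) auto
    moreover have "der2 \<pi> sc = der1 \<pi> 1" using sc g1[of sc] g1[of 1] by simp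
    ultimately have "(1 - x) * der1 \<pi> 1 \<le> (1 - x) * der2 \<pi> x" using x by (intro mult_left_mono) auto
    then have "(1 - x) * der1 \<pi> 1 \<le> der1 \<pi> 1 - der1 \<pi> x" using der1_chord[OF sq x01] by simp
    then show ?thesis using g1[OF x01] g1[of 1] by (simp add: \<mu>_def algebra_simps)
  qed
qed

lemma binom_eq_pmf: "p \<in> {0..1} \<Longrightarrow> binom j p k = pmf (binomial_pmf j p) k"
  by (simp add: binom_def)

text \<open>The law is exhibited as a mixture of binomial laws with parameters \<open>j\<close> and
  \<open>p\<close>, where \<open>j\<close> has weight
  \<open>pmf \<pi> j * s ^ j / (1 - \<alpha>)\<close>. As \<open>s * (1 - p + p * x)\<close> equals
  the argument of the generating function in \<open>g_series\<close>, uniqueness identifies the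
  mixture with \<open>pi_alpha\<close>. That \<open>p \<le> 1\<close> is the inequality of
  \<open>subcritical_root\<close> at \<open>s\<close>.\<close>

lemma pi_alpha_sums:
  assumes "supercritical \<pi>" "\<alpha> \<in> {0..alpha_c \<pi>}"
  defines "s \<equiv> gen_fun_inv \<pi> (1 - \<alpha>)" and "\<mu> \<equiv> gen_fun' \<pi> 1"
  defines "p \<equiv> gen_fun' \<pi> s / (s * \<mu>)"
  shows "p \<in> {0..1}" "(\<lambda>j. pmf \<pi> j * s ^ j * binom j p k) sums ((1 - \<alpha>) * pmf (pi_alpha \<pi> \<alpha>) k)"
proof -
  note r = subcritical_root[OF assms(1,2), folded s_def \<mu>_def]
  have sq: "summable (\<lambda>k. real k ^ 2 * pmf \<pi> k)" using assms(1) by (auto simp: supercritical_def)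
  have s01: "s \<in> {0..1}" using r by auto
  have a: "1 - \<alpha> > 0" using r(4) pmf_nonneg[of \<pi> 0] by linarith
  have "gen_fun' \<pi> s \<ge> 0"
    unfolding gen_fun_derivatives(3)[OF sq s01] der1_def[OF sq]
    using summable_der(1)[OF sq s01] r by (intro suminf_nonneg) auto
  then show p: "p \<in> {0..1}" using r(6)[of s] r by (auto simp: p_def divide_le_eq_1)
  define w where "w j = pmf \<pi> j * s ^ j / (1 - \<alpha>)" for j
  have wsums: "w sums 1"
    using sums_divide[OF gen_fun_eq_expectation(2)[OF s01, of \<pi>], of "1 - \<alpha>"] r(3) a
    by (simp add: w_def[abs_def])
  have w0: "0 \<le> w j" for j using r a by (simp add: w_def)
  have "(\<integral>\<^sup>+ j. ennreal (w j) \<partial>count_space UNIV) = 1"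
    using wsums w0 by (simp add: nn_integral_count_space_nat suminf_ennreal2 sums_iff)
  then have pw: "pmf (embed_pmf w) j = w j" for j using w0 by (intro pmf_embed_pmf) auto
  define q where "q = embed_pmf w \<bind> (\<lambda>j. binomial_pmf j p)"
  have gq: "gen_fun q x = g_series \<pi> \<alpha> x" if x: "x \<in> {0..1}" for x
  proof -
    define z where "z = 1 - p + p * x"
    have px: "0 \<le> p * x" "p * x \<le> p" using p x by (auto simp: mult_left_le)
    then have z: "z \<in> {0..1}" using p by (auto simp: z_def)
    have bin: "measure_pmf.expectation (binomial_pmf j p) (\<lambda>k. x ^ k) = z ^ j" for j
    proof -
      have "measure_pmf.expectation (binomial_pmf j p) (\<lambda>k. x ^ k) =
          (\<Sum>k\<le>j. real (j choose k) * (p * x) ^ k * (1 - p) ^ (j - k))"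
        by (subst expectation_binomial_pmf'[OF p]) (simp add: power_mult_distrib mult_ac)
      also have "\<dots> = (p * x + (1 - p)) ^ j" by (simp add: binomial_ring)
      finally show ?thesis by (simp add: z_def add_ac)
    qed
    have "gen_fun q x = measure_pmf.expectation (embed_pmf w) (\<lambda>j. z ^ j)"
      unfolding gen_fun_eq_expectation(1)[OF x] q_def
      by (subst expectation_bind_pmf_unit) (use x in \<open>auto simp: bin power_le_one\<close>)
    also have "\<dots> = gen_fun (embed_pmf w) z" by (simp add: gen_fun_eq_expectation(1)[OF z])
    also have "\<dots> = (\<Sum>j. (pmf \<pi> j * (s * z) ^ j) / (1 - \<alpha>))"
      by (simp add: gen_fun_def pw w_def power_mult_distrib mult_ac)
    also have "\<dots> = gen_fun \<pi> (s * z) / (1 - \<alpha>)"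
    proof -
      have "s * z \<in> {0..1}" using s01 z by (auto intro: mult_le_one)
      from sums_divide[OF gen_fun_eq_expectation(2)[OF this, of \<pi>], of "1 - \<alpha>"] show ?thesis
        by (simp add: sums_iff)
    qed
    also have "s * z = s - (1 - x) * (gen_fun' \<pi> s / \<mu>)"
      using r by (simp add: z_def p_def field_simps)
    finally show ?thesis by (simp add: g_series_def s_def \<mu>_def)
  qed
  have "pi_alpha \<pi> \<alpha> = q"
    unfolding pi_alpha_def
  proof (rule the_equality)
    show "\<forall>x\<in>{0..1}. gen_fun q x = g_series \<pi> \<alpha> x" using gq by blast
    fix q' assume "\<forall>x\<in>{0..1}. gen_fun q' x = g_series \<pi> \<alpha> x"
    then show "q' = q" using gq by (intro gen_fun_inject) auto
  qed
  moreover have "(\<lambda>j. w j * binom j p k) sums pmf q k"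
  proof -
    have "(\<lambda>j. pmf (embed_pmf w) j * pmf (binomial_pmf j p) k) sums pmf q k"
      unfolding q_def pmf_bind by (rule sums_expectation_nat[where B = 1]) (simp add: pmf_le_1)
    then show ?thesis by (simp only: pw binom_eq_pmf[OF p])
  qed
  ultimately have "(\<lambda>j. w j * binom j p k) sums pmf (pi_alpha \<pi> \<alpha>) k" by simp
  from sums_mult[OF this, of "1 - \<alpha>"]
  have "(\<lambda>j. (1 - \<alpha>) * (w j * binom j p k)) sums ((1 - \<alpha>) * pmf (pi_alpha \<pi> \<alpha>) k)" .
  moreover have "(\<lambda>j. (1 - \<alpha>) * (w j * binom j p k)) = (\<lambda>j. pmf \<pi> j * s ^ j * binom j p k)"
    using a by (simp add: w_def fun_eq_iff)
  ultimately show "(\<lambda>j. pmf \<pi> j * s ^ j * binom j p k) sums ((1 - \<alpha>) * pmf (pi_alpha \<pi> \<alpha>) k)"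
    by (simp only:)
qed

section \<open>Convergence of the empirical degrees\<close>

definition vs :: "nat \<Rightarrow> nat set" where "vs N = {1..N}"

lemma vs_simps [simp]: "finite (vs N)" "card (vs N) = N"
  by (simp_all add: vs_def)

text \<open>The degrees \<open>e\<close> will be those after the parity correction.\<close>

locale degree_limit =
  fixes \<pi> :: "nat pmf" and e :: "nat \<Rightarrow> nat \<Rightarrow> nat"
  assumes sq: "summable (\<lambda>k. real k ^ 2 * pmf \<pi> k)"
    and lim: "has_asymptotic_degrees e \<pi>"
    and sqlim: "(\<lambda>N. (\<Sum>i=1..N. real (e N i) ^ 2) / real N) \<longlonglongrightarrow> (\<Sum>k. real k ^ 2 * pmf \<pi> k)"
begin

abbreviation "nV N j \<equiv> half_edge_exploration.num (vs N) (e N) j (vs N)"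
abbreviation "tlN N K \<equiv> half_edge_exploration.tail (vs N) (e N) K"
abbreviation "pg N t \<equiv> half_edge_exploration.pgf (vs N) (e N) t"
abbreviation "pg' N t \<equiv> half_edge_exploration.pgf' (vs N) (e N) t"
abbreviation "LL N \<equiv> half_edge_exploration.L (vs N) (e N)"

lemma explore: "half_edge_exploration (vs N)"
  by unfold_locales (simp add: vs_def)

lemma square_limit: "(\<lambda>N. (\<Sum>i\<in>vs N. real (e N i) ^ 2) / real N) \<longlonglongrightarrow> (\<Sum>k. real k ^ 2 * pmf \<pi> k)"
  using sqlim unfolding vs_def .

lemma num_limit: "(\<lambda>N. nV N j / N) \<longlonglongrightarrow> pmf \<pi> j"
proof -
  have "nV N j = real (card {i \<in> {1..N}. e N i = j})" for N
  proof -
    interpret half_edge_exploration "vs N" "e N" by (rule explore)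
    have "vs N \<inter> D j = {i \<in> {1..N}. e N i = j}" unfolding D_def by (auto simp: vs_def)
    then show ?thesis unfolding num_def by simp
  qed
  then show ?thesis using lim by (simp add: has_asymptotic_degrees_def)
qed

text \<open>For fixed \<open>K\<close> the second moment carried by degrees above \<open>K\<close>
  converges, as a difference of two convergent sequences, to that of the limit law; it dominates the
  first moment \<open>tail\<close>. Stating the bounds for all \<open>K \<ge> K0\<close> lets later
  choices enlarge \<open>K\<close>.\<close>

lemma tail_small:
  fixes \<eta> :: real
  assumes "\<eta> > 0"
  obtains K0 where "\<And>K. K0 \<le> K \<Longrightarrow> eventually (\<lambda>N. tlN N K \<le> \<eta> * N) sequentially"
    "\<And>K. K0 \<le> K \<Longrightarrow> (\<Sum>k. real k ^ 2 * pmf \<pi> k) - (\<Sum>j\<le>K. real j ^ 2 * pmf \<pi> j) \<le> \<eta>"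
proof -
  let ?m2 = "\<Sum>k. real k ^ 2 * pmf \<pi> k"
  have "(\<lambda>n. \<Sum>j\<le>n. real j ^ 2 * pmf \<pi> j) \<longlonglongrightarrow> ?m2"
    using sq by (rule summable_LIMSEQ')
  then have "eventually (\<lambda>n. ?m2 - \<eta> / 2 < (\<Sum>j\<le>n. real j ^ 2 * pmf \<pi> j)) sequentially"
    using assms by (intro order_tendstoD(1)) auto
  then obtain K0 where K0: "\<And>K. K0 \<le> K \<Longrightarrow> ?m2 - \<eta> / 2 < (\<Sum>j\<le>K. real j ^ 2 * pmf \<pi> j)"
    by (auto simp: eventually_sequentially)
  have "eventually (\<lambda>N. tlN N K \<le> \<eta> * N) sequentially" if K: "K0 \<le> K" for K
  proof -
    have "(\<lambda>N. (\<Sum>i\<in>vs N. real (e N i) ^ 2) / N - (\<Sum>j\<le>K. real j ^ 2 * (nV N j / N))) \<longlonglongrightarrow>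
        ?m2 - (\<Sum>j\<le>K. real j ^ 2 * pmf \<pi> j)"
      by (intro tendsto_diff tendsto_sum tendsto_mult num_limit square_limit tendsto_const)
    then have "eventually (\<lambda>N. (\<Sum>i\<in>vs N. real (e N i) ^ 2) / N - (\<Sum>j\<le>K. real j ^ 2 * (nV N j / N)) < \<eta>) sequentially"
      by (rule order_tendstoD(2)) (use K0[OF K] assms in linarith)
    then show ?thesis
      using eventually_gt_at_top[of 0]
    proof eventually_elim
      case (elim N)
      interpret half_edge_exploration "vs N" "e N" by (rule explore)
      have "tail K \<le> (\<Sum>v\<in>{v\<in>vs N. K < e N v}. real (e N v) ^ 2)"
        unfolding tail_def
      proof (rule sum_mono)
        show "real (e N v) \<le> real (e N v) ^ 2" for v
          by (cases "e N v") (auto simp: power2_eq_square)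
      qed
      also have "\<dots> = (\<Sum>i\<in>vs N. real (e N i) ^ 2) - (\<Sum>j\<le>K. real j ^ 2 * num j (vs N))"
        using sum_by_degree[OF subset_refl, of "\<lambda>j. real j ^ 2" K] by simp
      also have "\<dots> = ((\<Sum>i\<in>vs N. real (e N i) ^ 2) / N - (\<Sum>j\<le>K. real j ^ 2 * (num j (vs N) / N))) * N"
      proof -
        have "(\<Sum>j\<le>K. real j ^ 2 * (num j (vs N) / N)) = (\<Sum>j\<le>K. real j ^ 2 * num j (vs N)) / N"
          by (simp add: sum_divide_distrib)
        moreover have "(a / N - b / N) * N = a - b" for a b :: real
          using elim(2) by (simp add: left_diff_distrib)
        ultimately show ?thesis by (simp only:)
      qed
      also have "\<dots> \<le> \<eta> * N" using elim by (intro mult_right_mono) auto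
      finally show ?case .
    qed
  qed
  moreover have "?m2 - (\<Sum>j\<le>K. real j ^ 2 * pmf \<pi> j) \<le> \<eta>" if "K0 \<le> K" for K
    using K0[OF that] assms by simp
  ultimately show ?thesis using that by blast
qed

text \<open>One tail bound for all series in use: for \<open>j \<ge> 1\<close> their terms are
  dominated by the second moment series, and the extra summand makes up for the vanishing factor at
  \<open>j = 0\<close>.\<close>

lemma series_tail_bounds:
  fixes c :: "nat \<Rightarrow> real"
  assumes "\<And>j. 0 \<le> c j" "\<And>j. c j \<le> real j ^ 2 * pmf \<pi> j + (if j = 0 then pmf \<pi> 0 else 0)" "c sums x"
  shows "(\<Sum>j\<le>K. c j) \<le> x" "x \<le> (\<Sum>j\<le>K. c j) + ((\<Sum>k. real k ^ 2 * pmf \<pi> k) - (\<Sum>j\<le>K. real j ^ 2 * pmf \<pi> j))"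
proof -
  have c: "summable c" "x = suminf c" using assms(3) by (auto simp: sums_iff)
  show "(\<Sum>j\<le>K. c j) \<le> x" unfolding c(2) using c(1) assms(1) by (intro sum_le_suminf) auto
  have "suminf c = (\<Sum>j. c (j + Suc K)) + (\<Sum>j\<le>K. c j)"
    using suminf_split_initial_segment[OF c(1), of "Suc K"] by (simp add: lessThan_Suc_atMost)
  moreover have "(\<Sum>k. real k ^ 2 * pmf \<pi> k) = (\<Sum>j. real (j + Suc K) ^ 2 * pmf \<pi> (j + Suc K)) + (\<Sum>j\<le>K. real j ^ 2 * pmf \<pi> j)"
    using suminf_split_initial_segment[OF sq, of "Suc K"] by (simp add: lessThan_Suc_atMost)
  moreover have "(\<Sum>j. c (j + Suc K)) \<le> (\<Sum>j. real (j + Suc K) ^ 2 * pmf \<pi> (j + Suc K))"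
  proof (rule suminf_le)
    show "c (j + Suc K) \<le> real (j + Suc K) ^ 2 * pmf \<pi> (j + Suc K)" for j using assms(2)[of "j + Suc K"] by simp
    show "summable (\<lambda>j. c (j + Suc K))" using c(1) by (rule summable_ignore_initial_segment)
    show "summable (\<lambda>j. real (j + Suc K) ^ 2 * pmf \<pi> (j + Suc K))" using sq by (rule summable_ignore_initial_segment)
  qed
  ultimately show "x \<le> (\<Sum>j\<le>K. c j) + ((\<Sum>k. real k ^ 2 * pmf \<pi> k) - (\<Sum>j\<le>K. real j ^ 2 * pmf \<pi> j))"
    unfolding c(2) by linarith
qed

text \<open>Uniformity in \<open>t\<close> is essential, as \<open>t\<close> will be the random
  \<open>scale U\<close>. It holds because only the coefficients \<open>t ^ j\<close> and
  \<open>j * t ^ j\<close> depend on \<open>t\<close>, and these are at most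
  \<open>j + 1\<close>.\<close>

lemma pgf_limit:
  fixes \<eta> :: real
  assumes "\<eta> > 0"
  shows "eventually (\<lambda>N. \<forall>t\<in>{0..1}. \<bar>pg N t - N * gen_fun \<pi> t\<bar> \<le> \<eta> * N \<and>
      \<bar>pg' N t - N * (t * gen_fun' \<pi> t)\<bar> \<le> \<eta> * N) sequentially"
proof -
  let ?tau = "\<lambda>K. (\<Sum>k. real k ^ 2 * pmf \<pi> k) - (\<Sum>j\<le>K. real j ^ 2 * pmf \<pi> j)"
  obtain K where "\<And>K'. K \<le> K' \<Longrightarrow> eventually (\<lambda>N. tlN N K' \<le> \<eta> / 2 * N) sequentially"
    "\<And>K'. K \<le> K' \<Longrightarrow> ?tau K' \<le> \<eta> / 2"
    using tail_small[OF half_gt_zero[OF assms]] by blast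
  then have K: "eventually (\<lambda>N. tlN N K \<le> \<eta> / 2 * N) sequentially" "?tau K \<le> \<eta> / 2" by simp_all
  have "(\<lambda>N. \<Sum>j\<le>K. real (j + 1) * \<bar>nV N j / N - pmf \<pi> j\<bar>) \<longlonglongrightarrow> (\<Sum>j\<le>K. real (j + 1) * \<bar>pmf \<pi> j - pmf \<pi> j\<bar>)"
    by (intro tendsto_intros num_limit)
  then have "eventually (\<lambda>N. (\<Sum>j\<le>K. real (j + 1) * \<bar>nV N j / N - pmf \<pi> j\<bar>) < \<eta> / 2) sequentially"
    using assms by (intro order_tendstoD(2)) auto
  then show ?thesis using K(1) eventually_gt_at_top[of 0]
  proof eventually_elim
    case (elim N)
    interpret half_edge_exploration "vs N" "e N" by (rule explore)
    have N: "real N > 0" using elim by simp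
    have T0: "0 \<le> tail K" unfolding tail_def by (intro sum_nonneg) auto
    have tau0: "0 \<le> ?tau K"
    proof -
      have "(\<Sum>j\<le>K. real j ^ 2 * pmf \<pi> j) \<le> (\<Sum>k. real k ^ 2 * pmf \<pi> k)"
        using sq by (intro sum_le_suminf) auto
      then show ?thesis by simp
    qed
    have close: "\<bar>y - N * x\<bar> \<le> \<eta> * N"
      if c: "\<And>j. 0 \<le> c j" "\<And>j. c j \<le> real (j + 1)"
        and y: "(\<Sum>j\<le>K. c j * num j (vs N)) \<le> y" "y \<le> (\<Sum>j\<le>K. c j * num j (vs N)) + tail K"
        and x: "(\<Sum>j\<le>K. c j * pmf \<pi> j) \<le> x" "x \<le> (\<Sum>j\<le>K. c j * pmf \<pi> j) + ?tau K"
      for c :: "nat \<Rightarrow> real" and x y :: real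
    proof -
      have "\<bar>(\<Sum>j\<le>K. c j * num j (vs N)) - N * (\<Sum>j\<le>K. c j * pmf \<pi> j)\<bar> =
          \<bar>\<Sum>j\<le>K. N * (c j * (num j (vs N) / N - pmf \<pi> j))\<bar>"
        using N by (simp add: sum_distrib_left sum_subtractf[symmetric] algebra_simps)
      also have "\<dots> \<le> (\<Sum>j\<le>K. N * (real (j + 1) * \<bar>num j (vs N) / N - pmf \<pi> j\<bar>))"
        using c by (intro order.trans[OF sum_abs] sum_mono) (auto simp: abs_mult intro!: mult_left_mono mult_right_mono)
      also have "\<dots> = N * (\<Sum>j\<le>K. real (j + 1) * \<bar>num j (vs N) / N - pmf \<pi> j\<bar>)" by (simp add: sum_distrib_left)
      also have "\<dots> \<le> N * (\<eta> / 2)" using elim N by (intro mult_left_mono) auto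
      finally have d: "\<bar>(\<Sum>j\<le>K. c j * num j (vs N)) - N * (\<Sum>j\<le>K. c j * pmf \<pi> j)\<bar> \<le> N * (\<eta> / 2)" .
      have "N * (\<Sum>j\<le>K. c j * pmf \<pi> j) \<le> N * x" using x(1) N by (intro mult_left_mono) auto
      moreover have "N * x \<le> N * (\<Sum>j\<le>K. c j * pmf \<pi> j) + N * (\<eta> / 2)"
      proof -
        have "N * x \<le> N * ((\<Sum>j\<le>K. c j * pmf \<pi> j) + \<eta> / 2)" using x(2) K(2) N by (intro mult_left_mono) auto
        then show ?thesis by (simp add: distrib_left)
      qed
      moreover have "tail K \<le> N * (\<eta> / 2)" using elim by (simp add: mult.commute)
      moreover have "\<eta> * N = N * (\<eta> / 2) + N * (\<eta> / 2)" by simp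
      ultimately show ?thesis using d y unfolding abs_le_iff by linarith
    qed
    show ?case
    proof (intro ballI conjI)
      fix t :: real assume t: "t \<in> {0..1}"
      have tp: "0 \<le> t ^ j" "t ^ j \<le> 1" for j using t by (auto simp: power_le_one)
      show "\<bar>pgf t - N * gen_fun \<pi> t\<bar> \<le> \<eta> * N"
      proof (rule close)
        show "0 \<le> t ^ j" for j using tp by auto
        show "t ^ j \<le> real (j + 1)" for j using tp(2)[of j] by simp
        show "(\<Sum>j\<le>K. t ^ j * num j (vs N)) \<le> pgf t" "pgf t \<le> (\<Sum>j\<le>K. t ^ j * num j (vs N)) + tail K"
          using pgf_by_degree[of t K] t by auto
        have "pmf \<pi> j * t ^ j \<le> real j ^ 2 * pmf \<pi> j + (if j = 0 then pmf \<pi> 0 else 0)" for j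
        proof (cases j)
          case (Suc i)
          have "pmf \<pi> j * t ^ j \<le> pmf \<pi> j * real j ^ 2"
          proof (intro mult_left_mono)
            have "1 \<le> real j ^ 2" using Suc by (simp add: one_le_power)
            then show "t ^ j \<le> real j ^ 2" using tp(2)[of j] by linarith
          qed simp
          then show ?thesis using Suc by (simp add: mult.commute)
        qed simp
        from series_tail_bounds[OF _ this gen_fun_eq_expectation(2)[OF t], of K] tp
        show "(\<Sum>j\<le>K. t ^ j * pmf \<pi> j) \<le> gen_fun \<pi> t" "gen_fun \<pi> t \<le> (\<Sum>j\<le>K. t ^ j * pmf \<pi> j) + ?tau K"
          by (auto simp: mult.commute)
      qed
      show "\<bar>pgf' t - N * (t * gen_fun' \<pi> t)\<bar> \<le> \<eta> * N"
      proof (rule close)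
        show "0 \<le> real j * t ^ j" for j using tp by auto
        have le: "real j * t ^ j \<le> real j" for j using tp(2)[of j] by (simp add: mult_left_le)
        then show "real j * t ^ j \<le> real (j + 1)" for j by (meson le_add1 of_nat_mono order_trans)
        show "(\<Sum>j\<le>K. real j * t ^ j * num j (vs N)) \<le> pgf' t" "pgf' t \<le> (\<Sum>j\<le>K. real j * t ^ j * num j (vs N)) + tail K"
          using sum_by_degree[OF subset_refl, of "\<lambda>j. real j * t ^ j" K]
            tail_bounds[OF subset_refl, of K "\<lambda>j. real j * t ^ j"] tp le
          by (auto simp: pgf'_def)
        have "real j * pmf \<pi> j * t ^ j \<le> real j ^ 2 * pmf \<pi> j + (if j = 0 then pmf \<pi> 0 else 0)" for j
        proof -
          have "real j * pmf \<pi> j * t ^ j = (real j * t ^ j) * pmf \<pi> j" by simp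
          also have "\<dots> \<le> real j * pmf \<pi> j" using le by (intro mult_right_mono) auto
          also have "\<dots> \<le> real j ^ 2 * pmf \<pi> j"
          proof (intro mult_right_mono)
            show "real j \<le> real j ^ 2" by (cases j) (auto simp: power2_eq_square)
          qed simp
          finally show ?thesis by simp
        qed
        from series_tail_bounds[OF _ this der1_mult[OF sq t], of K] tp
        show "(\<Sum>j\<le>K. real j * t ^ j * pmf \<pi> j) \<le> t * gen_fun' \<pi> t"
          "t * gen_fun' \<pi> t \<le> (\<Sum>j\<le>K. real j * t ^ j * pmf \<pi> j) + ?tau K"
          by (auto simp: gen_fun_derivatives(3)[OF sq t] mult_ac)
      qed
    qed
  qed
qed

lemma L_eq: "LL N = pg' N 1"
proof -
  interpret half_edge_exploration "vs N" "e N" by (rule explore)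
  show ?thesis by (simp add: L_def pgf'_def card_half_edges)
qed

end

text \<open>A single degree is raised, by at most 1. The sum of squares grows by at most
  \<open>2 * d N N + 1\<close>, and \<open>d N N\<close> is at most the square root of the sum of
  squares, of order \<open>sqrt N\<close>.\<close>

lemma degree_limit_make_even:
  assumes sq: "summable (\<lambda>k. real k ^ 2 * pmf \<pi> k)" and lim: "has_asymptotic_degrees d \<pi>"
    and sqlim: "(\<lambda>N. (\<Sum>i=1..N. real (d N i) ^ 2) / real N) \<longlonglongrightarrow> (\<Sum>k. real k ^ 2 * pmf \<pi> k)"
  shows "degree_limit \<pi> (\<lambda>N. make_even {1..N} (d N))"
proof
  let ?e = "\<lambda>N. make_even {1..N} (d N)"
  have Mx: "Max {1..N} = N" if "1 \<le> N" for N :: nat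
    by (intro Max_eqI) (use that in auto)
  have e: "?e N i = d N i" if "i \<in> {1..N}" "i \<noteq> N" for N i
  proof -
    have "1 \<le> N" using that by simp
    from Mx[OF this] show ?thesis using that(2) by (simp add: make_even_def)
  qed
  have eN: "d N N \<le> ?e N N" "?e N N \<le> d N N + 1" for N
    by (auto simp: make_even_def)
  show "summable (\<lambda>k. real k ^ 2 * pmf \<pi> k)" by fact
  have inv: "(\<lambda>N. 1 / real N) \<longlonglongrightarrow> 0" by (rule lim_1_over_n)
  show "has_asymptotic_degrees ?e \<pi>"
    unfolding has_asymptotic_degrees_def
  proof
    fix k
    let ?a = "\<lambda>N. real (card {i \<in> {1..N}. d N i = k})" and ?b = "\<lambda>N. real (card {i \<in> {1..N}. ?e N i = k})"
    have "(\<lambda>N. ?b N / N - ?a N / N) \<longlonglongrightarrow> 0"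
    proof (rule Lim_null_comparison[OF _ inv])
      show "eventually (\<lambda>N. norm (?b N / N - ?a N / N) \<le> 1 / N) sequentially"
      proof (rule always_eventually, rule allI)
        fix N
        have c: "card A \<le> card B + 1" if "A - {N} \<subseteq> B" "finite B" for A B :: "nat set"
        proof -
          have "A \<subseteq> insert N B" using that by auto
          then have "card A \<le> card (insert N B)" using that by (intro card_mono) auto
          also have "\<dots> \<le> card B + 1" using that by (simp add: card_insert_if)
          finally show ?thesis .
        qed
        have "card {i \<in> {1..N}. d N i = k} \<le> card {i \<in> {1..N}. ?e N i = k} + 1"
          "card {i \<in> {1..N}. ?e N i = k} \<le> card {i \<in> {1..N}. d N i = k} + 1"
          by (rule c; use e in auto)+
        then have "\<bar>?b N - ?a N\<bar> \<le> 1" by linarith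
        then show "norm (?b N / N - ?a N / N) \<le> 1 / N"
          by (simp add: diff_divide_distrib[symmetric] abs_divide divide_right_mono)
      qed
    qed
    from tendsto_add[OF this lim[unfolded has_asymptotic_degrees_def, rule_format, of k]]
    show "(\<lambda>N. ?b N / N) \<longlonglongrightarrow> pmf \<pi> k" by simp
  qed
  let ?a = "\<lambda>N. (\<Sum>i=1..N. real (d N i) ^ 2)" and ?b = "\<lambda>N. (\<Sum>i=1..N. real (?e N i) ^ 2)"
  have "(\<lambda>N. ?b N / N - ?a N / N) \<longlonglongrightarrow> 0"
  proof (rule Lim_null_comparison)
    have "(\<lambda>N. sqrt (1 / real N)) \<longlonglongrightarrow> sqrt 0" by (intro tendsto_real_sqrt inv)
    then have "(\<lambda>N. 2 * (sqrt (?a N / N) * sqrt (1 / N)) + 1 / real N) \<longlonglongrightarrow>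
        2 * (sqrt (\<Sum>k. real k ^ 2 * pmf \<pi> k) * sqrt 0) + 0"
      by (intro tendsto_intros sqlim inv)
    then show "(\<lambda>N. 2 * (sqrt (?a N / N) * sqrt (1 / N)) + 1 / real N) \<longlonglongrightarrow> 0" by simp
    show "eventually (\<lambda>N. norm (?b N / N - ?a N / N) \<le> 2 * (sqrt (?a N / N) * sqrt (1 / N)) + 1 / N) sequentially"
      using eventually_gt_at_top[of 0]
    proof eventually_elim
      case (elim N)
      have split: "(\<Sum>i=1..N. f i) = (\<Sum>i\<in>{1..N} - {N}. f i) + f N" for f :: "nat \<Rightarrow> real"
        using elim by (subst sum.remove[of _ N]) auto
      have "?b N - ?a N = real (?e N N) ^ 2 - real (d N N) ^ 2"
        unfolding split using e by simp
      moreover have "real (d N N) ^ 2 \<le> real (?e N N) ^ 2" using eN(1) by (intro power_mono) auto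
      moreover have "real (?e N N) ^ 2 \<le> (real (d N N) + 1) ^ 2"
        using eN(2)[of N] by (intro power_mono) linarith+
      moreover have "real (d N N) \<le> sqrt (?a N)"
        unfolding split by (intro real_le_rsqrt) (simp add: sum_nonneg)
      ultimately have "\<bar>?b N - ?a N\<bar> \<le> 2 * sqrt (?a N) + 1"
        by (simp add: power2_eq_square algebra_simps)
      then have "\<bar>?b N - ?a N\<bar> / N \<le> (2 * sqrt (?a N) + 1) / N" by (intro divide_right_mono) auto
      also have "\<dots> = 2 * (sqrt (?a N / N) * sqrt (1 / N)) + 1 / N"
      proof -
        have "sqrt (?a N / N) * sqrt (1 / N) = sqrt (?a N) / N"
          by (simp add: real_sqrt_divide)
        then show ?thesis by (simp add: add_divide_distrib)
      qed
      finally show ?case by (simp add: diff_divide_distrib[symmetric] abs_divide)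
    qed
  qed
  from tendsto_add[OF this sqlim] show "(\<lambda>N. ?b N / real N) \<longlonglongrightarrow> (\<Sum>k. real k ^ 2 * pmf \<pi> k)" by simp
qed

section \<open>The state of the exploration at the stopping time\<close>

context degree_limit
begin

definition close :: "real \<Rightarrow> nat \<Rightarrow> real \<Rightarrow> real \<Rightarrow> nat \<Rightarrow> nat \<Rightarrow> ustate \<Rightarrow> bool" where
  "close \<zeta> K s \<mu> m N x \<longleftrightarrow> half_edge_exploration.uinv (vs N) (e N) x \<and>
     (\<forall>j\<le>K. \<bar>half_edge_exploration.num (vs N) (e N) j (fst (snd x)) - N * (pmf \<pi> j * s ^ j)\<bar> \<le> \<zeta> * N) \<and>
     \<bar>real (card (unmatched x)) - N * (s\<^sup>2 * \<mu>)\<bar> \<le> \<zeta> * N \<and> card (fst (snd x)) = m"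

lemma stopping_size_bounds:
  fixes a :: real
  assumes "0 \<le> a" "a \<le> 1"
  shows "real (min (nat \<lfloor>a * real N\<rfloor>) (N - 1)) \<le> a * N" "a * N - 2 \<le> real (min (nat \<lfloor>a * real N\<rfloor>) (N - 1))"
proof -
  have nn: "0 \<le> a * real N" using assms by simp
  then have f: "real (nat \<lfloor>a * real N\<rfloor>) \<le> a * N" "a * N - 1 \<le> real (nat \<lfloor>a * real N\<rfloor>)"
    by (simp_all add: of_nat_nat)
  then show "real (min (nat \<lfloor>a * real N\<rfloor>) (N - 1)) \<le> a * N" unfolding of_nat_min by linarith
  have "a * real N \<le> 1 * real N" using assms by (intro mult_right_mono) auto
  moreover have "real N - 1 \<le> real (N - 1)" by (cases N) auto
  ultimately have "a * N - 2 \<le> real (N - 1)" by linarith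
  then show "a * N - 2 \<le> real (min (nat \<lfloor>a * real N\<rfloor>) (N - 1))" using f(2) unfolding of_nat_min by linarith
qed

text \<open>Write \<open>t\<close> for \<open>scale U\<close>. A \<open>good\<close> state with at
  least \<open>m N\<close> sleeping vertices has \<open>t \<ge> s - \<eta>'\<close> by the upper
  deviations alone. For such \<open>t\<close> the bound on \<open>?g t\<close> limits the picks.
  With few picks, \<open>t > s + \<eta>\<close> would leave too many sleeping vertices at the
  stopping time. Each constant depends only on those defined before it.\<close>

lemma stopped_state_close:
  fixes n :: "nat \<Rightarrow> nat"
  assumes sup: "supercritical \<pi>" and \<alpha>: "\<alpha> \<in> {0..alpha_c \<pi>}" and \<zeta>: "\<zeta> > 0"
    and ev: "\<And>N. N \<ge> 1 \<Longrightarrow> even (card (half_edges (vs N) (e N)))"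
    and n: "\<And>N. 2 * N + card (half_edges (vs N) (e N)) \<le> n N"
  defines "s \<equiv> gen_fun_inv \<pi> (1 - \<alpha>)" and "\<mu> \<equiv> gen_fun' \<pi> 1"
    and "m \<equiv> (\<lambda>N. min (nat \<lfloor>(1 - \<alpha>) * real N\<rfloor>) (N - 1))"
  shows "(\<lambda>N. measure_pmf.prob (run_until (small (m N)) ustep (n N) ([], vs N, half_edges (vs N) (e N), {}))
      {x. \<not> close \<zeta> K s \<mu> (m N) N x}) \<longlonglongrightarrow> 0"
proof -
  note r = subcritical_root[OF sup \<alpha>, folded s_def \<mu>_def]
  let ?f = "gen_fun \<pi>" and ?f' = "gen_fun' \<pi>"
  define a where "a = 1 - \<alpha>"
  have "0 \<le> pmf \<pi> 0" by simp
  then have "0 < a" using r(4) unfolding a_def by linarith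
  then have a: "0 < a" "a \<le> 1" "pmf \<pi> 0 < a" "?f s = a"
    using r(3,4) \<alpha> by (auto simp: a_def)
  have s01: "s \<in> {0..1}" using r by auto
  have d1: "der1 \<pi> 1 > 0" using r(5) gen_fun_derivatives(3)[OF sq, of 1] by (simp add: \<mu>_def)
  note mono = gen_fun_strict_mono[OF sq d1]

  have "eventually (\<lambda>t. (\<forall>j\<in>{..K}. dist (t ^ j) (s ^ j) < \<zeta> / 4) \<and> dist (\<mu> * t\<^sup>2) (\<mu> * s\<^sup>2) < \<zeta> / 4) (nhds s)"
    using \<zeta> by (intro eventually_conj eventually_ball_finite ballI tendstoD) (auto intro!: tendsto_intros filterlim_ident)
  then obtain d where d: "d > 0" "\<And>t. dist t s < d \<Longrightarrow>
      (\<forall>j\<in>{..K}. dist (t ^ j) (s ^ j) < \<zeta> / 4) \<and> dist (\<mu> * t\<^sup>2) (\<mu> * s\<^sup>2) < \<zeta> / 4"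
    unfolding eventually_nhds_metric by blast
  define \<eta> where "\<eta> = min (d / 2) (s / 2)"
  have \<eta>: "\<eta> > 0" "\<eta> \<le> s / 2" "\<eta> < d" using d r by (auto simp: \<eta>_def)
  have near: "\<bar>t ^ j - s ^ j\<bar> \<le> \<zeta> / 4" "\<bar>\<mu> * t\<^sup>2 - \<mu> * s\<^sup>2\<bar> \<le> \<zeta> / 4"
    if "\<bar>t - s\<bar> \<le> \<eta>" "j \<le> K" for t j
    using d(2)[of t] that \<eta> by (auto simp: dist_real_def intro: less_imp_le)
  \<comment> \<open>The excess of the generating function above \<open>s + \<eta>\<close>; the value
    1 is a dummy for the case that no such \<open>t\<close> is left in
    \<open>{0..1}\<close>.\<close>
  define \<theta> where "\<theta> = (if s + \<eta> \<le> 1 then ?f (s + \<eta>) - a else 1)"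
  have \<theta>: "\<theta> > 0" using r(8)[of "s + \<eta>"] \<eta> by (simp add: \<theta>_def a_def)
  have above: "a + \<theta> \<le> ?f t" if "s + \<eta> < t" "t \<le> 1" for t
    using mono[of "s + \<eta>" t] that r \<eta> by (simp add: \<theta>_def)
  \<comment> \<open>Puts \<open>(1 - \<delta>) * a\<close> midway between \<open>pmf \<pi> 0\<close>
    and \<open>a\<close>: while about \<open>a * N\<close> vertices sleep, a share of at least
    \<delta> of them has a half-edge.\<close>
  define \<delta> where "\<delta> = (a - pmf \<pi> 0) / (2 * a)"
  have \<delta>: "0 < \<delta>" "\<delta> \<le> 1" "pmf \<pi> 0 < (1 - \<delta>) * a"
    using a by (auto simp: \<delta>_def field_simps)
  \<comment> \<open>With at most \<open>\<kappa> * N\<close> picked vertices having a half-edge, and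
    deviations at most \<open>\<kappa> * N\<close>, all picked vertices number at most
    \<open>2 * \<kappa> * N / \<delta>\<close>, a quarter of
    \<open>min \<theta> \<zeta> * N\<close>.\<close>
  define \<kappa> where "\<kappa> = \<delta> * min \<theta> \<zeta> / 8"
  have \<kappa>: "\<kappa> > 0" using \<delta> \<theta> \<zeta> by (simp add: \<kappa>_def)
  have \<kappa>4: "\<kappa> / 4 > 0" using \<kappa> by simp
  obtain J where J: "eventually (\<lambda>N. tlN N J \<le> \<kappa> / 4 * N) sequentially"
    using tail_small[OF \<kappa>4] by blast
  \<comment> \<open>A lower bound for \<open>\<kappa> * t ^ J\<close> when
    \<open>t \<ge> s / 2\<close>; the right-hand side of \<open>good_picks\<close> must stay below
    \<open>\<omega> * N\<close>.\<close>
  define \<omega> where "\<omega> = \<kappa> * (s / 2) ^ J"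
  have \<omega>: "\<omega> > 0" using \<kappa> r by (simp add: \<omega>_def)
  let ?g = "\<lambda>t. t * ?f' t - t\<^sup>2 * \<mu>"
  have "continuous_on {0..1} ?f'"
    using continuous_gen_fun(2)[OF sq] gen_fun_derivatives(3)[OF sq] by (subst continuous_on_cong[OF refl]) auto
  then have "continuous_on {0..1} ?g" by (intro continuous_intros)
  then obtain d' where d': "d' > 0" "\<And>t. t \<in> {0..1} \<Longrightarrow> dist t s < d' \<Longrightarrow> dist (?g t) (?g s) < \<omega> / 8"
    unfolding continuous_on_iff using s01 \<omega> by (metis zero_less_divide_iff zero_less_numeral)
  define \<eta>' where "\<eta>' = min \<eta> (d' / 2)"
  have \<eta>': "\<eta>' > 0" "\<eta>' \<le> \<eta>" "\<eta>' < d'" "\<eta>' \<le> s / 2" using \<eta> d' by (auto simp: \<eta>'_def)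
  \<comment> \<open>Nonpositive from \<open>s\<close> on by \<open>subcritical_root\<close>, small
    just below \<open>s\<close> by continuity.\<close>
  have g: "?g t \<le> \<omega> / 8" if "s - \<eta>' \<le> t" "t \<le> 1" for t
  proof -
    have gle: "?g x \<le> 0" if "s \<le> x" "x \<le> 1" for x
    proof -
      have "x * ?f' x \<le> x * (x * \<mu>)" using r that by (intro mult_left_mono) auto
      then show ?thesis by (simp add: power2_eq_square mult_ac)
    qed
    show ?thesis
    proof (cases "s \<le> t")
      case True
      then show ?thesis using gle[of t] that \<omega> by linarith
    next
      case False
      have "t \<in> {0..1}" "dist t s < d'" using that False \<eta>' r by (auto simp: dist_real_def)
      from d'(2)[OF this] have "?g t - ?g s < \<omega> / 8" unfolding dist_real_def by linarith
      moreover have "?g s \<le> 0" using gle[of s] r by blast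
      ultimately show ?thesis by linarith
    qed
  qed
  define \<theta>' where "\<theta>' = a - ?f (s - \<eta>')"
  have \<theta>': "\<theta>' > 0" using r(7)[of "s - \<eta>'"] \<eta>' r by (simp add: \<theta>'_def a_def)
  have below: "?f t \<le> a - \<theta>'" if "0 \<le> t" "t < s - \<eta>'" for t
    using mono[of t "s - \<eta>'"] that r \<eta>' by (simp add: \<theta>'_def)
  \<comment> \<open>The common size of the errors of approximation, truncation and deviation, each
    of which is made at most \<open>ch / 8 * N\<close>.\<close>
  define ch where "ch = min (min \<theta>' \<theta>) (min \<omega> \<zeta>)"
  have ch: "ch > 0" "ch \<le> \<theta>'" "ch \<le> \<theta>" "ch \<le> \<omega>" "ch \<le> \<zeta>"
    using \<theta> \<theta>' \<omega> \<zeta> by (auto simp: ch_def)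
  have ch8: "ch / 8 > 0" using ch by simp
  obtain K0 where K0: "\<And>k. K0 \<le> k \<Longrightarrow> eventually (\<lambda>N. tlN N k \<le> ch / 8 * N) sequentially"
    using tail_small[OF ch8] by blast
  define K1 where "K1 = max K0 (max J K)"
  have K1: "J \<le> K1" "K \<le> K1" "eventually (\<lambda>N. tlN N K1 \<le> ch / 8 * N) sequentially"
    using K0 by (auto simp: K1_def)
  define \<epsilon> where "\<epsilon> = min \<kappa> (ch / (8 * (real K1 + 1)\<^sup>2))"
  have \<epsilon>: "\<epsilon> > 0" "\<epsilon> \<le> \<kappa>" using \<kappa> ch by (auto simp: \<epsilon>_def)
  have \<epsilon>K: "(real K1 + 1)\<^sup>2 * \<epsilon> \<le> ch / 8"
  proof -
    have "(real K1 + 1)\<^sup>2 * \<epsilon> \<le> (real K1 + 1)\<^sup>2 * (ch / (8 * (real K1 + 1)\<^sup>2))"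
      by (intro mult_left_mono) (auto simp: \<epsilon>_def)
    also have "\<dots> = ch / 8" by (simp add: field_simps)
    finally show ?thesis .
  qed
  have \<epsilon>K1: "real (K1 + 1) * \<epsilon> \<le> ch / 8" "\<epsilon> \<le> ch / 8"
  proof -
    have "real (K1 + 1) * \<epsilon> \<le> (real K1 + 1)\<^sup>2 * \<epsilon>"
      using \<epsilon> self_le_power[of "real K1 + 1" 2] by (intro mult_right_mono) auto
    then show "real (K1 + 1) * \<epsilon> \<le> ch / 8" using \<epsilon>K by linarith
    have "1 * \<epsilon> \<le> real (K1 + 1) * \<epsilon>" using \<epsilon> by (intro mult_right_mono) auto
    then show "\<epsilon> \<le> ch / 8" using \<open>real (K1 + 1) * \<epsilon> \<le> ch / 8\<close> by linarith
  qed
  \<comment> \<open>Gives \<open>card U \<ge> 2 * \<rho> * N\<close> from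
    \<open>t \<ge> s / 2\<close> and \<open>L \<ge> \<mu> / 2 * N\<close>.\<close>
  define \<rho> where "\<rho> = (s / 2)\<^sup>2 * \<mu> / 4"
  have \<rho>: "\<rho> > 0" using r by (simp add: \<rho>_def)
  define \<beta> where "\<beta> = min (ch / 8) (\<mu> / 2)"
  have \<beta>: "\<beta> > 0" "\<beta> \<le> ch / 8" "\<beta> \<le> \<mu> / 2" using ch r by (auto simp: \<beta>_def)
  define gap where "gap = (1 - \<delta>) * a - pmf \<pi> 0"
  have gap: "gap > 0" using \<delta> by (simp add: gap_def)
  define cst where "cst = (\<Sum>j\<le>K1. half_edge_exploration.slack \<rho> j) * (2 * \<mu>) + 1"

  have ev_num0: "eventually (\<lambda>N. nV N 0 / N < pmf \<pi> 0 + gap / 2) sequentially"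
    using gap by (intro order_tendstoD(2)[OF num_limit]) auto
  have ev_num: "eventually (\<lambda>N. \<forall>j\<in>{..K}. dist (nV N j / N) (pmf \<pi> j) < \<zeta> / 8) sequentially"
    using \<zeta> by (intro eventually_ball_finite ballI tendstoD num_limit) auto
  have ev_big: "eventually (\<lambda>N. c \<le> real N) sequentially" for c
    using filterlim_real_sequentially eventually_ge_at_top unfolding filterlim_at_top by blast

  have "eventually (\<lambda>N. measure_pmf.prob (run_until (small (m N)) ustep (n N) ([], vs N, half_edges (vs N) (e N), {}))
      {x. \<not> close \<zeta> K s \<mu> (m N) N x} \<le> cst / \<epsilon>\<^sup>2 * (1 / N)) sequentially"
    using pgf_limit[OF \<beta>(1)] J K1(3) ev_num0 ev_num ev_big[of "16 / ch"] ev_big[of "8 / \<kappa>"]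
      ev_big[of "1 / \<rho>"] ev_big[of "4 / gap"] eventually_ge_at_top[of 1]
  proof eventually_elim
    case (elim N)
    interpret half_edge_exploration "vs N" "e N" by (rule explore)
    note pgfs = elim(1)
    have N: "real N > 0" "real N \<ge> 1" using elim(10) by auto
    have pg: "\<bar>pgf t - N * ?f t\<bar> \<le> ch / 8 * N" "\<bar>pgf' t - N * (t * ?f' t)\<bar> \<le> ch / 8 * N" if "t \<in> {0..1}" for t
    proof -
      have "\<beta> * N \<le> ch / 8 * N" using \<beta> N by (intro mult_right_mono) auto
      then show "\<bar>pgf t - N * ?f t\<bar> \<le> ch / 8 * N" "\<bar>pgf' t - N * (t * ?f' t)\<bar> \<le> ch / 8 * N"
        using bspec[OF pgfs that] by linarith+
    qed
    have "\<bar>L - N * \<mu>\<bar> \<le> \<beta> * N" using bspec[OF pgfs, of 1] by (simp add: L_eq \<mu>_def)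
    moreover have "\<beta> * N \<le> \<mu> / 2 * N" "\<beta> * N \<le> ch / 8 * N" using \<beta> N by (auto intro!: mult_right_mono)
    ultimately have *: "\<bar>L - N * \<mu>\<bar> \<le> \<beta> * N" "\<beta> * N \<le> \<mu> / 2 * N" "\<beta> * N \<le> ch / 8 * N" by blast+
    have "\<mu> / 2 * N = N * \<mu> / 2" "2 * \<mu> * N = 2 * (N * \<mu>)" "0 < N * \<mu>" using r(5) N by auto
    then have L: "\<mu> / 2 * N \<le> L" "L \<le> 2 * \<mu> * N" "\<bar>L - N * \<mu>\<bar> \<le> ch / 8 * N"
      using * by linarith+
    have L0: "L > 0" using L(1) r(5) N by (meson divide_pos_pos less_le_trans mult_pos_pos zero_less_numeral)
    have m: "real (m N) \<le> a * N" "a * N - ch / 8 * N \<le> real (m N)"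
    proof -
      have "2 \<le> ch / 8 * N" using elim(6) ch by (simp add: field_simps)
      then show "real (m N) \<le> a * N" "a * N - ch / 8 * N \<le> real (m N)"
        using stopping_size_bounds[of a N] a unfolding m_def a_def by auto
    qed
    have V: "vs N \<noteq> {}" using elim(10) by (auto simp: vs_def)
    have tail1: "tail K1 \<le> ch / 8 * N" and tailJ: "tail J \<le> \<kappa> / 4 * N" using elim by auto
    have eps1: "real (K1 + 1) * (\<epsilon> * real (card (vs N))) \<le> ch / 8 * N"
      using mult_right_mono[OF \<epsilon>K1(1), of N] by simp
    have eps2: "(real K1 + 1)\<^sup>2 * (\<epsilon> * real (card (vs N))) \<le> ch / 8 * N"
      using mult_right_mono[OF \<epsilon>K, of N] by simp
    have sb: "scale U \<in> {0..1}" if "uinv (A, S, U, C)" for A S U C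
      using that scale_bounds[of U] by (auto simp: uinv_def)
    \<comment> \<open>Otherwise even the upper bound for the number of sleeping vertices would fall
      short of \<open>m N\<close>.\<close>
    have low: "s - \<eta>' \<le> scale U"
      if st: "uinv (A, S, U, C)" "good \<epsilon> \<delta> K1 (A, S, U, C)" "m N \<le> card S" for A S U C
    proof (rule ccontr)
      assume "\<not> s - \<eta>' \<le> scale U"
      then have "?f (scale U) \<le> a - \<theta>'" using sb[OF st(1)] by (intro below) auto
      then have "N * ?f (scale U) \<le> N * (a - \<theta>')" using N by (intro mult_left_mono) auto
      moreover have "real (m N) \<le> pgf (scale U) + real (K1 + 1) * (\<epsilon> * real (card (vs N))) + tail K1"
        using good_card_upper[OF st(1,2)] st(3) by linarith
      moreover have "pgf (scale U) \<le> N * ?f (scale U) + ch / 8 * N" using pg(1)[OF sb[OF st(1)]] by linarith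
      ultimately have "a * N - ch / 8 * N \<le> N * (a - \<theta>') + 3 * (ch / 8 * N)"
        using m(2) tail1 eps1 by linarith
      then have "N * \<theta>' \<le> N * (ch / 2)" by (simp add: algebra_simps)
      then have "\<theta>' \<le> ch / 2" using N by simp
      then show False using ch by linarith
    qed
    have u: "real (card U) = (scale U)\<^sup>2 * L" for U using L0 by (simp add: scale_def)
    let ?bad = "{x. \<not> (uinv x \<and> good \<epsilon> \<delta> K1 x \<and> real (picks x) \<le> \<kappa> * N \<and> card (fst (snd x)) = m N)}"
    have "measure_pmf.prob (run_until (small (m N)) ustep (n N) initial) ?bad \<le>
      ((\<Sum>j\<le>K1. slack \<rho> j) * L + card (vs N)) / (\<epsilon> * real (card (vs N)))\<^sup>2"
    proof (rule run_until_good)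
      show "even (card H)" using ev elim(10) by simp
      show "vs N \<noteq> {}" "L > 0" "\<epsilon> > 0" "0 \<le> \<delta>" "\<delta> \<le> 1" "\<rho> > 0" "0 \<le> \<kappa> * real N"
        using V L0 \<epsilon> \<delta> \<rho> \<kappa> N by auto
      show "2 * card (vs N) + card H \<le> n N" using n by simp
      show "m N \<le> card (vs N)" unfolding m_def by auto
      show "num 0 (vs N) \<le> (1 - \<delta>) * real (m N)"
      proof -
        have "num 0 (vs N) \<le> (pmf \<pi> 0 + gap / 2) * N" using elim(4) N by (simp add: field_simps)
        moreover have "(1 - \<delta>) * (a * N - 2) \<le> (1 - \<delta>) * real (m N)"
          using stopping_size_bounds(2)[of a N] a \<delta> unfolding m_def a_def by (intro mult_left_mono) auto
        moreover have "(1 - \<delta>) * 2 \<le> gap / 2 * N" using elim(9) gap \<delta> by (simp add: field_simps)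
        moreover have "(1 - \<delta>) * (a * N - 2) = (gap + pmf \<pi> 0) * N - (1 - \<delta>) * 2"
          by (simp add: gap_def algebra_simps)
        ultimately show ?thesis by (simp add: algebra_simps)
      qed
      fix A S U C assume st: "uinv (A, S, U, C)" "good \<epsilon> \<delta> K1 (A, S, U, C)" "m N < card S"
      have "s / 2 \<le> scale U" using low[OF st(1,2)] st(3) \<eta>' by simp
      then have "(s / 2)\<^sup>2 \<le> (scale U)\<^sup>2" using r by (intro power_mono) auto
      then have "(s / 2)\<^sup>2 * (\<mu> / 2 * N) \<le> (scale U)\<^sup>2 * L"
        using L N r(5) by (intro mult_mono) auto
      then have "2 * \<rho> * N \<le> real (card U)" unfolding u by (simp add: \<rho>_def mult_ac)
      moreover have "1 \<le> \<rho> * N" using elim(8) \<rho> by (simp add: field_simps)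
      ultimately show "\<rho> * real (card (vs N)) \<le> real (card U) - 1" by simp
    next
      fix S U C assume st: "uinv ([], S, U, C)" "good \<epsilon> \<delta> K1 ([], S, U, C)" "m N < card S"
      define t where "t = scale U"
      have t: "s - \<eta>' \<le> t" "t \<in> {0..1}" using low[OF st(1,2)] st(3) sb[OF st(1)] by (auto simp: t_def)
      have "t ^ J * (card (C \<inter> P) - tail J) \<le>
          pgf' t - t\<^sup>2 * L + (real K1 + 1)\<^sup>2 * (\<epsilon> * real (card (vs N))) + tail K1"
        unfolding t_def by (rule good_picks[OF st(1,2) K1(1) L0 \<epsilon>(1)])
      \<comment> \<open>The four errors stem from \<open>pgf'\<close>, from \<open>L\<close>, from
        the deviations and from the truncation.\<close>
      also have "\<dots> \<le> N * ?g t + 4 * (ch / 8 * N)"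
      proof -
        have "t\<^sup>2 * (N * \<mu> - L) \<le> 1 * (ch / 8 * N)"
        proof (rule order.trans[OF mult_left_mono mult_right_mono])
          show "N * \<mu> - L \<le> ch / 8 * N" using L(3) by linarith
          show "t\<^sup>2 \<le> 1" using t by (simp add: power_le_one)
        qed (use ch N in auto)
        moreover have "pgf' t \<le> N * (t * ?f' t) + ch / 8 * N" using pg(2)[OF t(2)] by linarith
        ultimately show ?thesis using eps2 tail1 by (simp add: algebra_simps)
      qed
      also have "\<dots> \<le> N * (\<omega> / 8) + 4 * (\<omega> / 8 * N)"
        using g[of t] t ch N by (intro add_mono mult_left_mono mult_right_mono) auto
      finally have *: "t ^ J * (card (C \<inter> P) - tail J) \<le> 5 / 8 * \<omega> * N" by simp
      \<comment> \<open>With \<open>tail J \<le> \<kappa> / 4 * N\<close> and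
        \<open>1 \<le> \<kappa> / 8 * N\<close> the three shares add up to exactly
        \<open>\<kappa> * N\<close>.\<close>
      have "real (card (C \<inter> P)) - tail J \<le> 5 / 8 * \<kappa> * N"
      proof (cases "0 \<le> real (card (C \<inter> P)) - tail J")
        case True
        have "(s / 2) ^ J \<le> t ^ J" using t \<eta>' r by (intro power_mono) auto
        then have "(s / 2) ^ J * (card (C \<inter> P) - tail J) \<le> t ^ J * (card (C \<inter> P) - tail J)"
          using True by (rule mult_right_mono)
        also have "\<dots> \<le> (s / 2) ^ J * (5 / 8 * \<kappa> * N)" using * by (simp add: \<omega>_def mult_ac)
        finally show ?thesis using r by (simp add: mult_le_cancel_left_pos)
      next
        case False
        have "0 \<le> 5 / 8 * \<kappa> * N" using \<kappa> N by simp
        then show ?thesis using False by linarith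
      qed
      moreover have "1 \<le> \<kappa> / 8 * N" using elim(7) \<kappa> by (simp add: field_simps)
      ultimately show "real (card (C \<inter> P)) + 1 \<le> \<kappa> * N" using tailJ by (simp add: algebra_simps)
    qed
    moreover have "{x. \<not> close \<zeta> K s \<mu> (m N) N x} \<subseteq> ?bad"
    proof (rule subsetI, rule ccontr)
      fix x assume "x \<in> {x. \<not> close \<zeta> K s \<mu> (m N) N x}" "x \<notin> ?bad"
      then have x: "\<not> close \<zeta> K s \<mu> (m N) N x" "uinv x" "good \<epsilon> \<delta> K1 x" "real (picks x) \<le> \<kappa> * N" "card (fst (snd x)) = m N" by auto
      obtain A S U C where xx: "x = (A, S, U, C)" by (metis prod_cases4)
      note st = x(2-4)[unfolded xx]
      define t where "t = scale U"
      define c where "c = (\<kappa> * N + \<epsilon> * real (card (vs N))) / \<delta>"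
      have cS: "card S = m N" using x(5) by (simp add: xx)
      have t: "s - \<eta>' \<le> t" "t \<in> {0..1}" using low[OF st(1,2)] cS sb[OF st(1)] by (auto simp: t_def)
      note lows = good_lower[OF st(1,2) \<delta>(1) st(3) \<epsilon>(1), folded c_def t_def]
      have c: "c \<le> \<theta> / 4 * N" "c \<le> \<zeta> / 4 * N"
      proof -
        have "\<kappa> * N + \<epsilon> * real (card (vs N)) \<le> 2 * \<kappa> * N"
          using mult_right_mono[OF \<epsilon>(2), of N] by simp
        then have "c \<le> 2 * \<kappa> * N / \<delta>" unfolding c_def using \<delta> by (intro divide_right_mono) auto
        also have "\<dots> = min \<theta> \<zeta> / 4 * N" using \<delta> by (simp add: \<kappa>_def)
        finally have "c \<le> min \<theta> \<zeta> / 4 * N" .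
        moreover have "min \<theta> \<zeta> / 4 * N \<le> \<theta> / 4 * N" "min \<theta> \<zeta> / 4 * N \<le> \<zeta> / 4 * N"
          using N by (auto intro!: mult_right_mono)
        ultimately show "c \<le> \<theta> / 4 * N" "c \<le> \<zeta> / 4 * N" by linarith+
      qed
      \<comment> \<open>Otherwise errors of at most \<open>5 / 8 * \<theta> * N\<close> would have
        to absorb the excess \<open>\<theta> * N\<close>.\<close>
      have "t \<le> s + \<eta>"
      proof (rule ccontr)
        assume "\<not> t \<le> s + \<eta>"
        then have "a + \<theta> \<le> ?f t" using t by (intro above) auto
        then have "N * (a + \<theta>) \<le> N * ?f t" using N by (intro mult_left_mono) auto
        moreover have "N * ?f t - ch / 8 * N \<le> pgf t" using pg(1)[OF t(2)] by linarith
        moreover have "pgf t - tail K1 - real (K1 + 1) * (\<epsilon> * real (card (vs N))) - c \<le> m N"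
          using lows(3) cS by simp
        ultimately have "N * (a + \<theta>) \<le> a * N + 3 * (ch / 8 * N) + \<theta> / 4 * N"
          using m(1) tail1 eps1 c(1) by linarith
        moreover have "3 * (ch / 8 * N) \<le> 3 * (\<theta> / 8 * N)" using ch N by simp
        ultimately have "N * \<theta> \<le> N * (5 / 8 * \<theta>)" by (simp add: algebra_simps)
        then show False using N \<theta> by simp
      qed
      then have ts: "\<bar>t - s\<bar> \<le> \<eta>" using t \<eta>' by auto
      have "\<bar>num j S - N * (pmf \<pi> j * s ^ j)\<bar> \<le> \<zeta> * N" if j: "j \<le> K" for j
      proof -
        have "\<bar>t ^ j * num j (vs N) - N * (pmf \<pi> j * s ^ j)\<bar> \<le> 3 / 8 * \<zeta> * N"
        proof -
          have "dist (nV N j / N) (pmf \<pi> j) < \<zeta> / 8" using elim(5) j by simp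
          then have n1: "\<bar>num j (vs N) / N - pmf \<pi> j\<bar> \<le> \<zeta> / 8" by (simp add: dist_real_def)
          have "t ^ j * (num j (vs N) / N) - pmf \<pi> j * s ^ j = t ^ j * (num j (vs N) / N - pmf \<pi> j) + pmf \<pi> j * (t ^ j - s ^ j)"
            by (simp add: algebra_simps)
          then have "\<bar>t ^ j * (num j (vs N) / N) - pmf \<pi> j * s ^ j\<bar> \<le> \<bar>t ^ j\<bar> * \<bar>num j (vs N) / N - pmf \<pi> j\<bar> + \<bar>pmf \<pi> j\<bar> * \<bar>t ^ j - s ^ j\<bar>"
            unfolding abs_mult[symmetric] by linarith
          also have "\<dots> \<le> 1 * (\<zeta> / 8) + 1 * (\<zeta> / 4)"
            using n1 near(1)[OF ts j] t by (intro add_mono mult_mono) (auto simp: pmf_le_1 power_le_one)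
          finally have "N * \<bar>t ^ j * (num j (vs N) / N) - pmf \<pi> j * s ^ j\<bar> \<le> N * (3 / 8 * \<zeta>)"
            using N by (intro mult_left_mono) auto
          moreover have "N * \<bar>t ^ j * (num j (vs N) / N) - pmf \<pi> j * s ^ j\<bar> = \<bar>N * (t ^ j * (num j (vs N) / N) - pmf \<pi> j * s ^ j)\<bar>"
            using N by (simp add: abs_mult)
          moreover have "N * (t ^ j * (num j (vs N) / N) - pmf \<pi> j * s ^ j) = t ^ j * num j (vs N) - N * (pmf \<pi> j * s ^ j)"
            using N by (simp add: algebra_simps)
          ultimately show ?thesis by (simp add: mult_ac)
        qed
        moreover have "t ^ j * num j (vs N) - \<epsilon> * real (card (vs N)) - c \<le> num j S"
          "num j S \<le> t ^ j * num j (vs N) + \<epsilon> * real (card (vs N))"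
          using lows(1,2)[of j] j K1 by auto
        moreover have "\<epsilon> * real (card (vs N)) \<le> \<zeta> / 8 * N"
        proof -
          have "\<epsilon> \<le> \<zeta> / 8" using \<epsilon>K1(2) ch(5) by linarith
          from mult_right_mono[OF this, of N] show ?thesis by simp
        qed
        moreover have "0 \<le> \<zeta> * N" using \<zeta> N by simp
        ultimately show ?thesis using c(2) unfolding abs_le_iff by linarith
      qed
      moreover have "\<bar>real (card U) - N * (s\<^sup>2 * \<mu>)\<bar> \<le> \<zeta> * N"
      proof -
        have "real (card U) - N * (s\<^sup>2 * \<mu>) = t\<^sup>2 * (L - N * \<mu>) + N * (\<mu> * t\<^sup>2 - \<mu> * s\<^sup>2)"
          unfolding u t_def by (simp add: algebra_simps)
        also have "\<bar>\<dots>\<bar> \<le> \<bar>t\<^sup>2\<bar> * \<bar>L - N * \<mu>\<bar> + \<bar>real N\<bar> * \<bar>\<mu> * t\<^sup>2 - \<mu> * s\<^sup>2\<bar>"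
          unfolding abs_mult[symmetric] by (rule abs_triangle_ineq)
        also have "\<dots> \<le> 1 * (ch / 8 * N) + N * (\<zeta> / 4)"
          using L(3) near(2)[OF ts le0] t by (intro add_mono mult_mono) (auto simp: power_le_one)
        also have "\<dots> \<le> \<zeta> * N"
        proof -
          have "ch * N \<le> \<zeta> * N" "0 \<le> \<zeta> * N" using ch(5) \<zeta> N by (auto intro: mult_right_mono)
          then show ?thesis by (simp add: mult.commute)
        qed
        finally show ?thesis .
      qed
      ultimately have "close \<zeta> K s \<mu> (m N) N x" using x(2,5) by (simp add: close_def xx)
      then show False using x(1) by simp
    qed
    then have "measure_pmf.prob (run_until (small (m N)) ustep (n N) initial) {x. \<not> close \<zeta> K s \<mu> (m N) N x} \<le>
      measure_pmf.prob (run_until (small (m N)) ustep (n N) initial) ?bad"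
      by (intro measure_pmf.finite_measure_mono) auto
    moreover have "((\<Sum>j\<le>K1. slack \<rho> j) * L + card (vs N)) / (\<epsilon> * real (card (vs N)))\<^sup>2 \<le> cst / \<epsilon>\<^sup>2 * (1 / N)"
    proof -
      have "0 \<le> (\<Sum>j\<le>K1. slack \<rho> j)" using \<rho> by (intro sum_nonneg) (simp add: slack_def)
      then have "(\<Sum>j\<le>K1. slack \<rho> j) * L \<le> (\<Sum>j\<le>K1. slack \<rho> j) * (2 * \<mu> * N)"
        using L by (intro mult_left_mono) auto
      then have "(\<Sum>j\<le>K1. slack \<rho> j) * L + card (vs N) \<le> cst * N"
        by (simp add: cst_def algebra_simps)
      then have "((\<Sum>j\<le>K1. slack \<rho> j) * L + card (vs N)) / (\<epsilon> * real (card (vs N)))\<^sup>2 \<le> cst * N / (\<epsilon> * real (card (vs N)))\<^sup>2"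
        by (intro divide_right_mono) auto
      also have "\<dots> = cst / \<epsilon>\<^sup>2 * (1 / N)" using N by (simp add: power2_eq_square field_simps)
      finally show ?thesis .
    qed
    ultimately show ?case unfolding initial_def by linarith
  qed
  moreover have "(\<lambda>N. cst / \<epsilon>\<^sup>2 * (1 / real N)) \<longlonglongrightarrow> 0"
    using tendsto_mult[OF tendsto_const lim_1_over_n, of "cst / \<epsilon>\<^sup>2"] by simp
  ultimately show ?thesis
    by (rule tendsto_sandwich[OF always_eventually[OF allI[OF measure_nonneg]] _ tendsto_const])
qed

end

section \<open>Degrees in the graph induced by the sleeping vertices\<close>

text \<open>All half-edges of a sleeping vertex are in \<open>U\<close>, and a partner lies in
  \<open>half_edges S e\<close> exactly when its vertex is in \<open>S\<close>, so the degrees in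
  the induced graph are values of \<open>deg_in\<close>. The deterministic lower bound
  \<open>u\<close> for \<open>card U\<close> makes the estimate uniform over the states.\<close>

lemma (in half_edge_exploration) prob_induced_degrees:
  fixes u \<eta> :: real and K k :: nat
  assumes inv: "uinv (A, S, U, C)" and u: "u > 0" "u \<le> card U" "8 * K \<le> u" and \<eta>: "\<eta> > 0"
  defines "p \<equiv> card (half_edges S e) / card U"
  shows "measure_pmf.prob (pmf_of_set (perfect_matchings U))
      {M. \<exists>j\<le>K. \<eta> < \<bar>real (card {v \<in> S \<inter> D j. vertex_degree (graph_of_matching S (inner S M)) v = k}) - num j S * binom j p k\<bar>}
    \<le> (K + 1) * ((card V + 3 * 4 ^ K * (32 * (real K)\<^sup>2 / u) * (real (card V))\<^sup>2) / \<eta>\<^sup>2)"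
proof -
  note fin = uinv_finite[OF inv]
  have I: "S \<subseteq> V" "U \<subseteq> H" "half_edges S e \<subseteq> U" using inv by (auto simp: uinv_def)
  let ?P = "pmf_of_set (perfect_matchings U)"
  let ?T = "\<lambda>v. half_edges {v} e"
  let ?B = "\<lambda>j. {M. \<eta> < \<bar>real (card {v \<in> S \<inter> D j. deg_in (half_edges S e) (?T v) M = k}) - real (card (S \<inter> D j)) * binom j p k\<bar>}"
  let ?c = "(card V + 3 * 4 ^ K * (32 * (real K)\<^sup>2 / u) * (real (card V))\<^sup>2) / \<eta>\<^sup>2"
  have deg: "vertex_degree (graph_of_matching S (inner S M)) v = deg_in (half_edges S e) (?T v) M"
    if M: "M \<in> perfect_matchings U" and v: "v \<in> S" for M v
  proof -
    have "{h \<in> U. fst h = v \<and> fst (partner M h) \<in> S} = {h \<in> ?T v. partner M h \<in> half_edges S e}"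
    proof -
      have "fst (partner M h) \<in> S \<longleftrightarrow> partner M h \<in> half_edges S e" if "h \<in> U" for h
      proof -
        have "partner M h \<in> H" using partner_edge(3)[OF M that] I by blast
        then show ?thesis by (auto simp: half_edges_def)
      qed
      moreover have "h \<in> U \<and> fst h = v \<longleftrightarrow> h \<in> ?T v" for h
      proof
        show "h \<in> U \<and> fst h = v \<Longrightarrow> h \<in> ?T v" using I(2) by (auto simp: half_edges_def)
        show "h \<in> ?T v \<Longrightarrow> h \<in> U \<and> fst h = v" using I(3) v by (auto simp: half_edges_def)
      qed
      ultimately show ?thesis by blast
    qed
    then show ?thesis unfolding vertex_degree_inner[OF M fin(2) v] deg_in_def by simp
  qed
  have "measure_pmf.prob ?P
      {M. \<exists>j\<le>K. \<eta> < \<bar>real (card {v \<in> S \<inter> D j. vertex_degree (graph_of_matching S (inner S M)) v = k}) - num j S * binom j p k\<bar>}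
    \<le> measure_pmf.prob ?P (\<Union>j\<in>{..K}. ?B j)"
  proof (rule measure_pmf.finite_measure_mono_AE)
    show "AE M in ?P. M \<in> {M. \<exists>j\<le>K. \<eta> < \<bar>real (card {v \<in> S \<inter> D j. vertex_degree (graph_of_matching S (inner S M)) v = k}) - num j S * binom j p k\<bar>}
      \<longrightarrow> M \<in> (\<Union>j\<in>{..K}. ?B j)"
      unfolding AE_measure_pmf_iff set_pmf_matchings[OF fin(2,4)]
    proof (intro ballI impI)
      fix M assume M: "M \<in> perfect_matchings U"
      have "{v \<in> S \<inter> D j. vertex_degree (graph_of_matching S (inner S M)) v = k} =
          {v \<in> S \<inter> D j. deg_in (half_edges S e) (?T v) M = k}" for j
        using deg[OF M] by auto
      moreover assume "M \<in> {M. \<exists>j\<le>K. \<eta> < \<bar>real (card {v \<in> S \<inter> D j. vertex_degree (graph_of_matching S (inner S M)) v = k}) - num j S * binom j p k\<bar>}"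
      ultimately show "M \<in> (\<Union>j\<in>{..K}. ?B j)" by (auto simp: num_def)
    qed
  qed simp
  also have "\<dots> \<le> (\<Sum>j\<le>K. measure_pmf.prob ?P (?B j))"
    by (intro measure_pmf.finite_measure_subadditive_finite) auto
  also have "\<dots> \<le> (\<Sum>j\<le>K. ?c)"
  proof (rule sum_mono)
    fix j assume "j \<in> {..K}"
    then have j: "j \<le> K" "real j \<le> K" by auto
    let ?n = "card (S \<inter> D j)" and ?err = "16 * (real j)\<^sup>2 / (real (card U) - 4 * real j)"
    have jU: "real (4 * j) < real (card U)" using j u by simp
    have "measure_pmf.prob ?P (?B j) \<le> (?n + 3 * 4 ^ j * ?err * (real ?n)\<^sup>2) / \<eta>\<^sup>2"
      unfolding p_def
    proof (rule prob_degree_count[OF fin(2,4) I(3)])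
      show "4 * j < card U" using jU unfolding of_nat_less_iff .
      show "finite (S \<inter> D j)" using fin by simp
      show "half_edges {v} e \<subseteq> half_edges S e \<and> card (half_edges {v} e) = j \<and> finite (half_edges {v} e)"
        if "v \<in> S \<inter> D j" for v
        using that by (auto simp: half_edges_def D_def)
      show "half_edges {v} e \<inter> half_edges {w} e = {}" if "v \<noteq> w" for v w
        using that by (auto simp: half_edges_def)
    qed fact
    also have "\<dots> \<le> ?c"
    proof (intro divide_right_mono add_mono mult_mono)
      have "?n \<le> card V" using I finite_V by (intro card_mono) auto
      then show n: "real ?n \<le> real (card V)" by simp
      then show "(real ?n)\<^sup>2 \<le> (real (card V))\<^sup>2" by (intro power_mono) auto
      show "(4::real) ^ j \<le> 4 ^ K" using j by (intro power_increasing) auto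
      have "?err \<le> 16 * (real K)\<^sup>2 / (u / 2)"
        using j u by (intro frac_le mult_left_mono power_mono) auto
      then show "?err \<le> 32 * (real K)\<^sup>2 / u" by simp
      show "0 \<le> ?err" using jU by (intro divide_nonneg_nonneg) auto
    qed (use u in auto)
    finally show "measure_pmf.prob ?P (?B j) \<le> ?c" .
  qed
  also have "\<dots> = (K + 1) * ?c" by simp
  finally show ?thesis .
qed

lemma binom_nearby:
  fixes \<delta> p :: real
  assumes "\<delta> > 0"
  obtains \<omega> where "\<omega> > 0" "\<And>p' j. \<bar>p' - p\<bar> < \<omega> \<Longrightarrow> j \<le> K \<Longrightarrow> \<bar>binom j p' k - binom j p k\<bar> \<le> \<delta>"
proof -
  have "eventually (\<lambda>p'. \<forall>j\<in>{..K}. dist (binom j p' k) (binom j p k) < \<delta>) (nhds p)"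
    using assms unfolding binom_def
    by (intro eventually_ball_finite ballI tendstoD) (auto intro!: tendsto_intros filterlim_ident)
  then obtain \<omega> where "\<omega> > 0" "\<And>p'. dist p' p < \<omega> \<Longrightarrow> \<forall>j\<in>{..K}. dist (binom j p' k) (binom j p k) < \<delta>"
    unfolding eventually_nhds_metric by blast
  then show ?thesis using that[of \<omega>] by (auto simp: dist_real_def intro!: less_imp_le)
qed

lemma proportion_near:
  fixes Z m N a q \<theta> :: real
  assumes "0 \<le> q" "q \<le> 1" "0 < a" "0 < N" "\<theta> \<le> a / 2" "4 * \<theta> \<le> \<epsilon> * a"
    and "\<bar>Z - N * (a * q)\<bar> \<le> \<theta> * N" "\<bar>m - a * N\<bar> \<le> \<theta> * N"
  shows "\<bar>Z / m - q\<bar> \<le> \<epsilon>"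
proof -
  have "\<theta> * N \<le> a / 2 * N" using assms by (intro mult_right_mono) auto
  then have m: "a / 2 * N \<le> m" using assms(8) by (simp add: abs_le_iff)
  have "0 < a / 2 * N" using assms by simp
  then have m0: "m > 0" using m by linarith
  have "\<bar>q\<bar> * \<bar>m - a * N\<bar> \<le> 1 * (\<theta> * N)" using assms by (intro mult_mono) auto
  then have "\<bar>q * (m - a * N)\<bar> \<le> \<theta> * N" by (simp add: abs_mult)
  moreover have "Z - q * m = (Z - N * (a * q)) - q * (m - a * N)" by (simp add: algebra_simps)
  ultimately have "\<bar>Z - q * m\<bar> \<le> 2 * \<theta> * N" using assms(7) by linarith
  also have "\<dots> \<le> \<epsilon> * (a / 2 * N)"
    using mult_right_mono[OF assms(6), of "N / 2"] assms(4) by (simp add: mult_ac)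
  also have "\<dots> \<le> \<epsilon> * m"
  proof (intro mult_left_mono m)
    have "0 \<le> \<theta> * N" using assms(7) by linarith
    then have "0 \<le> \<theta>" using assms(4) by (simp add: zero_le_mult_iff)
    then have "0 \<le> \<epsilon> * a" using assms(6) by linarith
    then show "0 \<le> \<epsilon>" using assms(3) by (simp add: zero_le_mult_iff)
  qed
  finally have "\<bar>Z - q * m\<bar> / m \<le> \<epsilon>" using m0 by (simp add: divide_le_eq)
  moreover have "Z / m - q = (Z - q * m) / m" using m0 by (simp add: field_simps)
  ultimately show ?thesis using m0 by (simp add: abs_divide)
qed

context degree_limit
begin

text \<open>The numerator of the thinning probability: divided by \<open>card U\<close>, which is
  close to \<open>N * s\<^sup>2 * \<mu>\<close>, it gives a ratio close to \<open>p\<close>.\<close>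

lemma close_half_edges:
  fixes p u y x0 :: real
  assumes close: "close \<zeta> K s \<mu> m N (A, S, U, C)" and s: "s \<in> {0..1}"
    and tails: "tlN N K \<le> \<sigma> * N" "(\<Sum>k. real k ^ 2 * pmf \<pi> k) - (\<Sum>j\<le>K. real j ^ 2 * pmf \<pi> j) \<le> \<sigma>"
  shows "\<bar>real (card (half_edges S (e N))) - N * (s * gen_fun' \<pi> s)\<bar> \<le> ((real K + 1)\<^sup>2 * \<zeta> + 2 * \<sigma>) * N"
proof -
  interpret half_edge_exploration "vs N" "e N" by (rule explore)
  have S: "S \<subseteq> vs N" using close by (auto simp: close_def uinv_def)
  then have fS: "finite S" by (rule finite_subset) simp
  have num: "\<bar>num j S - N * (pmf \<pi> j * s ^ j)\<bar> \<le> \<zeta> * N" if "j \<le> K" for j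
    using close that by (simp add: close_def)
  then have z: "0 \<le> \<zeta> * N" using abs_ge_zero order_trans by blast
  have c: "real (card (half_edges S (e N))) = (\<Sum>j\<le>K. real j * num j S) + (\<Sum>v\<in>{v\<in>S. K < e N v}. real (e N v))"
    using sum_by_degree[OF S, of real K] by (simp add: card_half_edges[OF fS])
  have t: "0 \<le> (\<Sum>v\<in>{v\<in>S. K < e N v}. real (e N v))" "(\<Sum>v\<in>{v\<in>S. K < e N v}. real (e N v)) \<le> tail K"
    using tail_bounds[OF S, of K real] by auto
  have sp: "0 \<le> s ^ j" "s ^ j \<le> 1" for j using s by (auto simp: power_le_one)
  have le: "real j * pmf \<pi> j * s ^ j \<le> real j ^ 2 * pmf \<pi> j + (if j = 0 then pmf \<pi> 0 else 0)" for j
  proof -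
    have "real j * pmf \<pi> j * s ^ j \<le> (real j * pmf \<pi> j) * 1" using sp by (intro mult_left_mono) auto
    also have "\<dots> = real j * pmf \<pi> j" by simp
    also have "\<dots> \<le> real j ^ 2 * pmf \<pi> j"
    proof (intro mult_right_mono)
      show "real j \<le> real j ^ 2" by (cases j) (auto simp: power2_eq_square)
    qed simp
    finally show ?thesis by simp
  qed
  let ?x = "s * gen_fun' \<pi> s" and ?X = "\<Sum>j\<le>K. real j * pmf \<pi> j * s ^ j"
  have x: "?X \<le> ?x" "?x \<le> ?X + \<sigma>"
    using series_tail_bounds[OF _ le der1_mult[OF sq s], of K] sp tails(2)
    by (auto simp: gen_fun_derivatives(3)[OF sq s])
  have "\<bar>(\<Sum>j\<le>K. real j * num j S) - N * ?X\<bar> = \<bar>\<Sum>j\<le>K. real j * (num j S - N * (pmf \<pi> j * s ^ j))\<bar>"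
    by (simp add: sum_distrib_left sum_subtractf[symmetric] algebra_simps)
  also have "\<dots> \<le> (\<Sum>j\<le>K. (real K + 1) * (\<zeta> * N))"
    using num z by (intro order.trans[OF sum_abs] sum_mono) (auto simp: abs_mult intro!: mult_mono)
  also have "\<dots> = (real K + 1)\<^sup>2 * \<zeta> * N" by (simp add: power2_eq_square)
  finally have "\<bar>(\<Sum>j\<le>K. real j * num j S) - N * ?X\<bar> \<le> (real K + 1)\<^sup>2 * \<zeta> * N" .
  moreover have "N * ?X \<le> N * ?x" "N * ?x \<le> N * ?X + \<sigma> * N"
    using mult_left_mono[OF x(1), of N] mult_left_mono[OF x(2), of N] by (simp_all add: algebra_simps)
  moreover have "((real K + 1)\<^sup>2 * \<zeta> + 2 * \<sigma>) * N = (real K + 1)\<^sup>2 * \<zeta> * N + \<sigma> * N + \<sigma> * N"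
    by (simp add: algebra_simps)
  ultimately show ?thesis using c t tails(1) unfolding abs_le_iff by linarith
qed

text \<open>Three errors of at most \<open>\<delta> * N\<close> for each degree up to
  \<open>K\<close>: the count given the state, the value \<open>b\<close> at the actual thinning
  probability instead of the limiting \<open>B\<close>, and the number of sleeping vertices of that
  degree. Larger degrees are left to the tails.\<close>

lemma close_degree_sum:
  fixes Z :: "nat \<Rightarrow> real" and B :: "nat \<Rightarrow> real"
  assumes close: "close \<zeta> K' s \<mu> m N (A, S, U, C)" and s: "s \<in> {0..1}" and K: "K \<le> K'"
    and tails: "tlN N K \<le> \<sigma> * N" "(\<Sum>k. real k ^ 2 * pmf \<pi> k) - (\<Sum>j\<le>K. real j ^ 2 * pmf \<pi> j) \<le> \<sigma>"
    and B: "\<And>j. 0 \<le> B j" "\<And>j. B j \<le> 1" "(\<lambda>j. pmf \<pi> j * s ^ j * B j) sums z"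
    and b: "\<And>j. j \<le> K \<Longrightarrow> \<bar>b j - B j\<bar> \<le> \<delta>"
    and Z: "\<And>j. j \<le> K \<Longrightarrow> \<bar>real (card {v \<in> S \<inter> half_edge_exploration.D (vs N) (e N) j. Q v}) -
        half_edge_exploration.num (vs N) (e N) j S * b j\<bar> \<le> \<delta> * N" and "\<zeta> \<le> \<delta>"
  shows "\<bar>real (card {v \<in> S. Q v}) - N * z\<bar> \<le> (3 * (real K + 1) * \<delta> + 2 * \<sigma>) * N"
proof -
  interpret half_edge_exploration "vs N" "e N" by (rule explore)
  have S: "S \<subseteq> vs N" using close by (auto simp: close_def uinv_def)
  then have fS: "finite S" by (rule finite_subset) simp
  have SQ: "{v \<in> S. Q v} \<subseteq> vs N" using S by auto
  have c: "real (card {v \<in> S. Q v}) = (\<Sum>j\<le>K. num j {v \<in> S. Q v}) + (\<Sum>v\<in>{v\<in>{v \<in> S. Q v}. K < e N v}. 1)"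
    using sum_by_degree[OF SQ, of "\<lambda>_. 1" K] by simp
  have t: "0 \<le> (\<Sum>v\<in>{v\<in>{v \<in> S. Q v}. K < e N v}. 1::real)" "(\<Sum>v\<in>{v\<in>{v \<in> S. Q v}. K < e N v}. 1) \<le> tail K"
    using tail_bounds[OF SQ, of K "\<lambda>_. 1"] by auto
  have sp: "0 \<le> s ^ j" "s ^ j \<le> 1" for j using s by (auto simp: power_le_one)
  have le: "pmf \<pi> j * s ^ j * B j \<le> real j ^ 2 * pmf \<pi> j + (if j = 0 then pmf \<pi> 0 else 0)" for j
  proof -
    have "pmf \<pi> j * s ^ j * B j \<le> pmf \<pi> j * 1 * 1"
      using sp B by (intro mult_mono) auto
    also have "\<dots> \<le> real j ^ 2 * pmf \<pi> j + (if j = 0 then pmf \<pi> 0 else 0)"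
    proof (cases j)
      case (Suc i)
      then have "1 * pmf \<pi> j \<le> real j ^ 2 * pmf \<pi> j" by (intro mult_right_mono) (auto simp: one_le_power)
      then show ?thesis using Suc by simp
    qed simp
    finally show ?thesis .
  qed
  let ?X = "\<Sum>j\<le>K. pmf \<pi> j * s ^ j * B j"
  have x: "?X \<le> z" "z \<le> ?X + \<sigma>"
    using series_tail_bounds[OF _ le B(3), of K] sp B tails(2) by auto
  have each: "\<bar>num j {v \<in> S. Q v} - N * (pmf \<pi> j * s ^ j * B j)\<bar> \<le> 3 * (\<delta> * N)" if j: "j \<le> K" for j
  proof -
    have "{v \<in> S. Q v} \<inter> D j = {v \<in> S \<inter> D j. Q v}" by auto
    then have "\<bar>num j {v \<in> S. Q v} - num j S * b j\<bar> \<le> \<delta> * N" using Z[OF j] by (simp add: num_def)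
    moreover have "\<bar>num j S * (b j - B j)\<bar> \<le> N * \<delta>"
      unfolding abs_mult using num_le(2,3)[OF S, of j] b[OF j] by (intro mult_mono) auto
    moreover have "\<bar>(num j S - N * (pmf \<pi> j * s ^ j)) * B j\<bar> \<le> \<zeta> * N * 1"
      unfolding abs_mult
    proof (rule mult_mono)
      show nj: "\<bar>num j S - N * (pmf \<pi> j * s ^ j)\<bar> \<le> \<zeta> * N" using close j K by (simp add: close_def)
      show "0 \<le> \<zeta> * N" using nj abs_ge_zero order_trans by blast
    qed (use B in auto)
    moreover have "\<zeta> * N \<le> \<delta> * N" using \<open>\<zeta> \<le> \<delta>\<close> by (intro mult_right_mono) auto
    moreover have "num j S * b j - N * (pmf \<pi> j * s ^ j * B j) =
        num j S * (b j - B j) + (num j S - N * (pmf \<pi> j * s ^ j)) * B j"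
      by (simp add: algebra_simps)
    moreover have "N * \<delta> = \<delta> * N" by simp
    ultimately show ?thesis by linarith
  qed
  have "\<bar>(\<Sum>j\<le>K. num j {v \<in> S. Q v}) - N * ?X\<bar> = \<bar>\<Sum>j\<le>K. num j {v \<in> S. Q v} - N * (pmf \<pi> j * s ^ j * B j)\<bar>"
    by (simp add: sum_distrib_left sum_subtractf)
  also have "\<dots> \<le> (\<Sum>j\<le>K. 3 * (\<delta> * N))"
    using each by (intro order.trans[OF sum_abs] sum_mono) auto
  also have "\<dots> = 3 * (real K + 1) * \<delta> * N" by simp
  finally have "\<bar>(\<Sum>j\<le>K. num j {v \<in> S. Q v}) - N * ?X\<bar> \<le> 3 * (real K + 1) * \<delta> * N" .
  moreover have "N * ?X \<le> N * z" "N * z \<le> N * ?X + \<sigma> * N"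
    using mult_left_mono[OF x(1), of N] mult_left_mono[OF x(2), of N] by (simp_all add: algebra_simps)
  moreover have "(3 * (real K + 1) * \<delta> + 2 * \<sigma>) * N = 3 * (real K + 1) * \<delta> * N + \<sigma> * N + \<sigma> * N"
    by (simp add: algebra_simps)
  ultimately show ?thesis using c t tails(1) unfolding abs_le_iff by linarith
qed


text \<open>Two cutoffs occur: the precision \<omega> required of the thinning probability depends
  on the cutoff \<open>K\<close> for the degrees, while reaching that precision may take the larger
  cutoff \<open>K'\<close>. The bound \<open>b\<close> is uniform over close states, so that it can
  be averaged over the stopped state.\<close>

lemma induced_degrees_concentrate:
  fixes \<epsilon> :: real and k :: nat
  assumes sup: "supercritical \<pi>" and \<alpha>: "\<alpha> \<in> {0..alpha_c \<pi>}" and \<epsilon>: "\<epsilon> > 0"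
  defines "s \<equiv> gen_fun_inv \<pi> (1 - \<alpha>)" and "\<mu> \<equiv> gen_fun' \<pi> 1"
    and "m \<equiv> (\<lambda>N. min (nat \<lfloor>(1 - \<alpha>) * real N\<rfloor>) (N - 1))"
  obtains \<zeta> K b where "\<zeta> > 0" "b \<longlonglongrightarrow> 0"
    "eventually (\<lambda>N. \<forall>x. close \<zeta> K s \<mu> (m N) N x \<longrightarrow>
       measure_pmf.prob (pmf_of_set (perfect_matchings (unmatched x)))
         {M. \<epsilon> < \<bar>degree_proportion (graph_of_matching (fst (snd x)) (inner (fst (snd x)) M)) k - pmf (pi_alpha \<pi> \<alpha>) k\<bar>} \<le> b N)
     sequentially"
proof -
  note r = subcritical_root[OF sup \<alpha>, folded s_def \<mu>_def]
  define a where "a = 1 - \<alpha>"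
  define p where "p = gen_fun' \<pi> s / (s * \<mu>)"
  define q where "q = pmf (pi_alpha \<pi> \<alpha>) k"
  define u0 where "u0 = s\<^sup>2 * \<mu>"
  note pi = pi_alpha_sums[OF sup \<alpha>, folded s_def \<mu>_def, folded p_def]
  have s01: "s \<in> {0..1}" using r by auto
  have p01: "0 \<le> p" "p \<le> 1" using pi(1) by auto
  have "0 \<le> pmf \<pi> 0" by simp
  then have "0 < a" using r(4) unfolding a_def by linarith
  then have a: "0 < a" "a \<le> 1" using \<alpha> by (auto simp: a_def)
  have q: "0 \<le> q" "q \<le> 1" by (simp_all add: q_def pmf_le_1)
  have B: "0 \<le> binom j p k" "binom j p k \<le> 1" for j
    using binom_eq_pmf[OF pi(1)] by (simp_all add: pmf_le_1)
  have z: "(\<lambda>j. pmf \<pi> j * s ^ j * binom j p k) sums (a * q)" using pi(2) by (simp add: a_def q_def)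
  have u0: "u0 > 0" "p * u0 = s * gen_fun' \<pi> s"
    using r by (auto simp: u0_def p_def power2_eq_square)
  \<comment> \<open>The first bound keeps \<open>card S\<close> above \<open>a / 2 * N\<close>, the
    second one controls the quotient in \<open>proportion_near\<close>.\<close>
  define \<theta> where "\<theta> = min (a / 2) (\<epsilon> * a / 4)"
  have \<theta>: "\<theta> > 0" "\<theta> \<le> a / 2" "4 * \<theta> \<le> \<epsilon> * a" using a \<epsilon> by (auto simp: \<theta>_def)
  have \<theta>8: "\<theta> / 8 > 0" using \<theta> by simp
  obtain K where K: "eventually (\<lambda>N. tlN N K \<le> \<theta> / 8 * N) sequentially"
    "(\<Sum>k. real k ^ 2 * pmf \<pi> k) - (\<Sum>j\<le>K. real j ^ 2 * pmf \<pi> j) \<le> \<theta> / 8"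
    using tail_small[OF \<theta>8] by blast
  define \<delta> where "\<delta> = \<theta> / (8 * (real K + 1))"
  have \<delta>: "\<delta> > 0" using \<theta> by (simp add: \<delta>_def)
  have \<delta>\<theta>: "3 * (real K + 1) * \<delta> + 2 * (\<theta> / 8) \<le> \<theta>"
  proof -
    have "(real K + 1) * \<delta> = \<theta> / 8" by (simp add: \<delta>_def field_simps)
    then show ?thesis using \<theta> by linarith
  qed
  obtain \<omega> where \<omega>: "\<omega> > 0" "\<And>p' j. \<bar>p' - p\<bar> < \<omega> \<Longrightarrow> j \<le> K \<Longrightarrow> \<bar>binom j p' k - binom j p k\<bar> \<le> \<delta>"
    using binom_nearby[OF \<delta>] by blast
  \<comment> \<open>The total error \<open>4 * \<sigma> * N\<close> is then at most
    \<open>\<omega> / 2 * card U\<close>, because \<open>card U \<ge> u0 / 2 * N\<close>.\<close>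
  define \<sigma> where "\<sigma> = \<omega> * u0 / 16"
  have \<sigma>: "\<sigma> > 0" using \<omega> u0 by (simp add: \<sigma>_def)
  obtain K0 where K0: "\<And>K. K0 \<le> K \<Longrightarrow> eventually (\<lambda>N. tlN N K \<le> \<sigma> * N) sequentially"
    "\<And>K. K0 \<le> K \<Longrightarrow> (\<Sum>k. real k ^ 2 * pmf \<pi> k) - (\<Sum>j\<le>K. real j ^ 2 * pmf \<pi> j) \<le> \<sigma>"
    using tail_small[OF \<sigma>] by blast
  define K' where "K' = max K K0"
  have K': "K \<le> K'" "K0 \<le> K'" by (auto simp: K'_def)
  define \<zeta> where "\<zeta> = min \<delta> (min (\<sigma> / (real K' + 1)\<^sup>2) (u0 / 2))"
  have \<zeta>: "\<zeta> \<le> \<delta>" "\<zeta> \<le> u0 / 2" "\<zeta> \<le> \<sigma> / (real K' + 1)\<^sup>2"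
    unfolding \<zeta>_def by linarith+
  have \<zeta>0: "\<zeta> > 0" using \<delta> \<sigma> u0 by (simp add: \<zeta>_def)
  have \<zeta>\<sigma>: "(real K' + 1)\<^sup>2 * \<zeta> \<le> \<sigma>"
  proof -
    have "(real K' + 1)\<^sup>2 * \<zeta> \<le> (real K' + 1)\<^sup>2 * (\<sigma> / (real K' + 1)\<^sup>2)"
      using \<zeta>(3) by (rule mult_left_mono) simp
    then show ?thesis by simp
  qed
  have \<zeta>\<sigma>1: "\<zeta> \<le> \<sigma>"
  proof -
    have "1 * \<zeta> \<le> (real K' + 1)\<^sup>2 * \<zeta>" using \<zeta>0 by (intro mult_right_mono) (auto simp: one_le_power)
    then show ?thesis using \<zeta>\<sigma> by linarith
  qed
  define c where "c = (K + 1) * ((1 + 3 * 4 ^ K * (32 * (real K)\<^sup>2 / (u0 / 2))) / \<delta>\<^sup>2)"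
  have ev_big: "eventually (\<lambda>N. c \<le> real N) sequentially" for c
    using filterlim_real_sequentially eventually_ge_at_top unfolding filterlim_at_top by blast

  have "eventually (\<lambda>N. \<forall>x. close \<zeta> K' s \<mu> (m N) N x \<longrightarrow>
       measure_pmf.prob (pmf_of_set (perfect_matchings (unmatched x)))
         {M. \<epsilon> < \<bar>degree_proportion (graph_of_matching (fst (snd x)) (inner (fst (snd x)) M)) k - q\<bar>} \<le> c * (1 / N))
     sequentially"
    using K(1) K0(1)[OF K'(2)] eventually_ge_at_top[of 1] ev_big[of "8 * K / (u0 / 2)"] ev_big[of "2 / \<theta>"]
  proof eventually_elim
    case (elim N)
    interpret half_edge_exploration "vs N" "e N" by (rule explore)
    have N: "real N > 0" using elim(3) by simp
    show ?case
    proof (intro allI impI)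
      fix x assume cx: "close \<zeta> K' s \<mu> (m N) N x"
      obtain A S U C where xx: "x = (A, S, U, C)" by (metis prod_cases4)
      note cl = cx[unfolded xx]
      have inv: "uinv (A, S, U, C)" and cS: "card S = m N"
        and cU: "\<bar>real (card U) - N * u0\<bar> \<le> \<zeta> * N"
        using cl by (auto simp: close_def u0_def)
      define p' where "p' = card (half_edges S (e N)) / card U"
      have U: "u0 / 2 * N \<le> card U" "0 < u0 / 2 * N"
      proof -
        have "\<zeta> * N \<le> u0 / 2 * N" using \<zeta>(2) N by (intro mult_right_mono) auto
        moreover have "N * u0 = u0 / 2 * N + u0 / 2 * N" by simp
        ultimately show "u0 / 2 * N \<le> card U" using cU by linarith
        show "0 < u0 / 2 * N" using u0 N by simp
      qed
      then have U0: "real (card U) > 0" by linarith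
      have "\<bar>p' - p\<bar> < \<omega>"
      proof -
        have "card U * (p' - p) = (card (half_edges S (e N)) - N * (s * gen_fun' \<pi> s)) - p * (card U - N * u0)"
          using U0 by (simp add: p'_def u0(2)[symmetric] algebra_simps)
        moreover have "\<bar>p * (card U - N * u0)\<bar> \<le> 1 * (\<zeta> * N)"
          unfolding abs_mult using p01 cU by (intro mult_mono) auto
        moreover have "\<bar>real (card (half_edges S (e N))) - N * (s * gen_fun' \<pi> s)\<bar> \<le> ((real K' + 1)\<^sup>2 * \<zeta> + 2 * \<sigma>) * N"
          by (rule close_half_edges[OF cl s01 elim(2) K0(2)[OF K'(2)]])
        moreover have "((real K' + 1)\<^sup>2 * \<zeta> + 2 * \<sigma>) * N + 1 * (\<zeta> * N) \<le> 4 * \<sigma> * N"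
        proof -
          have "((real K' + 1)\<^sup>2 * \<zeta> + 2 * \<sigma> + \<zeta>) * N \<le> 4 * \<sigma> * N"
            using \<zeta>\<sigma> \<zeta>\<sigma>1 N by (intro mult_right_mono) auto
          then show ?thesis by (simp add: algebra_simps)
        qed
        ultimately have "\<bar>card U * (p' - p)\<bar> \<le> 4 * \<sigma> * N" by linarith
        also have "\<dots> = \<omega> / 2 * (u0 / 2 * N)" by (simp add: \<sigma>_def)
        also have "\<dots> \<le> \<omega> / 2 * card U" using U \<omega> by (intro mult_left_mono) auto
        finally have "card U * \<bar>p' - p\<bar> \<le> card U * (\<omega> / 2)" by (simp add: abs_mult mult_ac)
        then have "\<bar>p' - p\<bar> \<le> \<omega> / 2" using U0 by simp
        then show ?thesis using \<omega> by simp
      qed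
      note b = \<omega>(2)[OF this]
      let ?G = "\<lambda>M. graph_of_matching S (inner S M)"
      let ?bad = "{M. \<exists>j\<le>K. \<delta> * N < \<bar>real (card {v \<in> S \<inter> D j. vertex_degree (?G M) v = k}) - num j S * binom j p' k\<bar>}"
      have "{M. \<epsilon> < \<bar>degree_proportion (?G M) k - q\<bar>} \<subseteq> ?bad"
      proof (rule subsetI, rule ccontr)
        fix M assume M: "M \<in> {M. \<epsilon> < \<bar>degree_proportion (?G M) k - q\<bar>}" "M \<notin> ?bad"
        then have nb: "\<bar>real (card {v \<in> S \<inter> D j. vertex_degree (?G M) v = k}) - num j S * binom j p' k\<bar> \<le> \<delta> * N"
          if "j \<le> K" for j
          using that by (auto simp: not_less)
        let ?Z = "real (card {v \<in> S. vertex_degree (?G M) v = k})"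
        have "\<bar>?Z - N * (a * q)\<bar> \<le> (3 * (real K + 1) * \<delta> + 2 * (\<theta> / 8)) * N"
          by (rule close_degree_sum[OF cl s01 K'(1) elim(1) K(2) B z b nb \<zeta>(1)])
        also have "\<dots> \<le> \<theta> * N" using \<delta>\<theta> N by (intro mult_right_mono) auto
        finally have Z: "\<bar>?Z - N * (a * q)\<bar> \<le> \<theta> * N" .
        have "2 \<le> \<theta> * N" using elim(5) \<theta> by (simp add: field_simps)
        then have "\<bar>real (card S) - a * N\<bar> \<le> \<theta> * N"
          using stopping_size_bounds[of a N] a unfolding cS m_def a_def by linarith
        from proportion_near[OF q a(1) N \<theta>(2,3) Z this]
        have "\<bar>degree_proportion (?G M) k - q\<bar> \<le> \<epsilon>"
          by (simp add: degree_proportion_def verts_def graph_of_matching_def)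
        then show False using M by simp
      qed
      then have "measure_pmf.prob (pmf_of_set (perfect_matchings U)) {M. \<epsilon> < \<bar>degree_proportion (?G M) k - q\<bar>} \<le>
          measure_pmf.prob (pmf_of_set (perfect_matchings U)) ?bad"
        by (intro measure_pmf.finite_measure_mono) auto
      also have "\<dots> \<le> (K + 1) * ((card (vs N) + 3 * 4 ^ K * (32 * (real K)\<^sup>2 / (u0 / 2 * N)) * (real (card (vs N)))\<^sup>2) / (\<delta> * N)\<^sup>2)"
        unfolding p'_def
      proof (rule prob_induced_degrees[OF inv U(2,1)])
        show "real (8 * K) \<le> u0 / 2 * real N" using elim(4) u0 by (simp add: field_simps)
        show "0 < \<delta> * N" using \<delta> N by simp
      qed
      also have "\<dots> = c * (1 / N)"
      proof -
        have "(N + 3 * 4 ^ K * (32 * (real K)\<^sup>2 / (u0 / 2 * N)) * (real N)\<^sup>2) / (\<delta> * N)\<^sup>2 =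
            ((1 + 3 * 4 ^ K * (32 * (real K)\<^sup>2 / (u0 / 2))) / \<delta>\<^sup>2) * (1 / N)"
          using N \<delta> u0 by (simp add: field_simps power2_eq_square)
        then show ?thesis by (simp add: c_def)
      qed
      finally show "measure_pmf.prob (pmf_of_set (perfect_matchings (unmatched x)))
         {M. \<epsilon> < \<bar>degree_proportion (graph_of_matching (fst (snd x)) (inner (fst (snd x)) M)) k - q\<bar>} \<le> c * (1 / N)"
        by (simp add: xx)
    qed
  qed
  moreover have "(\<lambda>N. c * (1 / real N)) \<longlonglongrightarrow> 0"
    using tendsto_mult[OF tendsto_const lim_1_over_n, of c] by simp
  ultimately show ?thesis using that[of \<zeta> "\<lambda>N. c * (1 / real N)" K'] \<zeta>0 by (simp add: q_def)
qed

end

lemma prob_bind_pmf_le: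
  assumes "\<And>x. Q x \<Longrightarrow> measure_pmf.prob (f x) A \<le> b" "0 \<le> b"
  shows "measure_pmf.prob (p \<bind> f) A \<le> measure_pmf.prob p {x. \<not> Q x} + b"
proof -
  have int: "integrable (measure_pmf p) (\<lambda>x. measure_pmf.prob (f x) A)" "integrable (measure_pmf p) (indicat_real {x. \<not> Q x})"
    by (intro measure_pmf.integrable_const_bound[where B = 1]; simp)+
  have "measure_pmf.expectation p (\<lambda>x. measure_pmf.prob (f x) A) \<le>
      measure_pmf.expectation p (\<lambda>x. indicat_real {x. \<not> Q x} x + b)"
  proof (rule integral_mono)
    show "measure_pmf.prob (f x) A \<le> indicat_real {x. \<not> Q x} x + b" for x
    proof (cases "Q x")
      case False
      have "measure_pmf.prob (f x) A \<le> 1" by simp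
      then have "measure_pmf.prob (f x) A \<le> 1 + b" using assms(2) by linarith
      then show ?thesis using False by simp
    qed (simp add: assms(1))
  qed (use int in auto)
  also have "\<dots> = measure_pmf.prob p {x. \<not> Q x} + b"
    using int by (simp add: measure_pmf.prob_space)
  finally show ?thesis by (simp only: prob_bind_pmf)
qed

text \<open>The stopped state is close to the predicted profile outside an event of vanishing
  probability, and given a close state only the uniform matching of the unmatched half-edges is
  still random.\<close>

lemma sleeping_degrees_limit:
  fixes \<epsilon> :: real
  assumes sup: "supercritical \<pi>" and \<alpha>: "\<alpha> \<in> {0..alpha_c \<pi>}" and \<epsilon>: "\<epsilon> > 0"
    and lim: "has_asymptotic_degrees d \<pi>"
    and sqlim: "(\<lambda>N. (\<Sum>i=1..N. real (d N i) ^ 2) / real N) \<longlonglongrightarrow> (\<Sum>k. real k ^ 2 * pmf \<pi> k)"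
  shows "(\<lambda>N. measure_pmf.prob (sleeping_graph N (d N) \<alpha>)
    {G. \<bar>degree_proportion G k - pmf (pi_alpha \<pi> \<alpha>) k\<bar> > \<epsilon>}) \<longlonglongrightarrow> 0"
proof -
  have sq: "summable (\<lambda>k. real k ^ 2 * pmf \<pi> k)" using sup by (simp add: supercritical_def)
  define e where "e N = make_even {1..N} (d N)" for N
  interpret degree_limit \<pi> e
    unfolding e_def[abs_def] by (rule degree_limit_make_even[OF sq lim sqlim])
  note r = subcritical_root[OF sup \<alpha>]
  have \<alpha>1: "0 \<le> \<alpha>" "\<alpha> \<le> 1" using \<alpha> r(4) pmf_nonneg[of \<pi> 0] by (auto, linarith)
  let ?s = "gen_fun_inv \<pi> (1 - \<alpha>)" and ?\<mu> = "gen_fun' \<pi> 1"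
  let ?m = "\<lambda>N. min (nat \<lfloor>(1 - \<alpha>) * real N\<rfloor>) (N - 1)"
  let ?n = "\<lambda>N. 2 * N + card (half_edges (vs N) (e N))"
  let ?R = "\<lambda>N. run_until (small (?m N)) ustep (?n N) ([], vs N, half_edges (vs N) (e N), {})"
  let ?A = "{G. \<epsilon> < \<bar>degree_proportion G k - pmf (pi_alpha \<pi> \<alpha>) k\<bar>}"
  obtain \<zeta> K b where b: "\<zeta> > 0" "b \<longlonglongrightarrow> 0"
    "eventually (\<lambda>N. \<forall>x. close \<zeta> K ?s ?\<mu> (?m N) N x \<longrightarrow>
       measure_pmf.prob (pmf_of_set (perfect_matchings (unmatched x)))
         {M. \<epsilon> < \<bar>degree_proportion (graph_of_matching (fst (snd x)) (inner (fst (snd x)) M)) k - pmf (pi_alpha \<pi> \<alpha>) k\<bar>} \<le> b N)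
     sequentially"
    using induced_degrees_concentrate[OF sup \<alpha> \<epsilon>] by blast
  have ev: "even (card (half_edges (vs N) (e N)))" if "N \<ge> 1" for N
    unfolding e_def vs_def using that even_make_even[of "{1..N}" "d N"] by (simp add: card_half_edges)
  have "(\<lambda>N. measure_pmf.prob (?R N) {x. \<not> close \<zeta> K ?s ?\<mu> (?m N) N x}) \<longlonglongrightarrow> 0"
    by (rule stopped_state_close[OF sup \<alpha> b(1) ev]) auto
  from tendsto_add[OF this tendsto_rabs[OF b(2)]]
  have lim0: "(\<lambda>N. measure_pmf.prob (?R N) {x. \<not> close \<zeta> K ?s ?\<mu> (?m N) N x} + \<bar>b N\<bar>) \<longlonglongrightarrow> 0" by simp
  have "eventually (\<lambda>N. measure_pmf.prob (sleeping_graph N (d N) \<alpha>) ?A \<le>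
      measure_pmf.prob (?R N) {x. \<not> close \<zeta> K ?s ?\<mu> (?m N) N x} + \<bar>b N\<bar>) sequentially"
    using b(3) eventually_ge_at_top[of 1]
  proof eventually_elim
    case (elim N)
    have eq: "sleeping_graph N (d N) \<alpha> = ?R N \<bind> (\<lambda>x.
        map_pmf (\<lambda>M. graph_of_matching (fst (snd x)) (inner (fst (snd x)) M))
          (pmf_of_set (perfect_matchings (unmatched x))))"
      unfolding e_def vs_def by (rule sleeping_graph_eq[OF elim(2) \<alpha>1 order_refl])
    have "measure_pmf.prob (map_pmf (\<lambda>M. graph_of_matching (fst (snd x)) (inner (fst (snd x)) M))
          (pmf_of_set (perfect_matchings (unmatched x)))) ?A \<le> \<bar>b N\<bar>"
      if "close \<zeta> K ?s ?\<mu> (?m N) N x" for x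
    proof -
      have "measure_pmf.prob (pmf_of_set (perfect_matchings (unmatched x)))
         {M. \<epsilon> < \<bar>degree_proportion (graph_of_matching (fst (snd x)) (inner (fst (snd x)) M)) k - pmf (pi_alpha \<pi> \<alpha>) k\<bar>} \<le> b N"
        using elim(1) that by blast
      then show ?thesis by (simp add: vimage_def)
    qed
    then show ?case unfolding eq by (rule prob_bind_pmf_le) simp_all
  qed
  then show ?thesis
    by (rule tendsto_sandwich[OF always_eventually[OF allI[OF measure_nonneg]] _ tendsto_const lim0])
qed

theorem proposition1:
  fixes \<pi> :: "nat pmf" and d :: "nat \<Rightarrow> nat \<Rightarrow> nat"
  assumes "supercritical \<pi>"
    and "has_asymptotic_degrees d \<pi>"
    and "(\<lambda>N. (\<Sum>i=1..N. real (d N i) ^ 2) / real N) \<longlonglongrightarrow> (\<Sum>k. real k ^ 2 * pmf \<pi> k)"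
    and "\<exists>\<gamma>>2. \<exists>C>0. \<forall>N\<ge>1. real (Max (d N ` {1..N})) \<le> C * real N powr (1 / \<gamma>)"
  shows "\<forall>\<alpha>\<in>{0..alpha_c \<pi>}.
           (\<forall>N\<ge>1. \<forall>V D.
              let A = {G. verts G = V \<and> (\<forall>v\<in>V. vertex_degree G v = D v)} in
              set_pmf (sleeping_graph N (d N) \<alpha>) \<inter> A \<noteq> {} \<longrightarrow>
              cond_pmf (sleeping_graph N (d N) \<alpha>) A = configuration_model V D)
         \<and> (\<forall>k. \<forall>\<epsilon>>0.
              (\<lambda>N. measure_pmf.prob (sleeping_graph N (d N) \<alpha>)
                     {G. \<bar>degree_proportion G k - pmf (pi_alpha \<pi> \<alpha>) k\<bar> > \<epsilon>})
              \<longlonglongrightarrow> 0)"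
proof (intro ballI conjI allI impI)
  fix \<alpha> assume \<alpha>: "\<alpha> \<in> {0..alpha_c \<pi>}"
  show "(\<lambda>N. measure_pmf.prob (sleeping_graph N (d N) \<alpha>)
      {G. \<epsilon> < \<bar>degree_proportion G k - pmf (pi_alpha \<pi> \<alpha>) k\<bar>}) \<longlonglongrightarrow> 0" if "0 < \<epsilon>" for k and \<epsilon> :: real
    by (rule sleeping_degrees_limit[OF assms(1) \<alpha> that assms(2,3)])
  have "pmf \<pi> 0 < 1 - \<alpha>" by (rule subcritical_root(4)[OF assms(1) \<alpha>])
  then have "\<alpha> \<le> 1" using pmf_nonneg[of \<pi> 0] by linarith
  then show "let A = {G. verts G = V \<and> (\<forall>v\<in>V. vertex_degree G v = D v)} in
      set_pmf (sleeping_graph N (d N) \<alpha>) \<inter> A \<noteq> {} \<longrightarrow>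
      cond_pmf (sleeping_graph N (d N) \<alpha>) A = configuration_model V D" if "1 \<le> N" for N V D
    unfolding Let_def using cond_sleeping_graph[OF that, of \<alpha> "d N" V D] \<alpha> by auto
qed

end
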